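(* Let $k$ be a field, $X$ a set, $G\subseteq \mathrm{Sym}(X)$ an oligomorphic permutation group, and $\mu$ a measure on $G$ with values in $k$. (1) For every integer $r\ge 1$, the operators $E_{ij}$ ($1\le i,j\le r$) on $(k^r)^{\otimes X}$ defined from $\mu$ in the context give an action of the Lie algebra $\mathfrak{gl}_r(k)$ on $(k^r)^{\otimes X}$ (the elementary matrix $E_{ij}$ acting by the operator $E_{ij}$), and this action commutes with the action of $G$. (2) Let $r=2$ and $k=\mathbb{C}$. The action of (1), restricted to $\mathfrak{sl}_2(\mathbb{C})\subseteq \mathfrak{gl}_2(\mathbb{C})$, restricts to an action of $\mathfrak{sl}_2(\mathbb{C})$ on the orbit algebra $\mathsf{H}^{\star}_{G,X}\subseteq (\mathbb{C}^2)^{\otimes X}$. If $X$ is infinite, then this $\mathfrak{sl}_2(\mathbb{C})$-representation has a (finite or countably infinite) ascending filtration $0=\mathcal{F}_0\subseteq \mathcal{F}_1\subseteq \mathcal{F}_2\subseteq\cdots$ by subrepresentations, with union $\mathsf{H}^{\star}_{G,X}$, all of whose successive subquotients $\mathcal{F}_{n+1}/\mathcal{F}_n$ are isomorphic to lowest weight Verma modules of $\mathfrak{sl}_2(\mathbb{C})$.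
   Context: Oligomorphic groups. A subgroup $G\subseteq \mathrm{Sym}(X)$ is oligomorphic if $G$ has finitely many orbits on $X^n$ for all $n\ge 0$. $G$ carries the pointwise convergence topology, whose basic open sets are $\{g\in G\mid gx_i=x_i',\ i=1,\dots,n\}$ for $x_i,x_i'\in X$; a subgroup is open iff it contains the pointwise stabilizer of some finite subset of $X$. For an open subgroup $U\subseteq G$, a $U$-set is smooth if all point stabilizers are open, and orbit-finite if it has finitely many orbits. $\hat G$-sets. A $\hat G$-set is a set $Z$ with a smooth, orbit-finite action of some open subgroup $U\subseteq G$; shrinking $U$ does not change the $\hat G$-set (so an isomorphism of $\hat G$-sets is a bijection equivariant under some open subgroup). A $\hat G$-subset of a smooth $G$-set $Y$ is a subset stable under some open subgroup of $G$. Measures. A measure on $G$ with values in $k$ assigns to each $\hat G$-set $Z$ an element $\mu(Z)\in k$ such that: (i) $\mu(Z_1)=\mu(Z_2)$ if $Z_1\cong Z_2$; (ii) $\mu(\{\mathrm{pt}\})=1$; (iii) $\mu(Z^g)=\mu(Z)$ for all $g\in G$, where $Z^g$ is $Z$ with the action conjugated by $g$; (iv) $\mu(Z_1)=\mu(f^{-1}(z))\,\mu(Z_2)$ for every homomorphism $f\colon Z_1\to Z_2$ of transitive smooth $U$-sets ($U\subseteq G$ an open subgroup) and $z\in Z_2$; (v) $\mu(Z_1\sqcup Z_2)=\mu(Z_1)+\mu(Z_2)$. Tensor power. $\mathrm{Part}_r(X)$ is the $G$-set of $r$-tuples $(X_1,\dots,X_r)$ of pairwise disjoint (possibly empty) $\hat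 G$-subsets of $X$ with $\bigcup_i X_i=X$, with componentwise $G$-action. For a smooth $G$-set $Y$, the Schwartz space $\mathcal{S}(Y)$ is the space of functions $v\colon Y\to k$ that are invariant under some open subgroup of $G$, with $G$-action $(gv)(y)=v(g^{-1}y)$. Set $(k^r)^{\otimes X}:=\mathcal{S}(\mathrm{Part}_r(X))$. Operators. For $i\ne j$, $\varphi\in (k^r)^{\otimes X}$ and $P=(X_1,\dots,X_r)\in\mathrm{Part}_r(X)$, let $P_{y}$ (for $y\in X_i$) be the tuple obtained from $P$ by removing $y$ from $X_i$ and adding it to $X_j$. Choose an open subgroup $U\subseteq G$ fixing $\varphi$ and stabilizing each $X_a$, decompose $X_i$ into its finitely many $U$-orbits $O_1,\dots,O_s$, choose $y_t\in O_t$, and put $(E_{ij}\varphi)(P):=\sum_{t=1}^s \mu(O_t)\,\varphi(P_{y_t})$ (independent of choices). On the indicator function $v_{P}$ of a single $P=(X_1,\dots,X_r)$ this is the formal sum, over $y\in X_j$, of the indicator functions of the tuples obtained by moving $y$ from $X_j$ to $X_i$. For $i=j$: $(E_{ii}\varphi)(P):=\mu(X_i)\varphi(P)$. Orbit algebra. $\mathsf{H}^{\star}_{G,X}=\bigoplus_{n\ge0}\mathsf{H}^n_{G,X}$ with $\mathsf{H}^n_{G,X}=\mathrm{Maps}\big(\binom{X}{n},\mathbb{C}\big)^G$, where $\binom Xn$ is the set of $n$-element subsets. It is viewed inside $(\mathbb{C}^2)^{\otimes X}$ by sending $v\in\mathsf{H}^n_{G,X}$ to the function with value $v(X_1)$ at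 $(X_1,X_2)$ if $|X_1|=n$, and $0$ otherwise. In $\mathfrak{sl}_2(\mathbb{C})$: $e=E_{12}$, $f=E_{21}$, $h=E_{11}-E_{22}$. The lowest weight Verma module $M^-(\lambda)$, $\lambda\in\mathbb{C}$, is $U(\mathfrak{sl}_2)\otimes_{U(\mathfrak b^-)}\mathbb{C}_\lambda$, where $\mathfrak b^-=\mathrm{span}(h,f)$, $f$ acts on $\mathbb{C}_\lambda$ by $0$ and $h$ by $\lambda$. *)

theory Defs
  imports
    "HOL-Analysis.Function_Topology"
    "HOL-Algebra.Group_Action"
    "HOL-Algebra.QuotRing"
    "HOL-Algebra.Generated_Groups"
    "HOL-Algebra.Free_Abelian_Groups"
    "HOL-Library.Ramsey"
    "HOL-Library.Extended_Nat"
    "Jordan_Normal_Form.VS_Connect"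
begin

hide_const (open) Wellorder_Constructions.zero

section \<open>Oligomorphic permutation groups\<close>

text \<open>\<open>Sym(X)\<close> is \<^term>\<open>BijGroup X\<close>, whose elements are \<open>undefined\<close> outside \<open>X\<close>. Subgroups are
  represented by their carriers.\<close>

abbreviation perm_group :: "'x set \<Rightarrow> ('x \<Rightarrow> 'x) set \<Rightarrow> ('x \<Rightarrow> 'x) monoid" where
  "perm_group X U \<equiv> (BijGroup X)\<lparr>carrier := U\<rparr>"

definition oligomorphic :: "'x set \<Rightarrow> ('x \<Rightarrow> 'x) set \<Rightarrow> bool" where
  "oligomorphic X G \<longleftrightarrow> subgroup G (BijGroup X) \<and>
     (\<forall>n. finite (orbits (perm_group X G) {xs. length xs = n \<and> set xs \<subseteq> X} map))"

definition pointwise_topology :: "'x set \<Rightarrow> ('x \<Rightarrow> 'x) set \<Rightarrow> ('x \<Rightarrow> 'x) topology" where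
  "pointwise_topology X G = subtopology (product_topology (\<lambda>_. discrete_topology X) X) G"

definition open_subgroup :: "'x set \<Rightarrow> ('x \<Rightarrow> 'x) set \<Rightarrow> ('x \<Rightarrow> 'x) set \<Rightarrow> bool" where
  "open_subgroup X G U \<longleftrightarrow>
     subgroup U (BijGroup X) \<and> U \<subseteq> G \<and> openin (pointwise_topology X G) U"

lemma Bij_mult_apply:
  assumes "f \<in> Bij X" "g \<in> Bij X" "x \<in> X"
  shows "(f \<otimes>\<^bsub>BijGroup X\<^esub> g) x = f (g x)"
  using assms by (simp add: BijGroup_def compose_eq)

lemma open_subgroup_iff:
  assumes G: "subgroup G (BijGroup X)"
  shows "open_subgroup X G U \<longleftrightarrow> subgroup U (BijGroup X) \<and> U \<subseteq> G \<and>
    (\<exists>A. finite A \<and> A \<subseteq> X \<and> {g \<in> G. \<forall>a\<in>A. g a = a} \<subseteq> U)"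
proof -
  interpret B: group "BijGroup X" by (rule group_BijGroup)
  have GB: "G \<subseteq> Bij X" using subgroup.subset[OF G] by (simp add: BijGroup_def)
  have "openin (pointwise_topology X G) U \<longleftrightarrow>
      (\<exists>A. finite A \<and> A \<subseteq> X \<and> {g \<in> G. \<forall>a\<in>A. g a = a} \<subseteq> U)" (is "?L \<longleftrightarrow> ?R")
    if U: "subgroup U (BijGroup X)" and UG: "U \<subseteq> G"
  proof
    assume ?L
    then obtain V where V: "openin (product_topology (\<lambda>_. discrete_topology X) X) V" "U = V \<inter> G"
      by (auto simp: pointwise_topology_def openin_subtopology)
    have "(\<lambda>x\<in>X. x) \<in> V"
      using subgroup.one_closed[OF U] V(2) by (simp add: BijGroup_def)
    with V(1) obtain W where W: "finite {i \<in> X. W i \<noteq> X}" "(\<lambda>x\<in>X. x) \<in> Pi\<^sub>E X W" "Pi\<^sub>E X W \<subseteq> V"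
      unfolding openin_product_topology_alt by fastforce
    have "g \<in> U" if g: "g \<in> G" "\<forall>a\<in>{i \<in> X. W i \<noteq> X}. g a = a" for g
    proof -
      have gB: "g \<in> Bij X" using g GB by auto
      have "g x \<in> W x" if x: "x \<in> X" for x
      proof (cases "W x = X")
        case True
        then show ?thesis using Bij_imp_funcset[OF gB] x by auto
      next
        case False
        then have "g x = x" using g x by auto
        then show ?thesis using W(2) x by (auto simp: PiE_iff)
      qed
      then have "g \<in> Pi\<^sub>E X W" using Bij_imp_extensional[OF gB] by (auto simp: PiE_iff)
      then show ?thesis using W(3) V(2) g by auto
    qed
    then show ?R using W(1) by (intro exI[of _ "{i \<in> X. W i \<noteq> X}"]) auto
  next
    assume ?R
    then obtain A where A: "finite A" "A \<subseteq> X" "{g \<in> G. \<forall>a\<in>A. g a = a} \<subseteq> U" by auto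
    define V where "V = {f \<in> X \<rightarrow>\<^sub>E X. \<exists>u\<in>U. \<forall>a\<in>A. f a = u a}"
    have "openin (product_topology (\<lambda>_. discrete_topology X) X) V"
      unfolding openin_product_topology_alt
    proof
      fix f assume f: "f \<in> V"
      show "\<exists>W. finite {i \<in> X. W i \<noteq> topspace (discrete_topology X)} \<and>
          (\<forall>i\<in>X. openin (discrete_topology X) (W i)) \<and> f \<in> Pi\<^sub>E X W \<and> Pi\<^sub>E X W \<subseteq> V"
      proof (intro exI conjI)
        let ?W = "\<lambda>i. if i \<in> A then {f i} else X"
        show "finite {i \<in> X. ?W i \<noteq> topspace (discrete_topology X)}"
          using A(1) by (rule rev_finite_subset) auto
        show "\<forall>i\<in>X. openin (discrete_topology X) (?W i)" using f by (auto simp: V_def)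
        show "f \<in> Pi\<^sub>E X ?W" using f by (auto simp: V_def PiE_iff)
        show "Pi\<^sub>E X ?W \<subseteq> V"
        proof
          fix h assume h: "h \<in> Pi\<^sub>E X ?W"
          have "h x \<in> X" if "x \<in> X" for x
            using h f that by (cases "x \<in> A") (auto simp: PiE_iff V_def dest!: bspec[where x=x])
          moreover have "h a = f a" if "a \<in> A" for a
            using h that A(2) by (auto simp: PiE_iff dest!: bspec[where x=a])
          ultimately show "h \<in> V" using f h by (auto simp: V_def PiE_iff)
        qed
      qed
    qed
    moreover have "U = V \<inter> G"
    proof
      show "U \<subseteq> V \<inter> G"
        using UG GB Bij_imp_funcset Bij_imp_extensional by (fastforce simp: V_def PiE_iff)
      show "V \<inter> G \<subseteq> U"
      proof
        fix g assume g: "g \<in> V \<inter> G"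
        then obtain u where u: "u \<in> U" "\<forall>a\<in>A. g a = u a" by (auto simp: V_def)
        have uB: "u \<in> carrier (BijGroup X)" and gB: "g \<in> carrier (BijGroup X)"
          using u g UG GB by (auto simp: BijGroup_def)
        let ?h = "inv\<^bsub>BijGroup X\<^esub> u \<otimes>\<^bsub>BijGroup X\<^esub> g"
        have iu: "inv\<^bsub>BijGroup X\<^esub> u \<in> U" by (rule subgroup.m_inv_closed[OF U u(1)])
        have hG: "?h \<in> G" using iu UG g subgroup.m_closed[OF G] by blast
        have "?h a = a" if a: "a \<in> A" for a
        proof -
          have aX: "a \<in> X" using a A by auto
          have iB: "inv\<^bsub>BijGroup X\<^esub> u \<in> Bij X" using iu UG GB by auto
          have "?h a = (inv\<^bsub>BijGroup X\<^esub> u) (u a)"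
            using Bij_mult_apply[OF iB _ aX] gB u(2) a by (simp add: BijGroup_def)
          also have "\<dots> = (inv\<^bsub>BijGroup X\<^esub> u \<otimes>\<^bsub>BijGroup X\<^esub> u) a"
            using Bij_mult_apply[OF iB _ aX] uB by (simp add: BijGroup_def)
          also have "\<dots> = a" using B.l_inv[OF uB] aX by (simp add: BijGroup_def)
          finally show ?thesis .
        qed
        then have "?h \<in> U" using A(3) hG by auto
        then have "u \<otimes>\<^bsub>BijGroup X\<^esub> ?h \<in> U" by (rule subgroup.m_closed[OF U u(1)])
        then show "g \<in> U" using B.inv_solve_left' uB gB
          by (metis B.inv_closed B.m_assoc B.r_inv B.l_one)
      qed
    qed
    ultimately show ?L by (auto simp: pointwise_topology_def openin_subtopology)
  qed
  then show ?thesis unfolding open_subgroup_def by blast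
qed

section \<open>G-hat-sets\<close>

record ('x, 'z) ghat_set =
  acting :: "('x \<Rightarrow> 'x) set"
  pts :: "'z set"
  act :: "('x \<Rightarrow> 'x) \<Rightarrow> 'z \<Rightarrow> 'z"

definition smooth_set :: "'x set \<Rightarrow> ('x \<Rightarrow> 'x) set \<Rightarrow> ('x, 'z) ghat_set \<Rightarrow> bool" where
  "smooth_set X G Z \<longleftrightarrow>
     open_subgroup X G (acting Z) \<and>
     group_action (perm_group X (acting Z)) (pts Z) (act Z) \<and>
     (\<forall>z\<in>pts Z. open_subgroup X G (stabilizer (perm_group X (acting Z)) (act Z) z))"

definition is_ghat_set :: "'x set \<Rightarrow> ('x \<Rightarrow> 'x) set \<Rightarrow> ('x, 'z) ghat_set \<Rightarrow> bool" where
  "is_ghat_set X G Z \<longleftrightarrow> smooth_set X G Z \<and>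
     finite (orbits (perm_group X (acting Z)) (pts Z) (act Z))"

definition transitive_set :: "'x set \<Rightarrow> ('x, 'z) ghat_set \<Rightarrow> bool" where
  "transitive_set X Z \<longleftrightarrow> pts Z \<noteq> {} \<and>
     transitive_action (perm_group X (acting Z)) (pts Z) (act Z)"

definition ghat_iso ::
  "'x set \<Rightarrow> ('x \<Rightarrow> 'x) set \<Rightarrow> ('x, 'y) ghat_set \<Rightarrow> ('x, 'z) ghat_set \<Rightarrow> bool" where
  "ghat_iso X G Y Z \<longleftrightarrow>
     (\<exists>f U. bij_betw f (pts Y) (pts Z) \<and>
        open_subgroup X G U \<and> U \<subseteq> acting Y \<and> U \<subseteq> acting Z \<and>
        (\<forall>u\<in>U. \<forall>y\<in>pts Y. f (act Y u y) = act Z u (f y)))"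

definition ghat_conj :: "'x set \<Rightarrow> ('x \<Rightarrow> 'x) \<Rightarrow> ('x, 'z) ghat_set \<Rightarrow> ('x, 'z) ghat_set" where
  "ghat_conj X g Z =
     \<lparr>acting = (\<lambda>u. g \<otimes>\<^bsub>BijGroup X\<^esub> u \<otimes>\<^bsub>BijGroup X\<^esub> inv\<^bsub>BijGroup X\<^esub> g) ` acting Z,
      pts = pts Z,
      act = (\<lambda>h. act Z (inv\<^bsub>BijGroup X\<^esub> g \<otimes>\<^bsub>BijGroup X\<^esub> h \<otimes>\<^bsub>BijGroup X\<^esub> g))\<rparr>"

definition ghat_sum :: "('x, 'y) ghat_set \<Rightarrow> ('x, 'z) ghat_set \<Rightarrow> ('x, 'y + 'z) ghat_set" where
  "ghat_sum Y Z =
     \<lparr>acting = acting Y \<inter> acting Z,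
      pts = pts Y <+> pts Z,
      act = (\<lambda>u. restrict (map_sum (act Y u) (act Z u)) (pts Y <+> pts Z))\<rparr>"

definition equivariant :: "('x, 'y) ghat_set \<Rightarrow> ('x, 'z) ghat_set \<Rightarrow> ('y \<Rightarrow> 'z) \<Rightarrow> bool" where
  "equivariant Y Z f \<longleftrightarrow> f \<in> pts Y \<rightarrow> pts Z \<and>
     (\<forall>u\<in>acting Y. \<forall>y\<in>pts Y. f (act Y u y) = act Z u (f y))"

definition ghat_fiber ::
  "'x set \<Rightarrow> ('x, 'y) ghat_set \<Rightarrow> ('x, 'z) ghat_set \<Rightarrow> ('y \<Rightarrow> 'z) \<Rightarrow> 'z \<Rightarrow> ('x, 'y) ghat_set" where
  "ghat_fiber X Y Z f z =
     \<lparr>acting = stabilizer (perm_group X (acting Z)) (act Z) z,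
      pts = {y \<in> pts Y. f y = z},
      act = (\<lambda>u. restrict (act Y u) {y \<in> pts Y. f y = z})\<rparr>"

definition ghat_subset :: "'x set \<Rightarrow> ('x \<Rightarrow> 'x) set \<Rightarrow> 'x set \<Rightarrow> bool" where
  "ghat_subset X G A \<longleftrightarrow> A \<subseteq> X \<and> (\<exists>U. open_subgroup X G U \<and> (\<forall>u\<in>U. u ` A = A))"

section \<open>Measures\<close>

text \<open>Since G-hat-sets form a proper class, a measure is a function on those whose
  underlying set lies in a fixed type. This type contains \<open>X\<close> and an isomorphic copy of every
  G-hat-set (lemma \<open>ghat_set_copy\<close>), so that by invariance under isomorphism nothing is
  lost.\<close>

type_synonym 'x upoint = "'x + ('x \<Rightarrow> 'x) set \<times> nat"

lemma ghat_set_copy: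
  fixes Z :: "('x, 'z) ghat_set"
  assumes Z: "is_ghat_set X G Z"
  shows "\<exists>Z' :: ('x, 'x upoint) ghat_set. is_ghat_set X G Z' \<and> ghat_iso X G Z Z'"
proof -
  let ?U = "perm_group X (acting Z)" and ?A = "act Z" and ?P = "pts Z"
  interpret group_action ?U ?P ?A using Z by (simp add: is_ghat_set_def smooth_set_def)
  interpret U: group ?U using group_hom by (rule group_hom.axioms(1))
  define Os where "Os = orbits ?U ?P ?A"
  have "finite Os" using Z by (simp add: is_ghat_set_def Os_def)
  then obtain idx :: "'z set \<Rightarrow> nat" where idx: "inj_on idx Os"
    using finite_imp_inj_to_nat_seg by blast
  define orb where "orb z = orbit ?U ?A z" for z
  define rep where "rep z = (SOME y. y \<in> orb z)" for z
  define F :: "'z \<Rightarrow> 'x upoint" where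
    "F z = Inr ({u \<in> acting Z. ?A u (rep z) = z}, idx (orb z))" for z
  have orb_eq: "z \<in> orb (rep z) \<and> rep z \<in> ?P" if z: "z \<in> ?P" for z
  proof -
    have "rep z \<in> orb z" unfolding rep_def using orbit_refl[OF z] someI[of "\<lambda>y. y \<in> orb z" z]
      by (simp add: orb_def)
    moreover from this have "rep z \<in> ?P"
      using z element_image by (auto simp: orb_def orbit_def)
    ultimately show ?thesis using orbit_sym[OF z] by (simp add: orb_def)
  qed
  have injF: "inj_on F ?P"
  proof (rule inj_onI)
    fix y z assume yz: "y \<in> ?P" "z \<in> ?P" "F y = F z"
    then have "orb y = orb z"
      using idx by (auto simp: F_def inj_on_def Os_def orbits_def orb_def)
    then have r: "rep y = rep z" by (simp add: rep_def)
    obtain u where "u \<in> acting Z" "?A u (rep y) = y"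
      using orb_eq[OF yz(1)] by (auto simp: orb_def orbit_def)
    with yz(3) r show "y = z" by (auto simp: F_def)
  qed
  define act' where "act' u = restrict (\<lambda>p. F (?A u (inv_into ?P F p))) (F ` ?P)" for u
  define Z' where "Z' = \<lparr>acting = acting Z, pts = F ` ?P, act = act'\<rparr>"
  have act': "act' u (F z) = F (?A u z)" if "z \<in> ?P" for u z
    using that injF by (simp add: act'_def)
  have Bij': "act' u \<in> Bij (F ` ?P)" if u: "u \<in> acting Z" for u
  proof -
    have "bij_betw (?A u) ?P ?P" using bij_prop0[of u] u by (simp add: Bij_def)
    then have b: "bij_betw (F \<circ> ?A u \<circ> inv_into ?P F) (F ` ?P) (F ` ?P)"
      using injF by (intro bij_betw_trans[of _ _ ?P] bij_betw_inv_into)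
        (auto simp: bij_betw_def)
    have "bij_betw (act' u) (F ` ?P) (F ` ?P)"
      by (rule bij_betw_cong[THEN iffD1, OF _ b]) (simp add: act'_def)
    then show ?thesis by (simp add: Bij_def act'_def)
  qed
  have ga: "group_action ?U (F ` ?P) act'"
  proof (rule group_action.intro, rule group_hom.intro[OF U.group_axioms group_BijGroup],
      rule group_hom_axioms.intro, rule homI)
    fix u assume "u \<in> carrier ?U"
    then show "act' u \<in> carrier (BijGroup (F ` ?P))" using Bij' by (simp add: BijGroup_def)
  next
    fix u v assume uv: "u \<in> carrier ?U" "v \<in> carrier ?U"
    have "act' (u \<otimes>\<^bsub>?U\<^esub> v) p = compose (F ` ?P) (act' u) (act' v) p" for p
    proof (cases "p \<in> F ` ?P")
      case True
      then obtain z where z: "z \<in> ?P" "p = F z" by auto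
      have "?A v z \<in> ?P" using element_image[OF uv(2) z(1)] by simp
      then show ?thesis
        using z uv composition_rule[OF z(1) uv] by (simp add: compose_eq act')
    next
      case False
      then show ?thesis by (simp add: act'_def compose_def)
    qed
    then show "act' (u \<otimes>\<^bsub>?U\<^esub> v) = act' u \<otimes>\<^bsub>BijGroup (F ` ?P)\<^esub> act' v"
      using uv Bij' by (auto simp: BijGroup_def)
  qed
  have stab: "stabilizer ?U act' (F z) = stabilizer ?U ?A z" if z: "z \<in> ?P" for z
    using z injF element_image[of _ z]
    by (auto simp: stabilizer_def act' inj_on_eq_iff)
  have orb': "orbit ?U act' (F z) = F ` orbit ?U ?A z" if z: "z \<in> ?P" for z
    using z by (auto simp: orbit_def act')
  have orbs: "orbits ?U (F ` ?P) act' = (`) F ` orbits ?U ?P ?A"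
  proof -
    have "orbits ?U (F ` ?P) act' = (\<lambda>z. orbit ?U act' (F z)) ` ?P"
      by (auto simp: orbits_def)
    also have "\<dots> = (\<lambda>z. F ` orbit ?U ?A z) ` ?P" using orb' by (rule image_cong[OF refl])
    finally show ?thesis by (auto simp: orbits_def)
  qed
  have "is_ghat_set X G Z'"
    using Z ga stab orbs by (auto simp: is_ghat_set_def smooth_set_def Z'_def)
  moreover have "ghat_iso X G Z Z'"
    unfolding ghat_iso_def Z'_def
    using Z injF act' by (intro exI[of _ F] exI[of _ "acting Z"])
      (auto simp: is_ghat_set_def smooth_set_def bij_betw_def)
  ultimately show ?thesis by blast
qed

locale ghat_measure =
  fixes X :: "'x set" and G :: "('x \<Rightarrow> 'x) set" and \<mu> :: "('x, 'x upoint) ghat_set \<Rightarrow> 'k::field"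
  assumes measure_iso:
      "\<lbrakk>is_ghat_set X G Y; is_ghat_set X G Z; ghat_iso X G Y Z\<rbrakk> \<Longrightarrow> \<mu> Y = \<mu> Z"
    and measure_pt: "\<lbrakk>is_ghat_set X G Z; pts Z = {z}\<rbrakk> \<Longrightarrow> \<mu> Z = 1"
    and measure_conj: "\<lbrakk>is_ghat_set X G Z; g \<in> G\<rbrakk> \<Longrightarrow> \<mu> (ghat_conj X g Z) = \<mu> Z"
    and measure_fiber:
      "\<lbrakk>smooth_set X G Y; smooth_set X G Z; acting Y = acting Z;
        transitive_set X Y; transitive_set X Z; equivariant Y Z f; z \<in> pts Z\<rbrakk>
       \<Longrightarrow> \<mu> Y = \<mu> (ghat_fiber X Y Z f z) * \<mu> Z"
    and measure_sum:
      "\<lbrakk>is_ghat_set X G Y; is_ghat_set X G Z; is_ghat_set X G W; ghat_iso X G W (ghat_sum Y Z)\<rbrakk>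
       \<Longrightarrow> \<mu> W = \<mu> Y + \<mu> Z"

text \<open>A G-hat-subset of \<open>X\<close> as a G-hat-set: its setwise stabilizer is an open subgroup, and by
  \<open>measure_iso\<close> the choice of open subgroup is irrelevant to the measure.\<close>

definition sub_ghat :: "('x \<Rightarrow> 'x) set \<Rightarrow> 'x set \<Rightarrow> ('x, 'x upoint) ghat_set" where
  "sub_ghat G A =
     \<lparr>acting = {g \<in> G. g ` A = A},
      pts = Inl ` A,
      act = (\<lambda>g. restrict (\<lambda>p. Inl (g (projl p))) (Inl ` A))\<rparr>"

section \<open>Schwartz spaces and the tensor power\<close>

text \<open>Functions on a set \<open>Y\<close> are represented by their extension by zero.\<close>

definition fun_space :: "('y \<Rightarrow> 'k::field) set \<Rightarrow> ('k, 'y \<Rightarrow> 'k) module" where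
  "fun_space S =
     \<lparr>carrier = S, mult = (\<lambda>v w y. v y * w y), one = (\<lambda>_. 1), zero = (\<lambda>_. 0),
      add = (\<lambda>v w y. v y + w y), smult = (\<lambda>c v y. c * v y)\<rparr>"

definition translate ::
  "'x set \<Rightarrow> 'y set \<Rightarrow> (('x \<Rightarrow> 'x) \<Rightarrow> 'y \<Rightarrow> 'y) \<Rightarrow> ('x \<Rightarrow> 'x) \<Rightarrow> ('y \<Rightarrow> 'k::field) \<Rightarrow> 'y \<Rightarrow> 'k" where
  "translate X Y \<alpha> g v = (\<lambda>y. if y \<in> Y then v (\<alpha> (inv\<^bsub>BijGroup X\<^esub> g) y) else 0)"

definition schwartz ::
  "'x set \<Rightarrow> ('x \<Rightarrow> 'x) set \<Rightarrow> 'y set \<Rightarrow> (('x \<Rightarrow> 'x) \<Rightarrow> 'y \<Rightarrow> 'y) \<Rightarrow> ('y \<Rightarrow> 'k::field) set" where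
  "schwartz X G Y \<alpha> =
     {v. (\<forall>y. y \<notin> Y \<longrightarrow> v y = 0) \<and>
         (\<exists>U. open_subgroup X G U \<and> (\<forall>u\<in>U. translate X Y \<alpha> u v = v))}"

text \<open>An \<open>r\<close>-tuple \<open>(X\<^sub>1, \<dots>, X\<^sub>r)\<close> is a list, with \<open>X\<^sub>i\<close> at position \<open>i - 1\<close>.\<close>

definition Part :: "'x set \<Rightarrow> ('x \<Rightarrow> 'x) set \<Rightarrow> nat \<Rightarrow> 'x set list set" where
  "Part X G r =
     {P. length P = r \<and> (\<forall>A\<in>set P. ghat_subset X G A) \<and>
         (\<forall>i<r. \<forall>j<r. i \<noteq> j \<longrightarrow> P ! i \<inter> P ! j = {}) \<and> \<Union> (set P) = X}"

definition part_act :: "('x \<Rightarrow> 'x) \<Rightarrow> 'x set list \<Rightarrow> 'x set list" where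
  "part_act g P = map ((`) g) P"

definition tensor_power ::
  "'x set \<Rightarrow> ('x \<Rightarrow> 'x) set \<Rightarrow> nat \<Rightarrow> ('k::field, 'x set list \<Rightarrow> 'k) module" where
  "tensor_power X G r = fun_space (schwartz X G (Part X G r) part_act)"

definition move :: "nat \<Rightarrow> nat \<Rightarrow> 'x \<Rightarrow> 'x set list \<Rightarrow> 'x set list" where
  "move i j y P = P[i := P ! i - {y}, j := insert y (P ! j)]"

definition E_op ::
  "'x set \<Rightarrow> ('x \<Rightarrow> 'x) set \<Rightarrow> (('x, 'x upoint) ghat_set \<Rightarrow> 'k::field) \<Rightarrow> nat \<Rightarrow> nat \<Rightarrow> nat \<Rightarrow>
   ('x set list \<Rightarrow> 'k) \<Rightarrow> 'x set list \<Rightarrow> 'k" where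
  "E_op X G \<mu> r i j \<phi> P =
     (if P \<notin> Part X G r then 0
      else if i = j then \<mu> (sub_ghat G (P ! i)) * \<phi> P
      else
        let U = (SOME U. open_subgroup X G U \<and>
                   (\<forall>u\<in>U. translate X (Part X G r) part_act u \<phi> = \<phi>) \<and>
                   (\<forall>u\<in>U. \<forall>A\<in>set P. u ` A = A))
        in \<Sum>Q\<in>orbits (perm_group X U) (P ! i) (\<lambda>u. u).
             \<mu> (sub_ghat G Q) * \<phi> (move i j (SOME y. y \<in> Q) P))"

section \<open>Lie algebras and their representations\<close>

record ('k, 'l) lie_algebra = "('k, 'l) module" +
  lie_bracket :: "'l \<Rightarrow> 'l \<Rightarrow> 'l"

locale lie_algebra = vectorspace class_ring L
  for L :: "('k::field, 'l, 'm) lie_algebra_scheme" (structure) +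
  assumes bracket_closed:
      "\<lbrakk>x \<in> carrier L; y \<in> carrier L\<rbrakk> \<Longrightarrow> lie_bracket L x y \<in> carrier L"
    and bracket_add_left:
      "\<lbrakk>x \<in> carrier L; y \<in> carrier L; z \<in> carrier L\<rbrakk>
       \<Longrightarrow> lie_bracket L (x \<oplus> y) z = lie_bracket L x z \<oplus> lie_bracket L y z"
    and bracket_add_right:
      "\<lbrakk>x \<in> carrier L; y \<in> carrier L; z \<in> carrier L\<rbrakk>
       \<Longrightarrow> lie_bracket L x (y \<oplus> z) = lie_bracket L x y \<oplus> lie_bracket L x z"
    and bracket_smult_left:
      "\<lbrakk>x \<in> carrier L; y \<in> carrier L\<rbrakk> \<Longrightarrow> lie_bracket L (c \<odot> x) y = c \<odot> lie_bracket L x y"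
    and bracket_smult_right:
      "\<lbrakk>x \<in> carrier L; y \<in> carrier L\<rbrakk> \<Longrightarrow> lie_bracket L x (c \<odot> y) = c \<odot> lie_bracket L x y"
    and bracket_self: "x \<in> carrier L \<Longrightarrow> lie_bracket L x x = \<zero>"
    and jacobi:
      "\<lbrakk>x \<in> carrier L; y \<in> carrier L; z \<in> carrier L\<rbrakk>
       \<Longrightarrow> lie_bracket L x (lie_bracket L y z) \<oplus> lie_bracket L y (lie_bracket L z x)
             \<oplus> lie_bracket L z (lie_bracket L x y) = \<zero>"

definition lie_rep ::
  "('k::field, 'l, 'm) lie_algebra_scheme \<Rightarrow> ('k, 'v, 'n) module_scheme \<Rightarrow> ('l \<Rightarrow> 'v \<Rightarrow> 'v) \<Rightarrow> bool"
  where
  "lie_rep L V \<rho> \<longleftrightarrow>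
     lie_algebra L \<and> vectorspace class_ring V \<and>
     (\<forall>x\<in>carrier L. linear_map class_ring V V (\<rho> x)) \<and>
     (\<forall>x\<in>carrier L. \<forall>y\<in>carrier L. \<forall>v\<in>carrier V. \<rho> (x \<oplus>\<^bsub>L\<^esub> y) v = \<rho> x v \<oplus>\<^bsub>V\<^esub> \<rho> y v) \<and>
     (\<forall>c. \<forall>x\<in>carrier L. \<forall>v\<in>carrier V. \<rho> (c \<odot>\<^bsub>L\<^esub> x) v = c \<odot>\<^bsub>V\<^esub> \<rho> x v) \<and>
     (\<forall>x\<in>carrier L. \<forall>y\<in>carrier L. \<forall>v\<in>carrier V.
        \<rho> (lie_bracket L x y) v = \<rho> x (\<rho> y v) \<ominus>\<^bsub>V\<^esub> \<rho> y (\<rho> x v))"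

definition lie_subrep ::
  "('k::field, 'l, 'm) lie_algebra_scheme \<Rightarrow> ('k, 'v) module \<Rightarrow> ('l \<Rightarrow> 'v \<Rightarrow> 'v) \<Rightarrow> 'v set \<Rightarrow> bool"
  where
  "lie_subrep L V \<rho> W \<longleftrightarrow>
     subspace class_ring W V \<and> (\<forall>x\<in>carrier L. \<forall>w\<in>W. \<rho> x w \<in> W)"

definition lie_rep_iso ::
  "('k::field, 'l, 'm) lie_algebra_scheme \<Rightarrow> ('k, 'v) module \<Rightarrow> ('l \<Rightarrow> 'v \<Rightarrow> 'v) \<Rightarrow>
   ('k, 'w) module \<Rightarrow> ('l \<Rightarrow> 'w \<Rightarrow> 'w) \<Rightarrow> bool" where
  "lie_rep_iso L V \<rho> W \<sigma> \<longleftrightarrow>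
     (\<exists>f. linear_map class_ring V W f \<and> bij_betw f (carrier V) (carrier W) \<and>
        (\<forall>x\<in>carrier L. \<forall>v\<in>carrier V. f (\<rho> x v) = \<sigma> x (f v)))"

definition quot_space :: "('k, 'v) module \<Rightarrow> 'v set \<Rightarrow> ('k, 'v set) module" where
  "quot_space V N =
     \<lparr>carrier = a_rcosets\<^bsub>V\<^esub> N, mult = undefined, one = undefined, zero = N, add = set_add V,
      smult = (\<lambda>c C. \<Union>v\<in>C. N +>\<^bsub>V\<^esub> (c \<odot>\<^bsub>V\<^esub> v))\<rparr>"

definition quot_act ::
  "('k, 'v) module \<Rightarrow> 'v set \<Rightarrow> ('l \<Rightarrow> 'v \<Rightarrow> 'v) \<Rightarrow> 'l \<Rightarrow> 'v set \<Rightarrow> 'v set" where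
  "quot_act V N \<rho> x C = (\<Union>v\<in>C. N +>\<^bsub>V\<^esub> \<rho> x v)"

definition gl :: "nat \<Rightarrow> ('k::field, 'k mat) lie_algebra" where
  "gl r = module.extend (module_mat TYPE('k) r r) \<lparr>lie_bracket = (\<lambda>A B. A * B - B * A)\<rparr>"

definition sl :: "nat \<Rightarrow> ('k::field, 'k mat) lie_algebra" where
  "sl r = (gl r)\<lparr>carrier := {A \<in> carrier_mat r r. (\<Sum>i<r. A $$ (i, i)) = 0}\<rparr>"

text \<open>Matrix indices start at \<open>0\<close>, so the elementary matrix \<open>E\<^sub>1\<^sub>2\<close> of size \<open>2\<close> is
  \<open>elem_mat 2 0 1\<close>.\<close>

definition elem_mat :: "nat \<Rightarrow> nat \<Rightarrow> nat \<Rightarrow> 'k::field mat" where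
  "elem_mat r i j = mat r r (\<lambda>(a, b). if a = i \<and> b = j then 1 else 0)"

definition gl_act ::
  "'x set \<Rightarrow> ('x \<Rightarrow> 'x) set \<Rightarrow> (('x, 'x upoint) ghat_set \<Rightarrow> 'k::field) \<Rightarrow> nat \<Rightarrow>
   'k mat \<Rightarrow> ('x set list \<Rightarrow> 'k) \<Rightarrow> 'x set list \<Rightarrow> 'k" where
  "gl_act X G \<mu> r A \<phi> P = (\<Sum>i<r. \<Sum>j<r. A $$ (i, j) * E_op X G \<mu> r i j \<phi> P)"

section \<open>The orbit algebra\<close>

definition orbit_component :: "'x set \<Rightarrow> ('x \<Rightarrow> 'x) set \<Rightarrow> nat \<Rightarrow> ('x set \<Rightarrow> complex) set" where
  "orbit_component X G n =
     {v. (\<forall>A. A \<notin> nsets X n \<longrightarrow> v A = 0) \<and> (\<forall>g\<in>G. \<forall>A\<in>nsets X n. v (g ` A) = v A)}"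

definition orbit_embed ::
  "'x set \<Rightarrow> ('x \<Rightarrow> 'x) set \<Rightarrow> nat \<Rightarrow> ('x set \<Rightarrow> complex) \<Rightarrow> 'x set list \<Rightarrow> complex" where
  "orbit_embed X G n v P = (if P \<in> Part X G 2 \<and> P ! 0 \<in> nsets X n then v (P ! 0) else 0)"

definition orbit_algebra :: "'x set \<Rightarrow> ('x \<Rightarrow> 'x) set \<Rightarrow> ('x set list \<Rightarrow> complex) set" where
  "orbit_algebra X G =
     {\<lambda>P. \<Sum>n<N. orbit_embed X G n (v n) P | N v. \<forall>n. v n \<in> orbit_component X G n}"

section \<open>Universal enveloping algebras and Verma modules\<close>

text \<open>The free associative algebra on the letters \<open>'l\<close> is the monoid algebra of the free monoid.\<close>

datatype 'l free_word = Word (letters: "'l list")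

instantiation free_word :: (type) monoid_add
begin
definition zero_free_word :: "'a free_word" where "0 = Word []"
definition plus_free_word :: "'a free_word \<Rightarrow> 'a free_word \<Rightarrow> 'a free_word" where
  "v + w = Word (letters v @ letters w)"
instance by standard (simp_all add: zero_free_word_def plus_free_word_def)
end

definition free_alg :: "('k::field, 'l, 'm) lie_algebra_scheme \<Rightarrow> ('l free_word \<Rightarrow>\<^sub>0 'k) ring" where
  "free_alg L =
     \<lparr>carrier = {p. \<forall>w\<in>Poly_Mapping.keys p. set (letters w) \<subseteq> carrier L},
      mult = (*), one = 1, zero = 0, add = (+)\<rparr>"

definition gen :: "'l \<Rightarrow> 'l free_word \<Rightarrow>\<^sub>0 'k::field" where
  "gen x = Poly_Mapping.single (Word [x]) 1"

definition const :: "'k::field \<Rightarrow> 'l free_word \<Rightarrow>\<^sub>0 'k" where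
  "const c = Poly_Mapping.single 0 c"

definition env_ideal :: "('k::field, 'l, 'm) lie_algebra_scheme \<Rightarrow> ('l free_word \<Rightarrow>\<^sub>0 'k) set" where
  "env_ideal L = Idl\<^bsub>free_alg L\<^esub>
     ({gen (x \<oplus>\<^bsub>L\<^esub> y) - gen x - gen y | x y. x \<in> carrier L \<and> y \<in> carrier L} \<union>
      {gen (c \<odot>\<^bsub>L\<^esub> x) - const c * gen x | c x. x \<in> carrier L} \<union>
      {gen x * gen y - gen y * gen x - gen (lie_bracket L x y) | x y.
         x \<in> carrier L \<and> y \<in> carrier L})"

definition env_alg ::
  "('k::field, 'l, 'm) lie_algebra_scheme \<Rightarrow> ('l free_word \<Rightarrow>\<^sub>0 'k) set ring" where
  "env_alg L = free_alg L Quot env_ideal L"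

definition env_class ::
  "('k::field, 'l, 'm) lie_algebra_scheme \<Rightarrow> ('l free_word \<Rightarrow>\<^sub>0 'k) \<Rightarrow> ('l free_word \<Rightarrow>\<^sub>0 'k) set" where
  "env_class L p = env_ideal L +>\<^bsub>free_alg L\<^esub> p"

text \<open>For a Lie subalgebra \<open>B\<close> of \<open>L\<close>, the homomorphism from \<open>U(B)\<close> to \<open>U(L)\<close> sends the class of
  \<open>p\<close> modulo \<open>env_ideal B\<close> to its class modulo the larger \<open>env_ideal L\<close>.\<close>

definition env_incl ::
  "('k::field, 'l, 'm) lie_algebra_scheme \<Rightarrow> ('l free_word \<Rightarrow>\<^sub>0 'k) set \<Rightarrow>
   ('l free_word \<Rightarrow>\<^sub>0 'k) set" where
  "env_incl L b = (\<Union>p\<in>b. env_class L p)"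

definition env_act ::
  "('k::field, 'v) module \<Rightarrow> ('l \<Rightarrow> 'v \<Rightarrow> 'v) \<Rightarrow> ('l free_word \<Rightarrow>\<^sub>0 'k) set \<Rightarrow> 'v \<Rightarrow> 'v" where
  "env_act V \<rho> b v =
     (let p = (SOME p. p \<in> b)
      in \<Oplus>\<^bsub>V\<^esub>w\<in>Poly_Mapping.keys p. Poly_Mapping.lookup p w \<odot>\<^bsub>V\<^esub> foldr \<rho> (letters w) v)"

text \<open>The tensor product \<open>U(L) \<otimes>\<^bsub>U(B)\<^esub> V\<close>: the free abelian group on \<open>U(L) \<times> V\<close> (its operation
  is written multiplicatively by the library) modulo biadditivity and balancedness.\<close>

definition tensor_free ::
  "('k::field, 'l, 'm) lie_algebra_scheme \<Rightarrow> ('k, 'v) module \<Rightarrow>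
   (('l free_word \<Rightarrow>\<^sub>0 'k) set \<times> 'v \<Rightarrow>\<^sub>0 int) monoid" where
  "tensor_free L V = free_Abelian_group (carrier (env_alg L) \<times> carrier V)"

definition tensor_rels ::
  "('k::field, 'l, 'm) lie_algebra_scheme \<Rightarrow> ('k, 'l, 'n) lie_algebra_scheme \<Rightarrow>
   ('k, 'v) module \<Rightarrow> ('l \<Rightarrow> 'v \<Rightarrow> 'v) \<Rightarrow> (('l free_word \<Rightarrow>\<^sub>0 'k) set \<times> 'v \<Rightarrow>\<^sub>0 int) set" where
  "tensor_rels L B V \<rho> = generate (tensor_free L V)
     ({frag_of (a \<oplus>\<^bsub>env_alg L\<^esub> a', v) - frag_of (a, v) - frag_of (a', v) | a a' v.
         a \<in> carrier (env_alg L) \<and> a' \<in> carrier (env_alg L) \<and> v \<in> carrier V} \<union>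
      {frag_of (a, v \<oplus>\<^bsub>V\<^esub> v') - frag_of (a, v) - frag_of (a, v') | a v v'.
         a \<in> carrier (env_alg L) \<and> v \<in> carrier V \<and> v' \<in> carrier V} \<union>
      {frag_of (a \<otimes>\<^bsub>env_alg L\<^esub> env_incl L b, v) - frag_of (a, env_act V \<rho> b v) | a b v.
         a \<in> carrier (env_alg L) \<and> b \<in> carrier (env_alg B) \<and> v \<in> carrier V})"

definition tensor_lmult ::
  "('k::field, 'l, 'm) lie_algebra_scheme \<Rightarrow> ('k, 'l, 'n) lie_algebra_scheme \<Rightarrow>
   ('k, 'v) module \<Rightarrow> ('l \<Rightarrow> 'v \<Rightarrow> 'v) \<Rightarrow> ('l free_word \<Rightarrow>\<^sub>0 'k) set \<Rightarrow>
   (('l free_word \<Rightarrow>\<^sub>0 'k) set \<times> 'v \<Rightarrow>\<^sub>0 int) set \<Rightarrow>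
   (('l free_word \<Rightarrow>\<^sub>0 'k) set \<times> 'v \<Rightarrow>\<^sub>0 int) set" where
  "tensor_lmult L B V \<rho> a C =
     (\<Union>t\<in>C. tensor_rels L B V \<rho> #>\<^bsub>tensor_free L V\<^esub>
        frag_extend (\<lambda>(a', v). frag_of (a \<otimes>\<^bsub>env_alg L\<^esub> a', v)) t)"

definition induced_space ::
  "('k::field, 'l, 'm) lie_algebra_scheme \<Rightarrow> ('k, 'l, 'n) lie_algebra_scheme \<Rightarrow>
   ('k, 'v) module \<Rightarrow> ('l \<Rightarrow> 'v \<Rightarrow> 'v) \<Rightarrow>
   ('k, (('l free_word \<Rightarrow>\<^sub>0 'k) set \<times> 'v \<Rightarrow>\<^sub>0 int) set) module" where
  "induced_space L B V \<rho> =
     (let T = tensor_free L V Mod tensor_rels L B V \<rho>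
      in \<lparr>carrier = carrier T, mult = undefined, one = undefined, zero = \<one>\<^bsub>T\<^esub>, add = mult T,
          smult = (\<lambda>c. tensor_lmult L B V \<rho> (env_class L (const c)))\<rparr>)"

definition induced_act ::
  "('k::field, 'l, 'm) lie_algebra_scheme \<Rightarrow> ('k, 'l, 'n) lie_algebra_scheme \<Rightarrow>
   ('k, 'v) module \<Rightarrow> ('l \<Rightarrow> 'v \<Rightarrow> 'v) \<Rightarrow> 'l \<Rightarrow>
   (('l free_word \<Rightarrow>\<^sub>0 'k) set \<times> 'v \<Rightarrow>\<^sub>0 int) set \<Rightarrow>
   (('l free_word \<Rightarrow>\<^sub>0 'k) set \<times> 'v \<Rightarrow>\<^sub>0 int) set" where
  "induced_act L B V \<rho> x = tensor_lmult L B V \<rho> (env_class L (gen x))"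

definition sl2_h :: "complex mat" where
  "sl2_h = elem_mat 2 0 0 - elem_mat 2 1 1"

definition sl2_f :: "complex mat" where
  "sl2_f = elem_mat 2 1 0"

definition borel_minus :: "(complex, complex mat) lie_algebra" where
  "borel_minus = (sl 2)\<lparr>carrier := {a \<cdot>\<^sub>m sl2_h + b \<cdot>\<^sub>m sl2_f | a b. True}\<rparr>"

definition line :: "(complex, complex) module" where
  "line = \<lparr>carrier = UNIV, mult = (*), one = 1, zero = 0, add = (+), smult = (*)\<rparr>"

text \<open>The entry at \<open>(0, 0)\<close> of \<open>a h + b f\<close> is \<open>a\<close>, so here \<open>h\<close> acts by \<open>l\<close> and \<open>f\<close> by \<open>0\<close>.\<close>

definition line_act :: "complex \<Rightarrow> complex mat \<Rightarrow> complex \<Rightarrow> complex" where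
  "line_act l A c = A $$ (0, 0) * l * c"

abbreviation verma_space where
  "verma_space l \<equiv> induced_space (sl 2) borel_minus line (line_act l)"

abbreviation verma_act where
  "verma_act l \<equiv> induced_act (sl 2) borel_minus line (line_act l)"

end

theory Submission
  imports Defs "HOL-Computational_Algebra.Polynomial" "HOL-Library.Function_Algebras"
begin

text \<open>A measure restricts to a finitely additive, \<open>G\<close>-invariant measure on the G-hat-subsets of \<open>X\<close>,
  and \<open>E\<^sub>i\<^sub>j \<phi> P\<close> is the integral over \<open>y \<in> P\<^sub>i\<close> of \<open>\<phi>\<close> at \<open>P\<close> with \<open>y\<close> moved to \<open>P\<^sub>j\<close>. In
  \<open>E\<^sub>i\<^sub>j E\<^sub>k\<^sub>l\<close> either the same point is moved twice, which happens only for \<open>j = k\<close> and gives \<open>E\<^sub>i\<^sub>l\<close>,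
  or two distinct points are moved, and this double integral is symmetric by a Fubini theorem. The
  Fubini theorem reduces to a single orbit \<open>U (y, z)\<close> on pairs, where it follows from multiplicativity
  of the measure along the two projections.

  For infinite \<open>X\<close>, \<open>e\<close> is injective on the orbit algebra and raises the degree by one. One adjoins to
  a subrepresentation \<open>S\<close> with \<open>e\<close>-torsion-free quotient a homogeneous element \<open>w\<close> outside \<open>S\<close> of
  minimal degree: then \<open>f w \<in> S\<close>, so \<open>w\<close> is a lowest weight vector modulo \<open>S\<close>, the \<open>e\<^sup>i w\<close> are
  independent modulo \<open>S\<close>, and \<open>S + \<complex>[e] w\<close> again has torsion-free quotient. The components being
  finite-dimensional, iterating exhausts the orbit algebra.\<close>

text \<open>The Verma module is a quotient of a free abelian group of formal tensors, whose size
  cannot be read off. Its comparison with a subquotient of the orbit algebra therefore runs through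
  a third space, the polynomials in one variable, which parametrize both sides with the same action.
  On the Verma side surjectivity comes from commuting \<open>h\<close> and \<open>f\<close> past
  powers of \<open>e\<close>, injectivity from evaluating tensors on polynomials. The operators are
  defined by orbit sums for a chosen subgroup. Rewriting them as integrals over all of
  \<open>X\<close> of a function extended by zero removes the choice; linearity, equivariance and
  products are then read off the integral. Torsion-freeness is carried along because it makes the
  powers of \<open>e\<close> applied to a new vector independent modulo what is already there. It
  starts with the injectivity of \<open>e\<close>, the place where an infinite \<open>X\<close>
  enters. A vector of degree \<open>n\<close> has weight \<open>2 n - nu X\<close>: a set of
  \<open>n\<close> points has measure \<open>n\<close>, its complement
  \<open>nu X - n\<close>.\<close>

lemma vectorspace_class_ringI:
  fixes W :: "('k::field, 'w, 'n) module_scheme"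
  assumes "abelian_group W"
    and "\<And>c x. x \<in> carrier W \<Longrightarrow> c \<odot>\<^bsub>W\<^esub> x \<in> carrier W"
    and "\<And>c d x. x \<in> carrier W \<Longrightarrow> (c + d) \<odot>\<^bsub>W\<^esub> x = c \<odot>\<^bsub>W\<^esub> x \<oplus>\<^bsub>W\<^esub> d \<odot>\<^bsub>W\<^esub> x"
    and "\<And>c x y. x \<in> carrier W \<Longrightarrow> y \<in> carrier W \<Longrightarrow>
      c \<odot>\<^bsub>W\<^esub> (x \<oplus>\<^bsub>W\<^esub> y) = c \<odot>\<^bsub>W\<^esub> x \<oplus>\<^bsub>W\<^esub> c \<odot>\<^bsub>W\<^esub> y"
    and "\<And>c d x. x \<in> carrier W \<Longrightarrow> (c * d) \<odot>\<^bsub>W\<^esub> x = c \<odot>\<^bsub>W\<^esub> (d \<odot>\<^bsub>W\<^esub> x)"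
    and "\<And>x. x \<in> carrier W \<Longrightarrow> 1 \<odot>\<^bsub>W\<^esub> x = x"
  shows "vectorspace class_ring W"
proof -
  have F: "field (class_ring :: 'k ring)" by (rule class_field)
  then have C: "cring (class_ring :: 'k ring)" by (simp add: field_def domain_def)
  have "module class_ring W"
    by (rule module.intro[OF C assms(1)], unfold_locales) (simp_all add: assms(2-))
  then show ?thesis using F by (simp add: vectorspace_def)
qed

text \<open>Every carrier element is some \<open>f x\<close>, so each axiom for the record
  \<open>W\<close> pulls back along \<open>f\<close> to the corresponding law of a type-class vector
  space.\<close>

lemma vectorspace_transport:
  fixes f :: "'v::ab_group_add \<Rightarrow> 'w" and W :: "('k::field, 'w, 'n) module_scheme"
  assumes sc: "Vector_Spaces.vector_space scl"
    and bij: "bij_betw f UNIV (carrier W)"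
    and add: "\<And>x y. f (x + y) = f x \<oplus>\<^bsub>W\<^esub> f y"
    and zero: "f 0 = \<zero>\<^bsub>W\<^esub>"
    and smult: "\<And>c x. f (scl c x) = c \<odot>\<^bsub>W\<^esub> f x"
  shows "vectorspace class_ring W"
proof -
  interpret Vector_Spaces.vector_space scl by (rule sc)
  have img: "\<exists>x. w = f x" if "w \<in> carrier W" for w
    using bij that by (auto simp: bij_betw_def)
  have fc: "f x \<in> carrier W" for x using bij by (auto simp: bij_betw_def)
  have "abelian_group W"
  proof (rule abelian_groupI)
    show "x \<oplus>\<^bsub>W\<^esub> y \<in> carrier W" if "x \<in> carrier W" "y \<in> carrier W" for x y
      using that img fc by (metis add)
    show "\<zero>\<^bsub>W\<^esub> \<in> carrier W" using fc zero by metis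
    show "x \<oplus>\<^bsub>W\<^esub> y \<oplus>\<^bsub>W\<^esub> z = x \<oplus>\<^bsub>W\<^esub> (y \<oplus>\<^bsub>W\<^esub> z)"
      if "x \<in> carrier W" "y \<in> carrier W" "z \<in> carrier W" for x y z
      using that[THEN img] by (auto simp: add[symmetric] add.assoc)
    show "x \<oplus>\<^bsub>W\<^esub> y = y \<oplus>\<^bsub>W\<^esub> x" if "x \<in> carrier W" "y \<in> carrier W" for x y
      using that[THEN img] by (auto simp: add[symmetric] add.commute)
    show "\<zero>\<^bsub>W\<^esub> \<oplus>\<^bsub>W\<^esub> x = x" if "x \<in> carrier W" for x
      using that[THEN img] by (auto simp: add[symmetric] zero[symmetric])
    show "\<exists>y\<in>carrier W. y \<oplus>\<^bsub>W\<^esub> x = \<zero>\<^bsub>W\<^esub>" if x: "x \<in> carrier W" for x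
    proof -
      obtain v where "x = f v" using img[OF x] by auto
      then show ?thesis using fc by (intro bexI[of _ "f (- v)"]) (auto simp: add[symmetric] zero)
    qed
  qed
  then show ?thesis
    by (rule vectorspace_class_ringI)
      (auto dest!: img simp: fc add[symmetric] smult[symmetric] scale_left_distrib scale_right_distrib)
qed

lemma linear_map_class_ringI:
  assumes "vectorspace class_ring V" "vectorspace class_ring W"
    and "\<And>x. x \<in> carrier V \<Longrightarrow> f x \<in> carrier W"
    and "\<And>x y. x \<in> carrier V \<Longrightarrow> y \<in> carrier V \<Longrightarrow> f (x \<oplus>\<^bsub>V\<^esub> y) = f x \<oplus>\<^bsub>W\<^esub> f y"
    and "\<And>c x. x \<in> carrier V \<Longrightarrow> f (c \<odot>\<^bsub>V\<^esub> x) = c \<odot>\<^bsub>W\<^esub> f x"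
  shows "linear_map class_ring V W f"
  using assms
  by (auto simp: linear_map_def mod_hom_def mod_hom_axioms_def module_hom_def vectorspace_def)

text \<open>The isomorphism is \<open>b\<close> after the inverse of \<open>a\<close>. In the
  application \<open>V\<close> is a subquotient and \<open>W\<close> a Verma module, both consisting
  of cosets; each is reached from polynomials by an explicit map, so no map between cosets has to be
  shown well defined.\<close>

lemma lie_rep_iso_common_model:
  fixes a :: "'v::ab_group_add \<Rightarrow> 'y" and b :: "'v \<Rightarrow> 'z"
    and V :: "('k::field, 'y) module" and W :: "('k, 'z) module"
  assumes sc: "Vector_Spaces.vector_space scl"
    and a: "bij_betw a UNIV (carrier V)" "\<And>x y. a (x + y) = a x \<oplus>\<^bsub>V\<^esub> a y"
      "a 0 = \<zero>\<^bsub>V\<^esub>" "\<And>c x. a (scl c x) = c \<odot>\<^bsub>V\<^esub> a x"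
      "\<And>A x. A \<in> carrier L \<Longrightarrow> a (K A x) = \<rho> A (a x)"
    and b: "bij_betw b UNIV (carrier W)" "\<And>x y. b (x + y) = b x \<oplus>\<^bsub>W\<^esub> b y"
      "b 0 = \<zero>\<^bsub>W\<^esub>" "\<And>c x. b (scl c x) = c \<odot>\<^bsub>W\<^esub> b x"
      "\<And>A x. A \<in> carrier L \<Longrightarrow> b (K A x) = \<sigma> A (b x)"
  shows "lie_rep_iso L V \<rho> W \<sigma>"
proof -
  define g where "g = b \<circ> inv_into UNIV a"
  have inj: "inj a" using a(1) by (simp add: bij_betw_def)
  have ga: "g (a x) = b x" for x using inj by (simp add: g_def)
  have img: "\<exists>x. w = a x" if "w \<in> carrier V" for w
    using a(1) that by (auto simp: bij_betw_def)
  have bc: "b x \<in> carrier W" for x using b(1) by (auto simp: bij_betw_def)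
  have "linear_map class_ring V W g"
    by (rule linear_map_class_ringI vectorspace_transport[OF sc a(1-4)]
        vectorspace_transport[OF sc b(1-4)])+
      (auto dest!: img simp: ga bc a(2,4)[symmetric] b(2,4))
  moreover have "bij_betw g (carrier V) (carrier W)"
    unfolding g_def using a(1) b(1) by (metis bij_betw_inv_into bij_betw_trans)
  moreover have "\<forall>A\<in>carrier L. \<forall>v\<in>carrier V. g (\<rho> A v) = \<sigma> A (g v)"
    by (auto dest!: img simp: ga a(5)[symmetric] b(5))
  ultimately show ?thesis unfolding lie_rep_iso_def by blast
qed

section \<open>A polynomial model of the lowest weight Verma module\<close>

text \<open>The monomial \<open>x\<^sup>n\<close> stands for \<open>e\<^sup>n\<close> applied to the lowest weight vector; the formulas for \<open>h\<close>
  and \<open>f\<close> result from commuting them past \<open>e\<^sup>n\<close>.\<close>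

definition poly_h :: "complex \<Rightarrow> complex poly \<Rightarrow> complex poly" where
  "poly_h l p = Polynomial.smult l p + Polynomial.smult 2 (pCons 0 (pderiv p))"

definition poly_f :: "complex \<Rightarrow> complex poly \<Rightarrow> complex poly" where
  "poly_f l p = - (Polynomial.smult l (pderiv p) + pCons 0 (pderiv (pderiv p)))"

text \<open>The entries at (0, 1), (1, 0) and (0, 0) are the coordinates of a trace zero matrix in
  the basis \<open>e\<close>, \<open>f\<close>, \<open>h\<close>; multiplication by the variable is
  \<open>e\<close>.\<close>

definition poly_act :: "complex \<Rightarrow> complex mat \<Rightarrow> complex poly \<Rightarrow> complex poly" where
  "poly_act l A p = Polynomial.smult (A $$ (0, 1)) (pCons 0 p) + Polynomial.smult (A $$ (1, 0)) (poly_f l p) +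
     Polynomial.smult (A $$ (0, 0)) (poly_h l p)"

lemma coeff_poly_h: "coeff (poly_h l p) n = (l + 2 * of_nat n) * coeff p n"
  by (cases n) (simp_all add: poly_h_def coeff_pCons coeff_pderiv algebra_simps)

lemma coeff_poly_f: "coeff (poly_f l p) n = - ((l + of_nat n) * of_nat (Suc n) * coeff p (Suc n))"
  by (cases n) (simp_all add: poly_f_def coeff_pCons coeff_pderiv algebra_simps)

lemmas poly_act_coeffs = poly_eq_iff coeff_poly_h coeff_poly_f coeff_pCons

text \<open>This is \<open>h e = e h + 2 e\<close> in the model; the constant term has weight
  \<open>l\<close>.\<close>

lemma poly_h_pCons:
  "poly_h l (pCons c p) = [:l * c:] + pCons 0 (poly_h l p) + Polynomial.smult 2 (pCons 0 p)"
  by (auto simp: poly_act_coeffs algebra_simps split: nat.splits)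

text \<open>This is \<open>f e = e f - h\<close> in the model. Since \<open>f\<close> kills
  constants, \<open>c\<close> does not occur on the right.\<close>

lemma poly_f_pCons: "poly_f l (pCons c p) = pCons 0 (poly_f l p) - poly_h l p"
  by (auto simp: poly_act_coeffs algebra_simps split: nat.splits)

lemma poly_act_add: "poly_act l A (p + q) = poly_act l A p + poly_act l A q"
  by (auto simp: poly_act_def poly_act_coeffs algebra_simps split: nat.splits)

lemma poly_act_smult: "poly_act l A (Polynomial.smult c p) = Polynomial.smult c (poly_act l A p)"
  by (auto simp: poly_act_def poly_act_coeffs algebra_simps split: nat.splits)

text \<open>Trace zero gives the off-diagonal entries of the commutator their factor 2. With the
  three entries known, the claim is an identity of coefficients.\<close>

lemma poly_act_bracket:
  assumes "A \<in> carrier_mat 2 2" "B \<in> carrier_mat 2 2"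
    and "A $$ (1, 1) = - A $$ (0, 0)" "B $$ (1, 1) = - B $$ (0, 0)"
  shows "poly_act l (A * B - B * A) p = poly_act l A (poly_act l B p) - poly_act l B (poly_act l A p)"
proof -
  define C where "C = A * B - B * A"
  have "C $$ (i, j) = (A $$ (i, 0) * B $$ (0, j) + A $$ (i, 1) * B $$ (1, j)) -
      (B $$ (i, 0) * A $$ (0, j) + B $$ (i, 1) * A $$ (1, j))" if "i < 2" "j < 2" for i j
    using assms(1,2) that by (simp add: C_def scalar_prod_def numeral_2_eq_2)
  then have c: "C $$ (0, 0) = A $$ (0, 1) * B $$ (1, 0) - B $$ (0, 1) * A $$ (1, 0)"
    "C $$ (0, 1) = 2 * (A $$ (0, 0) * B $$ (0, 1) - B $$ (0, 0) * A $$ (0, 1))"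
    "C $$ (1, 0) = 2 * (B $$ (0, 0) * A $$ (1, 0) - A $$ (0, 0) * B $$ (1, 0))"
    using assms(3,4) by (simp_all del: One_nat_def)
  show ?thesis unfolding C_def[symmetric] poly_act_def c
    by (auto simp: poly_act_coeffs algebra_simps simp del: One_nat_def split: nat.splits)
qed

section \<open>Free and enveloping algebras\<close>

text \<open>A finitely supported function is the sum of its single terms. The bound \<open>S\<close>
  on the support is carried through the induction so that the additive step may use it.\<close>

lemma poly_mapping_induct_single:
  assumes "Poly_Mapping.keys p \<subseteq> S"
    and zero: "P 0" and single: "\<And>k c. k \<in> S \<Longrightarrow> P (Poly_Mapping.single k c)"
    and add: "\<And>p q. Poly_Mapping.keys p \<subseteq> S \<Longrightarrow> Poly_Mapping.keys q \<subseteq> S \<Longrightarrow> P p \<Longrightarrow> P q \<Longrightarrow> P (p + q)"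
  shows "P (p :: 'a \<Rightarrow>\<^sub>0 'b::comm_monoid_add)"
proof -
  have "Poly_Mapping.keys (\<Sum>k\<in>A. Poly_Mapping.single k (Poly_Mapping.lookup p k)) \<subseteq> S \<and>
      P (\<Sum>k\<in>A. Poly_Mapping.single k (Poly_Mapping.lookup p k))" if "finite A" "A \<subseteq> S" for A
    using that
  proof (induction A rule: finite_induct)
    case (insert k A)
    have k: "Poly_Mapping.keys (Poly_Mapping.single k (Poly_Mapping.lookup p k)) \<subseteq> S"
      using insert.prems by auto
    then have "Poly_Mapping.keys (Poly_Mapping.single k (Poly_Mapping.lookup p k) +
        (\<Sum>k\<in>A. Poly_Mapping.single k (Poly_Mapping.lookup p k))) \<subseteq> S"
      using insert keys_add[of "Poly_Mapping.single k (Poly_Mapping.lookup p k)"] by blast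
    then show ?case using insert k by (auto intro!: add single)
  qed (simp add: zero)
  moreover have "(\<Sum>k\<in>Poly_Mapping.keys p. Poly_Mapping.single k (Poly_Mapping.lookup p k)) = p"
    by (rule poly_mapping_eqI)
      (auto simp: lookup_sum lookup_single when_def sum.delta in_keys_iff)
  ultimately show ?thesis using assms(1) by (metis finite_keys)
qed

lemma keys_mult_letters:
  "Poly_Mapping.keys p \<subseteq> {w. set (letters w) \<subseteq> S} \<Longrightarrow> Poly_Mapping.keys q \<subseteq> {w. set (letters w) \<subseteq> S} \<Longrightarrow>
   Poly_Mapping.keys (p * q :: 'l free_word \<Rightarrow>\<^sub>0 'k::field) \<subseteq> {w. set (letters w) \<subseteq> S}"
  using keys_mult[of p q] by (force simp: plus_free_word_def)

lemma carrier_free_alg: "carrier (free_alg L) = {p. Poly_Mapping.keys p \<subseteq> {w. set (letters w) \<subseteq> carrier L}}"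
  by (auto simp: free_alg_def)

lemma free_alg_simps [simp]:
  "mult (free_alg L) = (*)" "one (free_alg L) = 1" "zero (free_alg L) = 0" "add (free_alg L) = (+)"
  by (simp_all add: free_alg_def)

lemma free_alg_closed:
  fixes L :: "('k::field, 'l, 'm) lie_algebra_scheme"
  shows "p \<in> carrier (free_alg L) \<Longrightarrow> q \<in> carrier (free_alg L) \<Longrightarrow> p + q \<in> carrier (free_alg L)"
    "p \<in> carrier (free_alg L) \<Longrightarrow> q \<in> carrier (free_alg L) \<Longrightarrow> p * q \<in> carrier (free_alg L)"
    "p \<in> carrier (free_alg L) \<Longrightarrow> - p \<in> carrier (free_alg L)"
    "p \<in> carrier (free_alg L) \<Longrightarrow> q \<in> carrier (free_alg L) \<Longrightarrow> p - q \<in> carrier (free_alg L)"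
    "0 \<in> carrier (free_alg L)" "1 \<in> carrier (free_alg L)"
    "x \<in> carrier L \<Longrightarrow> gen x \<in> carrier (free_alg L)" "const c \<in> carrier (free_alg L)"
  using keys_add[of p q] keys_mult_letters[of p "carrier L" q] keys_diff[of p q]
  unfolding carrier_free_alg
  by (blast | auto simp: gen_def const_def zero_free_word_def)+

lemma free_alg_ring:
  fixes L :: "('k::field, 'l, 'm) lie_algebra_scheme"
  shows "ring (free_alg L)"
proof (rule ringI)
  show "abelian_group (free_alg L)"
  proof (rule abelian_groupI)
    show "\<exists>y\<in>carrier (free_alg L). y \<oplus>\<^bsub>free_alg L\<^esub> x = \<zero>\<^bsub>free_alg L\<^esub>"
      if "x \<in> carrier (free_alg L)" for x
      using that free_alg_closed(3)[OF that] by (intro bexI[of _ "- x"]) auto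
  qed (auto simp: free_alg_closed algebra_simps)
  show "Group.monoid (free_alg L)"
    by (rule Group.monoidI) (auto simp: free_alg_closed algebra_simps)
qed (auto simp: free_alg_closed algebra_simps)

lemma const_add: "const (a + b) = const a + const b"
  by (simp add: const_def single_add)

lemma const_mult: "const (a * b) = const a * const b"
  by (simp add: const_def mult_single)

lemma const_0 [simp]: "const 0 = 0" by (simp add: const_def)

lemma const_1 [simp]: "const 1 = 1" by (simp add: const_def)

text \<open>Scalars sit on the empty word, which commutes with every word.\<close>

lemma const_central: "const c * p = p * const c"
  unfolding const_def
  by (rule poly_mapping_induct_single[of p UNIV]) (auto simp: mult_single algebra_simps)

text \<open>Exactly the closure that puts the defining relations into the free algebra, so that they
  generate an ideal there. It serves both \<open>sl 2\<close> and the Borel subalgebra.\<close>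

locale lie_closed =
  fixes L :: "('k::field, 'l, 'm) lie_algebra_scheme"
  assumes add_closed: "\<lbrakk>x \<in> carrier L; y \<in> carrier L\<rbrakk> \<Longrightarrow> x \<oplus>\<^bsub>L\<^esub> y \<in> carrier L"
    and smult_closed: "x \<in> carrier L \<Longrightarrow> c \<odot>\<^bsub>L\<^esub> x \<in> carrier L"
    and bracket_closed: "\<lbrakk>x \<in> carrier L; y \<in> carrier L\<rbrakk> \<Longrightarrow> lie_bracket L x y \<in> carrier L"
begin

lemma ideal_env_ideal: "ideal (env_ideal L) (free_alg L)"
  unfolding env_ideal_def
  by (rule ring.genideal_ideal[OF free_alg_ring])
    (auto intro!: free_alg_closed add_closed smult_closed bracket_closed)

lemma env_ideal_closed:
  shows "0 \<in> env_ideal L" "p \<in> env_ideal L \<Longrightarrow> p \<in> carrier (free_alg L)"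
    "p \<in> env_ideal L \<Longrightarrow> q \<in> env_ideal L \<Longrightarrow> p + q \<in> env_ideal L"
    "p \<in> env_ideal L \<Longrightarrow> - p \<in> env_ideal L"
    "p \<in> env_ideal L \<Longrightarrow> q \<in> env_ideal L \<Longrightarrow> p - q \<in> env_ideal L"
    "p \<in> env_ideal L \<Longrightarrow> q \<in> carrier (free_alg L) \<Longrightarrow> p * q \<in> env_ideal L"
    "p \<in> env_ideal L \<Longrightarrow> q \<in> carrier (free_alg L) \<Longrightarrow> q * p \<in> env_ideal L"
proof -
  interpret ideal "env_ideal L" "free_alg L" by (rule ideal_env_ideal)
  show z: "0 \<in> env_ideal L" using additive_subgroup.zero_closed[OF additive_subgroup_axioms] by simp
  show c: "p \<in> env_ideal L \<Longrightarrow> p \<in> carrier (free_alg L)" for p by (rule Icarr)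
  show a: "p \<in> env_ideal L \<Longrightarrow> q \<in> env_ideal L \<Longrightarrow> p + q \<in> env_ideal L" for p q
    using additive_subgroup.a_closed[OF additive_subgroup_axioms, of p q] by simp
  show l: "p \<in> env_ideal L \<Longrightarrow> q \<in> carrier (free_alg L) \<Longrightarrow> q * p \<in> env_ideal L" for p q
    using I_l_closed[of p q] by simp
  show "p \<in> env_ideal L \<Longrightarrow> q \<in> carrier (free_alg L) \<Longrightarrow> p * q \<in> env_ideal L" for p q
    using I_r_closed[of p q] by simp
  show m: "- p \<in> env_ideal L" if "p \<in> env_ideal L" for p
    using l[OF that free_alg_closed(3)[OF free_alg_closed(6)]] by simp
  show "p \<in> env_ideal L \<Longrightarrow> q \<in> env_ideal L \<Longrightarrow> p - q \<in> env_ideal L" for p q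
    using a[of p "- q"] m[of q] by simp
qed

lemma env_relations:
  shows "\<lbrakk>x \<in> carrier L; y \<in> carrier L\<rbrakk> \<Longrightarrow> gen (x \<oplus>\<^bsub>L\<^esub> y) - gen x - gen y \<in> env_ideal L"
    "x \<in> carrier L \<Longrightarrow> gen (c \<odot>\<^bsub>L\<^esub> x) - const c * gen x \<in> env_ideal L"
    "\<lbrakk>x \<in> carrier L; y \<in> carrier L\<rbrakk> \<Longrightarrow> gen x * gen y - gen y * gen x - gen (lie_bracket L x y) \<in> env_ideal L"
proof -
  have "({gen (x \<oplus>\<^bsub>L\<^esub> y) - gen x - gen y | x y. x \<in> carrier L \<and> y \<in> carrier L} \<union>
      {gen (c \<odot>\<^bsub>L\<^esub> x) - const c * gen x | c x. x \<in> carrier L} \<union>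
      {gen x * gen y - gen y * gen x - gen (lie_bracket L x y) | x y.
         x \<in> carrier L \<and> y \<in> carrier L}) \<subseteq> env_ideal L"
    unfolding env_ideal_def
    by (rule ring.genideal_self[OF free_alg_ring])
      (auto intro!: free_alg_closed add_closed smult_closed bracket_closed)
  then show "\<lbrakk>x \<in> carrier L; y \<in> carrier L\<rbrakk> \<Longrightarrow> gen (x \<oplus>\<^bsub>L\<^esub> y) - gen x - gen y \<in> env_ideal L"
    "x \<in> carrier L \<Longrightarrow> gen (c \<odot>\<^bsub>L\<^esub> x) - const c * gen x \<in> env_ideal L"
    "\<lbrakk>x \<in> carrier L; y \<in> carrier L\<rbrakk> \<Longrightarrow> gen x * gen y - gen y * gen x - gen (lie_bracket L x y) \<in> env_ideal L"
    by blast+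
qed

text \<open>The means of mapping out of an enveloping algebra. It is applied to the kernel of the
  polynomial action and to the trace of the ideal of \<open>sl 2\<close> on the free algebra of the
  Borel subalgebra.\<close>

lemma env_ideal_minimal:
  assumes "ideal I (free_alg L)"
    and "\<And>x y. \<lbrakk>x \<in> carrier L; y \<in> carrier L\<rbrakk> \<Longrightarrow> gen (x \<oplus>\<^bsub>L\<^esub> y) - gen x - gen y \<in> I"
    and "\<And>c x. x \<in> carrier L \<Longrightarrow> gen (c \<odot>\<^bsub>L\<^esub> x) - const c * gen x \<in> I"
    and "\<And>x y. \<lbrakk>x \<in> carrier L; y \<in> carrier L\<rbrakk> \<Longrightarrow>
      gen x * gen y - gen y * gen x - gen (lie_bracket L x y) \<in> I"
  shows "env_ideal L \<subseteq> I"
  unfolding env_ideal_def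
  by (rule ring.genideal_minimal[OF free_alg_ring assms(1)]) (use assms(2-) in auto)

lemma env_class_eq_set: "env_class L p = {i + p | i. i \<in> env_ideal L}"
  by (auto simp: env_class_def a_r_coset_def r_coset_def)

lemma env_class_eq_iff: "env_class L p = env_class L q \<longleftrightarrow> p - q \<in> env_ideal L"
proof
  assume "env_class L p = env_class L q"
  moreover have "p \<in> env_class L p" using env_ideal_closed(1) by (auto simp: env_class_eq_set)
  ultimately obtain i where "p = i + q" "i \<in> env_ideal L" by (auto simp: env_class_eq_set)
  then show "p - q \<in> env_ideal L" by simp
next
  assume d: "p - q \<in> env_ideal L"
  have "i + p = (i + (p - q)) + q" "i + q = (i - (p - q)) + p" for i by simp_all
  then show "env_class L p = env_class L q"
    unfolding env_class_eq_set using d env_ideal_closed(3,5) by blast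
qed

lemma mem_env_class_iff: "q \<in> env_class L p \<longleftrightarrow> q - p \<in> env_ideal L"
  unfolding env_class_eq_set by (auto intro!: exI[of _ "q - p"])

lemma carrier_env_alg: "carrier (env_alg L) = env_class L ` carrier (free_alg L)"
  by (auto simp: env_alg_def FactRing_def A_RCOSETS_def RCOSETS_def env_class_def a_r_coset_def)

lemma env_class_add:
  assumes "p \<in> carrier (free_alg L)" "q \<in> carrier (free_alg L)"
  shows "env_class L p \<oplus>\<^bsub>env_alg L\<^esub> env_class L q = env_class L (p + q)"
proof -
  interpret ideal "env_ideal L" "free_alg L" by (rule ideal_env_ideal)
  show ?thesis using a_rcos_sum[OF assms] by (simp add: env_alg_def FactRing_def env_class_def)
qed

lemma env_class_mult:
  assumes "p \<in> carrier (free_alg L)" "q \<in> carrier (free_alg L)"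
  shows "env_class L p \<otimes>\<^bsub>env_alg L\<^esub> env_class L q = env_class L (p * q)"
proof -
  interpret ideal "env_ideal L" "free_alg L" by (rule ideal_env_ideal)
  show ?thesis using rcoset_mult_add[OF assms] by (simp add: env_alg_def FactRing_def env_class_def)
qed

end

section \<open>The lowest weight Verma module\<close>

lemma gl_simps [simp]:
  "carrier (gl r) = carrier_mat r r" "add (gl r) = (+)" "zero (gl r) = 0\<^sub>m r r"
  "smult (gl r) = (\<cdot>\<^sub>m)" "lie_bracket (gl r) = (\<lambda>A B. A * B - B * A)"
  by (simp_all add: gl_def module.defs module_mat_simps)

lemma sl_simps [simp]:
  "carrier (sl r) = {A \<in> carrier_mat r r. (\<Sum>i<r. A $$ (i, i)) = 0}" "add (sl r) = (+)"
  "zero (sl r) = 0\<^sub>m r r" "smult (sl r) = (\<cdot>\<^sub>m)" "lie_bracket (sl r) = (\<lambda>A B. A * B - B * A)"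
  by (simp_all add: sl_def)

lemma carrier_sl2: "A \<in> carrier (sl 2) \<longleftrightarrow> A \<in> carrier_mat 2 2 \<and> A $$ (1, 1) = - A $$ (0, 0)"
  by (auto simp: numeral_2_eq_2 add_eq_0_iff)

lemma trace_mult_commute:
  assumes "A \<in> carrier_mat r r" "B \<in> carrier_mat r r"
  shows "(\<Sum>i<r. (A * B) $$ (i, i)) = (\<Sum>i<r. (B * A) $$ (i, i) :: 'k::field)"
proof -
  have "(\<Sum>i<r. (A * B) $$ (i, i)) = (\<Sum>i<r. \<Sum>j<r. A $$ (i, j) * B $$ (j, i))"
    using assms by (simp add: scalar_prod_def atLeast0LessThan)
  also have "\<dots> = (\<Sum>j<r. \<Sum>i<r. A $$ (i, j) * B $$ (j, i))" by (rule sum.swap)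
  also have "\<dots> = (\<Sum>i<r. (B * A) $$ (i, i))"
    using assms by (simp add: scalar_prod_def atLeast0LessThan mult.commute)
  finally show ?thesis .
qed

lemma lie_closed_sl: "lie_closed (sl r :: ('k::field, 'k mat) lie_algebra)"
proof
  fix x y :: "'k mat" assume "x \<in> carrier (sl r)" "y \<in> carrier (sl r)"
  then show "x \<oplus>\<^bsub>sl r\<^esub> y \<in> carrier (sl r)" "lie_bracket (sl r) x y \<in> carrier (sl r)"
    using trace_mult_commute[of x r y] by (auto simp: sum.distrib sum_subtractf)
qed (auto simp: sum_distrib_left[symmetric])

lemma borel_minus_simps [simp]:
  "add borel_minus = (+)" "smult borel_minus = (\<cdot>\<^sub>m)"
  "lie_bracket borel_minus = (\<lambda>A B. A * B - B * A)"
  by (simp_all add: borel_minus_def)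

lemma carrier_borel_minus:
  "A \<in> carrier borel_minus \<longleftrightarrow> A \<in> carrier (sl 2) \<and> A $$ (0, 1) = 0"
proof -
  have "(\<exists>a b. A = a \<cdot>\<^sub>m sl2_h + b \<cdot>\<^sub>m sl2_f) \<longleftrightarrow>
      A \<in> carrier_mat 2 2 \<and> A $$ (1, 1) = - A $$ (0, 0) \<and> A $$ (0, 1) = 0"
  proof
    assume "A \<in> carrier_mat 2 2 \<and> A $$ (1, 1) = - A $$ (0, 0) \<and> A $$ (0, 1) = 0"
    then have "A = A $$ (0, 0) \<cdot>\<^sub>m sl2_h + A $$ (1, 0) \<cdot>\<^sub>m sl2_f"
      by (intro eq_matI) (auto simp: sl2_h_def sl2_f_def elem_mat_def less_2_cases_iff)
    then show "\<exists>a b. A = a \<cdot>\<^sub>m sl2_h + b \<cdot>\<^sub>m sl2_f" by blast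
  qed (auto simp: sl2_h_def sl2_f_def elem_mat_def)
  then show ?thesis by (auto simp: borel_minus_def carrier_sl2 simp del: sl_simps)
qed

lemma lie_closed_borel_minus: "lie_closed borel_minus"
proof -
  interpret S: lie_closed "sl 2 :: (complex, complex mat) lie_algebra" by (rule lie_closed_sl)
  show ?thesis
  proof
    fix x y assume "x \<in> carrier borel_minus" "y \<in> carrier borel_minus"
    then show "x \<oplus>\<^bsub>borel_minus\<^esub> y \<in> carrier borel_minus"
      "lie_bracket borel_minus x y \<in> carrier borel_minus"
      unfolding carrier_borel_minus using S.add_closed[of x y] S.bracket_closed[of x y]
      by (auto simp: scalar_prod_def numeral_2_eq_2)
  next
    fix c :: complex and x assume "x \<in> carrier borel_minus"
    then show "c \<odot>\<^bsub>borel_minus\<^esub> x \<in> carrier borel_minus"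
      unfolding carrier_borel_minus using S.smult_closed[of x c] by auto
  qed
qed

interpretation S: lie_closed "sl 2 :: (complex, complex mat) lie_algebra" by (rule lie_closed_sl)

interpretation B: lie_closed borel_minus by (rule lie_closed_borel_minus)

section \<open>The free algebra acting on polynomials\<close>

definition word_act :: "complex \<Rightarrow> complex mat free_word \<Rightarrow> complex poly \<Rightarrow> complex poly" where
  "word_act l w q = foldr (poly_act l) (letters w) q"

text \<open>Defined on the free algebra rather than on classes; \<open>env_ideal_alg_act\<close>
  shows that it descends.\<close>

definition alg_act ::
  "complex \<Rightarrow> (complex mat free_word \<Rightarrow>\<^sub>0 complex) \<Rightarrow> complex poly \<Rightarrow> complex poly" where
  "alg_act l p q = (\<Sum>w\<in>Poly_Mapping.keys p. Polynomial.smult (Poly_Mapping.lookup p w) (word_act l w q))"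

lemma word_act_add: "word_act l w (p + q) = word_act l w p + word_act l w q"
proof -
  have "foldr (poly_act l) ws (p + q) = foldr (poly_act l) ws p + foldr (poly_act l) ws q" for ws
    by (induction ws) (simp_all add: poly_act_add)
  then show ?thesis by (simp add: word_act_def)
qed

lemma word_act_smult: "word_act l w (Polynomial.smult c p) = Polynomial.smult c (word_act l w p)"
proof -
  have "foldr (poly_act l) ws (Polynomial.smult c p) = Polynomial.smult c (foldr (poly_act l) ws p)" for ws
    by (induction ws) (simp_all add: poly_act_smult)
  then show ?thesis by (simp add: word_act_def)
qed

lemma alg_act_eq:
  assumes "finite A" "Poly_Mapping.keys p \<subseteq> A"
  shows "alg_act l p q = (\<Sum>w\<in>A. Polynomial.smult (Poly_Mapping.lookup p w) (word_act l w q))"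
  unfolding alg_act_def
  by (rule sum.mono_neutral_left) (use assms in \<open>auto simp: in_keys_iff\<close>)

lemma alg_act_add: "alg_act l (p + p') q = alg_act l p q + alg_act l p' q"
proof -
  let ?A = "Poly_Mapping.keys p \<union> Poly_Mapping.keys p'"
  show ?thesis
    using keys_add[of p p']
    by (simp add: alg_act_eq[of ?A] lookup_add smult_add_left sum.distrib)
qed

lemma alg_act_single [simp]:
  "alg_act l (Poly_Mapping.single w c) q = Polynomial.smult c (word_act l w q)"
  by (simp add: alg_act_eq[of "{w}"])

lemma alg_act_0 [simp]: "alg_act l 0 q = 0" by (simp add: alg_act_def)

lemma alg_act_minus: "alg_act l (- p) q = - alg_act l p q"
  using alg_act_add[of l p "- p" q] by (simp add: add_eq_0_iff)

lemma alg_act_diff: "alg_act l (p - p') q = alg_act l p q - alg_act l p' q"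
  using alg_act_add[of l p "- p'" q] by (simp add: alg_act_minus)

lemma alg_act_add_right: "alg_act l p (q + q') = alg_act l p q + alg_act l p q'"
  by (simp add: alg_act_def word_act_add smult_add_right sum.distrib)

lemma alg_act_smult_right: "alg_act l p (Polynomial.smult c q) = Polynomial.smult c (alg_act l p q)"
  by (rule poly_mapping_induct_single[of p UNIV])
    (auto simp: alg_act_add smult_add_right word_act_smult mult.commute)

lemma alg_act_0_right [simp]: "alg_act l p 0 = 0"
  using alg_act_smult_right[of l p 0 0] by simp

text \<open>The sum of two words is their concatenation, which acts by composition; bilinearity does
  the rest.\<close>

lemma alg_act_mult: "alg_act l (p * p') q = alg_act l p (alg_act l p' q)"
proof (rule poly_mapping_induct_single[of p UNIV], goal_cases)
  case (3 v a)
  show ?case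
  proof (rule poly_mapping_induct_single[of p' UNIV], goal_cases)
    case (3 w b)
    show ?case
      by (simp add: mult_single word_act_smult)
        (simp add: word_act_def plus_free_word_def)
  qed (simp_all add: algebra_simps alg_act_add alg_act_add_right)
qed (simp_all add: algebra_simps alg_act_add)

lemma alg_act_gen [simp]: "alg_act l (gen x) q = poly_act l x q"
  by (simp add: gen_def word_act_def)

lemma alg_act_const [simp]: "alg_act l (const c) q = Polynomial.smult c q"
  by (simp add: const_def word_act_def zero_free_word_def)

lemma alg_act_kernel_ideal:
  "ideal {p \<in> carrier (free_alg L). \<forall>q. alg_act l p q = 0} (free_alg L)"
proof (rule idealI[OF free_alg_ring])
  interpret ring "free_alg L" by (rule free_alg_ring)
  have inv: "inv\<^bsub>add_monoid (free_alg L)\<^esub> p = - p" if "p \<in> carrier (free_alg L)" for p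
    using minus_equality[of "- p" p] that free_alg_closed(3)[OF that] by (simp add: a_inv_def)
  show "subgroup {p \<in> carrier (free_alg L). \<forall>q. alg_act l p q = 0} (add_monoid (free_alg L))"
    by unfold_locales (auto simp: inv[simplified] alg_act_add alg_act_minus free_alg_closed)
qed (auto simp: alg_act_mult free_alg_closed)

lemma poly_act_add_mat:
  assumes "A \<in> carrier_mat 2 2" "B \<in> carrier_mat 2 2"
  shows "poly_act l (A + B) q = poly_act l A q + poly_act l B q"
  using assms by (simp add: poly_act_def smult_add_left algebra_simps del: One_nat_def)

lemma poly_act_smult_mat:
  assumes "A \<in> carrier_mat 2 2"
  shows "poly_act l (c \<cdot>\<^sub>m A) q = Polynomial.smult c (poly_act l A q)"
  using assms by (simp add: poly_act_def smult_add_right del: One_nat_def)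

text \<open>The elements acting by zero form an ideal, and it contains the defining relations
  because \<open>poly_act\<close> respects sums, scalars and brackets on \<open>sl 2\<close>. The
  general \<open>L\<close> covers \<open>sl 2\<close> and the Borel subalgebra at once.\<close>

lemma env_ideal_alg_act:
  assumes L: "lie_closed L" "carrier L \<subseteq> carrier (sl 2)"
    "add L = (+)" "smult L = (\<cdot>\<^sub>m)" "lie_bracket L = (\<lambda>A B. A * B - B * A)"
    and p: "p \<in> env_ideal L"
  shows "alg_act l p q = 0"
proof -
  interpret lie_closed L by (rule L)
  have "env_ideal L \<subseteq> {p \<in> carrier (free_alg L). \<forall>q. alg_act l p q = 0}"
  proof (rule env_ideal_minimal[OF alg_act_kernel_ideal]; clarsimp; intro conjI allI)
    fix A B assume AB: "A \<in> carrier L" "B \<in> carrier L"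
    then have *: "A \<in> carrier (sl 2)" "B \<in> carrier (sl 2)" using L(2) by auto
    show "gen (A \<oplus>\<^bsub>L\<^esub> B) - gen A - gen B \<in> carrier (free_alg L)"
      by (intro free_alg_closed add_closed AB)
    show "alg_act l (gen (A \<oplus>\<^bsub>L\<^esub> B) - gen A - gen B) q = 0" for q
      using * by (simp add: alg_act_diff L poly_act_add_mat)
    show "gen A * gen B - gen B * gen A - gen (lie_bracket L A B) \<in> carrier (free_alg L)"
      by (intro free_alg_closed bracket_closed AB)
    show "alg_act l (gen A * gen B - gen B * gen A - gen (lie_bracket L A B)) q = 0" for q
      using *[unfolded carrier_sl2] by (simp add: alg_act_diff alg_act_mult L poly_act_bracket)
  next
    fix c A assume A: "A \<in> carrier L"
    then have *: "A \<in> carrier (sl 2)" using L(2) by auto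
    show "gen (c \<odot>\<^bsub>L\<^esub> A) - const c * gen A \<in> carrier (free_alg L)"
      by (intro free_alg_closed smult_closed A)
    show "alg_act l (gen (c \<odot>\<^bsub>L\<^esub> A) - const c * gen A) q = 0" for q
      using * by (simp add: alg_act_diff alg_act_mult L poly_act_smult_mat)
  qed
  then show ?thesis using p by blast
qed

lemma carrier_borel_minus_subset: "carrier borel_minus \<subseteq> carrier (sl 2)"
  by (auto simp: carrier_borel_minus simp del: sl_simps)

text \<open>The two ideals are generated in different free algebras. Intersecting the larger one
  with the smaller free algebra gives an ideal there that contains the Borel relations.\<close>

lemma env_ideal_borel_minus: "env_ideal borel_minus \<subseteq> env_ideal (sl 2)"
proof -
  interpret I: ideal "env_ideal (sl 2)" "free_alg (sl 2 :: (complex, complex mat) lie_algebra)"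
    by (rule S.ideal_env_ideal)
  have sub: "carrier (free_alg borel_minus) \<subseteq> carrier (free_alg (sl 2))"
    using carrier_borel_minus_subset unfolding carrier_free_alg by blast
  interpret R: ring "free_alg borel_minus" by (rule free_alg_ring)
  let ?I = "env_ideal (sl 2) \<inter> carrier (free_alg borel_minus)"
  have "ideal ?I (free_alg borel_minus)"
  proof (rule idealI[OF free_alg_ring])
    have inv: "inv\<^bsub>add_monoid (free_alg borel_minus)\<^esub> p = - p" if "p \<in> carrier (free_alg borel_minus)" for p
      using R.minus_equality[of "- p" p] that free_alg_closed(3)[OF that] by (simp add: a_inv_def)
    show "subgroup ?I (add_monoid (free_alg borel_minus))"
      by unfold_locales (auto simp: inv[simplified] S.env_ideal_closed free_alg_closed)
  qed (use sub in \<open>auto simp: S.env_ideal_closed free_alg_closed\<close>)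
  then have "env_ideal borel_minus \<subseteq> ?I"
  proof (rule B.env_ideal_minimal, goal_cases)
    case (1 x y)
    then show ?case using S.env_relations(1)[of x y] carrier_borel_minus_subset
      by (auto intro!: free_alg_closed B.add_closed[simplified])
  next
    case (2 c x)
    then show ?case using S.env_relations(2)[of x c] carrier_borel_minus_subset
      by (auto intro!: free_alg_closed B.smult_closed[simplified])
  next
    case (3 x y)
    then show ?case using S.env_relations(3)[of x y] carrier_borel_minus_subset
      by (auto intro!: free_alg_closed B.bracket_closed[simplified])
  qed
  then show ?thesis by blast
qed

lemma abelian_group_line: "abelian_group line"
  by (rule abelian_groupI) (auto simp: line_def algebra_simps intro: exI[of _ "- x" for x])

lemma finsum_line: "finite A \<Longrightarrow> (\<Oplus>\<^bsub>line\<^esub>x\<in>A. f x) = sum f A"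
proof (induction A rule: finite_induct)
  interpret abelian_group line by (rule abelian_group_line)
  case empty
  then show ?case by simp (simp add: line_def)
next
  interpret abelian_group line by (rule abelian_group_line)
  case (insert x A)
  then have "(\<Oplus>\<^bsub>line\<^esub>x\<in>insert x A. f x) = f x \<oplus>\<^bsub>line\<^esub> (\<Oplus>\<^bsub>line\<^esub>x\<in>A. f x)"
    by (intro finsum_insert) (auto simp: line_def)
  then show ?case using insert by (simp add: line_def)
qed

text \<open>A Borel element has no \<open>e\<close>-component and \<open>f\<close> kills constants,
  so constants stay constants and are acted on through the character. The representative chosen
  inside \<open>env_act\<close> is harmless because the enveloping ideal acts by zero.\<close>

lemma alg_act_line:
  assumes b: "b \<in> carrier (free_alg borel_minus)"
  shows "alg_act l b [:v:] = [:env_act line (line_act l) (env_class borel_minus b) v:]"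
proof -
  define p where "p = (SOME p. p \<in> env_class borel_minus b)"
  have "b \<in> env_class borel_minus b" by (simp add: B.mem_env_class_iff B.env_ideal_closed)
  then have "p \<in> env_class borel_minus b" unfolding p_def by (rule someI)
  then have d: "p - b \<in> env_ideal borel_minus" by (simp add: B.mem_env_class_iff)
  have "alg_act l (p - b) [:v:] = 0"
    by (rule env_ideal_alg_act[OF lie_closed_borel_minus carrier_borel_minus_subset _ _ _ d]) simp_all
  then have e: "alg_act l b [:v:] = alg_act l p [:v:]" by (simp add: alg_act_diff)
  have "p = (p - b) + b" by simp
  then have "p \<in> carrier (free_alg borel_minus)"
    using b B.env_ideal_closed(2)[OF d] by (metis free_alg_closed(1))
  then have k: "set (letters w) \<subseteq> carrier borel_minus" if "w \<in> Poly_Mapping.keys p" for w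
    using that by (auto simp: carrier_free_alg)
  have f: "foldr (poly_act l) ws [:v:] = [:foldr (line_act l) ws v:]"
    if "set ws \<subseteq> carrier borel_minus" for ws
    using that
  proof (induction ws)
    case (Cons A ws)
    then have "A $$ (0, 1) = 0" by (simp add: carrier_borel_minus)
    with Cons show ?case
      by (simp add: poly_act_def line_act_def poly_h_def poly_f_def pderiv_pCons)
  qed simp
  have sp: "sum (\<lambda>w. [:g w:]) A = [:sum g A:]" if "finite A" for g :: "complex mat free_word \<Rightarrow> complex" and A
    using that by (induction A rule: finite_induct) simp_all
  have "alg_act l p [:v:] =
      [:\<Sum>w\<in>Poly_Mapping.keys p. Poly_Mapping.lookup p w * foldr (line_act l) (letters w) v:]"
    unfolding alg_act_def word_act_def by (simp add: f k sp[symmetric])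
  also have "(\<Sum>w\<in>Poly_Mapping.keys p. Poly_Mapping.lookup p w * foldr (line_act l) (letters w) v) =
      env_act line (line_act l) (env_class borel_minus b) v"
    unfolding env_act_def p_def[symmetric] Let_def by (simp add: finsum_line) (simp add: line_def)
  finally show ?thesis using e by simp
qed

text \<open>The union in \<open>env_incl\<close> runs over representatives that differ by elements
  of the larger ideal, so all its members are the same class.\<close>

lemma env_incl_borel:
  assumes "b \<in> carrier (free_alg borel_minus)"
  shows "env_incl (sl 2) (env_class borel_minus b) = env_class (sl 2) b"
proof -
  have "env_class (sl 2) p = env_class (sl 2) b" if "p \<in> env_class borel_minus b" for p
    using that env_ideal_borel_minus by (auto simp: S.env_class_eq_iff B.mem_env_class_iff)
  moreover have "b \<in> env_class borel_minus b" by (simp add: B.mem_env_class_iff B.env_ideal_closed)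
  ultimately show ?thesis unfolding env_incl_def by blast
qed

lemma free_alg_borel_subset: "carrier (free_alg borel_minus) \<subseteq> carrier (free_alg (sl 2))"
  using carrier_borel_minus_subset unfolding carrier_free_alg by blast

section \<open>Tensor relations and their cosets\<close>

abbreviation U_cls where "U_cls \<equiv> env_class (sl 2 :: (complex, complex mat) lie_algebra)"
abbreviation U_alg where "U_alg \<equiv> carrier (free_alg (sl 2 :: (complex, complex mat) lie_algebra))"
abbreviation verma_free where "verma_free \<equiv> tensor_free (sl 2) line"
abbreviation verma_rels where "verma_rels l \<equiv> tensor_rels (sl 2) borel_minus line (line_act l)"

lemma carrier_line [simp]: "carrier line = UNIV" "add line = (+)" by (simp_all add: line_def)

text \<open>The tensor relations with classes replaced by representatives in the free algebra, and
  with the Borel action on the line expressed through constant polynomials.\<close>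

definition verma_gens :: "complex \<Rightarrow> ((complex mat free_word \<Rightarrow>\<^sub>0 complex) set \<times> complex \<Rightarrow>\<^sub>0 int) set" where
  "verma_gens l =
     {frag_of (U_cls (p + p'), v) - frag_of (U_cls p, v) - frag_of (U_cls p', v) | p p' v.
        p \<in> U_alg \<and> p' \<in> U_alg} \<union>
     {frag_of (U_cls p, v + v') - frag_of (U_cls p, v) - frag_of (U_cls p, v') | p v v'. p \<in> U_alg} \<union>
     {frag_of (U_cls (p * b), v) - frag_of (U_cls p, c) | p b v c.
        p \<in> U_alg \<and> b \<in> carrier (free_alg borel_minus) \<and> alg_act l b [:v:] = [:c:]}"

lemma verma_rels_eq: "verma_rels l = generate verma_free (verma_gens l)"
proof -
  have 1: "{frag_of (a \<oplus>\<^bsub>env_alg (sl 2)\<^esub> a', v) - frag_of (a, v) - frag_of (a', v) | a a' v.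
         a \<in> carrier (env_alg (sl 2)) \<and> a' \<in> carrier (env_alg (sl 2)) \<and> v \<in> carrier line} =
     {frag_of (U_cls (p + p'), v) - frag_of (U_cls p, v) - frag_of (U_cls p', v) | p p' v.
        p \<in> U_alg \<and> p' \<in> U_alg}" (is "?A = ?B")
  proof
    show "?A \<subseteq> ?B" unfolding S.carrier_env_alg by (fastforce simp: S.env_class_add)
    show "?B \<subseteq> ?A" unfolding S.carrier_env_alg
      by (clarsimp, metis S.env_class_add image_eqI)
  qed
  have 2: "{frag_of (a, v \<oplus>\<^bsub>line\<^esub> v') - frag_of (a, v) - frag_of (a, v') | a v v'.
         a \<in> carrier (env_alg (sl 2)) \<and> v \<in> carrier line \<and> v' \<in> carrier line} =
     {frag_of (U_cls p, v + v') - frag_of (U_cls p, v) - frag_of (U_cls p, v') | p v v'. p \<in> U_alg}"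
    unfolding S.carrier_env_alg by auto
  have 3: "{frag_of (a \<otimes>\<^bsub>env_alg (sl 2)\<^esub> env_incl (sl 2) b, v) - frag_of (a, env_act line (line_act l) b v) | a b v.
         a \<in> carrier (env_alg (sl 2)) \<and> b \<in> carrier (env_alg borel_minus) \<and> v \<in> carrier line} =
     {frag_of (U_cls (p * b), v) - frag_of (U_cls p, c) | p b v c.
        p \<in> U_alg \<and> b \<in> carrier (free_alg borel_minus) \<and> alg_act l b [:v:] = [:c:]}" (is "?A = ?B")
  proof -
    have m: "U_cls p \<otimes>\<^bsub>env_alg (sl 2)\<^esub> env_incl (sl 2) (env_class borel_minus b) = U_cls (p * b)"
      if "p \<in> U_alg" "b \<in> carrier (free_alg borel_minus)" for p b
      using that free_alg_borel_subset by (auto simp: env_incl_borel S.env_class_mult)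
    show ?thesis
    proof
      show "?A \<subseteq> ?B" unfolding S.carrier_env_alg B.carrier_env_alg
        using alg_act_line by (clarsimp, metis m)
      show "?B \<subseteq> ?A" unfolding S.carrier_env_alg B.carrier_env_alg
        by (clarsimp simp: alg_act_line, metis m image_eqI)
    qed
  qed
  show ?thesis unfolding tensor_rels_def verma_gens_def 1 2 3 ..
qed

lemma keys_verma_free:
  "t \<in> carrier verma_free \<longleftrightarrow> Poly_Mapping.keys t \<subseteq> (U_cls ` U_alg) \<times> UNIV"
  by (simp add: tensor_free_def S.carrier_env_alg)

lemma verma_free_simps [simp]:
  "mult verma_free = (+)" "one verma_free = 0"
  by (auto simp: tensor_free_def fun_eq_iff)

lemma verma_free_closed:
  "s \<in> carrier verma_free \<Longrightarrow> t \<in> carrier verma_free \<Longrightarrow> s + t \<in> carrier verma_free"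
  "s \<in> carrier verma_free \<Longrightarrow> t \<in> carrier verma_free \<Longrightarrow> s - t \<in> carrier verma_free"
  "s \<in> carrier verma_free \<Longrightarrow> - s \<in> carrier verma_free"
  "p \<in> U_alg \<Longrightarrow> frag_of (U_cls p, v) \<in> carrier verma_free"
  unfolding keys_verma_free using keys_add[of s t] keys_diff[of s t] by (blast | simp add: keys_minus)+

lemma verma_gens_subset: "verma_gens l \<subseteq> carrier verma_free"
  unfolding verma_gens_def using free_alg_borel_subset
  by (auto intro!: verma_free_closed free_alg_closed)

lemma comm_group_verma_free: "comm_group verma_free"
  by (simp add: tensor_free_def abelian_free_Abelian_group)

lemma verma_rels_normal: "verma_rels l \<lhd> verma_free"
proof -
  interpret comm_group verma_free by (rule comm_group_verma_free)
  show ?thesis unfolding verma_rels_eq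
    by (rule subgroup_imp_normal[OF generate_is_subgroup[OF verma_gens_subset]])
qed

lemma verma_rels_closed:
  "r \<in> verma_rels l \<Longrightarrow> r \<in> carrier verma_free"
  "0 \<in> verma_rels l" "r \<in> verma_rels l \<Longrightarrow> s \<in> verma_rels l \<Longrightarrow> r + s \<in> verma_rels l"
  "r \<in> verma_rels l \<Longrightarrow> - r \<in> verma_rels l"
  "r \<in> verma_rels l \<Longrightarrow> s \<in> verma_rels l \<Longrightarrow> r - s \<in> verma_rels l"
proof -
  interpret normal "verma_rels l" verma_free by (rule verma_rels_normal)
  show c: "r \<in> verma_rels l \<Longrightarrow> r \<in> carrier verma_free" for r by (rule subgroup.mem_carrier[OF is_subgroup])
  show "0 \<in> verma_rels l" using subgroup.one_closed[OF is_subgroup] by simp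
  show a: "r \<in> verma_rels l \<Longrightarrow> s \<in> verma_rels l \<Longrightarrow> r + s \<in> verma_rels l" for r s
    using subgroup.m_closed[OF is_subgroup, of r s] by simp
  show m: "- r \<in> verma_rels l" if "r \<in> verma_rels l" for r
    using subgroup.m_inv_closed[OF is_subgroup that] c[OF that] by (simp add: tensor_free_def)
  show "r \<in> verma_rels l \<Longrightarrow> s \<in> verma_rels l \<Longrightarrow> r - s \<in> verma_rels l" for r s
    using a[of r "- s"] m[of s] by simp
qed

lemma verma_rels_induct [consumes 1, case_names zero gen minus add]:
  assumes "r \<in> verma_rels l" and "P 0" "\<And>r. r \<in> verma_gens l \<Longrightarrow> P r"
    "\<And>r. P r \<Longrightarrow> P (- r)" "\<And>r s. P r \<Longrightarrow> P s \<Longrightarrow> P (r + s)"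
  shows "P r"
  using assms(1) unfolding verma_rels_eq
proof (induction rule: generate.induct)
  case (inv h)
  then have "inv\<^bsub>verma_free\<^esub> h = - h" using verma_gens_subset[of l] by (auto simp: tensor_free_def)
  then show ?case using inv assms by simp
qed (simp_all add: assms)

lemma verma_gens_rels: "verma_gens l \<subseteq> verma_rels l"
  unfolding verma_rels_eq by (auto intro: generate.incl)

definition verma_cls where "verma_cls l t = verma_rels l #>\<^bsub>verma_free\<^esub> t"

lemma verma_cls_set: "verma_cls l t = {r + t | r. r \<in> verma_rels l}"
  by (auto simp: verma_cls_def r_coset_def)

lemma verma_cls_eq_iff: "verma_cls l s = verma_cls l t \<longleftrightarrow> s - t \<in> verma_rels l"
proof
  assume "verma_cls l s = verma_cls l t"
  moreover have "s \<in> verma_cls l s" using verma_rels_closed(2) by (auto simp: verma_cls_set)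
  ultimately obtain i where "s = i + t" "i \<in> verma_rels l" by (auto simp: verma_cls_set)
  then show "s - t \<in> verma_rels l" by simp
next
  assume d: "s - t \<in> verma_rels l"
  have "i + s = (i + (s - t)) + t" "i + t = (i - (s - t)) + s" for i by simp_all
  then show "verma_cls l s = verma_cls l t"
    unfolding verma_cls_set using d verma_rels_closed(3,5) by blast
qed

lemma mem_verma_cls_iff: "s \<in> verma_cls l t \<longleftrightarrow> s - t \<in> verma_rels l"
  unfolding verma_cls_set by (auto intro!: exI[of _ "s - t"])

lemma verma_space_simps:
  "carrier (verma_space l) = verma_cls l ` carrier verma_free"
  "\<lbrakk>s \<in> carrier verma_free; t \<in> carrier verma_free\<rbrakk> \<Longrightarrow>
    verma_cls l s \<oplus>\<^bsub>verma_space l\<^esub> verma_cls l t = verma_cls l (s + t)"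
  "\<zero>\<^bsub>verma_space l\<^esub> = verma_cls l 0"
proof -
  interpret normal "verma_rels l" verma_free by (rule verma_rels_normal)
  show "carrier (verma_space l) = verma_cls l ` carrier verma_free"
    by (auto simp: induced_space_def Let_def FactGroup_def RCOSETS_def verma_cls_def)
  show "\<lbrakk>s \<in> carrier verma_free; t \<in> carrier verma_free\<rbrakk> \<Longrightarrow>
      verma_cls l s \<oplus>\<^bsub>verma_space l\<^esub> verma_cls l t = verma_cls l (s + t)"
    using rcos_sum[of s t] by (simp add: induced_space_def Let_def FactGroup_def verma_cls_def)
  show "\<zero>\<^bsub>verma_space l\<^esub> = verma_cls l 0"
    by (auto simp: induced_space_def Let_def FactGroup_def verma_cls_set)
qed

definition left_mult where
  "left_mult a = frag_extend (\<lambda>(a', v). frag_of (a \<otimes>\<^bsub>env_alg (sl 2)\<^esub> a', v :: complex))"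

lemma left_mult_of:
  "a \<in> U_alg \<Longrightarrow> p \<in> U_alg \<Longrightarrow> left_mult (U_cls a) (frag_of (U_cls p, v)) = frag_of (U_cls (a * p), v)"
  by (simp add: left_mult_def S.env_class_mult)

text \<open>Left multiplication by \<open>a\<close> carries each generating relation to one of the
  same kind, with \<open>p\<close> replaced by \<open>a * p\<close>.\<close>

lemma left_mult_rels:
  assumes a: "a \<in> U_alg" and r: "r \<in> verma_rels l"
  shows "left_mult (U_cls a) r \<in> verma_rels l"
  using r
proof (induction rule: verma_rels_induct)
  case (gen r)
  have "left_mult (U_cls a) r \<in> verma_gens l"
    using gen unfolding verma_gens_def
  proof (elim UnE, goal_cases)
    case 1
    then obtain p p' v where "r = frag_of (U_cls (p + p'), v) - frag_of (U_cls p, v) - frag_of (U_cls p', v)"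
      "p \<in> U_alg" "p' \<in> U_alg" by blast
    then have "left_mult (U_cls a) r = frag_of (U_cls (a * p + a * p'), v) -
        frag_of (U_cls (a * p), v) - frag_of (U_cls (a * p'), v)" "a * p \<in> U_alg" "a * p' \<in> U_alg"
      using a by (simp_all add: left_mult_of[unfolded left_mult_def] left_mult_def frag_extend_diff
          free_alg_closed distrib_left del: frag_extend_of)
    then show ?case by blast
  next
    case 2
    then obtain p v v' where "r = frag_of (U_cls p, v + v') - frag_of (U_cls p, v) - frag_of (U_cls p, v')"
      "p \<in> U_alg" by blast
    then have "left_mult (U_cls a) r = frag_of (U_cls (a * p), v + v') -
        frag_of (U_cls (a * p), v) - frag_of (U_cls (a * p), v')" "a * p \<in> U_alg"
      using a by (simp_all add: left_mult_of[unfolded left_mult_def] left_mult_def frag_extend_diff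
          free_alg_closed del: frag_extend_of)
    then show ?case by blast
  next
    case 3
    then obtain p b v c where "r = frag_of (U_cls (p * b), v) - frag_of (U_cls p, c)"
      "p \<in> U_alg" and b: "b \<in> carrier (free_alg borel_minus)" "alg_act l b [:v:] = [:c:]" by blast
    then have "left_mult (U_cls a) r = frag_of (U_cls ((a * p) * b), v) - frag_of (U_cls (a * p), c)"
      "a * p \<in> U_alg"
      using a free_alg_borel_subset by (auto simp: left_mult_of[unfolded left_mult_def] left_mult_def
          frag_extend_diff free_alg_closed mult.assoc simp del: frag_extend_of)
    then show ?case using b by blast
  qed
  then show ?case using verma_gens_rels by blast
qed (simp_all add: left_mult_def frag_extend_minus frag_extend_add verma_rels_closed)

text \<open>Relations are preserved by left multiplication, so the union over a coset is a single
  coset.\<close>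

lemma tensor_lmult_cls:
  assumes "a \<in> U_alg"
  shows "tensor_lmult (sl 2) borel_minus line (line_act l) (U_cls a) (verma_cls l t) =
    verma_cls l (left_mult (U_cls a) t)"
proof -
  have "verma_cls l (left_mult (U_cls a) s) = verma_cls l (left_mult (U_cls a) t)"
    if "s \<in> verma_cls l t" for s
    using that left_mult_rels[OF assms, of "s - t" l]
    by (simp add: verma_cls_eq_iff mem_verma_cls_iff left_mult_def frag_extend_diff)
  moreover have "t \<in> verma_cls l t" by (simp add: mem_verma_cls_iff verma_rels_closed)
  ultimately show ?thesis
    unfolding tensor_lmult_def left_mult_def[symmetric] verma_cls_def[symmetric] by blast
qed

text \<open>Evaluating tensors in the polynomial model shows that the induced module does not collapse.\<close>

definition tensor_eval ::
  "complex \<Rightarrow> ((complex mat free_word \<Rightarrow>\<^sub>0 complex) set \<times> complex \<Rightarrow>\<^sub>0 int) \<Rightarrow> complex poly" where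
  "tensor_eval l t = (\<Sum>x\<in>Poly_Mapping.keys t.
     of_int (Poly_Mapping.lookup t x) * alg_act l (SOME p. p \<in> fst x) [:snd x:])"

lemma tensor_eval_eq:
  assumes "finite A" "Poly_Mapping.keys t \<subseteq> A"
  shows "tensor_eval l t = (\<Sum>x\<in>A. of_int (Poly_Mapping.lookup t x) * alg_act l (SOME p. p \<in> fst x) [:snd x:])"
  unfolding tensor_eval_def
  by (rule sum.mono_neutral_left) (use assms in \<open>auto simp: in_keys_iff\<close>)

lemma tensor_eval_add: "tensor_eval l (s + t) = tensor_eval l s + tensor_eval l t"
proof -
  let ?A = "Poly_Mapping.keys s \<union> Poly_Mapping.keys t"
  show ?thesis
    using keys_add[of s t]
    by (simp add: tensor_eval_eq[of ?A] lookup_add distrib_right sum.distrib)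
qed

lemma tensor_eval_0 [simp]: "tensor_eval l 0 = 0" by (simp add: tensor_eval_def)

lemma tensor_eval_minus: "tensor_eval l (- s) = - tensor_eval l s"
  using tensor_eval_add[of l s "- s"] by (simp add: add_eq_0_iff)

lemma tensor_eval_diff: "tensor_eval l (s - t) = tensor_eval l s - tensor_eval l t"
  using tensor_eval_add[of l s "- t"] by (simp add: tensor_eval_minus)

lemma env_ideal_sl2_alg_act: "p \<in> env_ideal (sl 2) \<Longrightarrow> alg_act l p q = 0"
  by (rule env_ideal_alg_act[OF lie_closed_sl]) simp_all

text \<open>The representative picked by \<open>SOME\<close> differs from \<open>p\<close> by an
  element of the enveloping ideal, which acts by zero.\<close>

lemma tensor_eval_of: "tensor_eval l (frag_of (U_cls p, v)) = alg_act l p [:v:]"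
proof -
  define q where "q = (SOME q. q \<in> U_cls p)"
  have "p \<in> U_cls p" by (simp add: S.mem_env_class_iff S.env_ideal_closed)
  then have "q \<in> U_cls p" unfolding q_def by (rule someI)
  then have "alg_act l (q - p) [:v:] = 0"
    by (intro env_ideal_sl2_alg_act) (simp add: S.mem_env_class_iff)
  then show ?thesis
    by (simp add: tensor_eval_eq[of "{(U_cls p, v)}"] keys_frag_of q_def[symmetric] alg_act_diff)
qed

lemma tensor_eval_rels:
  assumes "r \<in> verma_rels l"
  shows "tensor_eval l r = 0"
  using assms
proof (induction rule: verma_rels_induct)
  case (gen r)
  have "alg_act l p [:v + v':] = alg_act l p [:v:] + alg_act l p [:v':]" for p v v'
    using alg_act_add_right[of l p "[:v:]" "[:v':]"] by simp
  with gen show ?case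
    by (auto simp: verma_gens_def tensor_eval_diff tensor_eval_of alg_act_add alg_act_mult)
qed (simp_all add: tensor_eval_add tensor_eval_minus)

section \<open>Every tensor is a polynomial in \<open>e\<close> applied to the lowest weight
  vector\<close>

definition sl2_e :: "complex mat" where "sl2_e = elem_mat 2 0 1"

lemma sl2_basis_mem [simp]:
  "sl2_e \<in> carrier (sl 2)" "sl2_h \<in> carrier (sl 2)" "sl2_f \<in> carrier (sl 2)"
  "sl2_h \<in> carrier borel_minus" "sl2_f \<in> carrier borel_minus"
  unfolding carrier_borel_minus carrier_sl2
  by (auto simp: sl2_e_def sl2_h_def sl2_f_def elem_mat_def)

lemma sl2_expand:
  assumes "A \<in> carrier (sl 2)"
  shows "A = A $$ (0, 0) \<cdot>\<^sub>m sl2_h + A $$ (1, 0) \<cdot>\<^sub>m sl2_f + A $$ (0, 1) \<cdot>\<^sub>m sl2_e"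
  using assms unfolding carrier_sl2
  by (intro eq_matI) (auto simp: sl2_h_def sl2_f_def sl2_e_def elem_mat_def less_2_cases_iff)

lemma sl2_brackets:
  "sl2_h * sl2_e - sl2_e * sl2_h = 2 \<cdot>\<^sub>m sl2_e" "sl2_f * sl2_e - sl2_e * sl2_f = (- 1) \<cdot>\<^sub>m sl2_h"
  by (rule eq_matI; auto simp: sl2_h_def sl2_f_def sl2_e_def elem_mat_def less_2_cases_iff
      scalar_prod_def numeral_2_eq_2)+

lemma poly_act_basis:
  "poly_act l sl2_e p = pCons 0 p" "poly_act l sl2_h p = poly_h l p" "poly_act l sl2_f p = poly_f l p"
  by (simp_all add: poly_act_def sl2_h_def sl2_f_def sl2_e_def elem_mat_def)

text \<open>Horner's scheme for substituting \<open>gen sl2_e\<close> for the variable. Applying the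
  result to the polynomial 1 gives back \<open>p\<close>, see
  \<open>alg_act_poly_lift\<close>.\<close>

definition poly_lift :: "complex poly \<Rightarrow> complex mat free_word \<Rightarrow>\<^sub>0 complex" where
  "poly_lift p = fold_coeffs (\<lambda>c q. const c + gen sl2_e * q) p 0"

lemma poly_lift_0 [simp]: "poly_lift 0 = 0" by (simp add: poly_lift_def)

lemma poly_lift_pCons: "poly_lift (pCons c p) = const c + gen sl2_e * poly_lift p"
  by (cases "c = 0 \<and> p = 0") (auto simp: poly_lift_def)

lemma poly_lift_add: "poly_lift (p + q) = poly_lift p + poly_lift q"
  by (induction p q rule: poly_induct2) (simp_all add: poly_lift_pCons const_add algebra_simps)

lemma const_left_commute: "p * (const c * q) = const c * (p * q)"
  by (metis const_central mult.assoc)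

lemma poly_lift_smult: "poly_lift (Polynomial.smult c p) = const c * poly_lift p"
proof (induction p)
  case (pCons a p)
  then show ?case
    by (simp add: poly_lift_pCons const_mult distrib_left const_left_commute[of "gen sl2_e"])
qed simp

lemma poly_lift_diff: "poly_lift (p - q) = poly_lift p - poly_lift q"
  using poly_lift_add[of "p - q" q] by simp

lemma poly_lift_closed: "poly_lift p \<in> U_alg"
  by (induction p) (simp_all add: poly_lift_pCons free_alg_closed del: sl_simps)

lemma alg_act_poly_lift: "alg_act l (poly_lift p) [:1:] = p"
  by (induction p) (simp_all add: poly_lift_pCons alg_act_add alg_act_mult poly_act_basis)

text \<open>The annihilator of the lowest weight vector, pulled back to the free algebra.\<close>

definition verma_ann :: "complex \<Rightarrow> (complex mat free_word \<Rightarrow>\<^sub>0 complex) set" where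
  "verma_ann l = {p \<in> U_alg. frag_of (U_cls p, 1) \<in> verma_rels l}"

lemma tensor_add_rel:
  assumes "p \<in> U_alg" "q \<in> U_alg"
  shows "frag_of (U_cls (p + q), v) - frag_of (U_cls p, v) - frag_of (U_cls q, v) \<in> verma_rels l"
  by (rule subsetD[OF verma_gens_rels], unfold verma_gens_def,
      rule UnI1, rule UnI1, rule CollectI, rule exI[of _ p], rule exI[of _ q], rule exI[of _ v],
      intro conjI refl assms)

lemma tensor_zero_rel: "frag_of (U_cls 0, v) \<in> verma_rels l"
  using verma_rels_closed(4)[OF tensor_add_rel[of 0 0 v l]] by (simp add: free_alg_closed)

lemma tensor_line_rel:
  assumes "p \<in> U_alg" "b \<in> carrier (free_alg borel_minus)" "alg_act l b [:v:] = [:c:]"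
  shows "frag_of (U_cls (p * b), v) - frag_of (U_cls p, c) \<in> verma_rels l"
  by (rule subsetD[OF verma_gens_rels], unfold verma_gens_def,
      rule UnI2, rule CollectI, rule exI[of _ p], rule exI[of _ b], rule exI[of _ v], rule exI[of _ c],
      intro conjI refl assms)

text \<open>Both tensors equal the tensor of \<open>p\<close> with \<open>c\<close>, since constants
  belong to the free algebra of the Borel subalgebra and act on the line as scalars.\<close>

lemma tensor_borel_rel:
  assumes p: "p \<in> U_alg" and b: "b \<in> carrier (free_alg borel_minus)" "alg_act l b [:1:] = [:c:]"
  shows "frag_of (U_cls (p * b), 1) - frag_of (U_cls (p * const c), 1) \<in> verma_rels l"
proof -
  have "frag_of (U_cls (p * const c), 1) - frag_of (U_cls p, c) \<in> verma_rels l"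
    by (rule tensor_line_rel[OF p]) (simp_all add: free_alg_closed)
  from verma_rels_closed(5)[OF tensor_line_rel[OF p b] this] show ?thesis
    by (simp add: algebra_simps)
qed

text \<open>Thus \<open>verma_ann\<close> is a left ideal containing the enveloping ideal: left
  multiplication preserves the relations, and the tensor of zero with 1 is a relation.\<close>

lemma verma_ann_closed:
  "p \<in> verma_ann l \<Longrightarrow> q \<in> verma_ann l \<Longrightarrow> p + q \<in> verma_ann l"
  "p \<in> verma_ann l \<Longrightarrow> - p \<in> verma_ann l"
  "p \<in> verma_ann l \<Longrightarrow> q \<in> verma_ann l \<Longrightarrow> p - q \<in> verma_ann l"
  "a \<in> U_alg \<Longrightarrow> p \<in> verma_ann l \<Longrightarrow> a * p \<in> verma_ann l"
  "p \<in> env_ideal (sl 2) \<Longrightarrow> p \<in> verma_ann l"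
proof -
  show add: "p + q \<in> verma_ann l" if "p \<in> verma_ann l" "q \<in> verma_ann l" for p q
  proof -
    have pq: "p \<in> U_alg" "q \<in> U_alg" "frag_of (U_cls p, 1) \<in> verma_rels l"
      "frag_of (U_cls q, 1) \<in> verma_rels l" using that by (simp_all add: verma_ann_def)
    from verma_rels_closed(3)[OF verma_rels_closed(3)[OF tensor_add_rel[OF pq(1,2), of 1 l] pq(3)] pq(4)]
    have "frag_of (U_cls (p + q), 1) \<in> verma_rels l" by simp
    then show ?thesis using pq by (simp add: verma_ann_def free_alg_closed)
  qed
  show minus: "- p \<in> verma_ann l" if "p \<in> verma_ann l" for p
  proof -
    have p: "- p \<in> U_alg" "p \<in> U_alg" "frag_of (U_cls p, 1) \<in> verma_rels l"
      using that by (simp_all add: verma_ann_def free_alg_closed)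
    from verma_rels_closed(3)[OF tensor_add_rel[OF p(1,2), of 1 l] p(3)]
    have "frag_of (U_cls 0, 1) - frag_of (U_cls (- p), 1) \<in> verma_rels l" by simp
    from verma_rels_closed(5)[OF tensor_zero_rel[of 1 l] this] show ?thesis
      using p(1) by (simp add: verma_ann_def)
  qed
  show "p \<in> verma_ann l \<Longrightarrow> q \<in> verma_ann l \<Longrightarrow> p - q \<in> verma_ann l" for p q
    using add[of p "- q"] minus[of q] by simp
  show "a \<in> U_alg \<Longrightarrow> p \<in> verma_ann l \<Longrightarrow> a * p \<in> verma_ann l" for a p
    using left_mult_rels[of a "frag_of (U_cls p, 1)" l]
    by (simp add: verma_ann_def left_mult_of free_alg_closed)
  show "p \<in> verma_ann l" if "p \<in> env_ideal (sl 2)" for p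
  proof -
    have "U_cls p = U_cls 0" using that by (simp add: S.env_class_eq_iff)
    then show ?thesis using that tensor_zero_rel S.env_ideal_closed(2) by (simp add: verma_ann_def)
  qed
qed

lemma verma_ann_borel:
  assumes b: "b \<in> carrier (free_alg borel_minus)" "alg_act l b [:1:] = [:c:]"
  shows "b - const c \<in> verma_ann l"
proof -
  have u: "b \<in> U_alg" "const c \<in> U_alg" "b - const c \<in> U_alg"
    using b free_alg_borel_subset by (auto intro!: free_alg_closed)
  have "frag_of (U_cls b, 1) - frag_of (U_cls (b - const c), 1) - frag_of (U_cls (const c), 1) \<in> verma_rels l"
    using tensor_add_rel[OF u(3,2), of 1 l] by simp
  moreover have "frag_of (U_cls b, 1) - frag_of (U_cls (const c), 1) \<in> verma_rels l"
    using tensor_borel_rel[OF free_alg_closed(6) b] by simp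
  ultimately have "(frag_of (U_cls b, 1) - frag_of (U_cls (const c), 1)) -
    (frag_of (U_cls b, 1) - frag_of (U_cls (b - const c), 1) - frag_of (U_cls (const c), 1)) \<in> verma_rels l"
    using verma_rels_closed(5) by blast
  then show ?thesis using u by (simp add: verma_ann_def)
qed

text \<open>Moves \<open>h\<close> past one power of \<open>e\<close> at a time, until it meets the
  lowest weight vector and becomes the scalar \<open>l\<close>.\<close>

lemma verma_ann_h: "gen sl2_h * poly_lift p - poly_lift (poly_h l p) \<in> verma_ann l"
proof (induction p)
  case 0
  then show ?case by (simp add: verma_ann_closed(5) S.env_ideal_closed poly_h_def)
next
  case (pCons c p)
  have w: "gen sl2_h - const l \<in> verma_ann l"
    by (rule verma_ann_borel) (simp_all add: free_alg_closed poly_act_basis poly_h_def)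
  \<comment> \<open>The bracket relation produces the generator of the matrix \<open>2 e\<close>;
    the scalar relation exchanges it for \<open>const 2 * gen sl2_e\<close>.\<close>
  have r: "gen sl2_h * gen sl2_e - gen sl2_e * gen sl2_h - const 2 * gen sl2_e \<in> env_ideal (sl 2)"
    using S.env_ideal_closed(3)[OF S.env_relations(3)[of sl2_h sl2_e] S.env_relations(2)[of sl2_e 2]]
    by (simp add: sl2_brackets del: sl_simps(1))
  \<comment> \<open>The summands are the base case for the constant term, the commutator applied to
    the remaining polynomial, and \<open>e\<close> times the induction hypothesis.\<close>
  have "const c * (gen sl2_h - const l) +
      (gen sl2_h * gen sl2_e - gen sl2_e * gen sl2_h - const 2 * gen sl2_e) * poly_lift p +
      gen sl2_e * (gen sl2_h * poly_lift p - poly_lift (poly_h l p)) \<in> verma_ann l" (is "?x \<in> _")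
    by (intro verma_ann_closed(1) verma_ann_closed(4)[OF _ w] verma_ann_closed(4)[OF _ pCons.IH]
        verma_ann_closed(5) S.env_ideal_closed(6)[OF r] free_alg_closed poly_lift_closed sl2_basis_mem)
  note m = this
  have "?x = gen sl2_h * poly_lift (pCons c p) - poly_lift (poly_h l (pCons c p))"
    using const_central[of c "gen sl2_h"]
    by (simp add: poly_h_pCons poly_lift_pCons poly_lift_add poly_lift_smult algebra_simps
        const_mult[of c l] const_left_commute[of "gen sl2_e"])
  from m[unfolded this] show ?case .
qed

text \<open>Same recursion with \<open>f e = e f - h\<close>: every exchange leaves an
  \<open>h\<close>, which \<open>verma_ann_h\<close> evaluates. At the end \<open>f\<close> kills
  the lowest weight vector.\<close>

lemma verma_ann_f: "gen sl2_f * poly_lift p - poly_lift (poly_f l p) \<in> verma_ann l"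
proof (induction p)
  case 0
  then show ?case by (simp add: verma_ann_closed(5) S.env_ideal_closed poly_f_def)
next
  case (pCons c p)
  have w: "gen sl2_f - const 0 \<in> verma_ann l"
    by (rule verma_ann_borel) (simp_all add: free_alg_closed poly_act_basis poly_f_def pderiv_pCons)
  have r: "gen sl2_f * gen sl2_e - gen sl2_e * gen sl2_f - const (- 1) * gen sl2_h \<in> env_ideal (sl 2)"
    using S.env_ideal_closed(3)[OF S.env_relations(3)[of sl2_f sl2_e] S.env_relations(2)[of sl2_h "- 1"]]
    by (simp add: sl2_brackets del: sl_simps(1))
  \<comment> \<open>As for \<open>h\<close>, with a fourth term: the subtracted one evaluates the
    \<open>h\<close> that the commutator leaves behind.\<close>
  have "const c * (gen sl2_f - const 0) +
      (gen sl2_f * gen sl2_e - gen sl2_e * gen sl2_f - const (- 1) * gen sl2_h) * poly_lift p +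
      gen sl2_e * (gen sl2_f * poly_lift p - poly_lift (poly_f l p)) -
      (gen sl2_h * poly_lift p - poly_lift (poly_h l p)) \<in> verma_ann l" (is "?x \<in> _")
    by (intro verma_ann_closed(1) verma_ann_closed(3)[OF _ verma_ann_h]
        verma_ann_closed(4)[OF _ w] verma_ann_closed(4)[OF _ pCons.IH]
        verma_ann_closed(5) S.env_ideal_closed(6)[OF r] free_alg_closed poly_lift_closed sl2_basis_mem)
  note m = this
  have n: "const (- 1) = - (1 :: complex mat free_word \<Rightarrow>\<^sub>0 complex)"
    by (simp add: const_def single_uminus)
  have "?x = gen sl2_f * poly_lift (pCons c p) - poly_lift (poly_f l (pCons c p))"
    using const_central[of c "gen sl2_f"]
      n
    by (simp add: poly_f_pCons poly_lift_pCons poly_lift_diff algebra_simps)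
  from m[unfolded this] show ?case .
qed

text \<open>\<open>gen\<close> is linear modulo the enveloping ideal, though not in the free
  algebra; the five relations added up in the proof telescope.\<close>

lemma gen_expand:
  fixes A :: "complex mat"
  assumes A: "A \<in> carrier (sl 2)"
  shows "gen A - (const (A $$ (0, 0)) * gen sl2_h + const (A $$ (1, 0)) * gen sl2_f +
    const (A $$ (0, 1)) * gen sl2_e) \<in> env_ideal (sl 2)"
proof -
  let ?a = "A $$ (0, 0)" and ?b = "A $$ (1, 0)" and ?c = "A $$ (0, 1)"
  have m: "c \<cdot>\<^sub>m x \<in> carrier (sl 2)" if "x \<in> carrier (sl 2)" for c :: complex and x
    using S.smult_closed[OF that] by (simp del: sl_simps(1))
  have "?a \<cdot>\<^sub>m sl2_h + ?b \<cdot>\<^sub>m sl2_f \<in> carrier (sl 2)"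
    using S.add_closed[OF m m, of sl2_h sl2_f] by (simp del: sl_simps(1))
  then have 1: "gen (?a \<cdot>\<^sub>m sl2_h + ?b \<cdot>\<^sub>m sl2_f + ?c \<cdot>\<^sub>m sl2_e) -
      gen (?a \<cdot>\<^sub>m sl2_h + ?b \<cdot>\<^sub>m sl2_f) - gen (?c \<cdot>\<^sub>m sl2_e) \<in> env_ideal (sl 2)"
    using S.env_relations(1)[of "?a \<cdot>\<^sub>m sl2_h + ?b \<cdot>\<^sub>m sl2_f" "?c \<cdot>\<^sub>m sl2_e"] m[of sl2_e]
    by (simp del: sl_simps(1))
  have 2: "gen (?a \<cdot>\<^sub>m sl2_h + ?b \<cdot>\<^sub>m sl2_f) - gen (?a \<cdot>\<^sub>m sl2_h) - gen (?b \<cdot>\<^sub>m sl2_f) \<in> env_ideal (sl 2)"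
    using S.env_relations(1)[of "?a \<cdot>\<^sub>m sl2_h" "?b \<cdot>\<^sub>m sl2_f"] m[of sl2_h] m[of sl2_f]
    by (simp del: sl_simps(1))
  have 3: "gen (c \<cdot>\<^sub>m x) - const c * gen x \<in> env_ideal (sl 2)" if "x \<in> carrier (sl 2)" for c :: complex and x
    using S.env_relations(2)[OF that, of c] by (simp del: sl_simps(1))
  have "(gen (?a \<cdot>\<^sub>m sl2_h + ?b \<cdot>\<^sub>m sl2_f + ?c \<cdot>\<^sub>m sl2_e) -
      gen (?a \<cdot>\<^sub>m sl2_h + ?b \<cdot>\<^sub>m sl2_f) - gen (?c \<cdot>\<^sub>m sl2_e)) +
    (gen (?a \<cdot>\<^sub>m sl2_h + ?b \<cdot>\<^sub>m sl2_f) - gen (?a \<cdot>\<^sub>m sl2_h) - gen (?b \<cdot>\<^sub>m sl2_f)) +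
    (gen (?a \<cdot>\<^sub>m sl2_h) - const ?a * gen sl2_h) + (gen (?b \<cdot>\<^sub>m sl2_f) - const ?b * gen sl2_f) +
    (gen (?c \<cdot>\<^sub>m sl2_e) - const ?c * gen sl2_e) \<in> env_ideal (sl 2)"
    by (intro S.env_ideal_closed(3) 1 2 3 sl2_basis_mem)
  then show ?thesis by (subst (1) sl2_expand[OF A]) (simp add: algebra_simps)
qed

lemma verma_ann_gen:
  assumes A: "A \<in> carrier (sl 2)"
  shows "gen A * poly_lift p - poly_lift (poly_act l A p) \<in> verma_ann l"
proof -
  let ?a = "A $$ (0, 0)" and ?b = "A $$ (1, 0)" and ?c = "A $$ (0, 1)"
  have "(gen A - (const ?a * gen sl2_h + const ?b * gen sl2_f + const ?c * gen sl2_e)) * poly_lift p +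
      const ?a * (gen sl2_h * poly_lift p - poly_lift (poly_h l p)) +
      const ?b * (gen sl2_f * poly_lift p - poly_lift (poly_f l p)) \<in> verma_ann l" (is "?x \<in> _")
    by (intro verma_ann_closed(1) verma_ann_closed(5) S.env_ideal_closed(6) gen_expand A
        poly_lift_closed verma_ann_closed(4) verma_ann_h verma_ann_f free_alg_closed)
  note m = this
  have "?x = gen A * poly_lift p - poly_lift (poly_act l A p)"
    by (simp add: poly_act_def poly_lift_add poly_lift_smult poly_lift_pCons algebra_simps
        const_left_commute[of "gen sl2_e"])
  from m[unfolded this] show ?thesis .
qed

definition verma_param :: "complex \<Rightarrow> complex poly \<Rightarrow> _" where
  "verma_param l p = verma_cls l (frag_of (U_cls (poly_lift p), 1))"

lemma verma_cls_eqI: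
  assumes "p \<in> U_alg" "q \<in> U_alg" "p - q \<in> verma_ann l"
  shows "verma_cls l (frag_of (U_cls p, 1)) = verma_cls l (frag_of (U_cls q, 1))"
proof -
  have "frag_of (U_cls ((p - q) + q), 1) - frag_of (U_cls (p - q), 1) - frag_of (U_cls q, 1) \<in> verma_rels l"
    using assms by (intro tensor_add_rel) (auto simp: free_alg_closed)
  moreover have "frag_of (U_cls (p - q), 1) \<in> verma_rels l" using assms(3) by (simp add: verma_ann_def)
  ultimately have "frag_of (U_cls ((p - q) + q), 1) - frag_of (U_cls (p - q), 1) -
      frag_of (U_cls q, 1) + frag_of (U_cls (p - q), 1) \<in> verma_rels l" by (rule verma_rels_closed(3))
  then show ?thesis by (simp add: verma_cls_eq_iff)
qed

lemma verma_param_add: "verma_param l (p + q) = verma_param l p \<oplus>\<^bsub>verma_space l\<^esub> verma_param l q"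
  using tensor_add_rel[OF poly_lift_closed[of p] poly_lift_closed[of q], of 1 l]
  by (simp add: verma_param_def verma_space_simps verma_free_closed poly_lift_closed
      poly_lift_add verma_cls_eq_iff diff_diff_eq)

lemma verma_param_zero: "verma_param l 0 = \<zero>\<^bsub>verma_space l\<^esub>"
  by (simp add: verma_param_def verma_space_simps verma_cls_eq_iff tensor_zero_rel)

lemma verma_param_smult: "verma_param l (Polynomial.smult c p) = c \<odot>\<^bsub>verma_space l\<^esub> verma_param l p"
  by (simp add: verma_param_def induced_space_def Let_def tensor_lmult_cls free_alg_closed
      left_mult_of poly_lift_closed poly_lift_smult)

lemma verma_param_act:
  assumes "A \<in> carrier (sl 2)"
  shows "verma_param l (poly_act l A p) = verma_act l A (verma_param l p)"
proof -
  have "verma_act l A (verma_param l p) = verma_cls l (frag_of (U_cls (gen A * poly_lift p), 1))"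
    using assms by (simp add: verma_param_def induced_act_def tensor_lmult_cls free_alg_closed
        left_mult_of poly_lift_closed del: sl_simps)
  also have "\<dots> = verma_param l (poly_act l A p)"
    unfolding verma_param_def
    by (intro verma_cls_eqI verma_ann_gen assms free_alg_closed poly_lift_closed)
  finally show ?thesis by simp
qed

text \<open>Evaluating the tensor recovers the polynomial and is constant on cosets.\<close>

lemma inj_verma_param: "inj (verma_param l)"
proof (rule injI)
  fix p q assume "verma_param l p = verma_param l q"
  then have "tensor_eval l (frag_of (U_cls (poly_lift p), 1) - frag_of (U_cls (poly_lift q), 1)) = 0"
    by (intro tensor_eval_rels) (simp add: verma_param_def verma_cls_eq_iff)
  then show "p = q" by (simp add: tensor_eval_diff tensor_eval_of alg_act_poly_lift)
qed

text \<open>Letters are absorbed one by one, each by \<open>verma_ann_gen\<close>. Hence the powers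
  of \<open>e\<close> applied to the lowest weight vector span the Verma module.\<close>

lemma poly_lift_mod_ann:
  assumes "a \<in> U_alg"
  shows "\<exists>q. a * poly_lift p - poly_lift q \<in> verma_ann l"
proof (rule poly_mapping_induct_single[of a "{w. set (letters w) \<subseteq> carrier (sl 2)}"], goal_cases)
  case 1
  then show ?case using assms by (simp add: carrier_free_alg)
next
  case 2
  show ?case by (rule exI[of _ 0]) (simp add: verma_ann_closed(5) S.env_ideal_closed)
next
  case (3 w c)
  have "\<exists>q. Poly_Mapping.single (Word ws) c * poly_lift p - poly_lift q \<in> verma_ann l"
    if "set ws \<subseteq> carrier (sl 2)" for ws
    using that
  proof (induction ws)
    case Nil
    have "Poly_Mapping.single (Word []) c * poly_lift p - poly_lift (Polynomial.smult c p) = 0"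
      by (simp add: poly_lift_smult) (simp add: const_def zero_free_word_def)
    then show ?case by (metis verma_ann_closed(5) S.env_ideal_closed(1))
  next
    case (Cons x ws)
    then obtain q where q: "Poly_Mapping.single (Word ws) c * poly_lift p - poly_lift q \<in> verma_ann l"
      by auto
    have x: "x \<in> carrier (sl 2)" using Cons.prems by simp
    have "gen x * (Poly_Mapping.single (Word ws) c * poly_lift p - poly_lift q) +
        (gen x * poly_lift q - poly_lift (poly_act l x q)) \<in> verma_ann l"
      by (intro verma_ann_closed(1) verma_ann_closed(4)[OF _ q] verma_ann_gen x free_alg_closed)
    moreover have "Poly_Mapping.single (Word (x # ws)) c = gen x * Poly_Mapping.single (Word ws) c"
      by (simp add: gen_def mult_single plus_free_word_def)
    ultimately show ?case
      by (intro exI[of _ "poly_act l x q"]) (simp add: algebra_simps)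
  qed
  from this[of "letters w"] 3 show ?case by simp
next
  case (4 a b)
  then obtain q q' where "a * poly_lift p - poly_lift q \<in> verma_ann l"
    "b * poly_lift p - poly_lift q' \<in> verma_ann l" by blast
  from verma_ann_closed(1)[OF this] show ?case
    by (intro exI[of _ "q + q'"]) (simp add: poly_lift_add algebra_simps)
qed

lemma surj_verma_param:
  assumes "C \<in> carrier (verma_space l)"
  shows "C \<in> range (verma_param l)"
proof -
  obtain t where t: "Poly_Mapping.keys t \<subseteq> (U_cls ` U_alg) \<times> UNIV" "C = verma_cls l t"
    using assms by (auto simp: verma_space_simps keys_verma_free)
  have "\<exists>q. t - frag_of (U_cls (poly_lift q), 1) \<in> verma_rels l"
    using t(1)
  proof (induction rule: frag_induction)
    case zero
    show ?case using verma_rels_closed(4)[OF tensor_zero_rel[of 1 l]] by (auto intro: exI[of _ 0])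
  next
    case (one x)
    then obtain a v where x: "x = (U_cls a, v)" "a \<in> U_alg" by auto
    have "poly_lift [:v:] = const v" by (simp add: poly_lift_pCons)
    with poly_lift_mod_ann[OF x(2), of "[:v:]" l]
    obtain q where q: "a * const v - poly_lift q \<in> verma_ann l" by auto
    \<comment> \<open>A scalar in the right factor is moved to the left, so that only tensors with 1
      on the right remain.\<close>
    have "frag_of (U_cls (a * const v), 1) - frag_of (U_cls a, v) \<in> verma_rels l"
      by (rule tensor_line_rel[OF x(2)]) (simp_all add: free_alg_closed)
    moreover have "frag_of (U_cls (a * const v), 1) - frag_of (U_cls (poly_lift q), 1) \<in> verma_rels l"
      using verma_cls_eqI[OF _ poly_lift_closed q] x(2) by (simp add: verma_cls_eq_iff free_alg_closed)
    ultimately have "(frag_of (U_cls (a * const v), 1) - frag_of (U_cls (poly_lift q), 1)) -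
        (frag_of (U_cls (a * const v), 1) - frag_of (U_cls a, v)) \<in> verma_rels l"
      by (rule verma_rels_closed(5)[rotated])
    then show ?case using x by auto
  next
    case (diff a b)
    then obtain p q where pq: "a - frag_of (U_cls (poly_lift p), 1) \<in> verma_rels l"
      "b - frag_of (U_cls (poly_lift q), 1) \<in> verma_rels l" by blast
    have "frag_of (U_cls (poly_lift p), 1) - frag_of (U_cls (poly_lift (p - q)), 1) -
        frag_of (U_cls (poly_lift q), 1) \<in> verma_rels l"
      using tensor_add_rel[OF poly_lift_closed[of "p - q"] poly_lift_closed[of q], of 1 l]
      by (simp add: poly_lift_add[symmetric])
    from verma_rels_closed(3)[OF verma_rels_closed(5)[OF pq] this]
    show ?case by (intro exI[of _ "p - q"]) (simp add: algebra_simps)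
  qed
  then show ?thesis using t(2) by (auto simp: verma_param_def verma_cls_eq_iff image_iff)
qed

lemma bij_verma_param: "bij_betw (verma_param l) UNIV (carrier (verma_space l))"
  unfolding bij_betw_def using inj_verma_param surj_verma_param
  by (auto simp: verma_param_def verma_space_simps verma_free_closed poly_lift_closed)

text \<open>Polynomials parametrize \<open>V / N\<close> through \<open>ev\<close>: surjectively by
  the form of the carrier, injectively because \<open>ev p\<close> lies in \<open>N\<close> only for
  \<open>p = 0\<close>. The action has to match the model only modulo \<open>N\<close>, which leaves
  room for a vector that \<open>f\<close> kills merely modulo \<open>N\<close>.\<close>

lemma quotient_verma_iso:
  fixes V :: "(complex, 'a::ab_group_add) module" and ev :: "complex poly \<Rightarrow> 'a"
  assumes vs: "Vector_Spaces.vector_space scl"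
    and V: "add V = (+)" "smult V = scl" "carrier V = {s + ev p | s p. s \<in> N}"
    and N: "0 \<in> N" "\<And>x y. x \<in> N \<Longrightarrow> y \<in> N \<Longrightarrow> x + y \<in> N" "\<And>c x. x \<in> N \<Longrightarrow> scl c x \<in> N"
    and ev: "\<And>p q. ev (p + q) = ev p + ev q" "\<And>c p. ev (Polynomial.smult c p) = scl c (ev p)"
      "\<And>p. ev p \<in> N \<Longrightarrow> p = 0"
    and \<rho>N: "\<And>A v. A \<in> carrier (sl 2) \<Longrightarrow> v \<in> N \<Longrightarrow> \<rho> A v \<in> N"
    and \<rho>add: "\<And>A s p. A \<in> carrier (sl 2) \<Longrightarrow> s \<in> N \<Longrightarrow> \<rho> A (s + ev p) = \<rho> A s + \<rho> A (ev p)"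
    and \<rho>ev: "\<And>A p. A \<in> carrier (sl 2) \<Longrightarrow> \<rho> A (ev p) - ev (poly_act l A p) \<in> N"
  shows "lie_rep_iso (sl 2) (quot_space V N) (quot_act V N \<rho>) (verma_space l) (verma_act l)"
proof -
  interpret Vector_Spaces.vector_space scl by (rule vs)
  have Nm: "- x \<in> N" if "x \<in> N" for x using N(3)[OF that, of "- 1"] by simp
  have Nd: "x - y \<in> N" if "x \<in> N" "y \<in> N" for x y using N(2)[OF that(1) Nm[OF that(2)]] by simp
  define cs where "cs x = {s + x | s. s \<in> N}" for x
  have cs_eq: "cs x = cs y \<longleftrightarrow> x - y \<in> N" for x y
  proof
    assume "cs x = cs y"
    moreover have "x \<in> cs x" using N(1) by (force simp: cs_def)
    ultimately show "x - y \<in> N" by (auto simp: cs_def)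
  next
    assume d: "x - y \<in> N"
    have "s + x = (s + (x - y)) + y" "s + y = (s - (x - y)) + x" for s by simp_all
    then show "cs x = cs y" unfolding cs_def using d N(2) Nd by blast
  qed
  have mem_cs: "x \<in> cs y \<longleftrightarrow> x - y \<in> N" for x y
    unfolding cs_def by (auto intro!: exI[of _ "x - y"])
  have rc: "N +>\<^bsub>V\<^esub> x = cs x" for x by (auto simp: a_r_coset_def r_coset_def cs_def V)
  \<comment> \<open>The operations on \<open>quot_space\<close> are unions over representatives;
    once the map respects \<open>N\<close>, all cosets in the union coincide.\<close>
  have UN: "(\<Union>v\<in>cs x. cs (f v)) = cs (f x)" if "\<And>v. v - x \<in> N \<Longrightarrow> f v - f x \<in> N" for f :: "'a \<Rightarrow> 'a" and x
    using that N(1) by (force simp: mem_cs cs_eq[THEN iffD2])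
  have car: "carrier (quot_space V N) = cs ` {s + ev p | s p. s \<in> N}"
  proof -
    have "A_RCOSETS V N = cs ` carrier V"
      unfolding A_RCOSETS_def RCOSETS_def a_r_coset_def[symmetric] rc by auto
    then show ?thesis by (simp add: quot_space_def V)
  qed
  define a where "a p = cs (ev p)" for p
  have ev0: "ev 0 = 0" using ev(2)[of 0 0] by simp
  have evd: "ev (p - q) = ev p - ev q" for p q using ev(1)[of "p - q" q] by simp
  show ?thesis
  proof (rule lie_rep_iso_common_model[where a = a and b = "verma_param l" and K = "poly_act l"
        and scl = Polynomial.smult])
    show "Vector_Spaces.vector_space (Polynomial.smult :: complex \<Rightarrow> _)"
      by unfold_locales (auto simp: smult_add_right smult_add_left)
    show "bij_betw a UNIV (carrier (quot_space V N))"
    proof (rule bij_betw_imageI)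
      show "inj a"
      proof (rule injI)
        fix p q assume "a p = a q"
        then have "ev (p - q) \<in> N" by (simp add: a_def cs_eq evd)
        from ev(3)[OF this] show "p = q" by simp
      qed
      have "cs (s + ev p) = a p" if "s \<in> N" for s p using that by (simp add: a_def cs_eq)
      then show "range a = carrier (quot_space V N)"
        unfolding car using N(1) by (force simp: a_def image_iff)
    qed
    show "a (p + q) = a p \<oplus>\<^bsub>quot_space V N\<^esub> a q" for p q
    proof -
      have "set_add V (cs x) (cs y) = cs (x + y)" for x y
      proof
        show "set_add V (cs x) (cs y) \<subseteq> cs (x + y)"
        proof
          fix z assume "z \<in> set_add V (cs x) (cs y)"
          then obtain s t where st: "s \<in> N" "t \<in> N" "z = (s + x) + (t + y)"
            by (auto simp: set_add_def set_mult_def cs_def V)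
          then have "z = (s + t) + (x + y)" by (simp add: algebra_simps)
          then show "z \<in> cs (x + y)" using N(2)[OF st(1,2)] by (auto simp: cs_def)
        qed
        show "cs (x + y) \<subseteq> set_add V (cs x) (cs y)"
        proof
          fix z assume "z \<in> cs (x + y)"
          then obtain s where "s \<in> N" "z = (s + x) + (0 + y)" by (auto simp: cs_def algebra_simps)
          then show "z \<in> set_add V (cs x) (cs y)"
            using N(1) by (auto simp: set_add_def set_mult_def cs_def V)
        qed
      qed
      then show ?thesis by (simp add: quot_space_def a_def ev)
    qed
    show "a 0 = \<zero>\<^bsub>quot_space V N\<^esub>" by (auto simp: quot_space_def a_def ev0 cs_def)
    show "a (Polynomial.smult c p) = c \<odot>\<^bsub>quot_space V N\<^esub> a p" for c p
    proof -
      have "(\<Union>v\<in>cs (ev p). cs (scl c v)) = cs (scl c (ev p))"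
        by (rule UN) (use N(3)[of "v - ev p" c for v] in \<open>simp add: scale_right_diff_distrib\<close>)
      then show ?thesis by (simp add: quot_space_def a_def ev rc V)
    qed
    show "a (poly_act l A p) = quot_act V N \<rho> A (a p)" if A: "A \<in> carrier (sl 2)" for A p
    proof -
      have "(\<Union>v\<in>cs (ev p). cs (\<rho> A v)) = cs (\<rho> A (ev p))"
      proof (rule UN)
        fix v assume "v - ev p \<in> N"
        from \<rho>N[OF A this] \<rho>add[OF A this, of p] show "\<rho> A v - \<rho> A (ev p) \<in> N" by simp
      qed
      also have "\<dots> = cs (ev (poly_act l A p))" using \<rho>ev[OF A] by (simp add: cs_eq)
      finally show ?thesis by (simp add: quot_act_def a_def rc)
    qed
  qed (use bij_verma_param verma_param_add verma_param_zero verma_param_smult verma_param_act in blast)+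
qed

lemma subspace_class_ringI:
  fixes V :: "('k::field, 'v, 'n) module_scheme"
  assumes "vectorspace class_ring V" "W \<subseteq> carrier V" "\<zero>\<^bsub>V\<^esub> \<in> W"
    and "\<And>x y. x \<in> W \<Longrightarrow> y \<in> W \<Longrightarrow> x \<oplus>\<^bsub>V\<^esub> y \<in> W" "\<And>c x. x \<in> W \<Longrightarrow> c \<odot>\<^bsub>V\<^esub> x \<in> W"
  shows "subspace class_ring W V"
  using assms by (simp add: subspace_def submodule_def vectorspace_def)

section \<open>Filtrations of graded \<open>sl\<^sub>2\<close>-representations\<close>

text \<open>What the filtration argument sees of the orbit algebra: \<open>pr n\<close> projects to
  degree \<open>n\<close>; \<open>E\<close>, \<open>F\<close>, \<open>H\<close> have degrees 1, -1,
  0; \<open>H\<close> has eigenvalue \<open>2 n - c\<close> in degree \<open>n\<close>;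
  \<open>E\<close> is injective on homogeneous vectors; and \<open>g n\<close> lists finitely many
  vectors spanning degree \<open>n\<close>.\<close>

locale graded_sl2 = Vector_Spaces.vector_space scl
  for scl :: "complex \<Rightarrow> 'a::ab_group_add \<Rightarrow> 'a" +
  fixes M :: "(complex, 'a) module" and \<rho> :: "complex mat \<Rightarrow> 'a \<Rightarrow> 'a"
    and pr :: "nat \<Rightarrow> 'a \<Rightarrow> 'a" and E F H :: "'a \<Rightarrow> 'a" and c :: complex
    and g :: "nat \<Rightarrow> nat \<Rightarrow> 'a" and d :: "nat \<Rightarrow> nat"
  assumes M: "vectorspace class_ring M" "add M = (+)" "zero M = 0" "smult M = scl"
    and V_add: "\<And>x y. x \<in> carrier M \<Longrightarrow> y \<in> carrier M \<Longrightarrow> x + y \<in> carrier M"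
    and V_scl: "\<And>a x. x \<in> carrier M \<Longrightarrow> scl a x \<in> carrier M"
    and V_zero: "0 \<in> carrier M"
    and \<rho>: "\<And>A v. A \<in> carrier (sl 2) \<Longrightarrow> v \<in> carrier M \<Longrightarrow>
      \<rho> A v = scl (A $$ (0, 1)) (E v) + scl (A $$ (1, 0)) (F v) + scl (A $$ (0, 0)) (H v)"
    and op_mem: "\<And>v. v \<in> carrier M \<Longrightarrow> E v \<in> carrier M" "\<And>v. v \<in> carrier M \<Longrightarrow> F v \<in> carrier M"
      "\<And>v. v \<in> carrier M \<Longrightarrow> H v \<in> carrier M" "\<And>n v. v \<in> carrier M \<Longrightarrow> pr n v \<in> carrier M"
    and op_add: "\<And>v w. v \<in> carrier M \<Longrightarrow> w \<in> carrier M \<Longrightarrow> E (v + w) = E v + E w"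
      "\<And>v w. v \<in> carrier M \<Longrightarrow> w \<in> carrier M \<Longrightarrow> F (v + w) = F v + F w"
      "\<And>v w. v \<in> carrier M \<Longrightarrow> w \<in> carrier M \<Longrightarrow> H (v + w) = H v + H w"
      "\<And>n v w. v \<in> carrier M \<Longrightarrow> w \<in> carrier M \<Longrightarrow> pr n (v + w) = pr n v + pr n w"
    and op_scl: "\<And>a v. v \<in> carrier M \<Longrightarrow> E (scl a v) = scl a (E v)"
      "\<And>a v. v \<in> carrier M \<Longrightarrow> F (scl a v) = scl a (F v)"
      "\<And>a v. v \<in> carrier M \<Longrightarrow> H (scl a v) = scl a (H v)"
      "\<And>n a v. v \<in> carrier M \<Longrightarrow> pr n (scl a v) = scl a (pr n v)"
    and FE: "\<And>v. v \<in> carrier M \<Longrightarrow> F (E v) = E (F v) - H v"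
    and HE: "\<And>v. v \<in> carrier M \<Longrightarrow> H (E v) = E (H v) + scl 2 (E v)"
    and pr_pr: "\<And>m n v. v \<in> carrier M \<Longrightarrow> pr m (pr n v) = (if m = n then pr n v else 0)"
    and pr_sum: "\<And>v. v \<in> carrier M \<Longrightarrow> \<exists>n. v = (\<Sum>i<n. pr i v)"
    and pr_E: "\<And>n v. v \<in> carrier M \<Longrightarrow> pr (Suc n) (E v) = E (pr n v)"
    and pr_0_E: "\<And>v. v \<in> carrier M \<Longrightarrow> pr 0 (E v) = 0"
    and pr_F: "\<And>n v. v \<in> carrier M \<Longrightarrow> pr n (F v) = F (pr (Suc n) v)"
    and F_pr_0: "\<And>v. v \<in> carrier M \<Longrightarrow> F (pr 0 v) = 0"
    and pr_H: "\<And>n v. v \<in> carrier M \<Longrightarrow> pr n (H v) = scl (2 * of_nat n - c) (pr n v)"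
    and E_inj: "\<And>n v. v \<in> carrier M \<Longrightarrow> pr n v = v \<Longrightarrow> E v = 0 \<Longrightarrow> v = 0"
    and g: "\<And>n i. i < d n \<Longrightarrow> g n i \<in> carrier M" "\<And>n i. i < d n \<Longrightarrow> pr n (g n i) = g n i"
    and g_span: "\<And>n v. v \<in> carrier M \<Longrightarrow> pr n v = v \<Longrightarrow> \<exists>a. v = (\<Sum>i<d n. scl (a i) (g n i))"
begin

abbreviation "V \<equiv> carrier M"

definition comp where "comp n = {v \<in> V. pr n v = v}"

text \<open>The last condition says that \<open>V / S\<close> is torsion-free over \<open>\<complex>[e]\<close>.\<close>

definition good :: "'a set \<Rightarrow> bool" where
  "good S \<longleftrightarrow> S \<subseteq> V \<and> 0 \<in> S \<and> (\<forall>x\<in>S. \<forall>y\<in>S. x + y \<in> S) \<and> (\<forall>a. \<forall>x\<in>S. scl a x \<in> S) \<and>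
     (\<forall>n. \<forall>x\<in>S. pr n x \<in> S) \<and> (\<forall>x\<in>S. E x \<in> S) \<and> (\<forall>x\<in>S. F x \<in> S) \<and>
     (\<forall>n. \<forall>v\<in>comp n. E v \<in> S \<longrightarrow> v \<in> S)"

lemma goodD:
  assumes "good S"
  shows "x \<in> S \<Longrightarrow> x \<in> V" "0 \<in> S" "x \<in> S \<Longrightarrow> y \<in> S \<Longrightarrow> x + y \<in> S" "x \<in> S \<Longrightarrow> scl a x \<in> S"
    "x \<in> S \<Longrightarrow> pr n x \<in> S" "x \<in> S \<Longrightarrow> E x \<in> S" "x \<in> S \<Longrightarrow> F x \<in> S"
    "v \<in> comp n \<Longrightarrow> E v \<in> S \<Longrightarrow> v \<in> S"
  using assms by (auto simp: good_def)

lemma good_sum: "good S \<Longrightarrow> (\<And>i. i \<in> I \<Longrightarrow> f i \<in> S) \<Longrightarrow> sum f I \<in> S"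
  by (induction I rule: infinite_finite_induct) (auto intro: goodD)

lemma op_zero [simp]: "E 0 = 0" "F 0 = 0" "H 0 = 0" "pr n 0 = 0"
  using op_scl(1-3)[OF V_zero, of 0] op_scl(4)[OF V_zero, of n 0] by simp_all

lemma V_minus: "x \<in> V \<Longrightarrow> - x \<in> V" using V_scl[of x "- 1"] by simp

lemma V_diff: "x \<in> V \<Longrightarrow> y \<in> V \<Longrightarrow> x - y \<in> V" using V_add[of x "- y"] V_minus[of y] by simp

lemma op_diff: "v \<in> V \<Longrightarrow> w \<in> V \<Longrightarrow> E (v - w) = E v - E w" "v \<in> V \<Longrightarrow> w \<in> V \<Longrightarrow> pr n (v - w) = pr n v - pr n w"
  using op_add(1,4)[of "v - w" w] by (auto simp: V_diff)

lemma comp_closed: "x \<in> comp n \<Longrightarrow> y \<in> comp n \<Longrightarrow> x - y \<in> comp n" "x \<in> comp n \<Longrightarrow> scl a x \<in> comp n"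
  "x \<in> comp n \<Longrightarrow> E x \<in> comp (Suc n)" "v \<in> V \<Longrightarrow> pr n v \<in> comp n" "x \<in> comp n \<Longrightarrow> x \<in> V"
  by (auto simp: comp_def V_diff op_diff V_scl op_scl op_mem pr_E pr_pr)

lemma comp_pr: "x \<in> comp n \<Longrightarrow> pr m x = (if m = n then x else 0)"
  using pr_pr[of x m n] by (auto simp: comp_def)

lemma V_subset: "good S \<Longrightarrow> (\<And>n. comp n \<subseteq> S) \<Longrightarrow> V \<subseteq> S"
proof
  fix v assume S: "good S" "\<And>n. comp n \<subseteq> S" and v: "v \<in> V"
  obtain n where "v = (\<Sum>i<n. pr i v)" using pr_sum[OF v] by auto
  moreover have "(\<Sum>i<n. pr i v) \<in> S" using S comp_closed(4)[OF v] by (intro good_sum) auto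
  ultimately show "v \<in> S" by simp
qed

lemma comp_subset:
  assumes "good S" "\<And>i. i < d n \<Longrightarrow> g n i \<in> S"
  shows "comp n \<subseteq> S"
proof
  fix v assume "v \<in> comp n"
  then obtain a where "v = (\<Sum>i<d n. scl (a i) (g n i))" using g_span[of v n] by (auto simp: comp_def)
  moreover have "(\<Sum>i<d n. scl (a i) (g n i)) \<in> S"
    by (rule good_sum[OF assms(1)], rule goodD(4)[OF assms(1)], rule assms(2)) simp
  ultimately show "v \<in> S" by simp
qed

text \<open>\<open>pr_H\<close> describes only the projections of \<open>H w\<close>; since
  \<open>H w\<close> is the sum of finitely many of them, it is determined.\<close>

lemma H_eq: "w \<in> comp m \<Longrightarrow> H w = scl (2 * of_nat m - c) w"
proof -
  assume w: "w \<in> comp m"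
  then have wV: "w \<in> V" by (simp add: comp_def)
  obtain n where n: "H w = (\<Sum>i<n. pr i (H w))" using pr_sum[OF op_mem(3)[OF wV]] by auto
  have *: "pr i (H w) = (if i = m then scl (2 * of_nat m - c) w else 0)" for i
    using comp_pr[OF w] by (simp add: pr_H[OF wV])
  \<comment> \<open>If degree \<open>m\<close> is outside the range of the sum, then
    \<open>H w = 0\<close>, and projecting to degree \<open>m\<close> shows that the expected
    multiple of \<open>w\<close> is zero as well.\<close>
  have "H w = (if m < n then scl (2 * of_nat m - c) w else 0)"
    by (subst n) (simp add: * sum.delta)
  moreover have "pr m (H w) = scl (2 * of_nat m - c) w" using * by simp
  ultimately show ?thesis by (auto split: if_splits)
qed

text \<open>Stability under \<open>H\<close> is absent from \<open>good\<close>: it follows from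
  stability under projections, on whose images \<open>H\<close> is a scalar.\<close>

lemma good_H:
  assumes S: "good S" and x: "x \<in> S"
  shows "H x \<in> S"
proof -
  have xV: "x \<in> V" using goodD(1)[OF S x] .
  obtain n where n: "H x = (\<Sum>i<n. pr i (H x))" using pr_sum[OF op_mem(3)[OF xV]] by auto
  have "(\<Sum>i<n. pr i (H x)) \<in> S" 
    by (rule good_sum[OF S]) (simp add: pr_H[OF xV] goodD(4)[OF S goodD(5)[OF S x]])
  with n show ?thesis by simp
qed

text \<open>Horner's scheme for the polynomial \<open>p\<close> in \<open>E\<close>, applied to
  \<open>w\<close>.\<close>

definition ev :: "'a \<Rightarrow> complex poly \<Rightarrow> 'a" where
  "ev w p = fold_coeffs (\<lambda>a u. scl a w + E u) p 0"

lemma ev_0 [simp]: "ev w 0 = 0" by (simp add: ev_def)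

lemma ev_pCons: "ev w (pCons a p) = scl a w + E (ev w p)"
  by (cases "a = 0 \<and> p = 0") (auto simp: ev_def)

lemma ev_mem: "w \<in> V \<Longrightarrow> ev w p \<in> V"
  by (induction p) (auto simp: ev_pCons V_zero V_add V_scl op_mem)

lemma ev_add: "w \<in> V \<Longrightarrow> ev w (p + q) = ev w p + ev w q"
  by (induction p q rule: poly_induct2)
    (simp_all add: ev_pCons op_add ev_mem scale_left_distrib algebra_simps)

lemma ev_smult: "w \<in> V \<Longrightarrow> ev w (Polynomial.smult a p) = scl a (ev w p)"
  by (induction p) (simp_all add: ev_pCons op_scl ev_mem scale_right_distrib)

lemma ev_diff: "w \<in> V \<Longrightarrow> ev w (p - q) = ev w p - ev w q"
  using ev_add[of w "p - q" q] by simp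

lemma Epow_comp: "w \<in> comp m \<Longrightarrow> (E ^^ i) w \<in> comp (m + i)"
  by (induction i) (auto intro: comp_closed)

lemma ev_monom: "w \<in> V \<Longrightarrow> ev w (monom a i) = scl a ((E ^^ i) w)"
proof (induction i)
  case 0
  then show ?case by (simp add: monom_0 ev_pCons)
next
  case (Suc i)
  have "(E ^^ i) w \<in> V" using Suc.prems by (induction i) (auto intro: op_mem)
  with Suc show ?case by (simp add: monom_Suc ev_pCons op_scl)
qed

text \<open>The vector obtained from \<open>w\<close> by \<open>E ^^ i\<close> has degree
  \<open>m + i\<close>, so a projection selects a single monomial.\<close>

lemma pr_ev:
  assumes w: "w \<in> comp m"
  shows "pr n (ev w p) = (if m \<le> n then scl (coeff p (n - m)) ((E ^^ (n - m)) w) else 0)"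
proof (induction p arbitrary: n)
  case (pCons a p)
  have wV: "w \<in> V" using w by (simp add: comp_def)
  have e: "pr n (ev w (pCons a p)) = scl a (pr n w) + pr n (E (ev w p))"
    using wV by (simp add: ev_pCons op_add op_scl V_scl op_mem ev_mem)
  show ?case
  proof (cases n)
    case 0
    then show ?thesis using e comp_pr[OF w, of 0] by (simp add: pr_0_E[OF ev_mem[OF wV]])
  next
    case (Suc k)
    have "(E ^^ i) w \<in> V" for i using Epow_comp[OF w] by (simp add: comp_def)
    then have "pr n (E (ev w p)) =
        (if m \<le> k then scl (coeff p (k - m)) ((E ^^ Suc (k - m)) w) else 0)"
      by (simp add: Suc pr_E[OF ev_mem[OF wV]] pCons.IH op_scl)
    then show ?thesis
      using e comp_pr[OF w, of n] Suc by (auto simp: coeff_pCons Suc_diff_le le_Suc_eq split: nat.splits)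
  qed
qed simp

section \<open>Adjoining one lowest weight vector\<close>

context
  fixes S m w
  assumes S: "good S" and w: "w \<in> comp m" and wS: "w \<notin> S" and lower: "\<And>k. k < m \<Longrightarrow> comp k \<subseteq> S"
begin

lemma wV: "w \<in> V" using w by (simp add: comp_def)

definition extend where "extend = {s + ev w p | s p. s \<in> S}"

lemma extend_mem: "s \<in> S \<Longrightarrow> s + ev w p \<in> extend" "s \<in> S \<Longrightarrow> s \<in> extend" "ev w p \<in> extend" "w \<in> extend"
proof -
  show a: "s \<in> S \<Longrightarrow> s + ev w p \<in> extend" for s p by (auto simp: extend_def)
  show "s \<in> S \<Longrightarrow> s \<in> extend" using a[of s 0] by simp
  show b: "ev w p \<in> extend" for p using a[of 0 p] goodD(2)[OF S] by simp
  show "w \<in> extend" using b[of "[:1:]"] by (simp add: ev_pCons)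
qed

text \<open>Torsion-freeness read backwards: a homogeneous vector outside \<open>S\<close> has its
  image under \<open>E\<close> outside \<open>S\<close>.\<close>

lemma Epow_notin: "(E ^^ i) w \<notin> S"
proof (induction i)
  case (Suc i)
  then show ?case using goodD(8)[OF S Epow_comp[OF w, of i]] by auto
qed (simp add: wS)

text \<open>Different powers of \<open>E\<close> have different degrees. Projecting to the degree of
  a nonzero coefficient would put a power of \<open>E\<close> applied to \<open>w\<close> into
  \<open>S\<close>.\<close>

lemma ev_indep: "ev w p \<in> S \<Longrightarrow> p = 0"
proof (rule ccontr)
  assume e: "ev w p \<in> S" and "p \<noteq> 0"
  then obtain i where i: "coeff p i \<noteq> 0" by (metis leading_coeff_neq_0)
  have "pr (m + i) (ev w p) \<in> S" by (rule goodD(5)[OF S e])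
  then have "scl (coeff p i) ((E ^^ i) w) \<in> S" by (simp add: pr_ev[OF w])
  from goodD(4)[OF S this, of "inverse (coeff p i)"] i have "(E ^^ i) w \<in> S" by simp
  then show False using Epow_notin by simp
qed

text \<open>\<open>F\<close> lowers the degree by one, and \<open>S\<close> contains all degrees
  below \<open>m\<close>. In degree 0 the image is zero.\<close>

lemma F_w: "F w \<in> S"
proof (cases m)
  case 0
  then show ?thesis using F_pr_0[OF wV] comp_pr[OF w, of 0] goodD(2)[OF S] by simp
next
  case (Suc k)
  have "pr k (F w) = F w" using pr_F[OF wV, of k] comp_pr[OF w, of m] Suc by simp
  then have "F w \<in> comp k" using op_mem(2)[OF wV] by (simp add: comp_def)
  then show ?thesis using lower[of k] Suc by auto
qed

lemma H_ev: "H (ev w p) = ev w (poly_h (2 * of_nat m - c) p)"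
proof (induction p)
  case (pCons a p)
  have "H (ev w (pCons a p)) = scl a (H w) + (E (H (ev w p)) + scl 2 (E (ev w p)))"
    using wV by (simp add: ev_pCons op_add op_scl HE ev_mem op_mem V_scl)
  also have "\<dots> = ev w (poly_h (2 * of_nat m - c) (pCons a p))"
    using wV by (simp add: pCons.IH poly_h_pCons ev_add ev_smult ev_pCons H_eq[OF w] mult.commute
        op_add op_scl ev_mem V_scl)
  finally show ?case .
qed (simp add: poly_h_def)

text \<open>The \<open>H\<close>-terms from commuting \<open>F\<close> past \<open>E\<close> are
  exact by \<open>H_ev\<close>. The only discrepancy consists of powers of \<open>E\<close> applied
  to \<open>F w\<close>, and these lie in \<open>S\<close>.\<close>

lemma F_ev: "F (ev w p) - ev w (poly_f (2 * of_nat m - c) p) \<in> S"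
proof (induction p)
  case (pCons a p)
  let ?f = "poly_f (2 * of_nat m - c)"
  have "F (ev w (pCons a p)) - ev w (?f (pCons a p)) = scl a (F w) + E (F (ev w p) - ev w (?f p))"
    using wV by (simp add: ev_pCons op_add op_scl FE ev_mem op_mem V_scl poly_f_pCons ev_diff H_ev op_diff)
  then show ?case using goodD[OF S] F_w pCons.IH by auto
qed (simp add: poly_f_def goodD(2)[OF S])

text \<open>The closure conditions are formulas for \<open>ev\<close>. The substance is the last
  condition: the quotient by the larger subspace is torsion-free again, so the construction can be
  repeated.\<close>

lemma good_extend: "good extend"
  unfolding good_def
proof (intro conjI ballI allI impI)
  note SD = goodD[OF S]
  show "extend \<subseteq> V" using SD(1) ev_mem[OF wV] V_add by (auto simp: extend_def)
  show "0 \<in> extend" by (rule extend_mem(2)[OF SD(2)])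
  have dec: "\<exists>s p. s \<in> S \<and> s \<in> V \<and> ev w p \<in> V \<and> x = s + ev w p" if "x \<in> extend" for x
    using that SD(1) ev_mem[OF wV] by (auto simp: extend_def)
  show "x + y \<in> extend" if xy: "x \<in> extend" "y \<in> extend" for x y
  proof -
    obtain s p t q where st: "s \<in> S" "t \<in> S" "x = s + ev w p" "y = t + ev w q"
      using dec[OF xy(1)] dec[OF xy(2)] by blast
    then have "x + y = (s + t) + ev w (p + q)" by (simp add: ev_add[OF wV] algebra_simps)
    then show ?thesis using extend_mem(1)[OF SD(3)[OF st(1,2)]] by simp
  qed
  show "scl a x \<in> extend" if x: "x \<in> extend" for a x
  proof -
    obtain s p where s: "s \<in> S" "x = s + ev w p" using dec[OF x] by blast
    then have "scl a x = scl a s + ev w (Polynomial.smult a p)"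
      by (simp add: ev_smult[OF wV] scale_right_distrib)
    then show ?thesis using extend_mem(1)[OF SD(4)[OF s(1)]] by simp
  qed
  show "pr n x \<in> extend" if x: "x \<in> extend" for n x
  proof -
    obtain s p where s: "s \<in> S" "s \<in> V" "ev w p \<in> V" "x = s + ev w p" using dec[OF x] by blast
    have "pr n (ev w p) = ev w (if m \<le> n then monom (coeff p (n - m)) (n - m) else 0)"
      by (simp add: pr_ev[OF w] ev_monom[OF wV])
    then have "pr n x = pr n s + ev w (if m \<le> n then monom (coeff p (n - m)) (n - m) else 0)"
      using s by (simp add: op_add)
    then show ?thesis using extend_mem(1)[OF SD(5)[OF s(1)]] by metis
  qed
  show "E x \<in> extend" if x: "x \<in> extend" for x
  proof -
    obtain s p where s: "s \<in> S" "s \<in> V" "ev w p \<in> V" "x = s + ev w p" using dec[OF x] by blast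
    then have "E x = E s + ev w (pCons 0 p)" by (simp add: op_add ev_pCons)
    then show ?thesis using extend_mem(1)[OF SD(6)[OF s(1)]] by metis
  qed
  show "F x \<in> extend" if x: "x \<in> extend" for x
  proof -
    obtain s p where s: "s \<in> S" "s \<in> V" "ev w p \<in> V" "x = s + ev w p" using dec[OF x] by blast
    let ?q = "poly_f (2 * of_nat m - c) p"
    have "F x = (F s + (F (ev w p) - ev w ?q)) + ev w ?q" using s by (simp add: op_add)
    then show ?thesis using extend_mem(1)[OF SD(3)[OF SD(7)[OF s(1)] F_ev]] by metis
  qed
  show "v \<in> extend" if v: "v \<in> comp n" and Ev: "E v \<in> extend" for n v
  proof (cases "n < m")
    case True
    then show ?thesis using lower v extend_mem(2) by blast
  next
    case False
    obtain s p where s: "s \<in> S" "s \<in> V" "ev w p \<in> V" "E v = s + ev w p" using dec[OF Ev] by blast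
    \<comment> \<open>Chosen so that \<open>E ?u\<close> is the part of degree \<open>Suc n\<close>
      of \<open>ev w p\<close>. Then \<open>E (v - ?u)\<close> is a projection of \<open>s\<close>,
      lies in \<open>S\<close>, and torsion-freeness modulo \<open>S\<close> applies to
      \<open>v - ?u\<close>.\<close>
    let ?u = "scl (coeff p (Suc n - m)) ((E ^^ (n - m)) w)"
    have uc: "?u \<in> comp n" using Epow_comp[OF w, of "n - m"] False by (auto intro: comp_closed)
    have "E v = pr (Suc n) (E v)" using comp_closed(3)[OF v] by (simp add: comp_def)
    also have "\<dots> = pr (Suc n) s + scl (coeff p (Suc n - m)) ((E ^^ (Suc n - m)) w)"
      using s False by (simp add: op_add pr_ev[OF w])
    also have "scl (coeff p (Suc n - m)) ((E ^^ (Suc n - m)) w) = E ?u"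
      using False Epow_comp[OF w, of "n - m"] by (simp add: Suc_diff_le op_scl comp_def)
    finally have "E (v - ?u) = pr (Suc n) s"
      using comp_closed(5)[OF v] comp_closed(5)[OF uc] by (simp add: op_diff)
    then have "v - ?u \<in> S" using SD(5)[OF s(1)] SD(8)[OF comp_closed(1)[OF v uc]] by simp
    moreover have "?u = ev w (monom (coeff p (Suc n - m)) (n - m))" by (simp add: ev_monom[OF wV])
    ultimately show ?thesis using extend_mem(1)[of "v - ?u"] by (metis diff_add_cancel)
  qed
qed

text \<open>The lowest weight is the eigenvalue of \<open>H\<close> on the adjoined vector
  \<open>w\<close> of degree \<open>m\<close>.\<close>

lemma extend_verma:
  "lie_rep_iso (sl 2) (quot_space (M\<lparr>carrier := extend\<rparr>) S) (quot_act (M\<lparr>carrier := extend\<rparr>) S \<rho>)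
     (verma_space (2 * of_nat m - c)) (verma_act (2 * of_nat m - c))"
proof (rule quotient_verma_iso[where ev = "ev w" and scl = scl])
  note SD = goodD[OF S]
  show "\<rho> A v \<in> S" if "A \<in> carrier (sl 2)" "v \<in> S" for A v
    using that SD good_H[OF S] by (simp add: \<rho> del: sl_simps)
  show "\<rho> A (s + ev w p) = \<rho> A s + \<rho> A (ev w p)" if "A \<in> carrier (sl 2)" "s \<in> S" for A s p
    using that SD(1)[OF that(2)] ev_mem[OF wV, of p]
    by (simp add: \<rho> V_add op_add scale_right_distrib algebra_simps del: sl_simps)
  show "\<rho> A (ev w p) - ev w (poly_act (2 * of_nat m - c) A p) \<in> S" if "A \<in> carrier (sl 2)" for A p
  proof -
    have "\<rho> A (ev w p) - ev w (poly_act (2 * of_nat m - c) A p) =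
        scl (A $$ (1, 0)) (F (ev w p) - ev w (poly_f (2 * of_nat m - c) p))"
      using that ev_mem[OF wV, of p] wV
      by (simp add: \<rho> poly_act_def ev_add ev_smult ev_pCons H_ev scale_right_diff_distrib op_scl del: sl_simps)
    then show ?thesis using SD(4)[OF F_ev] by simp
  qed
qed (use goodD[OF S] ev_indep in \<open>auto simp: M extend_def ev_add[OF wV] ev_smult[OF wV]
    intro: vector_space_axioms\<close>)

end

section \<open>Iteration of the extension step\<close>

definition step_deg where "step_deg S = (LEAST m. \<not> comp m \<subseteq> S)"

text \<open>The least missing generator in the least missing degree: with arbitrary choices an
  infinite chain could pass over some generator forever.\<close>

definition step_idx where "step_idx S = (LEAST i. i < d (step_deg S) \<and> g (step_deg S) i \<notin> S)"

definition step_gen where "step_gen S = g (step_deg S) (step_idx S)"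

definition step where "step S = extend S (step_gen S)"

lemma step_props:
  assumes S: "good S" "S \<noteq> V"
  shows "step_gen S \<in> comp (step_deg S)" "step_gen S \<notin> S" "\<And>k. k < step_deg S \<Longrightarrow> comp k \<subseteq> S"
    "step_idx S < d (step_deg S)" "\<And>i. i < step_idx S \<Longrightarrow> g (step_deg S) i \<in> S"
proof -
  have "\<exists>m. \<not> comp m \<subseteq> S" using V_subset[OF S(1)] S goodD(1) by blast
  then have d: "\<not> comp (step_deg S) \<subseteq> S" unfolding step_deg_def by (rule LeastI_ex)
  show "comp k \<subseteq> S" if "k < step_deg S" for k using not_less_Least[OF that[unfolded step_deg_def]] by blast
  have "\<exists>i. i < d (step_deg S) \<and> g (step_deg S) i \<notin> S" using comp_subset[OF S(1)] d by blast
  then have i: "step_idx S < d (step_deg S) \<and> g (step_deg S) (step_idx S) \<notin> S"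
    unfolding step_idx_def by (rule LeastI_ex)
  then show "step_gen S \<in> comp (step_deg S)" "step_gen S \<notin> S" "step_idx S < d (step_deg S)"
    using g by (auto simp: step_gen_def comp_def)
  show "g (step_deg S) k \<in> S" if "k < step_idx S" for k
    using not_less_Least[OF that[unfolded step_idx_def]] that i by auto
qed

definition filt where "filt n = (step ^^ n) {0}"

text \<open>Torsion-freeness modulo the zero subspace is the assumption
  \<open>E_inj\<close>.\<close>

lemma good_zero: "good {0}"
  using E_inj by (auto simp: good_def V_zero comp_def)

text \<open>Once nothing is missing, \<open>step_gen\<close> has no meaning; the chain is therefore
  cut at the first stage equal to \<open>V\<close>, and is infinite if no stage is.\<close>

definition filt_len :: enat where
  "filt_len = (if \<exists>n. filt n = V then enat (LEAST n. filt n = V) else \<infinity>)"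

lemma filt_proper: "enat n < filt_len \<Longrightarrow> filt n \<noteq> V"
  by (auto simp: filt_len_def dest: not_less_Least split: if_splits)

lemma good_filt: "enat n \<le> filt_len \<Longrightarrow> good (filt n)"
proof (induction n)
  case 0
  then show ?case by (simp add: filt_def good_zero)
next
  case (Suc n)
  then have n: "enat n < filt_len" by (meson Suc_ile_eq)
  then have S: "good (filt n)" "filt n \<noteq> V" using Suc.IH filt_proper by auto
  have "good (step (filt n))"
    unfolding step_def by (rule good_extend[OF S(1) step_props(1-3)[OF S]])
  then show ?case by (simp add: filt_def)
qed

lemma filt_Suc:
  assumes n: "enat n < filt_len"
  shows "filt n \<subseteq> filt (Suc n)" "step_gen (filt n) \<in> filt (Suc n)"
    "\<exists>l. lie_rep_iso (sl 2) (quot_space (M\<lparr>carrier := filt (Suc n)\<rparr>) (filt n))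
       (quot_act (M\<lparr>carrier := filt (Suc n)\<rparr>) (filt n) \<rho>) (verma_space l) (verma_act l)"
proof -
  have S: "good (filt n)" "filt n \<noteq> V" using n filt_proper good_filt by auto
  have e: "filt (Suc n) = extend (filt n) (step_gen (filt n))" by (simp add: filt_def step_def)
  show "filt n \<subseteq> filt (Suc n)" unfolding e using extend_mem(2)[OF S(1) step_props(1-3)[OF S]] by blast
  show "step_gen (filt n) \<in> filt (Suc n)" unfolding e by (rule extend_mem(4)[OF S(1) step_props(1-3)[OF S]])
  show "\<exists>l. lie_rep_iso (sl 2) (quot_space (M\<lparr>carrier := filt (Suc n)\<rparr>) (filt n))
       (quot_act (M\<lparr>carrier := filt (Suc n)\<rparr>) (filt n) \<rho>) (verma_space l) (verma_act l)"
    unfolding e by (rule exI, rule extend_verma[OF S(1) step_props(1-3)[OF S]])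
qed

text \<open>Outer induction on the degree, inner induction on the generators of that degree. If all
  earlier generators are present and \<open>g m i\<close> is missing, it is the least missing one,
  so the next step adjoins precisely it. As \<open>d m\<close> is finite, each degree is completed
  after finitely many steps.\<close>

lemma filt_exhausts:
  assumes inf: "filt_len = \<infinity>"
  shows "\<exists>n. \<forall>k<m. comp k \<subseteq> filt n"
proof (induction m)
  case (Suc m)
  have S: "good (filt n)" "filt n \<noteq> V" for n using inf good_filt filt_proper by auto
  have "filt n \<subseteq> filt (Suc n)" for n using filt_Suc(1)[of n] inf by simp
  then have mono: "filt i \<subseteq> filt j" if "i \<le> j" for i j using that by (rule lift_Suc_mono_le)
  obtain n where n: "\<forall>k<m. comp k \<subseteq> filt n" using Suc.IH by blast
  have "\<exists>n'\<ge>n. \<forall>j<i. g m j \<in> filt n'" if "i \<le> d m" for i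
    using that
  proof (induction i)
    case (Suc i)
    then obtain n' where n': "n' \<ge> n" "\<forall>j<i. g m j \<in> filt n'" by auto
    show ?case
    proof (cases "g m i \<in> filt n'")
      case True
      then show ?thesis using n' less_Suc_eq by auto
    next
      case False
      have "g m i \<in> comp m" using g Suc.prems by (simp add: comp_def)
      then have "\<not> comp m \<subseteq> filt n'" using False by blast
      moreover have "comp k \<subseteq> filt n'" if "k < m" for k using n that mono[OF n'(1)] by blast
      ultimately have dg: "step_deg (filt n') = m"
        unfolding step_deg_def by (intro Least_equality) (auto simp: not_less[symmetric])
      have "step_idx (filt n') = i"
        unfolding step_idx_def dg using False n'(2) Suc.prems
        by (intro Least_equality) (auto simp: not_less[symmetric])
      then have "g m i \<in> filt (Suc n')" using filt_Suc(2)[of n'] inf by (simp add: step_gen_def dg)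
      then show ?thesis using n' mono[of n' "Suc n'"] less_Suc_eq
        by (intro exI[of _ "Suc n'"]) auto
    qed
  qed auto
  then obtain n' where n': "n' \<ge> n" "\<forall>j<d m. g m j \<in> filt n'" by blast
  then have "comp m \<subseteq> filt n'" using comp_subset[OF S(1)] by blast
  moreover have "comp k \<subseteq> filt n'" if "k < m" for k using n that mono[OF n'(1)] by blast
  ultimately show ?case using less_Suc_eq by auto
qed simp

text \<open>An element has finitely many homogeneous parts, so for an infinite chain one stage
  contains them all. A finite chain ends at \<open>V\<close> by the choice of its length.\<close>

lemma Union_filt: "(\<Union>n\<in>{n. enat n \<le> filt_len}. filt n) = V"
proof
  show "(\<Union>n\<in>{n. enat n \<le> filt_len}. filt n) \<subseteq> V" using good_filt goodD(1) by blast
  show "V \<subseteq> (\<Union>n\<in>{n. enat n \<le> filt_len}. filt n)"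
  proof (cases "\<exists>n. filt n = V")
    case True
    then have "filt (LEAST n. filt n = V) = V" by (rule LeastI_ex)
    then show ?thesis using True by (auto simp: filt_len_def)
  next
    case False
    then have inf: "filt_len = \<infinity>" by (simp add: filt_len_def)
    show ?thesis
    proof
      fix v assume v: "v \<in> V"
      obtain m where m: "v = (\<Sum>i<m. pr i v)" using pr_sum[OF v] by auto
      obtain n where n: "\<forall>k<m. comp k \<subseteq> filt n" using filt_exhausts[OF inf] by blast
      have "(\<Sum>i<m. pr i v) \<in> filt n"
        using n comp_closed(4)[OF v] by (intro good_sum good_filt) (auto simp: inf)
      then show "v \<in> (\<Union>n\<in>{n. enat n \<le> filt_len}. filt n)" using m inf by auto
    qed
  qed
qed

lemma good_subrep: "good S \<Longrightarrow> lie_subrep (sl 2) M \<rho> S"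
  unfolding lie_subrep_def
proof (intro conjI ballI)
  assume S: "good S"
  show "VectorSpace.subspace class_ring S M"
    by (rule subspace_class_ringI[OF M(1)]) (use goodD[OF S] in \<open>auto simp: M\<close>)
  show "\<rho> x w \<in> S" if "x \<in> carrier (sl 2)" "w \<in> S" for x w
    using that goodD[OF S] good_H[OF S] by (simp add: \<rho> del: sl_simps)
qed

theorem verma_filtration:
  "\<exists>(N :: enat) F.
     F 0 = {\<zero>\<^bsub>M\<^esub>} \<and>
     (\<forall>n. enat n < N \<longrightarrow> F n \<subseteq> F (Suc n)) \<and>
     (\<forall>n. enat n \<le> N \<longrightarrow> lie_subrep (sl 2) M \<rho> (F n)) \<and>
     (\<Union>n\<in>{n. enat n \<le> N}. F n) = carrier M \<and>
     (\<forall>n. enat n < N \<longrightarrow>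
        (\<exists>l. lie_rep_iso (sl 2)
               (quot_space (M\<lparr>carrier := F (Suc n)\<rparr>) (F n))
               (quot_act (M\<lparr>carrier := F (Suc n)\<rparr>) (F n) \<rho>)
               (verma_space l) (verma_act l)))"
  using filt_Suc good_filt good_subrep Union_filt
  by (intro exI[of _ filt_len] exI[of _ filt] conjI) (auto simp: filt_def M)

end

section \<open>Oligomorphic groups and their open subgroups\<close>

text \<open>On \<open>S\<close> the map \<open>f\<close> factors through \<open>k\<close>.\<close>

lemma finite_image_factor:
  assumes "finite (k ` S)" "\<And>a b. a \<in> S \<Longrightarrow> b \<in> S \<Longrightarrow> k a = k b \<Longrightarrow> f a = f b"
  shows "finite (f ` S)"
proof -
  have "f ` S \<subseteq> (\<lambda>c. f (SOME a. a \<in> S \<and> k a = c)) ` (k ` S)"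
  proof
    fix y assume "y \<in> f ` S"
    then obtain a where a: "a \<in> S" "y = f a" by auto
    have "(SOME b. b \<in> S \<and> k b = k a) \<in> S \<and> k (SOME b. b \<in> S \<and> k b = k a) = k a"
      by (rule someI[of _ a]) (use a in simp)
    then have "f (SOME b. b \<in> S \<and> k b = k a) = y" using assms(2) a by metis
    then show "y \<in> (\<lambda>c. f (SOME a. a \<in> S \<and> k a = c)) ` (k ` S)" using a by force
  qed
  then show ?thesis using assms(1) finite_subset by blast
qed

locale oligomorphic_group =
  fixes X :: "'x set" and G :: "('x \<Rightarrow> 'x) set"
  assumes oligomorphic: "oligomorphic X G"
begin

abbreviation mul (infixl \<open>\<cdot>\<close> 70) where "g \<cdot> h \<equiv> g \<otimes>\<^bsub>BijGroup X\<^esub> h"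
abbreviation gid where "gid \<equiv> \<one>\<^bsub>BijGroup X\<^esub>"
abbreviation ginv where "ginv g \<equiv> inv\<^bsub>BijGroup X\<^esub> g"

lemma G_subgroup: "subgroup G (BijGroup X)"
  using oligomorphic by (simp add: oligomorphic_def)

sublocale B: Group.group "BijGroup X" by (rule group_BijGroup)

lemma carrier_Bij: "carrier (BijGroup X) = Bij X" by (simp add: BijGroup_def)

lemma G_Bij: "g \<in> G \<Longrightarrow> g \<in> Bij X"
  using subgroup.subset[OF G_subgroup] by (auto simp: carrier_Bij)

lemma G_closed: "g \<in> G \<Longrightarrow> h \<in> G \<Longrightarrow> g \<cdot> h \<in> G" "g \<in> G \<Longrightarrow> ginv g \<in> G" "gid \<in> G"
  using G_subgroup by (auto intro: subgroup.m_closed subgroup.m_inv_closed subgroup.one_closed)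

lemma G_mem: "g \<in> G \<Longrightarrow> x \<in> X \<Longrightarrow> g x \<in> X"
  using Bij_imp_funcset[OF G_Bij] by auto

lemma mul_apply: "g \<in> G \<Longrightarrow> h \<in> G \<Longrightarrow> x \<in> X \<Longrightarrow> (g \<cdot> h) x = g (h x)"
  by (rule Bij_mult_apply) (auto dest: G_Bij)

lemma gid_apply: "x \<in> X \<Longrightarrow> gid x = x" by (simp add: BijGroup_def)

lemma ginv_apply: "g \<in> G \<Longrightarrow> x \<in> X \<Longrightarrow> ginv g (g x) = x" "g \<in> G \<Longrightarrow> x \<in> X \<Longrightarrow> g (ginv g x) = x"
  using mul_apply[of "ginv g" g x] mul_apply[of g "ginv g" x] G_closed G_Bij
  by (auto simp: carrier_Bij gid_apply)

lemma G_inj: "g \<in> G \<Longrightarrow> inj_on g X" by (rule inj_on_inverseI[of _ "ginv g"]) (simp add: ginv_apply)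

lemma G_eq_iff: "g \<in> G \<Longrightarrow> x \<in> X \<Longrightarrow> y \<in> X \<Longrightarrow> g x = g y \<longleftrightarrow> x = y"
  using G_inj by (auto simp: inj_on_def)

lemma subgroup_closed:
  assumes "subgroup U (BijGroup X)"
  shows "u \<in> U \<Longrightarrow> v \<in> U \<Longrightarrow> u \<cdot> v \<in> U" "u \<in> U \<Longrightarrow> ginv u \<in> U" "gid \<in> U"
  using assms by (auto intro: subgroup.m_closed subgroup.m_inv_closed subgroup.one_closed)

abbreviation osub where "osub \<equiv> open_subgroup X G"

lemma osubD:
  assumes "osub U"
  shows "u \<in> U \<Longrightarrow> u \<in> G" "u \<in> U \<Longrightarrow> v \<in> U \<Longrightarrow> u \<cdot> v \<in> U" "u \<in> U \<Longrightarrow> ginv u \<in> U" "gid \<in> U"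
    "subgroup U (BijGroup X)"
  using assms by (auto simp: open_subgroup_def intro: subgroup_closed)

lemma osubI:
  assumes "U \<subseteq> G" "gid \<in> U" "\<And>u v. u \<in> U \<Longrightarrow> v \<in> U \<Longrightarrow> u \<cdot> v \<in> U" "\<And>u. u \<in> U \<Longrightarrow> ginv u \<in> U"
    and A: "finite A" "A \<subseteq> X" "\<And>g. g \<in> G \<Longrightarrow> \<forall>a\<in>A. g a = a \<Longrightarrow> g \<in> U"
  shows "osub U"
proof -
  have "subgroup U (BijGroup X)"
    by (rule subgroup.intro) (use assms G_Bij in \<open>auto simp: carrier_Bij\<close>)
  moreover have "{g \<in> G. \<forall>a\<in>A. g a = a} \<subseteq> U" using A(3) by auto
  ultimately show ?thesis using assms(1) A(1,2) unfolding open_subgroup_iff[OF G_subgroup] by blast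
qed

lemma osub_support: "osub U \<Longrightarrow> \<exists>A. finite A \<and> A \<subseteq> X \<and> (\<forall>g\<in>G. (\<forall>a\<in>A. g a = a) \<longrightarrow> g \<in> U)"
  unfolding open_subgroup_iff[OF G_subgroup] by blast

lemma osub_G: "osub G"
  by (rule osubI[of _ "{}"]) (auto simp: G_closed)

lemma osub_Int: "osub U \<Longrightarrow> osub V \<Longrightarrow> osub (U \<inter> V)"
proof -
  assume UV: "osub U" "osub V"
  obtain A where A: "finite A" "A \<subseteq> X" "\<forall>g\<in>G. (\<forall>a\<in>A. g a = a) \<longrightarrow> g \<in> U"
    using osub_support[OF UV(1)] by blast
  obtain B where B: "finite B" "B \<subseteq> X" "\<forall>g\<in>G. (\<forall>a\<in>B. g a = a) \<longrightarrow> g \<in> V"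
    using osub_support[OF UV(2)] by blast
  show ?thesis
  proof (rule osubI[of _ "A \<union> B"])
    show "U \<inter> V \<subseteq> G" using osubD(1)[OF UV(1)] by blast
    show "gid \<in> U \<inter> V" by (simp add: osubD(4) UV)
    show "u \<cdot> v \<in> U \<inter> V" if "u \<in> U \<inter> V" "v \<in> U \<inter> V" for u v
      using that by (simp add: osubD(2) UV)
    show "ginv u \<in> U \<inter> V" if "u \<in> U \<inter> V" for u using that by (simp add: osubD(3) UV)
  qed (use A B in auto)
qed

lemma osub_Inter:
  "finite I \<Longrightarrow> (\<And>i. i \<in> I \<Longrightarrow> osub (U i)) \<Longrightarrow> osub (G \<inter> (\<Inter>i\<in>I. U i))"
proof (induction I rule: finite_induct)
  case (insert i I)
  then have "osub (U i \<inter> (G \<inter> (\<Inter>i\<in>I. U i)))" by (intro osub_Int[of "U i"]) simp_all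
  then show ?case by (simp add: Int_left_commute)
qed (simp add: osub_G)

text \<open>A finite set that determines whether \<open>q\<close> is fixed, together with a finite
  support of \<open>U\<close>, supports the stabilizer. The action \<alpha> is general so that
  subsets of \<open>X\<close> and sets of pairs are treated alike.\<close>

lemma osub_stab:
  assumes U: "osub U" and q: "q \<in> Q"
    and cl: "\<And>u q. u \<in> U \<Longrightarrow> q \<in> Q \<Longrightarrow> \<alpha> u q \<in> Q"
    and mult: "\<And>u v q. u \<in> U \<Longrightarrow> v \<in> U \<Longrightarrow> q \<in> Q \<Longrightarrow> \<alpha> (u \<cdot> v) q = \<alpha> u (\<alpha> v q)"
    and one: "\<And>q. q \<in> Q \<Longrightarrow> \<alpha> gid q = q"
    and A: "finite A" "A \<subseteq> X" "\<And>u. u \<in> U \<Longrightarrow> \<forall>a\<in>A. u a = a \<Longrightarrow> \<alpha> u q = q"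
  shows "osub {u \<in> U. \<alpha> u q = q}"
proof -
  note UD = osubD[OF U]
  obtain B where B: "finite B" "B \<subseteq> X" "\<forall>g\<in>G. (\<forall>a\<in>B. g a = a) \<longrightarrow> g \<in> U"
    using osub_support[OF U] by blast
  show ?thesis
  proof (rule osubI[of _ "A \<union> B"])
    show "ginv u \<in> {u \<in> U. \<alpha> u q = q}" if "u \<in> {u \<in> U. \<alpha> u q = q}" for u
    proof -
      have u: "u \<in> U" "\<alpha> u q = q" "u \<in> carrier (BijGroup X)"
        using that UD(1) G_Bij by (auto simp: carrier_Bij)
      have "\<alpha> (ginv u) q = \<alpha> (ginv u \<cdot> u) q" using mult[OF UD(3)[OF u(1)] u(1) q] u(2) by simp
      then show ?thesis using UD(3)[OF u(1)] u(3) one[OF q] by simp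
    qed
    show "{u \<in> U. \<alpha> u q = q} \<subseteq> G" using UD(1) by blast
    show "gid \<in> {u \<in> U. \<alpha> u q = q}" using UD(4) one[OF q] by simp
    show "u \<cdot> v \<in> {u \<in> U. \<alpha> u q = q}" if "u \<in> {u \<in> U. \<alpha> u q = q}" "v \<in> {u \<in> U. \<alpha> u q = q}" for u v
      using that UD(2) mult[OF _ _ q] by simp
  qed (use A B in auto)
qed

lemma osub_point_stab: "osub U \<Longrightarrow> x \<in> X \<Longrightarrow> osub {u \<in> U. u x = x}"
  by (rule osub_stab[where Q = X and A = "{x}"])
    (auto simp: osubD(1) G_mem mul_apply gid_apply)

text \<open>The full stabilizer contains the open subgroup supplied by \<open>ghat_subset\<close>,
  hence is open. It is the acting group in \<open>sub_ghat\<close>.\<close>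

lemma osub_setwise_stab:
  assumes A: "ghat_subset X G A"
  shows "osub {g \<in> G. g ` A = A}"
proof -
  obtain U where U: "osub U" "\<forall>u\<in>U. u ` A = A" and AX: "A \<subseteq> X" using A by (auto simp: ghat_subset_def)
  obtain B where B: "finite B" "B \<subseteq> X" "\<forall>g\<in>G. (\<forall>a\<in>B. g a = a) \<longrightarrow> g \<in> U"
    using osub_support[OF U(1)] by blast
  have m: "(g \<cdot> h) ` A = g ` (h ` A)" if "g \<in> G" "h \<in> G" for g h
    using that AX by (force simp: mul_apply)
  show ?thesis
  proof (rule osubI[of _ B])
    show "ginv u \<in> {g \<in> G. g ` A = A}" if "u \<in> {g \<in> G. g ` A = A}" for u
    proof -
      have u: "u \<in> G" "u ` A = A" using that by auto
      have "ginv u ` u ` A = A" using ginv_apply(1)[OF u(1)] AX by (force simp: image_image)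
      then show ?thesis using u G_closed by simp
    qed
    show "gid \<in> {g \<in> G. g ` A = A}" using G_closed(3) AX by (force simp: gid_apply)
  qed (use B U G_closed in \<open>auto simp: m\<close>)
qed

text \<open>Inclusion of the image in \<open>A\<close> suffices for equality, since it may be
  applied to the inverse.\<close>

lemma ghat_subsetI:
  assumes "osub U" "A \<subseteq> X" "\<And>u a. u \<in> U \<Longrightarrow> a \<in> A \<Longrightarrow> u a \<in> A"
  shows "ghat_subset X G A"
proof -
  have "u ` A = A" if u: "u \<in> U" for u
  proof
    show "u ` A \<subseteq> A" using assms(3) u by auto
    show "A \<subseteq> u ` A"
    proof
      fix a assume a: "a \<in> A"
      have "u (ginv u a) = a" using ginv_apply(2) osubD(1)[OF assms(1) u] a assms(2) by auto
      moreover have "ginv u a \<in> A" using assms(3) osubD(3)[OF assms(1) u] a by auto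
      ultimately show "a \<in> u ` A" by force
    qed
  qed
  then show ?thesis using assms by (auto simp: ghat_subset_def)
qed

section \<open>Orbits of open subgroups\<close>

definition orb where "orb U x = (\<lambda>u. u x) ` U"

lemma orb_refl: "osub U \<Longrightarrow> x \<in> X \<Longrightarrow> x \<in> orb U x"
  unfolding orb_def by (rule image_eqI[of _ _ gid]) (simp_all add: gid_apply osubD(4))

lemma orb_subset: "osub U \<Longrightarrow> x \<in> X \<Longrightarrow> orb U x \<subseteq> X"
  by (auto simp: orb_def intro: G_mem osubD(1))

lemma orb_closed:
  assumes U: "osub U" and x: "x \<in> X" and y: "y \<in> orb U x" and u: "u \<in> U"
  shows "u y \<in> orb U x"
proof -
  obtain v where v: "v \<in> U" "y = v x" using y by (auto simp: orb_def)
  then have "u y = (u \<cdot> v) x" using mul_apply osubD(1)[OF U] u x by simp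
  then show ?thesis using osubD(2)[OF U u v(1)] by (auto simp: orb_def)
qed

lemma orb_eq:
  assumes U: "osub U" and x: "x \<in> X" and y: "y \<in> orb U x"
  shows "orb U y = orb U x"
proof
  have yX: "y \<in> X" using orb_subset[OF U x] y by auto
  obtain u where u: "u \<in> U" "y = u x" using y by (auto simp: orb_def)
  then have "x = ginv u y" using ginv_apply(1) osubD(1)[OF U] x by auto
  then have "x \<in> orb U y" using osubD(3)[OF U u(1)] by (auto simp: orb_def)
  then show "orb U x \<subseteq> orb U y" using orb_closed[OF U yX] by (auto simp: orb_def[of U x])
  show "orb U y \<subseteq> orb U x" using orb_closed[OF U x y] by (auto simp: orb_def[of U y])
qed

lemma orb_ghat: "osub U \<Longrightarrow> x \<in> X \<Longrightarrow> ghat_subset X G (orb U x)"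
  by (rule ghat_subsetI) (auto simp: orb_subset orb_closed)

text \<open>Oligomorphy concerns \<open>G\<close> itself. For an open \<open>U\<close>, prefix each
  tuple with a list \<open>as\<close> of points supporting \<open>U\<close>: a group element
  carrying one prefixed tuple to another fixes \<open>as\<close>, so it lies in \<open>U\<close>.
  Thus \<open>U\<close>-orbits are counted by \<open>G\<close>-orbits of longer tuples.\<close>

lemma finite_tuple_orbits:
  assumes U: "osub U"
  shows "finite ((\<lambda>xs. (\<lambda>u. map u xs) ` U) ` {xs. length xs = n \<and> set xs \<subseteq> X})"
proof -
  obtain A where A: "finite A" "A \<subseteq> X" "\<forall>g\<in>G. (\<forall>a\<in>A. g a = a) \<longrightarrow> g \<in> U"
    using osub_support[OF U] by blast
  obtain as where as: "set as = A" using A(1) finite_list by blast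
  let ?S = "\<lambda>n. {xs. length xs = n \<and> set xs \<subseteq> X}"
  have "finite ((\<lambda>xs. (\<lambda>u. map u xs) ` G) ` ?S (length as + n))"
  proof -
    have "orbits (perm_group X G) (?S (length as + n)) map = (\<lambda>xs. (\<lambda>u. map u xs) ` G) ` ?S (length as + n)"
      by (auto simp: orbits_def orbit_def)
    moreover have "finite (orbits (perm_group X G) (?S (length as + n)) map)"
      by (rule conjunct2[OF oligomorphic[unfolded oligomorphic_def], rule_format])
    ultimately show ?thesis by (rule subst)
  qed
  moreover have "(\<lambda>xs. (\<lambda>u. map u (as @ xs)) ` G) ` ?S n \<subseteq> (\<lambda>xs. (\<lambda>u. map u xs) ` G) ` ?S (length as + n)"
  proof (rule image_subsetI)
    fix xs assume "xs \<in> ?S n"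
    then show "(\<lambda>u. map u (as @ xs)) ` G \<in> (\<lambda>xs. (\<lambda>u. map u xs) ` G) ` ?S (length as + n)"
      using as A(2) by (intro image_eqI[of _ _ "as @ xs"]) auto
  qed
  ultimately have f: "finite ((\<lambda>xs. (\<lambda>u. map u (as @ xs)) ` G) ` ?S n)" by (rule rev_finite_subset)
  show ?thesis
  proof (rule finite_image_factor[OF f])
    fix xs ys assume xs: "xs \<in> ?S n" and ys: "ys \<in> ?S n"
      and e: "(\<lambda>u. map u (as @ xs)) ` G = (\<lambda>u. map u (as @ ys)) ` G"
    have "as @ ys \<in> (\<lambda>u. map u (as @ ys)) ` G"
      using G_closed(3) ys as A(2) by (intro image_eqI[of _ _ gid]) (auto intro!: map_idI[symmetric] simp: gid_apply)
    then obtain g where g: "g \<in> G" "as @ ys = map g (as @ xs)" unfolding e[symmetric] by auto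
    then have "as = map g as" "ys = map g xs" using xs ys by auto
    then have "\<forall>a\<in>A. g a = a" using as by (metis map_eq_conv map_ident)
    then have gU: "g \<in> U" using A g by auto
    have *: "(\<lambda>u. map u (map h zs)) ` U \<subseteq> (\<lambda>u. map u zs) ` U" if "h \<in> U" "set zs \<subseteq> X" for h zs
    proof
      fix w assume "w \<in> (\<lambda>u. map u (map h zs)) ` U"
      then obtain u where u: "u \<in> U" "w = map u (map h zs)" by auto
      then have "w = map (u \<cdot> h) zs" using that osubD(1)[OF U] by (auto simp: mul_apply)
      then show "w \<in> (\<lambda>u. map u zs) ` U" using osubD(2)[OF U u(1) that(1)] by auto
    qed
    have "xs = map (ginv g) ys" using \<open>ys = map g xs\<close> xs ginv_apply(1)[OF g(1)]
      by (auto intro!: map_idI[symmetric])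
    then have "(\<lambda>u. map u xs) ` U \<subseteq> (\<lambda>u. map u ys) ` U"
      using *[OF osubD(3)[OF U gU], of ys] ys by simp
    moreover have "(\<lambda>u. map u ys) ` U \<subseteq> (\<lambda>u. map u xs) ` U"
      using *[OF gU, of xs] xs \<open>ys = map g xs\<close> by simp
    ultimately show "(\<lambda>u. map u xs) ` U = (\<lambda>u. map u ys) ` U" by blast
  qed
qed

lemma finite_orbs: "osub U \<Longrightarrow> finite (orb U ` X)"
proof -
  assume U: "osub U"
  have "orb U ` X \<subseteq> (\<lambda>Q. hd ` Q) ` ((\<lambda>xs. (\<lambda>u. map u xs) ` U) ` {xs. length xs = 1 \<and> set xs \<subseteq> X})"
  proof
    fix Q assume "Q \<in> orb U ` X"
    then obtain x where x: "x \<in> X" "Q = orb U x" by auto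
    then have "Q = hd ` ((\<lambda>u. map u [x]) ` U)" by (simp add: orb_def image_image)
    with x show "Q \<in> (\<lambda>Q. hd ` Q) ` ((\<lambda>xs. (\<lambda>u. map u xs) ` U) ` {xs. length xs = 1 \<and> set xs \<subseteq> X})"
      by (intro image_eqI[OF _ imageI[of "[x]"]]) auto
  qed
  then show ?thesis by (rule finite_subset[OF _ finite_imageI[OF finite_tuple_orbits[OF U]]])
qed

definition orb2 where "orb2 U q = (\<lambda>u. (u (fst q), u (snd q))) ` U"

lemma finite_orb2s: "osub U \<Longrightarrow> finite (orb2 U ` (X \<times> X))"
proof -
  assume U: "osub U"
  have "orb2 U ` (X \<times> X) \<subseteq> (\<lambda>Q. (\<lambda>xs. (xs ! 0, xs ! 1)) ` Q) `
      ((\<lambda>xs. (\<lambda>u. map u xs) ` U) ` {xs. length xs = 2 \<and> set xs \<subseteq> X})"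
  proof
    fix Q assume "Q \<in> orb2 U ` (X \<times> X)"
    then obtain x y where x: "x \<in> X" "y \<in> X" "Q = orb2 U (x, y)" by auto
    then have "Q = (\<lambda>xs. (xs ! 0, xs ! 1)) ` ((\<lambda>u. map u [x, y]) ` U)"
      by (simp add: orb2_def image_image)
    with x show "Q \<in> (\<lambda>Q. (\<lambda>xs. (xs ! 0, xs ! 1)) ` Q) `
      ((\<lambda>xs. (\<lambda>u. map u xs) ` U) ` {xs. length xs = 2 \<and> set xs \<subseteq> X})"
      by (intro image_eqI[OF _ imageI[of "[x, y]"]]) auto
  qed
  then show ?thesis by (rule finite_subset[OF _ finite_imageI[OF finite_tuple_orbits[OF U]]])
qed

section \<open>Encoded G-hat-sets\<close>

text \<open>Measures are defined only on sets of points of one fixed type. An action \<alpha> on a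
  set \<open>Q\<close> of any type is brought there by an injection \<open>enc\<close>; the action
  is undefined outside the points, as \<open>BijGroup\<close> requires.\<close>

definition enc_ghat ::
  "('x \<Rightarrow> 'x) set \<Rightarrow> 'q set \<Rightarrow> ('q \<Rightarrow> 'z) \<Rightarrow> (('x \<Rightarrow> 'x) \<Rightarrow> 'q \<Rightarrow> 'q) \<Rightarrow> ('x, 'z) ghat_set" where
  "enc_ghat U Q enc \<alpha> = \<lparr>acting = U, pts = enc ` Q,
     act = (\<lambda>u. restrict (\<lambda>p. enc (\<alpha> u (inv_into Q enc p))) (enc ` Q))\<rparr>"

text \<open>The last clause is smoothness in terms of \<open>Q\<close>: each point has a finite
  support.\<close>

definition enc_ok where
  "enc_ok U Q enc \<alpha> \<longleftrightarrow> osub U \<and> inj_on enc Q \<and> (\<forall>u\<in>U. \<forall>q\<in>Q. \<alpha> u q \<in> Q) \<and>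
     (\<forall>u\<in>U. \<forall>v\<in>U. \<forall>q\<in>Q. \<alpha> (u \<cdot> v) q = \<alpha> u (\<alpha> v q)) \<and> (\<forall>q\<in>Q. \<alpha> gid q = q) \<and>
     (\<forall>q\<in>Q. \<exists>A. finite A \<and> A \<subseteq> X \<and> (\<forall>u\<in>U. (\<forall>a\<in>A. u a = a) \<longrightarrow> \<alpha> u q = q))"

lemma enc_ghat_simps [simp]:
  "acting (enc_ghat U Q enc \<alpha>) = U" "pts (enc_ghat U Q enc \<alpha>) = enc ` Q"
  by (simp_all add: enc_ghat_def)

lemma enc_ghat_act:
  "inj_on enc Q \<Longrightarrow> q \<in> Q \<Longrightarrow> act (enc_ghat U Q enc \<alpha>) u (enc q) = enc (\<alpha> u q)"
  by (simp add: enc_ghat_def)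

lemma enc_okD:
  assumes "enc_ok U Q enc \<alpha>"
  shows "osub U" "inj_on enc Q" "u \<in> U \<Longrightarrow> q \<in> Q \<Longrightarrow> \<alpha> u q \<in> Q"
    "u \<in> U \<Longrightarrow> v \<in> U \<Longrightarrow> q \<in> Q \<Longrightarrow> \<alpha> (u \<cdot> v) q = \<alpha> u (\<alpha> v q)" "q \<in> Q \<Longrightarrow> \<alpha> gid q = q"
    "q \<in> Q \<Longrightarrow> \<exists>A. finite A \<and> A \<subseteq> X \<and> (\<forall>u\<in>U. (\<forall>a\<in>A. u a = a) \<longrightarrow> \<alpha> u q = q)"
  using assms by (auto simp: enc_ok_def)

lemma group_perm_group: "osub U \<Longrightarrow> Group.group (perm_group X U)"
  by (rule B.subgroup_imp_group) (rule osubD(5))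

lemma enc_action:
  assumes ok: "enc_ok U Q enc \<alpha>"
  shows "group_action (perm_group X U) (enc ` Q) (act (enc_ghat U Q enc \<alpha>))"
proof -
  note D = enc_okD[OF ok]
  note UD = osubD[OF D(1)]
  let ?a = "act (enc_ghat U Q enc \<alpha>)"
  have inv: "\<alpha> (ginv u) (\<alpha> u q) = q" "\<alpha> u (\<alpha> (ginv u) q) = q" if u: "u \<in> U" and q: "q \<in> Q" for u q
  proof -
    have "u \<in> carrier (BijGroup X)" using UD(1)[OF u] G_Bij by (simp add: carrier_Bij)
    then show "\<alpha> (ginv u) (\<alpha> u q) = q" "\<alpha> u (\<alpha> (ginv u) q) = q"
      using D(4)[OF UD(3)[OF u] u q] D(4)[OF u UD(3)[OF u] q] D(5)[OF q] by auto
  qed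
  have bij: "?a u \<in> Bij (enc ` Q)" if u: "u \<in> U" for u
  proof -
    have "bij_betw (?a u) (enc ` Q) (enc ` Q)"
      by (rule bij_betw_byWitness[of _ "?a (ginv u)"])
        (use u UD(3)[OF u] D(3) in \<open>auto simp: enc_ghat_act[OF D(2)] inv\<close>)
    then show ?thesis by (simp add: Bij_def enc_ghat_def)
  qed
  show ?thesis
  proof (rule group_action.intro, rule group_hom.intro[OF group_perm_group[OF D(1)] group_BijGroup],
      rule group_hom_axioms.intro, rule homI)
    fix u assume "u \<in> carrier (perm_group X U)"
    then show "?a u \<in> carrier (BijGroup (enc ` Q))" using bij by (simp add: BijGroup_def)
  next
    fix u v assume uv: "u \<in> carrier (perm_group X U)" "v \<in> carrier (perm_group X U)"
    have "?a (u \<cdot> v) p = compose (enc ` Q) (?a u) (?a v) p" for p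
    proof (cases "p \<in> enc ` Q")
      case True
      then show ?thesis using uv D(3,4) by (auto simp: compose_eq enc_ghat_act[OF D(2)])
    next
      case False
      then show ?thesis by (simp add: enc_ghat_def compose_def)
    qed
    then show "?a (u \<otimes>\<^bsub>perm_group X U\<^esub> v) = ?a u \<otimes>\<^bsub>BijGroup (enc ` Q)\<^esub> ?a v"
      using uv bij by (auto simp: BijGroup_def)
  qed
qed

lemma enc_smooth:
  assumes ok: "enc_ok U Q enc \<alpha>"
  shows "smooth_set X G (enc_ghat U Q enc \<alpha>)"
proof -
  note D = enc_okD[OF ok]
  have "osub (stabilizer (perm_group X U) (act (enc_ghat U Q enc \<alpha>)) (enc q))" if q: "q \<in> Q" for q
  proof -
    obtain A where A: "finite A" "A \<subseteq> X" "\<forall>u\<in>U. (\<forall>a\<in>A. u a = a) \<longrightarrow> \<alpha> u q = q"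
      using D(6)[OF q] by blast
    have "stabilizer (perm_group X U) (act (enc_ghat U Q enc \<alpha>)) (enc q) = {u \<in> U. \<alpha> u q = q}"
      using D(2,3) q by (auto simp: stabilizer_def enc_ghat_act[OF D(2)] inj_on_eq_iff)
    moreover have "osub {u \<in> U. \<alpha> u q = q}"
      by (rule osub_stab[OF D(1) q, where A = A]) (use D A in auto)
    ultimately show ?thesis by simp
  qed
  then show ?thesis using D(1) enc_action[OF ok] by (auto simp: smooth_set_def)
qed

lemma enc_is_ghat:
  assumes ok: "enc_ok U Q enc \<alpha>" and fin: "finite ((\<lambda>q. (\<lambda>u. \<alpha> u q) ` U) ` Q)"
  shows "is_ghat_set X G (enc_ghat U Q enc \<alpha>)"
proof -
  note D = enc_okD[OF ok]
  have "orbit (perm_group X U) (act (enc_ghat U Q enc \<alpha>)) (enc q) = enc ` ((\<lambda>u. \<alpha> u q) ` U)"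
    if "q \<in> Q" for q
    using that by (auto simp: orbit_def enc_ghat_act[OF D(2)])
  then have "orbits (perm_group X U) (enc ` Q) (act (enc_ghat U Q enc \<alpha>)) \<subseteq>
      (`) enc ` ((\<lambda>q. (\<lambda>u. \<alpha> u q) ` U) ` Q)"
    unfolding orbits_def by auto
  then have "finite (orbits (perm_group X U) (enc ` Q) (act (enc_ghat U Q enc \<alpha>)))"
    by (rule finite_subset[OF _ finite_imageI[OF fin]])
  then show ?thesis using enc_smooth[OF ok] by (simp add: is_ghat_set_def)
qed

lemma enc_transitive:
  assumes ok: "enc_ok U Q enc \<alpha>" and q0: "q0 \<in> Q" and Q: "Q = (\<lambda>u. \<alpha> u q0) ` U"
  shows "transitive_set X (enc_ghat U Q enc \<alpha>)" "finite ((\<lambda>q. (\<lambda>u. \<alpha> u q) ` U) ` Q)"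
proof -
  note D = enc_okD[OF ok]
  note UD = osubD[OF D(1)]
  have tr: "\<exists>u\<in>U. \<alpha> u q = q'" if q: "q \<in> Q" "q' \<in> Q" for q q'
  proof -
    obtain u v where uv: "u \<in> U" "v \<in> U" "q = \<alpha> u q0" "q' = \<alpha> v q0" using q Q by auto
    have "u \<in> carrier (BijGroup X)" using UD(1)[OF uv(1)] G_Bij by (simp add: carrier_Bij)
    then have "\<alpha> (ginv u) q = q0"
      using uv D(4)[OF UD(3)[OF uv(1)] uv(1) q0] D(5)[OF q0] by simp
    then have "\<alpha> (v \<cdot> ginv u) q = q'"
      using uv D(4)[OF uv(2) UD(3)[OF uv(1)] q(1)] by simp
    then show ?thesis using UD(2)[OF uv(2) UD(3)[OF uv(1)]] by blast
  qed
  have "transitive_action (perm_group X U) (enc ` Q) (act (enc_ghat U Q enc \<alpha>))"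
    by (rule transitive_action.intro[OF enc_action[OF ok]], rule transitive_action_axioms.intro)
      (use tr in \<open>auto simp: enc_ghat_act[OF D(2)], metis\<close>)
  then show "transitive_set X (enc_ghat U Q enc \<alpha>)" using q0 by (auto simp: transitive_set_def)
  have "(\<lambda>u. \<alpha> u q) ` U = Q" if q: "q \<in> Q" for q
  proof
    show "(\<lambda>u. \<alpha> u q) ` U \<subseteq> Q" using D(3) q by blast
    show "Q \<subseteq> (\<lambda>u. \<alpha> u q) ` U"
    proof
      fix q' assume "q' \<in> Q"
      from tr[OF q this] show "q' \<in> (\<lambda>u. \<alpha> u q) ` U" by blast
    qed
  qed
  then have "(\<lambda>q. (\<lambda>u. \<alpha> u q) ` U) ` Q \<subseteq> {Q}" by blast
  then show "finite ((\<lambda>q. (\<lambda>u. \<alpha> u q) ` U) ` Q)" by (rule finite_subset) simp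
qed

lemma enc_iso:
  assumes ok: "enc_ok U Q enc \<alpha>" "enc_ok U' Q' enc' \<alpha>'"
    and V: "osub V" "V \<subseteq> U" "V \<subseteq> U'"
    and h: "bij_betw h Q Q'" "\<And>u q. u \<in> V \<Longrightarrow> q \<in> Q \<Longrightarrow> h (\<alpha> u q) = \<alpha>' u (h q)"
  shows "ghat_iso X G (enc_ghat U Q enc \<alpha>) (enc_ghat U' Q' enc' \<alpha>')"
proof -
  note D = enc_okD[OF ok(1)] and D' = enc_okD[OF ok(2)]
  define f where "f = enc' \<circ> h \<circ> inv_into Q enc"
  have f: "f (enc q) = enc' (h q)" if "q \<in> Q" for q using that D(2) by (simp add: f_def)
  have "bij_betw f (enc ` Q) (enc' ` Q')"
    unfolding f_def using D(2) D'(2) h(1)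
    by (intro bij_betw_trans[of _ _ Q] bij_betw_inv_into bij_betw_trans[of h Q Q'])
      (auto simp: bij_betw_def)
  moreover have "h q \<in> Q'" if "q \<in> Q" for q using h(1) that by (auto simp: bij_betw_def)
  ultimately show ?thesis
    unfolding ghat_iso_def using V h(2) D(3)
    by (intro exI[of _ f] exI[of _ V])
      (auto simp: f enc_ghat_act[OF D(2)] enc_ghat_act[OF D'(2)] subset_iff)
qed

end

section \<open>Measures as finitely additive measures on \<open>X\<close>\<close>

context oligomorphic_group begin

lemma enc_ok_sub:
  assumes "osub U" "A \<subseteq> X" "\<And>u a. u \<in> U \<Longrightarrow> a \<in> A \<Longrightarrow> u a \<in> A"
  shows "enc_ok U A Inl (\<lambda>u x. u x)"
  unfolding enc_ok_def
proof (intro conjI ballI)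
  show "inj_on Inl A" by simp
  show "(u \<cdot> v) q = u (v q)" if "u \<in> U" "v \<in> U" "q \<in> A" for u v q
    using that osubD(1)[OF assms(1)] assms(2) by (auto intro: mul_apply)
  show "\<exists>B. finite B \<and> B \<subseteq> X \<and> (\<forall>u\<in>U. (\<forall>a\<in>B. u a = a) \<longrightarrow> u q = q)" if "q \<in> A" for q
    using that assms(2) by (intro exI[of _ "{q}"]) auto
qed (use assms in \<open>auto simp: gid_apply subset_iff\<close>)

lemma finite_sub_orbits: "osub U \<Longrightarrow> A \<subseteq> X \<Longrightarrow> finite ((\<lambda>q. (\<lambda>u. u q) ` U) ` A)"
  by (rule finite_subset[OF _ finite_orbs[of U]]) (auto simp: orb_def)

lemma sub_ghat_eq: "sub_ghat G A = enc_ghat {g \<in> G. g ` A = A} A Inl (\<lambda>u x. u x)"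
  by (simp add: sub_ghat_def enc_ghat_def, rule ext, rule restrict_ext) (auto simp: inv_into_f_f)

lemma enc_ok_sub_ghat: "ghat_subset X G A \<Longrightarrow> enc_ok {g \<in> G. g ` A = A} A Inl (\<lambda>u x. u x)"
  by (rule enc_ok_sub[OF osub_setwise_stab]) (auto simp: ghat_subset_def)

lemma is_ghat_sub: "ghat_subset X G A \<Longrightarrow> is_ghat_set X G (sub_ghat G A)"
  unfolding sub_ghat_eq
  by (rule enc_is_ghat[OF enc_ok_sub_ghat finite_sub_orbits[OF osub_setwise_stab]])
    (auto simp: ghat_subset_def)

lemma ghat_subset_X: "ghat_subset X G A \<Longrightarrow> A \<subseteq> X" by (simp add: ghat_subset_def)

lemma ghat_subset_osub: "ghat_subset X G A \<Longrightarrow> \<exists>U. osub U \<and> (\<forall>u\<in>U. \<forall>a\<in>A. u a \<in> A)"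
  unfolding ghat_subset_def by blast

lemma ghat_subset_finite: "finite A \<Longrightarrow> A \<subseteq> X \<Longrightarrow> ghat_subset X G A"
proof -
  assume A: "finite A" "A \<subseteq> X"
  have "osub {g \<in> G. \<forall>a\<in>A. g a = a}"
  proof (rule osubI[of _ A])
    show "ginv u \<in> {g \<in> G. \<forall>a\<in>A. g a = a}" if "u \<in> {g \<in> G. \<forall>a\<in>A. g a = a}" for u
    proof -
      have "ginv u a = a" if a: "a \<in> A" for a
        using ginv_apply(1)[of u a] \<open>u \<in> _\<close> a A by auto
      then show ?thesis using that G_closed by auto
    qed
  qed (use A G_closed in \<open>auto simp: gid_apply mul_apply subset_iff\<close>)
  then show ?thesis by (rule ghat_subsetI) (use A in auto)
qed

lemma ghat_subset_Un: "ghat_subset X G A \<Longrightarrow> ghat_subset X G B \<Longrightarrow> ghat_subset X G (A \<union> B)"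
proof -
  assume AB: "ghat_subset X G A" "ghat_subset X G B"
  obtain U where U: "osub U" "\<forall>u\<in>U. \<forall>a\<in>A. u a \<in> A" using ghat_subset_osub[OF AB(1)] by blast
  obtain V where V: "osub V" "\<forall>u\<in>V. \<forall>a\<in>B. u a \<in> B" using ghat_subset_osub[OF AB(2)] by blast
  show ?thesis
    by (rule ghat_subsetI[OF osub_Int[OF U(1) V(1)]])
      (use U V AB[THEN ghat_subset_X] in auto)
qed

lemma ghat_subset_Int: "ghat_subset X G A \<Longrightarrow> ghat_subset X G B \<Longrightarrow> ghat_subset X G (A \<inter> B)"
proof -
  assume AB: "ghat_subset X G A" "ghat_subset X G B"
  obtain U where U: "osub U" "\<forall>u\<in>U. \<forall>a\<in>A. u a \<in> A" using ghat_subset_osub[OF AB(1)] by blast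
  obtain V where V: "osub V" "\<forall>u\<in>V. \<forall>a\<in>B. u a \<in> B" using ghat_subset_osub[OF AB(2)] by blast
  show ?thesis
    by (rule ghat_subsetI[OF osub_Int[OF U(1) V(1)]])
      (use U V AB[THEN ghat_subset_X] in auto)
qed

lemma ghat_subset_Diff:
  assumes A: "ghat_subset X G A"
  shows "ghat_subset X G (X - A)"
proof -
  obtain U where U: "osub U" "\<forall>u\<in>U. \<forall>a\<in>A. u a \<in> A" using ghat_subset_osub[OF A] by blast
  show ?thesis
  proof (rule ghat_subsetI[OF U(1)])
    show "u a \<in> X - A" if u: "u \<in> U" and a: "a \<in> X - A" for u a
    proof -
      have "ginv u (u a) = a" using ginv_apply(1) osubD(1)[OF U(1) u] a by auto
      then have "u a \<notin> A" using U(2) osubD(3)[OF U(1) u] a by (metis DiffD2)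
      then show ?thesis using G_mem osubD(1)[OF U(1) u] a by auto
    qed
  qed auto
qed

text \<open>If the finite set \<open>A\<close> supports \<open>U\<close>, its image under
  \<open>g\<close> supports the conjugate.\<close>

lemma osub_conj:
  assumes U: "osub U" and g: "g \<in> G"
  shows "osub ((\<lambda>u. g \<cdot> u \<cdot> ginv g) ` U)"
proof -
  obtain A where A: "finite A" "A \<subseteq> X" "\<forall>g\<in>G. (\<forall>a\<in>A. g a = a) \<longrightarrow> g \<in> U"
    using osub_support[OF U] by blast
  have car: "u \<in> carrier (BijGroup X)" if "u \<in> G" for u using G_Bij that by (simp add: carrier_Bij)
  note gc = car[OF g]
  have Uc: "u \<in> carrier (BijGroup X)" if "u \<in> U" for u using osubD(1)[OF U that] by (rule car)
  show ?thesis
  proof (rule osubI[of _ "g ` A"])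
    show "(\<lambda>u. g \<cdot> u \<cdot> ginv g) ` U \<subseteq> G" using osubD(1)[OF U] G_closed g by auto
    show "gid \<in> (\<lambda>u. g \<cdot> u \<cdot> ginv g) ` U"
      by (rule image_eqI[of _ _ gid]) (simp_all add: gc osubD(4)[OF U])
    show "x \<cdot> y \<in> (\<lambda>u. g \<cdot> u \<cdot> ginv g) ` U"
      if "x \<in> (\<lambda>u. g \<cdot> u \<cdot> ginv g) ` U" "y \<in> (\<lambda>u. g \<cdot> u \<cdot> ginv g) ` U" for x y
    proof -
      obtain u v where uv: "u \<in> U" "v \<in> U" "x = g \<cdot> u \<cdot> ginv g" "y = g \<cdot> v \<cdot> ginv g" using \<open>x \<in> _\<close> \<open>y \<in> _\<close> by blast
      have "ginv g \<cdot> (g \<cdot> w) = w" if "w \<in> carrier (BijGroup X)" for w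
        using that gc by (simp add: B.m_assoc[symmetric])
      then have "x \<cdot> y = g \<cdot> (u \<cdot> v) \<cdot> ginv g"
        using uv gc Uc by (simp add: B.m_assoc)
      then show ?thesis using osubD(2)[OF U uv(1,2)] by blast
    qed
    show "ginv x \<in> (\<lambda>u. g \<cdot> u \<cdot> ginv g) ` U" if x: "x \<in> (\<lambda>u. g \<cdot> u \<cdot> ginv g) ` U" for x
    proof -
      obtain u where u: "u \<in> U" "x = g \<cdot> u \<cdot> ginv g" using x by blast
      have "ginv x = g \<cdot> ginv u \<cdot> ginv g"
        using u gc Uc by (simp add: B.inv_mult_group B.m_assoc)
      then show ?thesis using osubD(3)[OF U u(1)] by blast
    qed
    show "finite (g ` A)" using A by simp
    show "g ` A \<subseteq> X" using A g by (auto intro: G_mem)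
    show "h \<in> (\<lambda>u. g \<cdot> u \<cdot> ginv g) ` U" if h: "h \<in> G" "\<forall>a\<in>g ` A. h a = a" for h
    proof -
      have "(ginv g \<cdot> h \<cdot> g) a = a" if "a \<in> A" for a
        using that h g A G_closed by (auto simp: mul_apply ginv_apply G_mem subset_iff)
      then have "ginv g \<cdot> h \<cdot> g \<in> U" using A G_closed g h by auto
      moreover have "h = g \<cdot> (ginv g \<cdot> h \<cdot> g) \<cdot> ginv g"
      proof -
        have hc: "h \<in> carrier (BijGroup X)" by (rule car[OF h(1)])
        have "g \<cdot> (ginv g \<cdot> w) = w" if "w \<in> carrier (BijGroup X)" for w
          using that gc by (simp add: B.m_assoc[symmetric])
        then show ?thesis using gc hc by (simp add: B.m_assoc)
      qed
      ultimately show ?thesis by blast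
    qed
  qed
qed

lemma ghat_subset_image:
  assumes A: "ghat_subset X G A" and g: "g \<in> G"
  shows "ghat_subset X G (g ` A)"
proof -
  obtain U where U: "osub U" "\<forall>u\<in>U. \<forall>a\<in>A. u a \<in> A" using ghat_subset_osub[OF A] by blast
  have AX: "A \<subseteq> X" by (rule ghat_subset_X[OF A])
  show ?thesis
  proof (rule ghat_subsetI[OF osub_conj[OF U(1) g]])
    show "g ` A \<subseteq> X" using AX g by (auto intro: G_mem)
    show "h b \<in> g ` A" if hb: "h \<in> (\<lambda>u. g \<cdot> u \<cdot> ginv g) ` U" "b \<in> g ` A" for h b
    proof -
      obtain u a where ua: "u \<in> U" "a \<in> A" "h = g \<cdot> u \<cdot> ginv g" "b = g a" using hb by blast
      have "h b = g (u a)"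
        using ua AX osubD(1)[OF U(1) ua(1)] g G_closed
        by (auto simp: mul_apply G_mem ginv_apply subset_iff)
      then show ?thesis using U(2) ua by blast
    qed
  qed
qed

end

locale oligomorphic_measure = oligomorphic_group X G + ghat_measure X G \<mu>
  for X :: "'x set" and G :: "('x \<Rightarrow> 'x) set" and \<mu> :: "('x, 'x upoint) ghat_set \<Rightarrow> 'k::field"
begin

definition nu :: "'x set \<Rightarrow> 'k" where "nu A = \<mu> (sub_ghat G A)"

text \<open>The bijection is equivariant under \<open>U\<close> intersected with the stabilizer of
  \<open>A\<close>, an open subgroup of both acting groups; this is what isomorphism of G-hat-sets
  asks for.\<close>

lemma mu_eq_nu:
  assumes ok: "enc_ok U Q enc \<alpha>" and fin: "finite ((\<lambda>q. (\<lambda>u. \<alpha> u q) ` U) ` Q)"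
    and A: "ghat_subset X G A" and h: "bij_betw h Q A"
    and eq: "\<And>u q. u \<in> U \<Longrightarrow> q \<in> Q \<Longrightarrow> h (\<alpha> u q) = u (h q)"
  shows "\<mu> (enc_ghat U Q enc \<alpha>) = nu A"
  unfolding nu_def
proof (rule measure_iso[OF enc_is_ghat[OF ok fin] is_ghat_sub[OF A]])
  show "ghat_iso X G (enc_ghat U Q enc \<alpha>) (sub_ghat G A)"
    unfolding sub_ghat_eq
    by (rule enc_iso[OF ok enc_ok_sub_ghat[OF A] osub_Int[OF enc_okD(1)[OF ok] osub_setwise_stab[OF A]] _ _ h])
      (use eq in auto)
qed

lemma nu_Un:
  assumes A: "ghat_subset X G A" and B: "ghat_subset X G B" and AB: "A \<inter> B = {}"
  shows "nu (A \<union> B) = nu A + nu B"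
  unfolding nu_def
proof (rule measure_sum[OF is_ghat_sub[OF A] is_ghat_sub[OF B] is_ghat_sub[OF ghat_subset_Un[OF A B]]])
  \<comment> \<open>Points go to the summand they belong to. Disjointness ensures that group
    elements stabilizing \<open>A\<close> and \<open>B\<close> respect this choice.\<close>
  define f :: "'x upoint \<Rightarrow> 'x upoint + 'x upoint" where
    "f p = (if p \<in> Inl ` A then Inl p else Inr p)" for p
  let ?V = "{g \<in> G. g ` A = A} \<inter> {g \<in> G. g ` B = B}"
  show "ghat_iso X G (sub_ghat G (A \<union> B)) (ghat_sum (sub_ghat G A) (sub_ghat G B))"
    unfolding ghat_iso_def
  proof (intro exI[of _ f] exI[of _ ?V] conjI ballI)
    show "bij_betw f (pts (sub_ghat G (A \<union> B))) (pts (ghat_sum (sub_ghat G A) (sub_ghat G B)))"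
      unfolding bij_betw_def
    proof
      show "inj_on f (pts (sub_ghat G (A \<union> B)))"
        by (auto simp: inj_on_def f_def split: if_splits)
      show "f ` pts (sub_ghat G (A \<union> B)) = pts (ghat_sum (sub_ghat G A) (sub_ghat G B))"
        using AB by (force simp: sub_ghat_def ghat_sum_def f_def image_Un image_image)
    qed
    show "osub ?V" by (rule osub_Int[OF osub_setwise_stab[OF A] osub_setwise_stab[OF B]])
    show "?V \<subseteq> acting (sub_ghat G (A \<union> B))" by (auto simp: sub_ghat_def image_Un)
    show "?V \<subseteq> acting (ghat_sum (sub_ghat G A) (sub_ghat G B))"
      by (auto simp: sub_ghat_def ghat_sum_def)
    fix u p assume u: "u \<in> ?V" and p: "p \<in> pts (sub_ghat G (A \<union> B))"
    then obtain x where x: "p = Inl x" "x \<in> A \<union> B" by (auto simp: sub_ghat_def)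
    have "u x \<in> A \<longleftrightarrow> x \<in> A"
    proof (cases "x \<in> A")
      case False
      then have "u x \<in> B" using x u by auto
      then show ?thesis using False AB by auto
    qed (use u in auto)
    moreover have "u x \<in> A \<union> B" using x u by auto
    ultimately show "f (act (sub_ghat G (A \<union> B)) u p) = act (ghat_sum (sub_ghat G A) (sub_ghat G B)) u (f p)"
      using x by (auto simp: sub_ghat_def ghat_sum_def f_def)
  qed
qed

lemma nu_empty: "nu {} = 0"
proof -
  have "ghat_subset X G {}" by (rule ghat_subset_finite) auto
  from nu_Un[OF this this] have "nu {} = nu {} + nu {}" unfolding Un_empty_left by blast
  then show ?thesis by (metis add_cancel_right_right)
qed

lemma nu_singleton: "x \<in> X \<Longrightarrow> nu {x} = 1"
  unfolding nu_def
  by (rule measure_pt[OF is_ghat_sub[OF ghat_subset_finite]]) (auto simp: sub_ghat_def)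

lemma nu_finite: "finite A \<Longrightarrow> A \<subseteq> X \<Longrightarrow> nu A = of_nat (card A)"
proof (induction A rule: finite_induct)
  case (insert x A)
  then have "nu (insert x A) = nu {x} + nu A"
    using nu_Un[of "{x}" A] ghat_subset_finite by simp
  then show ?case using insert nu_singleton by simp
qed (simp add: nu_empty)

text \<open>\<open>measure_conj\<close> keeps the points of \<open>A\<close> and conjugates the
  action. The bijection \<open>g\<close> turns that action into the ordinary one on the translated
  set, and invariance under isomorphism concludes.\<close>

lemma nu_image:
  assumes A: "ghat_subset X G A" and g: "g \<in> G"
  shows "nu (g ` A) = nu A"
proof -
  let ?H = "{h \<in> G. h ` A = A}"
  define C where "C = (\<lambda>u. g \<cdot> u \<cdot> ginv g) ` ?H"
  define \<alpha> where "\<alpha> h a = (ginv g \<cdot> h \<cdot> g) a" for h a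
  have H: "osub ?H" by (rule osub_setwise_stab[OF A])
  have AX: "A \<subseteq> X" by (rule ghat_subset_X[OF A])
  have C: "osub C" unfolding C_def by (rule osub_conj[OF H g])
  have \<alpha>: "\<alpha> h a = ginv g (h (g a))" if "h \<in> G" "a \<in> A" for h a
    using that g AX G_closed by (auto simp: \<alpha>_def mul_apply G_mem subset_iff)
  have \<alpha>C: "\<alpha> (g \<cdot> u \<cdot> ginv g) a = u a" if "u \<in> ?H" "a \<in> A" for u a
    using that g AX G_closed by (auto simp: \<alpha> mul_apply G_mem ginv_apply subset_iff)
  have CG: "h \<in> G" if "h \<in> C" for h using osubD(1)[OF C that] .
  have \<alpha>A: "\<alpha> h a \<in> A" if "h \<in> C" "a \<in> A" for h a
    using that \<alpha>C by (auto simp: C_def)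
  have ok: "enc_ok C A Inl \<alpha>"
    unfolding enc_ok_def
  proof (intro conjI ballI)
    show "\<alpha> (u \<cdot> v) q = \<alpha> u (\<alpha> v q)" if "u \<in> C" "v \<in> C" "q \<in> A" for u v q
    proof -
      have "q \<in> X" using that(3) AX by auto
      then have "q \<in> X" "g q \<in> X" "v (g q) \<in> X" using G_mem[OF g] G_mem[OF CG[OF that(2)]] by simp_all
      then show ?thesis
        using \<alpha>[OF CG[OF that(2)] that(3)] \<alpha>[OF CG[OF that(1)] \<alpha>A[OF that(2,3)]]
          \<alpha>[OF G_closed(1)[OF CG[OF that(1)] CG[OF that(2)]] that(3)]
          mul_apply[OF CG[OF that(1)] CG[OF that(2)]] ginv_apply(2)[OF g] by simp
    qed
    show "\<alpha> gid q = q" if "q \<in> A" for q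
      using that \<alpha>[OF G_closed(3) that] AX g by (auto simp: gid_apply G_mem ginv_apply subset_iff)
    show "\<exists>B. finite B \<and> B \<subseteq> X \<and> (\<forall>u\<in>C. (\<forall>a\<in>B. u a = a) \<longrightarrow> \<alpha> u q = q)" if "q \<in> A" for q
    proof (intro exI[of _ "{g q}"] conjI ballI impI)
      fix u assume "u \<in> C" "\<forall>a\<in>{g q}. u a = a"
      then show "\<alpha> u q = q" using \<alpha>[OF CG that] ginv_apply(1)[OF g] AX that by auto
    qed (use that AX g G_mem in auto)
  qed (use C \<alpha>A in auto)
  have "(\<lambda>h. \<alpha> h q) ` C = (\<lambda>u. u q) ` ?H" if "q \<in> A" for q
    using that \<alpha>C by (force simp: image_image C_def)
  then have fin: "finite ((\<lambda>q. (\<lambda>u. \<alpha> u q) ` C) ` A)"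
    using finite_sub_orbits[OF H AX] by (metis (no_types, lifting) image_cong)
  have "ghat_conj X g (sub_ghat G A) = enc_ghat C A Inl \<alpha>"
    by (simp add: ghat_conj_def sub_ghat_def enc_ghat_def C_def, rule ext, rule restrict_ext)
      (auto simp: inv_into_f_f \<alpha>_def)
  then have "nu A = \<mu> (enc_ghat C A Inl \<alpha>)"
    using measure_conj[OF is_ghat_sub[OF A] g] by (simp add: nu_def)
  also have "\<dots> = nu (g ` A)"
  proof (rule mu_eq_nu[OF ok fin ghat_subset_image[OF A g], of g])
    show "bij_betw g A (g ` A)" using G_inj[OF g] AX by (auto simp: bij_betw_def intro: inj_on_subset)
    show "g (\<alpha> u q) = u (g q)" if "u \<in> C" "q \<in> A" for u q
      using \<alpha>[OF CG[OF that(1)] that(2)] that AX g CG[OF that(1)] by (auto simp: ginv_apply G_mem subset_iff)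
  qed
  finally show ?thesis ..
qed

text \<open>A \<open>U\<close>-orbit on pairs, embedded into the type of points by sending a pair to the coset of group
  elements moving the base point to it.\<close>

definition pair_enc :: "('x \<Rightarrow> 'x) set \<Rightarrow> 'x \<times> 'x \<Rightarrow> 'x \<times> 'x \<Rightarrow> 'x upoint" where
  "pair_enc U q p = Inr ({u \<in> U. (u (fst q), u (snd q)) = p}, 0)"

abbreviation pair_act where "pair_act \<equiv> (\<lambda>u (p :: 'x \<times> 'x). (u (fst p), u (snd p)))"

lemma orb2_refl: "osub U \<Longrightarrow> q \<in> X \<times> X \<Longrightarrow> q \<in> orb2 U q"
  unfolding orb2_def by (rule image_eqI[of _ _ gid]) (auto simp: gid_apply osubD(4))

lemma orb2_closed:
  assumes U: "osub U" and q: "q \<in> X \<times> X" and p: "p \<in> orb2 U q" and u: "u \<in> U"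
  shows "pair_act u p \<in> orb2 U q"
proof -
  obtain v where v: "v \<in> U" "p = pair_act v q" using p by (auto simp: orb2_def)
  then have "pair_act u p = pair_act (u \<cdot> v) q" using mul_apply osubD(1)[OF U] u q by auto
  then show ?thesis using osubD(2)[OF U u v(1)] by (auto simp: orb2_def)
qed

lemma orb2_subset: "osub U \<Longrightarrow> q \<in> X \<times> X \<Longrightarrow> orb2 U q \<subseteq> X \<times> X"
  by (auto simp: orb2_def intro: G_mem osubD(1))

lemma orb2_eq:
  assumes U: "osub U" and q: "q \<in> X \<times> X" and p: "p \<in> orb2 U q"
  shows "orb2 U p = orb2 U q"
proof
  have pX: "p \<in> X \<times> X" using orb2_subset[OF U q] p by auto
  obtain u where u: "u \<in> U" "p = pair_act u q" using p by (auto simp: orb2_def)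
  then have "q = pair_act (ginv u) p" using ginv_apply(1) osubD(1)[OF U] q by auto
  then have "q \<in> orb2 U p" using osubD(3)[OF U u(1)] by (auto simp: orb2_def)
  then show "orb2 U q \<subseteq> orb2 U p" using orb2_closed[OF U pX] by (auto simp: orb2_def[of U q])
  show "orb2 U p \<subseteq> orb2 U q" using orb2_closed[OF U q p] by (auto simp: orb2_def[of U p])
qed

lemma pair_enc_inj: "inj_on (pair_enc U q) (orb2 U q)"
proof (rule inj_onI)
  fix p p' assume p: "p \<in> orb2 U q" and e: "pair_enc U q p = pair_enc U q p'"
  obtain u where u: "u \<in> U" "p = pair_act u q" using p by (auto simp: orb2_def)
  then have "u \<in> {u \<in> U. (u (fst q), u (snd q)) = p'}" using e by (auto simp: pair_enc_def)
  with u show "p = p'" by simp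
qed

lemma enc_ok_pair:
  assumes U: "osub U" and "inj_on enc Q" "Q \<subseteq> X \<times> X" "\<And>u p. u \<in> U \<Longrightarrow> p \<in> Q \<Longrightarrow> pair_act u p \<in> Q"
  shows "enc_ok U Q enc pair_act"
  unfolding enc_ok_def
proof (intro conjI ballI)
  show "pair_act (u \<cdot> v) q = pair_act u (pair_act v q)" if "u \<in> U" "v \<in> U" "q \<in> Q" for u v q
    using that osubD(1)[OF U] assms(3) by (auto simp: mul_apply)
  show "\<exists>B. finite B \<and> B \<subseteq> X \<and> (\<forall>u\<in>U. (\<forall>a\<in>B. u a = a) \<longrightarrow> pair_act u q = q)" if "q \<in> Q" for q
    using that assms(3) by (intro exI[of _ "{fst q, snd q}"]) auto
  show "pair_act gid q = q" if "q \<in> Q" for q using that assms(3) by (auto simp: gid_apply)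
qed (use assms in auto)

text \<open>Multiplicativity for the projection of the pair orbit to the orbit of \<open>y\<close>.
  The fibre over \<open>y\<close> is a single orbit of the stabilizer of \<open>y\<close>, and its
  second coordinates form the orbit of \<open>z\<close> under that stabilizer.\<close>

lemma mu_pair_orbit:
  assumes U: "osub U" and y: "y \<in> X" and z: "z \<in> X"
  shows "\<mu> (enc_ghat U (orb2 U (y, z)) (pair_enc U (y, z)) pair_act) =
    nu (orb {u \<in> U. u y = y} z) * nu (orb U y)"
proof -
  let ?O = "orb2 U (y, z)" and ?enc = "pair_enc U (y, z)" and ?S = "{u \<in> U. u y = y}"
  let ?Y = "enc_ghat U ?O ?enc pair_act" and ?W = "enc_ghat U (orb U y) Inl (\<lambda>u x. u x) :: ('x, 'x upoint) ghat_set"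
  have q: "(y, z) \<in> X \<times> X" using y z by simp
  note inj = pair_enc_inj[of U "(y, z)"]
  have okY: "enc_ok U ?O ?enc pair_act"
    by (rule enc_ok_pair[OF U inj orb2_subset[OF U q] orb2_closed[OF U q]])
  have okW: "enc_ok U (orb U y) Inl (\<lambda>u x. u x)"
    by (rule enc_ok_sub[OF U orb_subset[OF U y]]) (rule orb_closed[OF U y])
  have S: "osub ?S" by (rule osub_point_stab[OF U y])
  define f :: "'x upoint \<Rightarrow> 'x upoint" where "f p = Inl (fst (inv_into ?O ?enc p))" for p
  have f: "f (?enc p) = Inl (fst p)" if "p \<in> ?O" for p using that inj by (simp add: f_def)
  have tY: "transitive_set X ?Y"
    by (rule enc_transitive(1)[OF okY orb2_refl[OF U q]]) (simp add: orb2_def)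
  have tW: "transitive_set X ?W" "finite ((\<lambda>q. (\<lambda>u. u q) ` U) ` orb U y)"
    by (rule enc_transitive[OF okW orb_refl[OF U y]]; simp add: orb_def)+
  have fst_orb: "fst p \<in> orb U y" if "p \<in> ?O" for p using that by (auto simp: orb2_def orb_def)
  have eqv: "equivariant ?Y ?W f"
    unfolding equivariant_def
  proof (intro conjI ballI)
    show "f \<in> pts ?Y \<rightarrow> pts ?W" using fst_orb by (auto simp: f)
    show "f (act ?Y u p) = act ?W u (f p)" if up: "u \<in> acting ?Y" "p \<in> pts ?Y" for u p
    proof -
      obtain r where r: "r \<in> ?O" "p = ?enc r" using up by auto
      have "pair_act u r \<in> ?O" using up r orb2_closed[OF U q] by simp
      then show ?thesis
        using r fst_orb[OF r(1)] by (simp add: f enc_ghat_act[OF inj] enc_ghat_act)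
    qed
  qed
  have "\<mu> ?Y = \<mu> (ghat_fiber X ?Y ?W f (Inl y)) * \<mu> ?W"
    by (rule measure_fiber[OF enc_smooth[OF okY] enc_smooth[OF okW] _ tY tW(1) eqv])
      (use orb_refl[OF U y] in auto)
  moreover have "\<mu> ?W = nu (orb U y)"
    by (rule mu_eq_nu[OF okW tW(2) orb_ghat[OF U y], of "\<lambda>x. x"]) (auto simp: bij_betw_def)
  moreover have "\<mu> (ghat_fiber X ?Y ?W f (Inl y)) = nu (orb ?S z)"
  proof -
    let ?Q = "{p \<in> ?O. fst p = y}"
    have Q: "?Q = (\<lambda>u. pair_act u (y, z)) ` ?S"
    proof
      show "?Q \<subseteq> (\<lambda>u. pair_act u (y, z)) ` ?S" by (auto simp: orb2_def)
      show "(\<lambda>u. pair_act u (y, z)) ` ?S \<subseteq> ?Q" 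
      proof (rule image_subsetI)
        fix u assume u: "u \<in> ?S"
        then have "pair_act u (y, z) \<in> orb2 U (y, z)" unfolding orb2_def by blast
        with u show "pair_act u (y, z) \<in> ?Q" by simp
      qed
    qed
    have okQ: "enc_ok ?S ?Q ?enc pair_act"
    proof (rule enc_ok_pair[OF S])
      show "inj_on ?enc ?Q" using inj by (rule inj_on_subset) auto
      show "?Q \<subseteq> X \<times> X" using orb2_subset[OF U q] by auto
      show "pair_act u p \<in> ?Q" if "u \<in> ?S" "p \<in> ?Q" for u p
        using that orb2_closed[OF U q, of p u] by auto
    qed
    have yz: "(y, z) \<in> ?Q" using orb2_refl[OF U q] by simp
    \<comment> \<open>The fibre acts by restriction of an encoded action. To be the encoded action
      on the smaller set as a record, it must agree with it outside the points too.\<close>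
    have "act (ghat_fiber X ?Y ?W f (Inl y)) u = act (enc_ghat ?S ?Q ?enc pair_act) u" for u
    proof -
      have p: "{p \<in> pts ?Y. f p = Inl y} = ?enc ` ?Q" by (auto simp: f)
      have "restrict (act ?Y u) (?enc ` ?Q) =
          restrict (\<lambda>p. ?enc (pair_act u (inv_into ?Q ?enc p))) (?enc ` ?Q)"
      proof (rule restrict_ext)
        fix p assume "p \<in> ?enc ` ?Q"
        then obtain r where r: "r \<in> ?Q" "p = ?enc r" by auto
        have "inv_into ?Q ?enc p = r" unfolding r(2)
          by (rule inv_into_f_f[OF inj_on_subset[OF inj] r(1)]) auto
        then show "act ?Y u p = ?enc (pair_act u (inv_into ?Q ?enc p))"
          using r enc_ghat_act[OF inj] by simp
      qed
      then show ?thesis unfolding ghat_fiber_def p by (simp add: enc_ghat_def)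
    qed
    moreover have "acting (ghat_fiber X ?Y ?W f (Inl y)) = ?S"
      using orb_refl[OF U y] by (auto simp: ghat_fiber_def stabilizer_def enc_ghat_act)
    moreover have "pts (ghat_fiber X ?Y ?W f (Inl y)) = ?enc ` ?Q"
      by (auto simp: ghat_fiber_def f)
    ultimately have e: "ghat_fiber X ?Y ?W f (Inl y) = enc_ghat ?S ?Q ?enc pair_act"
      by (intro ghat_set.equality) auto
    have "bij_betw snd ?Q (orb ?S z)"
      unfolding bij_betw_def
    proof
      show "inj_on snd ?Q" by (auto simp: inj_on_def)
      show "snd ` ?Q = orb ?S z" unfolding Q by (simp add: image_image orb_def)
    qed
    then show ?thesis unfolding e
      by (intro mu_eq_nu[OF okQ enc_transitive(2)[OF okQ yz Q] orb_ghat[OF S z]]) auto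
  qed
  ultimately show ?thesis by simp
qed

text \<open>Swapping coordinates is an isomorphism between the orbits of (y, z) and (z, y), and
  \<open>mu_pair_orbit\<close> computes the measure of each. This is Fubini for one orbit.\<close>

lemma nu_pair_symmetric:
  assumes U: "osub U" and y: "y \<in> X" and z: "z \<in> X"
  shows "nu (orb {u \<in> U. u y = y} z) * nu (orb U y) = nu (orb {u \<in> U. u z = z} y) * nu (orb U z)"
proof -
  have ok: "enc_ok U (orb2 U (a, b)) (pair_enc U (a, b)) pair_act"
    and fin: "finite ((\<lambda>q. (\<lambda>u. pair_act u q) ` U) ` orb2 U (a, b))" if "a \<in> X" "b \<in> X" for a b
  proof -
    have q: "(a, b) \<in> X \<times> X" using that by simp
    show o: "enc_ok U (orb2 U (a, b)) (pair_enc U (a, b)) pair_act"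
      by (rule enc_ok_pair[OF U pair_enc_inj orb2_subset[OF U q] orb2_closed[OF U q]])
    show "finite ((\<lambda>q. (\<lambda>u. pair_act u q) ` U) ` orb2 U (a, b))"
      by (rule enc_transitive(2)[OF o orb2_refl[OF U q]]) (simp add: orb2_def)
  qed
  have "\<mu> (enc_ghat U (orb2 U (y, z)) (pair_enc U (y, z)) pair_act) =
      \<mu> (enc_ghat U (orb2 U (z, y)) (pair_enc U (z, y)) pair_act)"
  proof (rule measure_iso[OF enc_is_ghat[OF ok fin] enc_is_ghat[OF ok fin]])
    show "ghat_iso X G (enc_ghat U (orb2 U (y, z)) (pair_enc U (y, z)) pair_act)
        (enc_ghat U (orb2 U (z, y)) (pair_enc U (z, y)) pair_act)"
    proof (rule enc_iso[OF ok ok U, of _ _ _ _ prod.swap])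
      show "bij_betw prod.swap (orb2 U (y, z)) (orb2 U (z, y))"
        by (auto simp: bij_betw_def orb2_def image_image)
    qed (use y z in auto)
  qed (use y z in auto)
  then show ?thesis using mu_pair_orbit[OF U] y z by simp
qed

end

section \<open>Integration of smooth functions\<close>

context oligomorphic_measure begin

definition invariant_under :: "('x \<Rightarrow> 'x) set \<Rightarrow> ('x \<Rightarrow> 'k) \<Rightarrow> bool" where
  "invariant_under U \<psi> \<longleftrightarrow> osub U \<and> (\<forall>u\<in>U. \<forall>x\<in>X. \<psi> (u x) = \<psi> x)"

definition smooth_fun :: "('x \<Rightarrow> 'k) \<Rightarrow> bool" where
  "smooth_fun \<psi> \<longleftrightarrow> (\<exists>U. invariant_under U \<psi>)"

text \<open>The sum over level sets mentions no subgroup, so nothing has to be shown independent of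
  a choice; \<open>integ_orbs\<close> converts it to an orbit sum for any open subgroup leaving the
  function invariant.\<close>

definition integ :: "('x \<Rightarrow> 'k) \<Rightarrow> 'k" where
  "integ \<psi> = (\<Sum>c\<in>\<psi> ` X. c * nu {x \<in> X. \<psi> x = c})"

lemma integ_cong: "(\<And>x. x \<in> X \<Longrightarrow> \<psi> x = \<psi>' x) \<Longrightarrow> integ \<psi> = integ \<psi>'"
  unfolding integ_def by (rule sum.cong) (auto intro!: arg_cong[where f = nu])

lemma invariant_mono: "invariant_under U \<psi> \<Longrightarrow> osub V \<Longrightarrow> V \<subseteq> U \<Longrightarrow> invariant_under V \<psi>"
  by (auto simp: invariant_under_def)

lemma ghat_subset_Union_orbs:
  assumes "osub U" "\<Q> \<subseteq> orb U ` X"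
  shows "ghat_subset X G (\<Union>\<Q>)"
proof (rule ghat_subsetI[OF assms(1)])
  show "\<Union>\<Q> \<subseteq> X" using assms orb_subset by blast
  show "u a \<in> \<Union>\<Q>" if ua: "u \<in> U" "a \<in> \<Union>\<Q>" for u a
  proof -
    obtain x where x: "x \<in> X" "orb U x \<in> \<Q>" "a \<in> orb U x" using ua assms(2) by blast
    then show ?thesis using orb_closed[OF assms(1) x(1,3) ua(1)] by blast
  qed
qed

lemma nu_Union_orbs:
  assumes U: "osub U" and "\<Q> \<subseteq> orb U ` X"
  shows "nu (\<Union>\<Q>) = (\<Sum>Q\<in>\<Q>. nu Q)"
proof -
  have "finite \<Q>" using finite_orbs[OF U] assms(2) by (rule rev_finite_subset)
  then show ?thesis using assms(2)
  proof (induction \<Q> rule: finite_induct)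
    case (insert Q \<Q>)
    then obtain x where x: "x \<in> X" "Q = orb U x" by auto
    have "Q \<inter> \<Union>\<Q> = {}"
    proof (rule ccontr)
      assume "Q \<inter> \<Union>\<Q> \<noteq> {}"
      then obtain y R where y: "y \<in> Q" "y \<in> R" "R \<in> \<Q>" by blast
      obtain z where z: "z \<in> X" "R = orb U z" using y insert.prems by auto
      have "Q = R" using orb_eq[OF U x(1)] orb_eq[OF U z(1)] x z y by metis
      then show False using y insert.hyps by simp
    qed
    then have "nu (Q \<union> \<Union>\<Q>) = nu Q + nu (\<Union>\<Q>)"
      using x orb_ghat[OF U] ghat_subset_Union_orbs[OF U] insert.prems by (intro nu_Un) auto
    then show ?case using insert by simp
  qed (simp add: nu_empty)
qed

lemma some_orb: "osub U \<Longrightarrow> x \<in> X \<Longrightarrow> (SOME y. y \<in> orb U x) \<in> orb U x"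
  by (rule someI[of _ x]) (rule orb_refl)

lemma invariant_orb:
  assumes "invariant_under U \<psi>" "x \<in> X" "y \<in> orb U x"
  shows "\<psi> y = \<psi> x"
  using assms by (auto simp: invariant_under_def orb_def)

lemma ghat_level: "smooth_fun \<psi> \<Longrightarrow> ghat_subset X G {x \<in> X. \<psi> x = c}"
proof -
  assume "smooth_fun \<psi>"
  then obtain U where U: "osub U" "\<forall>u\<in>U. \<forall>x\<in>X. \<psi> (u x) = \<psi> x"
    by (auto simp: smooth_fun_def invariant_under_def)
  show ?thesis by (rule ghat_subsetI[OF U(1)]) (use U in \<open>auto simp: G_mem osubD(1)\<close>)
qed

text \<open>Level sets are disjoint unions of orbits, so the orbits are grouped by the value taken
  there. Orbit sums for different subgroups agree, since the left side does not involve
  \<open>U\<close>.\<close>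

lemma integ_orbs:
  assumes inv: "invariant_under U \<psi>"
  shows "integ \<psi> = (\<Sum>Q\<in>orb U ` X. nu Q * \<psi> (SOME y. y \<in> Q))"
proof -
  have U: "osub U" using inv by (simp add: invariant_under_def)
  define r where "r Q = \<psi> (SOME y. y \<in> Q)" for Q
  have r: "r (orb U x) = \<psi> x" if "x \<in> X" for x
    unfolding r_def by (rule invariant_orb[OF inv that some_orb[OF U that]])
  have fin: "finite (orb U ` X)" by (rule finite_orbs[OF U])
  have im: "r ` (orb U ` X) = \<psi> ` X" using r by (force simp: image_image)
  have lev: "nu {x \<in> X. \<psi> x = c} = (\<Sum>Q\<in>{Q \<in> orb U ` X. r Q = c}. nu Q)" for c
  proof -
    have "{x \<in> X. \<psi> x = c} = \<Union>{Q \<in> orb U ` X. r Q = c}"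
    proof
      show "{x \<in> X. \<psi> x = c} \<subseteq> \<Union>{Q \<in> orb U ` X. r Q = c}"
        using r orb_refl[OF U] by blast
      show "\<Union>{Q \<in> orb U ` X. r Q = c} \<subseteq> {x \<in> X. \<psi> x = c}"
        using r orb_subset[OF U] invariant_orb[OF inv] by auto
    qed
    also have "nu \<dots> = (\<Sum>Q\<in>{Q \<in> orb U ` X. r Q = c}. nu Q)"
      by (rule nu_Union_orbs[OF U]) auto
    finally show ?thesis .
  qed
  have "(\<Sum>Q\<in>orb U ` X. nu Q * r Q) =
      (\<Sum>c\<in>r ` (orb U ` X). \<Sum>Q\<in>{Q \<in> orb U ` X. r Q = c}. nu Q * r Q)"
    by (rule sum.image_gen[OF fin])
  also have "\<dots> = (\<Sum>c\<in>\<psi> ` X. c * nu {x \<in> X. \<psi> x = c})"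
    unfolding im lev sum_distrib_left by (intro sum.cong refl) (simp add: mult.commute)
  finally show ?thesis by (simp add: integ_def r_def)
qed

lemma invariant_binary:
  assumes "smooth_fun \<psi>" "smooth_fun \<psi>'"
  shows "\<exists>U. invariant_under U \<psi> \<and> invariant_under U \<psi>'"
proof -
  obtain U V where "invariant_under U \<psi>" "invariant_under V \<psi>'"
    using assms by (auto simp: smooth_fun_def)
  moreover from this have "osub (U \<inter> V)" by (auto simp: invariant_under_def intro: osub_Int)
  ultimately show ?thesis by (auto intro!: exI[of _ "U \<inter> V"] intro: invariant_mono)
qed

lemma smooth_add: "smooth_fun \<psi> \<Longrightarrow> smooth_fun \<psi>' \<Longrightarrow> smooth_fun (\<lambda>x. \<psi> x + \<psi>' x)"
  using invariant_binary[of \<psi> \<psi>'] by (auto simp: smooth_fun_def invariant_under_def)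

lemma smooth_const: "smooth_fun (\<lambda>x. c)"
  using osub_G by (auto simp: smooth_fun_def invariant_under_def)

lemma smooth_sum: "(\<And>i. i \<in> I \<Longrightarrow> smooth_fun (f i)) \<Longrightarrow> smooth_fun (\<lambda>x. \<Sum>i\<in>I. f i x)"
  by (induction I rule: infinite_finite_induct) (auto intro: smooth_const smooth_add)

lemma smooth_indicator: "ghat_subset X G A \<Longrightarrow> smooth_fun (\<lambda>x. if x \<in> A then c else 0)"
proof -
  assume "ghat_subset X G A"
  then obtain U where U: "osub U" "\<forall>u\<in>U. u ` A = A" "A \<subseteq> X" by (auto simp: ghat_subset_def)
  have "u x \<in> A \<longleftrightarrow> x \<in> A" if "u \<in> U" "x \<in> X" for u x
  proof
    assume "u x \<in> A"
    moreover have "u ` A = A" using U(2) that(1) by simp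
    ultimately have "u x \<in> u ` A" by simp
    then obtain a where "a \<in> A" "u x = u a" by auto
    then show "x \<in> A"
      using G_eq_iff[OF osubD(1)[OF U(1) that(1)] that(2), of a] U(3) by auto
  qed (use U(2) that in auto)
  then show ?thesis using U(1) by (auto simp: smooth_fun_def invariant_under_def)
qed

text \<open>Level sets of a sum are unrelated to those of the summands, whereas the orbit sum for a
  common subgroup is visibly additive.\<close>

lemma integ_add:
  assumes "smooth_fun \<psi>" "smooth_fun \<psi>'"
  shows "integ (\<lambda>x. \<psi> x + \<psi>' x) = integ \<psi> + integ \<psi>'"
proof -
  obtain U where U: "invariant_under U \<psi>" "invariant_under U \<psi>'" using invariant_binary[OF assms] by auto
  then have "invariant_under U (\<lambda>x. \<psi> x + \<psi>' x)" by (simp add: invariant_under_def)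
  with U show ?thesis by (simp add: integ_orbs sum.distrib distrib_left)
qed

lemma integ_scale:
  assumes "smooth_fun \<psi>"
  shows "integ (\<lambda>x. c * \<psi> x) = c * integ \<psi>"
proof -
  obtain U where U: "invariant_under U \<psi>" using assms by (auto simp: smooth_fun_def)
  then have "invariant_under U (\<lambda>x. c * \<psi> x)" by (simp add: invariant_under_def)
  with U show ?thesis by (simp add: integ_orbs sum_distrib_left mult.left_commute)
qed

lemma integ_0 [simp]: "integ (\<lambda>x. 0) = 0"
  using integ_scale[OF smooth_const, of 0 0] by simp

lemma integ_sum:
  "(\<And>i. i \<in> I \<Longrightarrow> smooth_fun (f i)) \<Longrightarrow> integ (\<lambda>x. \<Sum>i\<in>I. f i x) = (\<Sum>i\<in>I. integ (f i))"
proof (induction I rule: infinite_finite_induct)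
  case (insert i I)
  then show ?case using integ_add[of "f i" "\<lambda>x. \<Sum>i\<in>I. f i x"] by (simp add: smooth_sum)
qed simp_all

lemma integ_indicator:
  assumes A: "ghat_subset X G A"
  shows "integ (\<lambda>x. if x \<in> A then c else 0) = c * nu A"
proof (cases "c = 0")
  case False
  have AX: "A \<subseteq> X" by (rule ghat_subset_X[OF A])
  let ?\<psi> = "\<lambda>x. if x \<in> A then c else 0"
  have "integ ?\<psi> = (\<Sum>c'\<in>{c, 0}. c' * nu {x \<in> X. ?\<psi> x = c'})"
    \<comment> \<open>One of the two values may fail to be attained; its level set is then empty and
      of measure zero. The case \<open>c = 0\<close> is separate because there the level set is
      \<open>X\<close> rather than \<open>A\<close>.\<close>
    unfolding integ_def
  proof (rule sum.mono_neutral_left)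
    show "\<forall>i\<in>{c, 0} - ?\<psi> ` X. i * nu {x \<in> X. ?\<psi> x = i} = 0"
    proof
      fix i assume "i \<in> {c, 0} - ?\<psi> ` X"
      then have "{x \<in> X. ?\<psi> x = i} = {}" by auto
      then show "i * nu {x \<in> X. ?\<psi> x = i} = 0" by (simp only: nu_empty mult_zero_right)
    qed
  qed auto
  also have "\<dots> = c * nu {x \<in> X. ?\<psi> x = c}" using False by simp
  also have "{x \<in> X. ?\<psi> x = c} = A" using False AX by auto
  finally show ?thesis .
qed (simp cong: if_cong)

text \<open>A point has measure 1. This isolates the diagonal term when two moves are
  composed.\<close>

lemma integ_remove_point:
  assumes "smooth_fun \<psi>" "y \<in> X"
  shows "integ \<psi> = \<psi> y + integ (\<lambda>x. if x = y then 0 else \<psi> x)"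
    "smooth_fun (\<lambda>x. if x = y then 0 else \<psi> x)"
proof -
  have y: "ghat_subset X G {y}" using assms(2) by (simp add: ghat_subset_finite)
  have e: "(\<lambda>x. if x = y then 0 else \<psi> x) = (\<lambda>x. \<psi> x + (if x \<in> {y} then - \<psi> y else 0))" by auto
  show "smooth_fun (\<lambda>x. if x = y then 0 else \<psi> x)"
    unfolding e by (intro smooth_add assms smooth_indicator y)
  show "integ \<psi> = \<psi> y + integ (\<lambda>x. if x = y then 0 else \<psi> x)"
    unfolding e integ_add[OF assms(1) smooth_indicator[OF y]] integ_indicator[OF y]
    by (simp add: nu_singleton assms(2))
qed

lemma integ_finite_support:
  assumes A: "finite A" "A \<subseteq> X" and z: "\<And>x. x \<in> X \<Longrightarrow> x \<notin> A \<Longrightarrow> \<psi> x = 0"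
  shows "integ \<psi> = (\<Sum>x\<in>A. \<psi> x)"
proof -
  have g: "ghat_subset X G {y}" if "y \<in> A" for y
    by (rule ghat_subset_finite) (use that A(2) in auto)
  have "integ \<psi> = integ (\<lambda>x. \<Sum>y\<in>A. if x \<in> {y} then \<psi> y else 0)"
    using z A(1) by (intro integ_cong) (auto simp: sum.delta)
  also have "\<dots> = (\<Sum>y\<in>A. integ (\<lambda>x. if x \<in> {y} then \<psi> y else 0))"
    by (rule integ_sum) (intro smooth_indicator g)
  also have "\<dots> = (\<Sum>x\<in>A. \<psi> x)"
    using A(2) by (intro sum.cong refl) (simp add: integ_indicator[OF g, simplified] nu_singleton subset_iff)
  finally show ?thesis .
qed

text \<open>Level sets are translated by the inverse of \<open>g\<close>, which preserves their
  measure.\<close>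

lemma integ_translate:
  assumes \<psi>: "smooth_fun \<psi>" and g: "g \<in> G"
  shows "integ (\<lambda>x. \<psi> (g x)) = integ \<psi>"
proof -
  have im: "(\<lambda>x. \<psi> (g x)) ` X = \<psi> ` X"
  proof
    show "(\<lambda>x. \<psi> (g x)) ` X \<subseteq> \<psi> ` X" using G_mem[OF g] by auto
    show "\<psi> ` X \<subseteq> (\<lambda>x. \<psi> (g x)) ` X"
    proof (rule image_subsetI)
      fix x assume x: "x \<in> X"
      show "\<psi> x \<in> (\<lambda>x. \<psi> (g x)) ` X"
        by (rule image_eqI[of _ _ "ginv g x"]) (simp_all add: ginv_apply g x G_mem G_closed)
    qed
  qed
  have "{x \<in> X. \<psi> (g x) = c} = ginv g ` {x \<in> X. \<psi> x = c}" for c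
  proof
    show "{x \<in> X. \<psi> (g x) = c} \<subseteq> ginv g ` {x \<in> X. \<psi> x = c}"
    proof
      fix x assume "x \<in> {x \<in> X. \<psi> (g x) = c}"
      then show "x \<in> ginv g ` {x \<in> X. \<psi> x = c}"
        by (intro image_eqI[of _ _ "g x"]) (simp_all add: ginv_apply g G_mem)
    qed
    show "ginv g ` {x \<in> X. \<psi> x = c} \<subseteq> {x \<in> X. \<psi> (g x) = c}"
      using g by (auto simp: ginv_apply G_mem G_closed)
  qed
  then have "nu {x \<in> X. \<psi> (g x) = c} = nu {x \<in> X. \<psi> x = c}" for c
    using nu_image[OF ghat_level[OF \<psi>] G_closed(2)[OF g]] by simp
  then show ?thesis unfolding integ_def im by simp
qed

section \<open>Iterated integrals\<close>

definition invariant2 :: "('x \<Rightarrow> 'x) set \<Rightarrow> ('x \<Rightarrow> 'x \<Rightarrow> 'k) \<Rightarrow> bool" where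
  "invariant2 U F \<longleftrightarrow> osub U \<and> (\<forall>u\<in>U. \<forall>x\<in>X. \<forall>y\<in>X. F (u x) (u y) = F x y)"

lemma invariant2_swap: "invariant2 U F \<Longrightarrow> invariant2 U (\<lambda>y x. F x y)"
  by (auto simp: invariant2_def)

text \<open>For fixed \<open>y\<close> the function \<open>F y\<close> is invariant under the
  stabilizer of \<open>y\<close> in \<open>U\<close>, which is again open.\<close>

lemma invariant2_inner: "invariant2 U F \<Longrightarrow> y \<in> X \<Longrightarrow> smooth_fun (F y)"
  unfolding smooth_fun_def invariant_under_def invariant2_def
  using osub_point_stab[of U y] by (intro exI[of _ "{u \<in> U. u y = y}"]) (auto, metis)

lemma invariant2_outer:
  assumes F: "invariant2 U F"
  shows "smooth_fun (\<lambda>y. integ (F y))"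
proof -
  have U: "osub U" using F by (simp add: invariant2_def)
  have "integ (F (u y)) = integ (F y)" if u: "u \<in> U" and y: "y \<in> X" for u y
  proof -
    have "u y \<in> X" using G_mem osubD(1)[OF U u] y by simp
    then have "integ (F (u y)) = integ (\<lambda>x. F (u y) (u x))"
      using integ_translate[OF invariant2_inner[OF F] osubD(1)[OF U u], of "u y"] by simp
    also have "\<dots> = integ (F y)" using F u y by (intro integ_cong) (simp add: invariant2_def)
    finally show ?thesis .
  qed
  then show ?thesis using U by (auto simp: smooth_fun_def invariant_under_def)
qed

text \<open>Over a point \<open>u a\<close> the section of the pair orbit is the translate by
  \<open>u\<close> of the section over \<open>a\<close>; all sections therefore have the same
  measure.\<close>

lemma integ_orb2:
  assumes U: "osub U" and a: "a \<in> X" and b: "b \<in> X"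
  shows "integ (\<lambda>y. integ (\<lambda>z. if (y, z) \<in> orb2 U (a, b) then c else 0)) =
    c * nu (orb {u \<in> U. u a = a} b) * nu (orb U a)"
proof -
  let ?S = "{u \<in> U. u a = a}"
  have S: "osub ?S" by (rule osub_point_stab[OF U a])
  have q: "(a, b) \<in> X \<times> X" using a b by simp
  have inner: "integ (\<lambda>z. if (y, z) \<in> orb2 U (a, b) then c else 0) =
      (if y \<in> orb U a then c * nu (orb ?S b) else 0)" if y: "y \<in> X" for y
  proof (cases "y \<in> orb U a")
    case True
    then obtain u where u: "u \<in> U" "y = u a" by (auto simp: orb_def)
    have uG: "u \<in> G" by (rule osubD(1)[OF U u(1)])
    have "(y, z) \<in> orb2 U (a, b) \<longleftrightarrow> z \<in> u ` orb ?S b" for z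
    proof
      assume "(y, z) \<in> orb2 U (a, b)"
      then obtain v where v: "v \<in> U" "y = v a" "z = v b" by (auto simp: orb2_def)
      have vG: "v \<in> G" by (rule osubD(1)[OF U v(1)])
      have "(ginv u \<cdot> v) a = a"
        using mul_apply[OF G_closed(2)[OF uG] vG a] ginv_apply(1)[OF uG a] u(2) v(2) by simp
      then have "(ginv u \<cdot> v) b \<in> orb ?S b"
        using osubD(2)[OF U osubD(3)[OF U u(1)] v(1)] unfolding orb_def by blast
      moreover have "u ((ginv u \<cdot> v) b) = z"
        using uG vG b v(3) by (simp add: mul_apply G_closed ginv_apply G_mem)
      ultimately show "z \<in> u ` orb ?S b" by blast
    next
      assume "z \<in> u ` orb ?S b"
      then obtain v where v: "v \<in> U" "v a = a" "z = u (v b)" by (auto simp: orb_def)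
      have "(y, z) = ((u \<cdot> v) a, (u \<cdot> v) b)"
        using u v uG osubD(1)[OF U v(1)] a b by (simp add: mul_apply)
      then show "(y, z) \<in> orb2 U (a, b)" using osubD(2)[OF U u(1) v(1)] by (auto simp: orb2_def)
    qed
    then have "integ (\<lambda>z. if (y, z) \<in> orb2 U (a, b) then c else 0) = c * nu (u ` orb ?S b)"
      using integ_indicator[OF ghat_subset_image[OF orb_ghat[OF S b] uG]] by simp
    then show ?thesis using True nu_image[OF orb_ghat[OF S b] uG] by simp
  next
    case False
    then have "(y, z) \<notin> orb2 U (a, b)" for z by (auto simp: orb2_def orb_def)
    then show ?thesis using False by simp
  qed
  have "integ (\<lambda>y. integ (\<lambda>z. if (y, z) \<in> orb2 U (a, b) then c else 0)) =
      integ (\<lambda>y. if y \<in> orb U a then c * nu (orb ?S b) else 0)"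
    by (rule integ_cong) (rule inner)
  then show ?thesis using integ_indicator[OF orb_ghat[OF U a]] by simp
qed

lemma orb2_swap: "(y, z) \<in> orb2 U (a, b) \<longleftrightarrow> (z, y) \<in> orb2 U (b, a)"
  by (auto simp: orb2_def)

theorem integ_Fubini:
  assumes F: "invariant2 U F"
  shows "integ (\<lambda>y. integ (\<lambda>z. F y z)) = integ (\<lambda>z. integ (\<lambda>y. F y z))"
proof -
  have U: "osub U" using F by (simp add: invariant2_def)
  let ?\<O> = "orb2 U ` (X \<times> X)"
  define r where "r W = (SOME q. q \<in> W)" for W :: "('x \<times> 'x) set"
  \<comment> \<open>The restriction of \<open>F\<close> to the orbit \<open>W\<close>, on which
    \<open>F\<close> is constant by invariance; \<open>F\<close> is the finite sum of these.\<close>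
  define K where "K W y z = (if (y, z) \<in> W then F (fst (r W)) (snd (r W)) else 0)" for W y z
  have fin: "finite ?\<O>" by (rule finite_orb2s[OF U])
  have dec: "F y z = (\<Sum>W\<in>?\<O>. K W y z)" if yz: "y \<in> X" "z \<in> X" for y z
  proof -
    have q: "(y, z) \<in> X \<times> X" using yz by simp
    have only: "(y, z) \<in> W \<longleftrightarrow> W = orb2 U (y, z)" if "W \<in> ?\<O>" for W
      using that orb2_refl[OF U q] orb2_eq[OF U] by blast
    have "r (orb2 U (y, z)) \<in> orb2 U (y, z)"
      unfolding r_def by (rule someI[of _ "(y, z)"]) (rule orb2_refl[OF U q])
    then obtain u where "u \<in> U" "r (orb2 U (y, z)) = (u y, u z)" by (auto simp: orb2_def)
    then have rF: "F (fst (r (orb2 U (y, z)))) (snd (r (orb2 U (y, z)))) = F y z"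
      using F yz by (simp add: invariant2_def)
    have "(\<Sum>W\<in>?\<O>. K W y z) = (\<Sum>W\<in>?\<O>. if W = orb2 U (y, z) then F y z else 0)"
      by (rule sum.cong) (auto simp: K_def only rF)
    also have "\<dots> = F y z" using fin q by (simp add: sum.delta)
    finally show ?thesis by simp
  qed
  have K: "invariant2 U (K W)" if W: "W \<in> ?\<O>" for W
  proof -
    obtain q where q: "q \<in> X \<times> X" "W = orb2 U q" using W by auto
    have "(u y, u z) \<in> W \<longleftrightarrow> (y, z) \<in> W" if u: "u \<in> U" and yz: "y \<in> X" "z \<in> X" for u y z
    proof
      assume "(u y, u z) \<in> W"
      from orb2_closed[OF U q(1) this[unfolded q(2)] osubD(3)[OF U u]]
      show "(y, z) \<in> W" using ginv_apply(1)[OF osubD(1)[OF U u]] yz q(2) by simp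
    next
      assume "(y, z) \<in> W"
      from orb2_closed[OF U q(1) this[unfolded q(2)] u]
      show "(u y, u z) \<in> W" using q(2) by simp
    qed
    then show ?thesis using U by (simp add: invariant2_def K_def)
  qed
  have swap: "integ (\<lambda>y. integ (\<lambda>z. K W y z)) = integ (\<lambda>z. integ (\<lambda>y. K W y z))" if "W \<in> ?\<O>" for W
  proof -
    obtain a b where ab: "a \<in> X" "b \<in> X" "W = orb2 U (a, b)" using \<open>W \<in> _\<close> by auto
    define c where "c = F (fst (r W)) (snd (r W))"
    have Kc: "K W y z = (if (y, z) \<in> W then c else 0)" for y z by (simp add: K_def c_def)
    have "integ (\<lambda>y. integ (\<lambda>z. K W y z)) = c * (nu (orb {u \<in> U. u a = a} b) * nu (orb U a))"
      using integ_orb2[OF U ab(1,2), of c] by (simp add: Kc ab(3)[symmetric] mult.assoc)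
    moreover have "integ (\<lambda>z. integ (\<lambda>y. K W y z)) = c * (nu (orb {u \<in> U. u b = b} a) * nu (orb U b))"
      using integ_orb2[OF U ab(2,1), of c]
      by (simp add: Kc orb2_swap[of _ _ U b a] ab(3)[symmetric] mult.assoc)
    ultimately show ?thesis using nu_pair_symmetric[OF U ab(1,2)] by simp
  qed
  have "integ (\<lambda>y. integ (\<lambda>z. F y z)) = integ (\<lambda>y. \<Sum>W\<in>?\<O>. integ (\<lambda>z. K W y z))"
  proof (rule integ_cong)
    fix y assume y: "y \<in> X"
    have "integ (F y) = integ (\<lambda>z. \<Sum>W\<in>?\<O>. K W y z)" by (rule integ_cong) (rule dec[OF y])
    also have "\<dots> = (\<Sum>W\<in>?\<O>. integ (\<lambda>z. K W y z))"
      by (rule integ_sum) (rule invariant2_inner[OF K y])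
    finally show "integ (F y) = (\<Sum>W\<in>?\<O>. integ (\<lambda>z. K W y z))" .
  qed
  also have "\<dots> = (\<Sum>W\<in>?\<O>. integ (\<lambda>y. integ (\<lambda>z. K W y z)))"
    by (rule integ_sum) (rule invariant2_outer[OF K])
  also have "\<dots> = (\<Sum>W\<in>?\<O>. integ (\<lambda>z. integ (\<lambda>y. K W y z)))"
    by (rule sum.cong[OF refl]) (rule swap)
  also have "\<dots> = integ (\<lambda>z. \<Sum>W\<in>?\<O>. integ (\<lambda>y. K W y z))"
    by (rule integ_sum[symmetric]) (rule invariant2_outer[OF invariant2_swap[OF K]])
  also have "\<dots> = integ (\<lambda>z. integ (\<lambda>y. F y z))"
  proof (rule integ_cong)
    fix z assume z: "z \<in> X"
    have "integ (\<lambda>y. F y z) = integ (\<lambda>y. \<Sum>W\<in>?\<O>. K W y z)" by (rule integ_cong) (rule dec[OF _ z])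
    also have "\<dots> = (\<Sum>W\<in>?\<O>. integ (\<lambda>y. K W y z))"
      by (rule integ_sum) (rule invariant2_inner[OF invariant2_swap[OF K] z])
    finally show "(\<Sum>W\<in>?\<O>. integ (\<lambda>y. K W y z)) = integ (\<lambda>y. F y z)" by simp
  qed
  finally show ?thesis .
qed

end

section \<open>The operators \<open>E\<^sub>i\<^sub>j\<close>\<close>

context oligomorphic_group begin

lemma PartD:
  assumes "P \<in> Part X G r"
  shows "length P = r" "i < r \<Longrightarrow> ghat_subset X G (P ! i)" "i < r \<Longrightarrow> P ! i \<subseteq> X"
    "i < r \<Longrightarrow> j < r \<Longrightarrow> x \<in> P ! i \<Longrightarrow> x \<in> P ! j \<Longrightarrow> i = j" "x \<in> X \<Longrightarrow> \<exists>i<r. x \<in> P ! i"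
proof -
  show l: "length P = r" using assms by (simp add: Part_def)
  show g: "i < r \<Longrightarrow> ghat_subset X G (P ! i)" for i using assms l by (auto simp: Part_def)
  show "i < r \<Longrightarrow> P ! i \<subseteq> X" by (rule ghat_subset_X[OF g])
  show "i < r \<Longrightarrow> j < r \<Longrightarrow> x \<in> P ! i \<Longrightarrow> x \<in> P ! j \<Longrightarrow> i = j" using assms by (auto simp: Part_def)
  show "x \<in> X \<Longrightarrow> \<exists>i<r. x \<in> P ! i" using assms l by (auto simp: Part_def in_set_conv_nth)
qed

lemma PartI:
  assumes "length P = r" "\<And>i. i < r \<Longrightarrow> ghat_subset X G (P ! i)"
    "\<And>i j x. i < r \<Longrightarrow> j < r \<Longrightarrow> x \<in> P ! i \<Longrightarrow> x \<in> P ! j \<Longrightarrow> i = j"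
    "\<And>x. x \<in> X \<Longrightarrow> \<exists>i<r. x \<in> P ! i"
  shows "P \<in> Part X G r"
proof -
  have "\<Union> (set P) = X"
  proof
    show "\<Union> (set P) \<subseteq> X"
    proof (rule Union_least)
      fix A assume "A \<in> set P"
      then obtain i where "i < r" "A = P ! i" using assms(1) by (auto simp: in_set_conv_nth)
      then show "A \<subseteq> X" using ghat_subset_X[OF assms(2)] by simp
    qed
    show "X \<subseteq> \<Union> (set P)"
    proof
      fix x assume "x \<in> X"
      then obtain i where "i < r" "x \<in> P ! i" using assms(4) by blast
      then show "x \<in> \<Union> (set P)" using assms(1) nth_mem by blast
    qed
  qed
  moreover have "\<forall>A\<in>set P. ghat_subset X G A" using assms(1,2) by (auto simp: in_set_conv_nth)
  moreover have "P ! i \<inter> P ! j = {}" if "i < r" "j < r" "i \<noteq> j" for i j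
    using assms(3)[OF that(1,2)] that(3) by blast
  ultimately show ?thesis using assms(1) by (simp add: Part_def)
qed

text \<open>Identities between moves are proved pointwise through this. The case
  \<open>i = j\<close> is included: the second list update overwrites the first, so nothing
  changes.\<close>

lemma mem_move:
  assumes P: "P \<in> Part X G r" and "i < r" "j < r" "k < r" and y: "y \<in> P ! i"
  shows "z \<in> move i j y P ! k \<longleftrightarrow> (if z = y then k = j else z \<in> P ! k)"
proof -
  have "y \<in> P ! k \<Longrightarrow> k = i" using PartD(4)[OF P assms(4,2) _ y] .
  then show ?thesis using PartD(1)[OF P] assms
    by (auto simp: move_def nth_list_update)
qed

lemma length_move [simp]: "length (move i j y P) = length P" by (simp add: move_def)

lemma move_Part:
  assumes P: "P \<in> Part X G r" and ij: "i < r" "j < r" and y: "y \<in> P ! i"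
  shows "move i j y P \<in> Part X G r"
proof (rule PartI)
  note m = mem_move[OF P ij _ y]
  have yX: "y \<in> X" using PartD(3)[OF P ij(1)] y by auto
  show "length (move i j y P) = r" using PartD(1)[OF P] by simp
  show "ghat_subset X G (move i j y P ! k)" if k: "k < r" for k
  proof -
    have "move i j y P ! k = (P ! k \<inter> (X - {y})) \<union> (if k = j then {y} else {})"
    proof (rule Set.set_eqI)
      fix z
      show "z \<in> move i j y P ! k \<longleftrightarrow> z \<in> (P ! k \<inter> (X - {y})) \<union> (if k = j then {y} else {})"
        unfolding m[OF k] using PartD(3)[OF P k] by auto
    qed
    moreover have "ghat_subset X G {y}" "ghat_subset X G {}" using yX by (auto intro: ghat_subset_finite)
    ultimately have "ghat_subset X G (if k = j then {y} else {})" "ghat_subset X G {y}" by simp_all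
    then show ?thesis unfolding \<open>move i j y P ! k = _\<close>
      by (intro ghat_subset_Un ghat_subset_Int ghat_subset_Diff PartD(2)[OF P k])
  qed
  show "k = k'" if "k < r" "k' < r" "x \<in> move i j y P ! k" "x \<in> move i j y P ! k'" for k k' x
    using that PartD(4)[OF P that(1,2)] by (auto simp: m split: if_splits)
  show "\<exists>k<r. x \<in> move i j y P ! k" if x: "x \<in> X" for x
    using PartD(5)[OF P x] ij by (cases "x = y") (auto simp: m)
qed

lemma Part_eqI:
  assumes "P \<in> Part X G r" "Q \<in> Part X G r" "\<And>k z. k < r \<Longrightarrow> z \<in> P ! k \<longleftrightarrow> z \<in> Q ! k"
  shows "P = Q"
  by (rule nth_equalityI) (use assms PartD(1) in auto)

text \<open>Accounts for the term \<open>E r i l\<close> in a product: the same point is moved on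
  from \<open>j\<close> to \<open>l\<close>.\<close>

lemma move_move_same:
  assumes P: "P \<in> Part X G r" "i < r" "j < r" "l < r" "y \<in> P ! i"
  shows "move j l y (move i j y P) = move i l y P"
proof (rule Part_eqI)
  have y: "y \<in> move i j y P ! j" using P by (simp add: mem_move)
  have m: "move i j y P \<in> Part X G r" using P by (intro move_Part)
  show "move j l y (move i j y P) \<in> Part X G r" by (rule move_Part[OF m P(3,4) y])
  show "move i l y P \<in> Part X G r" by (rule move_Part[OF P(1,2,4,5)])
  show "z \<in> move j l y (move i j y P) ! k \<longleftrightarrow> z \<in> move i l y P ! k" if "k < r" for k z
    using that P by (simp add: mem_move[OF m P(3,4) that y] mem_move[OF P(1)])
qed

text \<open>Makes the integrand over two distinct moved points symmetric.\<close>

lemma move_commute: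
  assumes P: "P \<in> Part X G r" "i < r" "j < r" "k < r" "l < r" "y \<in> P ! i" "z \<in> P ! k" "y \<noteq> z"
  shows "move k l z (move i j y P) = move i j y (move k l z P)"
proof (rule Part_eqI)
  have z: "z \<in> move i j y P ! k" and y: "y \<in> move k l z P ! i" using P by (simp_all add: mem_move)
  have m: "move i j y P \<in> Part X G r" and m': "move k l z P \<in> Part X G r" using P by (simp_all add: move_Part)
  show "move k l z (move i j y P) \<in> Part X G r" by (rule move_Part[OF m P(4,5) z])
  show "move i j y (move k l z P) \<in> Part X G r" by (rule move_Part[OF m' P(2,3) y])
  show "x \<in> move k l z (move i j y P) ! n \<longleftrightarrow> x \<in> move i j y (move k l z P) ! n" if "n < r" for n x
    using that P by (auto simp: mem_move[OF m P(4,5) that z] mem_move[OF m' P(2,3) that y] mem_move[OF P(1)])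
qed

lemma move_same: "P \<in> Part X G r \<Longrightarrow> i < r \<Longrightarrow> y \<in> P ! i \<Longrightarrow> move i i y P = P"
  using PartD(1)[of P r] by (simp add: move_def insert_absorb)

lemma length_part_act [simp]: "length (part_act g P) = length P" by (simp add: part_act_def)

lemma nth_part_act: "k < length P \<Longrightarrow> part_act g P ! k = g ` (P ! k)" by (simp add: part_act_def)

lemma mem_part_act:
  assumes g: "g \<in> G" and P: "P \<in> Part X G r" and k: "k < r" and x: "x \<in> X"
  shows "g x \<in> part_act g P ! k \<longleftrightarrow> x \<in> P ! k"
  using PartD(1,3)[OF P] k x G_eq_iff[OF g x] by (fastforce simp: nth_part_act)

lemma part_act_Part:
  assumes g: "g \<in> G" and P: "P \<in> Part X G r"
  shows "part_act g P \<in> Part X G r"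
proof (rule PartI)
  note m = mem_part_act[OF g P]
  have n: "part_act g P ! k = g ` (P ! k)" if "k < r" for k using that PartD(1)[OF P] by (simp add: nth_part_act)
  show "length (part_act g P) = r" using PartD(1)[OF P] by simp
  show "ghat_subset X G (part_act g P ! i)" if "i < r" for i
    using ghat_subset_image[OF PartD(2)[OF P that] g] n[OF that] by simp
  show "\<exists>i<r. x \<in> part_act g P ! i" if x: "x \<in> X" for x
  proof -
    have "ginv g x \<in> X" using x g by (simp add: G_mem G_closed)
    then obtain i where "i < r" "ginv g x \<in> P ! i" using PartD(5)[OF P] by blast
    then have "g (ginv g x) \<in> part_act g P ! i" using n by auto
    then show ?thesis using \<open>i < r\<close> ginv_apply(2)[OF g x] by auto
  qed
  show "i = j" if ij: "i < r" "j < r" "x \<in> part_act g P ! i" "x \<in> part_act g P ! j" for i j x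
  proof -
    obtain y where y: "y \<in> P ! i" "x = g y" using ij(1,3) n by auto
    then have "y \<in> X" using PartD(3)[OF P that(1)] by auto
    then have "y \<in> P ! j" using m[OF that(2)] that(4) y by simp
    then show ?thesis using PartD(4)[OF P that(1,2)] y by simp
  qed
qed

lemma part_act_mul:
  assumes "g \<in> G" "h \<in> G" and P: "P \<in> Part X G r"
  shows "part_act g (part_act h P) = part_act (g \<cdot> h) P"
proof -
  have "g ` h ` A = (g \<cdot> h) ` A" if "A \<in> set P" for A
  proof -
    have "A \<subseteq> X" using P that by (auto simp: Part_def)
    then show ?thesis using assms by (auto simp: image_image mul_apply subset_iff intro!: image_cong)
  qed
  then show ?thesis by (simp add: part_act_def)
qed

lemma part_act_id:
  assumes P: "P \<in> Part X G r"
  shows "part_act gid P = P"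
proof -
  have "gid ` A = A" if "A \<in> set P" for A
  proof -
    have "A \<subseteq> X" using P that by (auto simp: Part_def)
    then show ?thesis by (force simp: gid_apply)
  qed
  then show ?thesis by (simp add: part_act_def map_idI)
qed

lemma part_act_inv:
  assumes g: "g \<in> G" and P: "P \<in> Part X G r"
  shows "part_act (ginv g) (part_act g P) = P" "part_act g (part_act (ginv g) P) = P"
proof -
  have "g \<in> carrier (BijGroup X)" using G_Bij[OF g] by (simp add: carrier_Bij)
  then show "part_act (ginv g) (part_act g P) = P" "part_act g (part_act (ginv g) P) = P"
    using part_act_mul[OF _ _ P, of "ginv g" g] part_act_mul[OF _ _ P, of g "ginv g"] g
    by (simp_all add: G_closed part_act_id[OF P])
qed

lemma part_act_move:
  assumes g: "g \<in> G" and P: "P \<in> Part X G r" "i < r" "j < r" "y \<in> P ! i"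
  shows "part_act g (move i j y P) = move i j (g y) (part_act g P)"
proof -
  have yX: "y \<in> X" using PartD(3)[OF P(1,2)] P(4) by auto
  have "g ` (P ! i - {y}) = g ` (P ! i) - {g y}"
    using inj_on_image_set_diff[OF G_inj[OF g], of "P ! i" "{y}"] PartD(3)[OF P(1,2)] yX by auto
  then show ?thesis using P PartD(1)[OF P(1)] by (simp add: move_def part_act_def map_update)
qed

section \<open>Smooth functions on partitions\<close>

definition part_stab :: "'x set list \<Rightarrow> ('x \<Rightarrow> 'x) set" where
  "part_stab P = G \<inter> (\<Inter>A\<in>set P. {g \<in> G. g ` A = A})"

lemma osub_part_stab: "P \<in> Part X G r \<Longrightarrow> osub (part_stab P)"
  unfolding part_stab_def by (intro osub_Inter osub_setwise_stab) (simp_all add: Part_def)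

lemma part_stab_act: "u \<in> part_stab P \<Longrightarrow> part_act u P = P"
  by (auto simp: part_stab_def part_act_def intro!: map_idI)

text \<open>Being fixed by all translations from \<open>U\<close>, written without inverses; for
  functions vanishing off \<open>Part\<close> the two agree because \<open>U\<close> is closed under
  inverses.\<close>

definition part_invariant :: "nat \<Rightarrow> ('x \<Rightarrow> 'x) set \<Rightarrow> ('x set list \<Rightarrow> 'k::field) \<Rightarrow> bool" where
  "part_invariant r U \<phi> \<longleftrightarrow> osub U \<and> (\<forall>u\<in>U. \<forall>P\<in>Part X G r. \<phi> (part_act u P) = \<phi> P)"

abbreviation S where "S r \<equiv> schwartz X G (Part X G r) part_act"

abbreviation tr where "tr r \<equiv> translate X (Part X G r) part_act"

lemma tr_apply: "P \<in> Part X G r \<Longrightarrow> tr r g \<phi> P = \<phi> (part_act (ginv g) P)"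
  by (simp add: translate_def)

lemma translate_invariant_iff:
  assumes U: "osub U" and z: "\<forall>P. P \<notin> Part X G r \<longrightarrow> \<phi> P = 0"
  shows "(\<forall>u\<in>U. tr r u \<phi> = \<phi>) \<longleftrightarrow> part_invariant r U \<phi>"
proof
  assume a: "\<forall>u\<in>U. tr r u \<phi> = \<phi>"
  have "\<phi> (part_act u P) = \<phi> P" if u: "u \<in> U" and P: "P \<in> Part X G r" for u P
  proof -
    have uG: "u \<in> G" by (rule osubD(1)[OF U u])
    have "\<phi> (part_act u P) = tr r u \<phi> (part_act u P)" using a u by simp
    also have "\<dots> = \<phi> P" using part_act_Part[OF uG P] part_act_inv(1)[OF uG P] by (simp add: tr_apply)
    finally show ?thesis .
  qed
  then show "part_invariant r U \<phi>" using U by (simp add: part_invariant_def)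
next
  assume a: "part_invariant r U \<phi>"
  show "\<forall>u\<in>U. tr r u \<phi> = \<phi>"
  proof (intro ballI ext)
    fix u P assume "u \<in> U"
    then show "tr r u \<phi> P = \<phi> P"
      using a z osubD(3)[OF U] by (cases "P \<in> Part X G r") (auto simp: tr_apply part_invariant_def translate_def)
  qed
qed

lemma schwartz_iff:
  "\<phi> \<in> S r \<longleftrightarrow> (\<forall>P. P \<notin> Part X G r \<longrightarrow> \<phi> P = 0) \<and> (\<exists>U. part_invariant r U \<phi>)"
proof -
  have "(\<exists>U. osub U \<and> (\<forall>u\<in>U. tr r u \<phi> = \<phi>)) \<longleftrightarrow> (\<exists>U. part_invariant r U \<phi>)"
    if "\<forall>P. P \<notin> Part X G r \<longrightarrow> \<phi> P = 0"
    using translate_invariant_iff[OF _ that] by (metis part_invariant_def)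
  then show ?thesis by (auto simp: schwartz_def)
qed

lemma schwartz_zero: "(\<lambda>P. 0) \<in> S r"
  using osub_G by (auto simp: schwartz_iff part_invariant_def)

lemma schwartz_add:
  assumes "\<phi> \<in> S r" "\<psi> \<in> S r"
  shows "(\<lambda>P. \<phi> P + \<psi> P) \<in> S r"
proof -
  obtain U V where "part_invariant r U \<phi>" "part_invariant r V \<psi>" using assms by (auto simp: schwartz_iff)
  moreover from this have "osub (U \<inter> V)" by (auto simp: part_invariant_def intro: osub_Int)
  ultimately have "part_invariant r (U \<inter> V) (\<lambda>P. \<phi> P + \<psi> P)" by (simp add: part_invariant_def)
  then show ?thesis using assms by (auto simp: schwartz_iff)
qed

lemma schwartz_scale: "\<phi> \<in> S r \<Longrightarrow> (\<lambda>P. c * \<phi> P) \<in> S r"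
  by (auto simp: schwartz_iff part_invariant_def)

lemma schwartz_sum: "(\<And>i. i \<in> I \<Longrightarrow> f i \<in> S r) \<Longrightarrow> (\<lambda>P. \<Sum>i\<in>I. f i P) \<in> S r"
  by (induction I rule: infinite_finite_induct) (simp_all add: schwartz_zero schwartz_add)

text \<open>If \<open>U\<close> fixes \<phi>, its conjugate by \<open>g\<close> fixes the
  translate.\<close>

lemma tr_schwartz:
  assumes g: "g \<in> G" and \<phi>: "\<phi> \<in> S r"
  shows "tr r g \<phi> \<in> S r"
proof -
  obtain U where U: "part_invariant r U \<phi>" using \<phi> by (auto simp: schwartz_iff)
  then have osU: "osub U" by (simp add: part_invariant_def)
  have C: "osub ((\<lambda>u. g \<cdot> u \<cdot> ginv g) ` U)" by (rule osub_conj[OF osU g])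
  have "tr r g \<phi> (part_act (g \<cdot> u \<cdot> ginv g) P) = tr r g \<phi> P" if u: "u \<in> U" and P: "P \<in> Part X G r" for u P
  proof -
    have uG: "u \<in> G" by (rule osubD(1)[OF osU u])
    have P': "part_act (ginv g) P \<in> Part X G r" by (rule part_act_Part[OF G_closed(2)[OF g] P])
    have uP': "part_act u (part_act (ginv g) P) \<in> Part X G r" by (rule part_act_Part[OF uG P'])
    have "part_act (g \<cdot> u \<cdot> ginv g) P = part_act g (part_act u (part_act (ginv g) P))"
      using P g uG G_closed G_Bij
      by (simp add: part_act_mul[OF _ _ P] part_act_mul[OF _ _ P'] B.m_assoc carrier_Bij)
    then have "tr r g \<phi> (part_act (g \<cdot> u \<cdot> ginv g) P) = \<phi> (part_act u (part_act (ginv g) P))"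
      using part_act_Part[OF g uP'] part_act_inv(1)[OF g uP'] by (simp add: tr_apply)
    also have "\<dots> = \<phi> (part_act (ginv g) P)" using U u P' by (simp add: part_invariant_def)
    finally show ?thesis using P by (simp add: tr_apply)
  qed
  then have "part_invariant r ((\<lambda>u. g \<cdot> u \<cdot> ginv g) ` U) (tr r g \<phi>)" using C by (auto simp: part_invariant_def)
  then show ?thesis by (auto simp: schwartz_iff translate_def)
qed

end

section \<open>The operators as integrals, and their products\<close>

context oligomorphic_measure begin

abbreviation E where "E \<equiv> E_op X G \<mu>"

text \<open>Extended by zero outside \<open>P ! i\<close>, so that integrals run over all of
  \<open>X\<close>.\<close>

definition move_fun :: "nat \<Rightarrow> nat \<Rightarrow> ('x set list \<Rightarrow> 'k) \<Rightarrow> 'x set list \<Rightarrow> 'x \<Rightarrow> 'k" where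
  "move_fun i j \<phi> P y = (if y \<in> P ! i then \<phi> (move i j y P) else 0)"

lemma move_fun_invariant:
  assumes U: "part_invariant r U \<phi>" "\<And>u. u \<in> U \<Longrightarrow> part_act u P = P"
    and P: "P \<in> Part X G r" "i < r" "j < r"
  shows "invariant_under U (move_fun i j \<phi> P)"
proof -
  have osU: "osub U" using U by (simp add: part_invariant_def)
  have "move_fun i j \<phi> P (u y) = move_fun i j \<phi> P y" if u: "u \<in> U" and y: "y \<in> X" for u y
  proof -
    have uG: "u \<in> G" by (rule osubD(1)[OF osU u])
    have m: "u y \<in> P ! i \<longleftrightarrow> y \<in> P ! i" using mem_part_act[OF uG P(1,2) y] U(2)[OF u] by simp
    have "\<phi> (move i j (u y) P) = \<phi> (move i j y P)" if yP: "y \<in> P ! i"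
    proof -
      have "move i j (u y) P = part_act u (move i j y P)"
        using part_act_move[OF uG P yP] U(2)[OF u] by simp
      then show ?thesis using U(1) u move_Part[OF P yP] by (simp add: part_invariant_def)
    qed
    then show ?thesis using m by (simp add: move_fun_def)
  qed
  then show ?thesis using osU by (simp add: invariant_under_def)
qed

text \<open>Among other things, shows that a subgroup as chosen in \<open>E_op\<close>
  exists.\<close>

lemma schwartz_stab:
  assumes "\<phi> \<in> S r" "P \<in> Part X G r"
  shows "\<exists>U. part_invariant r U \<phi> \<and> (\<forall>u\<in>U. \<forall>A\<in>set P. u ` A = A) \<and> (\<forall>u\<in>U. part_act u P = P)"
proof -
  obtain U where U: "part_invariant r U \<phi>" using assms by (auto simp: schwartz_iff)
  then have "osub (U \<inter> part_stab P)"
    using osub_part_stab[OF assms(2)] by (auto simp: part_invariant_def intro: osub_Int)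
  then have "part_invariant r (U \<inter> part_stab P) \<phi>" using U by (auto simp: part_invariant_def)
  then show ?thesis using part_stab_act
    by (intro exI[of _ "U \<inter> part_stab P"]) (auto simp: part_stab_def)
qed

lemma move_fun_smooth:
  assumes "\<phi> \<in> S r" "P \<in> Part X G r" "i < r" "j < r"
  shows "smooth_fun (move_fun i j \<phi> P)"
proof -
  obtain U where U: "part_invariant r U \<phi>" "\<forall>u\<in>U. part_act u P = P"
    using schwartz_stab[OF assms(1,2)] by blast
  have "invariant_under U (move_fun i j \<phi> P)"
    by (rule move_fun_invariant[OF U(1) _ assms(2-4)]) (use U(2) in simp)
  then show ?thesis by (auto simp: smooth_fun_def)
qed

text \<open>Removes the chosen subgroup from \<open>E_op\<close>. For \<open>i = j\<close> moving a
  point changes nothing, so the integrand is the constant \<open>\<phi> P\<close> on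
  \<open>P ! i\<close>, and the diagonal operators obey the same formula.\<close>

lemma E_eq:
  assumes \<phi>: "\<phi> \<in> S r" and P: "P \<in> Part X G r" and ij: "i < r" "j < r"
  shows "E r i j \<phi> P = integ (move_fun i j \<phi> P)"
proof (cases "i = j")
  case True
  have "integ (move_fun i j \<phi> P) = integ (\<lambda>y. if y \<in> P ! i then \<phi> P else 0)"
    by (rule integ_cong) (simp add: move_fun_def True move_same[OF P ij(2)])
  also have "\<dots> = \<phi> P * nu (P ! i)" by (rule integ_indicator[OF PartD(2)[OF P ij(1)]])
  finally show ?thesis using True P by (simp add: E_op_def nu_def mult.commute)
next
  case False
  define U where "U = (SOME U. osub U \<and> (\<forall>u\<in>U. tr r u \<phi> = \<phi>) \<and> (\<forall>u\<in>U. \<forall>A\<in>set P. u ` A = A))"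
  have z: "\<forall>P. P \<notin> Part X G r \<longrightarrow> \<phi> P = 0" using \<phi> by (simp add: schwartz_iff)
  obtain V where V: "part_invariant r V \<phi>" "\<forall>u\<in>V. \<forall>A\<in>set P. u ` A = A"
    using schwartz_stab[OF \<phi> P] by blast
  have osV: "osub V" using V by (simp add: part_invariant_def)
  have "osub V \<and> (\<forall>u\<in>V. tr r u \<phi> = \<phi>) \<and> (\<forall>u\<in>V. \<forall>A\<in>set P. u ` A = A)"
    using osV V translate_invariant_iff[OF osV z] by simp
  then have U: "osub U \<and> (\<forall>u\<in>U. tr r u \<phi> = \<phi>) \<and> (\<forall>u\<in>U. \<forall>A\<in>set P. u ` A = A)"
    unfolding U_def by (rule someI)
  then have inv: "part_invariant r U \<phi>" and osU: "osub U" using translate_invariant_iff[OF _ z] by auto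
  have act: "part_act u P = P" if "u \<in> U" for u
  proof -
    have "\<forall>A\<in>set P. u ` A = A" using U that by blast
    then show ?thesis by (simp add: part_act_def map_idI)
  qed
  have "integ (move_fun i j \<phi> P) = (\<Sum>Q\<in>orb U ` X. nu Q * move_fun i j \<phi> P (SOME y. y \<in> Q))"
    by (rule integ_orbs[OF move_fun_invariant[OF inv act P ij]])
  also have "\<dots> = (\<Sum>Q\<in>orb U ` (P ! i). nu Q * \<phi> (move i j (SOME y. y \<in> Q) P))"
  \<comment> \<open>An orbit meeting \<open>P ! i\<close> stays inside it because \<open>U\<close>
    stabilizes this part; on all other orbits the integrand is zero.\<close>
  proof (rule sum.mono_neutral_cong_right[OF finite_orbs[OF osU]])
    show "orb U ` (P ! i) \<subseteq> orb U ` X" using PartD(3)[OF P ij(1)] by auto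
    have Pi: "P ! i \<in> set P" using ij PartD(1)[OF P] by simp
    have sub: "orb U y \<subseteq> P ! i" if "y \<in> P ! i" for y
    proof -
      have "u ` (P ! i) = P ! i" if "u \<in> U" for u using U Pi that by blast
      then show ?thesis using that by (auto simp: orb_def)
    qed
    show "\<forall>Q\<in>orb U ` X - orb U ` (P ! i). nu Q * move_fun i j \<phi> P (SOME y. y \<in> Q) = 0"
    proof
      fix Q assume Q: "Q \<in> orb U ` X - orb U ` (P ! i)"
      then obtain x where x: "x \<in> X" "Q = orb U x" by auto
      have "(SOME y. y \<in> Q) \<in> Q" using some_orb[OF osU x(1)] x(2) by simp
      moreover have "y \<notin> P ! i" if "y \<in> Q" for y
        using orb_eq[OF osU x(1)] that x Q by blast
      ultimately show "nu Q * move_fun i j \<phi> P (SOME y. y \<in> Q) = 0" by (simp add: move_fun_def)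
    qed
    show "nu Q * move_fun i j \<phi> P (SOME y. y \<in> Q) = nu Q * \<phi> (move i j (SOME y. y \<in> Q) P)"
      if Q: "Q \<in> orb U ` (P ! i)" for Q
    proof -
      obtain x where x: "x \<in> P ! i" "Q = orb U x" using Q by auto
      then have "(SOME y. y \<in> Q) \<in> Q" using some_orb[OF osU] PartD(3)[OF P ij(1)] by auto
      then have "(SOME y. y \<in> Q) \<in> P ! i" using sub x by auto
      then show ?thesis by (simp add: move_fun_def)
    qed
  qed
  also have "orb U ` (P ! i) = orbits (perm_group X U) (P ! i) (\<lambda>u. u)"
    by (auto simp: orbits_def orbit_def orb_def)
  finally show ?thesis using False P by (simp add: E_op_def U_def[symmetric] nu_def Let_def)
qed

lemma E_outside: "P \<notin> Part X G r \<Longrightarrow> E r i j \<phi> P = 0" by (simp add: E_op_def)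

text \<open>Moves commute with the group action, and the integral is invariant under the
  substitution by \<open>ginv g\<close>.\<close>

lemma E_tr:
  assumes \<phi>: "\<phi> \<in> S r" and g: "g \<in> G" and ij: "i < r" "j < r"
  shows "E r i j (tr r g \<phi>) = tr r g (E r i j \<phi>)"
proof
  fix P
  show "E r i j (tr r g \<phi>) P = tr r g (E r i j \<phi>) P"
  proof (cases "P \<in> Part X G r")
    case P: True
    have g': "ginv g \<in> G" by (rule G_closed(2)[OF g])
    let ?P = "part_act (ginv g) P"
    have P': "?P \<in> Part X G r" by (rule part_act_Part[OF g' P])
    have "move_fun i j (tr r g \<phi>) P y = move_fun i j \<phi> ?P (ginv g y)" if y: "y \<in> X" for y
      using mem_part_act[OF g' P ij(1) y] move_Part[OF P ij] part_act_move[OF g' P ij]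
      by (simp add: move_fun_def tr_apply)
    then have "integ (move_fun i j (tr r g \<phi>) P) = integ (\<lambda>y. move_fun i j \<phi> ?P (ginv g y))"
      by (rule integ_cong)
    also have "\<dots> = integ (move_fun i j \<phi> ?P)"
      by (rule integ_translate[OF move_fun_smooth[OF \<phi> P' ij] g'])
    finally show ?thesis
      using E_eq[OF tr_schwartz[OF g \<phi>] P ij] E_eq[OF \<phi> P' ij] P by (simp add: tr_apply)
  qed (simp add: E_outside translate_def)
qed

text \<open>By equivariance, every open subgroup fixing \<phi> also fixes its image.\<close>

lemma E_schwartz:
  assumes \<phi>: "\<phi> \<in> S r" and ij: "i < r" "j < r"
  shows "E r i j \<phi> \<in> S r"
proof -
  obtain U where U: "part_invariant r U \<phi>" using \<phi> by (auto simp: schwartz_iff)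
  then have osU: "osub U" by (simp add: part_invariant_def)
  have z: "\<forall>P. P \<notin> Part X G r \<longrightarrow> \<phi> P = 0" using \<phi> by (simp add: schwartz_iff)
  have "tr r u (E r i j \<phi>) = E r i j \<phi>" if "u \<in> U" for u
    using E_tr[OF \<phi> osubD(1)[OF osU that] ij] translate_invariant_iff[OF osU z] U that by simp
  then have "part_invariant r U (E r i j \<phi>)"
    using translate_invariant_iff[OF osU, of r "E r i j \<phi>"] by (simp add: E_outside)
  then show ?thesis by (auto simp: schwartz_iff E_outside)
qed

lemma E_add:
  assumes "\<phi> \<in> S r" "\<psi> \<in> S r" and ij: "i < r" "j < r"
  shows "E r i j (\<lambda>P. \<phi> P + \<psi> P) P = E r i j \<phi> P + E r i j \<psi> P"
proof (cases "P \<in> Part X G r")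
  case True
  have "integ (move_fun i j (\<lambda>P. \<phi> P + \<psi> P) P) = integ (\<lambda>y. move_fun i j \<phi> P y + move_fun i j \<psi> P y)"
    by (rule integ_cong) (simp add: move_fun_def)
  then show ?thesis using True assms schwartz_add[OF assms(1,2)]
    by (simp add: E_eq integ_add[OF move_fun_smooth move_fun_smooth])
qed (simp add: E_outside)

lemma E_scale:
  assumes "\<phi> \<in> S r" and ij: "i < r" "j < r"
  shows "E r i j (\<lambda>P. c * \<phi> P) P = c * E r i j \<phi> P"
proof (cases "P \<in> Part X G r")
  case True
  have "integ (move_fun i j (\<lambda>P. c * \<phi> P) P) = integ (\<lambda>y. c * move_fun i j \<phi> P y)"
    by (rule integ_cong) (simp add: move_fun_def)
  then show ?thesis using True assms schwartz_scale[OF assms(1)]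
    by (simp add: E_eq integ_scale[OF move_fun_smooth])
qed (simp add: E_outside)

lemma E_sum:
  assumes "\<And>p. p \<in> I \<Longrightarrow> f p \<in> S r" and ij: "i < r" "j < r"
  shows "E r i j (\<lambda>P. \<Sum>p\<in>I. f p P) P = (\<Sum>p\<in>I. E r i j (f p) P)"
proof -
  have z: "E r i j (\<lambda>P. 0) P = 0" using E_scale[OF schwartz_zero ij, where c = 0 and P = P] by simp
  show ?thesis using assms(1)
  proof (induction I rule: infinite_finite_induct)
    case (insert p I)
    then show ?case using E_add[OF _ schwartz_sum ij, of "f p" I f P] by simp
  qed (simp_all add: z)
qed

text \<open>The second point is taken from part \<open>k\<close> of \<open>P\<close> itself, not of
  the moved partition; for \<open>z\<close> different from \<open>y\<close> this makes no
  difference, and it makes the condition symmetric.\<close>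

definition move2_fun ::
  "nat \<Rightarrow> nat \<Rightarrow> nat \<Rightarrow> nat \<Rightarrow> ('x set list \<Rightarrow> 'k) \<Rightarrow> 'x set list \<Rightarrow> 'x \<Rightarrow> 'x \<Rightarrow> 'k" where
  "move2_fun i j k l \<phi> P y z =
     (if y \<in> P ! i \<and> z \<in> P ! k \<and> z \<noteq> y then \<phi> (move k l z (move i j y P)) else 0)"

lemma move2_fun_invariant:
  assumes \<phi>: "\<phi> \<in> S r" and P: "P \<in> Part X G r" and ijkl: "i < r" "j < r" "k < r" "l < r"
  shows "\<exists>U. invariant2 U (move2_fun i j k l \<phi> P)"
proof -
  obtain U where U: "part_invariant r U \<phi>" "\<forall>u\<in>U. part_act u P = P"
    using schwartz_stab[OF \<phi> P] by blast
  have osU: "osub U" using U by (simp add: part_invariant_def)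
  have "move2_fun i j k l \<phi> P (u y) (u z) = move2_fun i j k l \<phi> P y z"
    if u: "u \<in> U" and yz: "y \<in> X" "z \<in> X" for u y z
  proof -
    have uG: "u \<in> G" by (rule osubD(1)[OF osU u])
    have m: "u y \<in> P ! i \<longleftrightarrow> y \<in> P ! i" "u z \<in> P ! k \<longleftrightarrow> z \<in> P ! k" "u z = u y \<longleftrightarrow> z = y"
      using mem_part_act[OF uG P ijkl(1) yz(1)] mem_part_act[OF uG P ijkl(3) yz(2)] U(2) u
        G_eq_iff[OF uG yz(2,1)] by simp_all
    have "\<phi> (move k l (u z) (move i j (u y) P)) = \<phi> (move k l z (move i j y P))"
      if c: "y \<in> P ! i" "z \<in> P ! k" "z \<noteq> y"
    proof -
      have mP: "move i j y P \<in> Part X G r" by (rule move_Part[OF P ijkl(1,2) c(1)])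
      have z: "z \<in> move i j y P ! k" using c by (simp add: mem_move[OF P ijkl(1-3) c(1)])
      have "move k l (u z) (move i j (u y) P) = part_act u (move k l z (move i j y P))"
        using part_act_move[OF uG P ijkl(1,2) c(1)] part_act_move[OF uG mP ijkl(3,4) z] U(2) u by simp
      then show ?thesis using U(1) u move_Part[OF mP ijkl(3,4) z] by (simp add: part_invariant_def)
    qed
    then show ?thesis using m by (simp add: move2_fun_def)
  qed
  then show ?thesis using osU by (auto simp: invariant2_def)
qed

definition pair_integ where
  "pair_integ i j k l \<phi> P = integ (\<lambda>y. integ (move2_fun i j k l \<phi> P y))"

lemma pair_integ_symmetric:
  assumes \<phi>: "\<phi> \<in> S r" and P: "P \<in> Part X G r" and ijkl: "i < r" "j < r" "k < r" "l < r"
  shows "pair_integ i j k l \<phi> P = pair_integ k l i j \<phi> P"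
proof -
  obtain U where U: "invariant2 U (move2_fun i j k l \<phi> P)"
    using move2_fun_invariant[OF assms] by blast
  have "move2_fun i j k l \<phi> P y z = move2_fun k l i j \<phi> P z y" for y z
    using move_commute[OF P ijkl, of y z] by (auto simp: move2_fun_def)
  then have "integ (\<lambda>z. integ (\<lambda>y. move2_fun i j k l \<phi> P y z)) = pair_integ k l i j \<phi> P"
    by (simp add: pair_integ_def)
  then show ?thesis using integ_Fubini[OF U] by (simp add: pair_integ_def)
qed

text \<open>The two points moved by \<open>E\<^sub>i\<^sub>j E\<^sub>k\<^sub>l\<close> coincide or not; only the first case is asymmetric.\<close>

lemma E_E:
  assumes \<phi>: "\<phi> \<in> S r" and P: "P \<in> Part X G r" and ijkl: "i < r" "j < r" "k < r" "l < r"
  shows "E r i j (E r k l \<phi>) P = (if j = k then E r i l \<phi> P else 0) + pair_integ i j k l \<phi> P"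
proof -
  obtain U where U: "invariant2 U (move2_fun i j k l \<phi> P)"
    using move2_fun_invariant[OF assms] by blast
  have "move_fun i j (E r k l \<phi>) P y =
      (if j = k then move_fun i l \<phi> P y else 0) + integ (move2_fun i j k l \<phi> P y)" for y
  proof (cases "y \<in> P ! i")
    case y: True
    have yX: "y \<in> X" using PartD(3)[OF P ijkl(1)] y by auto
    let ?M = "move i j y P"
    have M: "?M \<in> Part X G r" by (rule move_Part[OF P ijkl(1,2) y])
    note m = mem_move[OF P ijkl(1-3) y]
    have "E r k l \<phi> ?M = integ (move_fun k l \<phi> ?M)" by (rule E_eq[OF \<phi> M ijkl(3,4)])
    \<comment> \<open>The point \<open>z = y\<close> is split off from the inner integral, as the
      one point where membership depends on the first move.\<close>
    also have "\<dots> = move_fun k l \<phi> ?M y + integ (\<lambda>z. if z = y then 0 else move_fun k l \<phi> ?M z)"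
      by (rule integ_remove_point(1)[OF move_fun_smooth[OF \<phi> M ijkl(3,4)] yX])
    \<comment> \<open>After the first move \<open>y\<close> lies in part \<open>j\<close> only, so
      it can be moved again exactly when \<open>j = k\<close>.\<close>
    also have "move_fun k l \<phi> ?M y = (if j = k then move_fun i l \<phi> P y else 0)"
      using y move_move_same[OF P ijkl(1,2,4) y] m[of y] by (cases "j = k") (simp_all add: move_fun_def)
    also have "integ (\<lambda>z. if z = y then 0 else move_fun k l \<phi> ?M z) = integ (move2_fun i j k l \<phi> P y)"
      by (rule integ_cong) (simp add: move_fun_def move2_fun_def m y)
    finally show ?thesis using y by (simp add: move_fun_def)
  next
    case False
    have "integ (move2_fun i j k l \<phi> P y) = integ (\<lambda>z. 0)"
      by (rule integ_cong) (simp add: move2_fun_def False)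
    then show ?thesis using False by (simp add: move_fun_def)
  qed
  then have e: "move_fun i j (E r k l \<phi>) P =
      (\<lambda>y. (if j = k then move_fun i l \<phi> P y else 0) + integ (move2_fun i j k l \<phi> P y))" by (rule ext)
  have "E r i j (E r k l \<phi>) P =
      integ (\<lambda>y. (if j = k then move_fun i l \<phi> P y else 0) + integ (move2_fun i j k l \<phi> P y))"
    using E_eq[OF E_schwartz[OF \<phi> ijkl(3,4)] P ijkl(1,2)] unfolding e .
  also have "\<dots> = (if j = k then E r i l \<phi> P else 0) + pair_integ i j k l \<phi> P"
  proof (cases "j = k")
    case True
    then show ?thesis
      using integ_add[OF move_fun_smooth[OF \<phi> P ijkl(1,4)] invariant2_outer[OF U]]
        E_eq[OF \<phi> P ijkl(1,4)] by (simp add: pair_integ_def)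
  qed (simp add: pair_integ_def)
  finally show ?thesis .
qed

end

section \<open>The representation of \<open>gl\<^sub>r\<close>\<close>

lemma lie_algebra_mat:
  fixes L :: "('k::field, 'k mat, 'm) lie_algebra_scheme"
  assumes ops: "add L = (+)" "zero L = 0\<^sub>m r r" "smult L = (\<cdot>\<^sub>m)" "lie_bracket L = (\<lambda>A B. A * B - B * A)"
    and sub: "carrier L \<subseteq> carrier_mat r r" "0\<^sub>m r r \<in> carrier L"
    and cl: "lie_closed L"
  shows "lie_algebra L"
proof -
  interpret lie_closed L by (rule cl)
  have c: "A \<in> carrier_mat r r" if "A \<in> carrier L" for A using sub(1) that by blast
  have "abelian_group L"
  proof (rule abelian_groupI)
    show "\<exists>B\<in>carrier L. B \<oplus>\<^bsub>L\<^esub> A = \<zero>\<^bsub>L\<^esub>" if "A \<in> carrier L" for A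
      using smult_closed[OF that, of "- 1"] c[OF that]
      by (intro bexI[of _ "(- 1) \<cdot>\<^sub>m A"]) (auto simp: ops intro!: eq_matI)
    show "A \<oplus>\<^bsub>L\<^esub> B = B \<oplus>\<^bsub>L\<^esub> A" if "A \<in> carrier L" "B \<in> carrier L" for A B
      using comm_add_mat[OF c[OF that(1)] c[OF that(2)]] by (simp add: ops)
    show "A \<oplus>\<^bsub>L\<^esub> B \<oplus>\<^bsub>L\<^esub> C = A \<oplus>\<^bsub>L\<^esub> (B \<oplus>\<^bsub>L\<^esub> C)" if "A \<in> carrier L" "B \<in> carrier L" "C \<in> carrier L" for A B C
      using assoc_add_mat[OF c[OF that(1)] c[OF that(2)] c[OF that(3)]] by (simp add: ops)
    show "\<zero>\<^bsub>L\<^esub> \<oplus>\<^bsub>L\<^esub> A = A" if "A \<in> carrier L" for A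
      using left_add_zero_mat[OF c[OF that]] by (simp add: ops)
  qed (use add_closed sub(2) in \<open>simp_all add: ops\<close>)
  then have "vectorspace class_ring L"
    by (rule vectorspace_class_ringI[OF _ smult_closed])
      (auto dest!: c simp: ops algebra_simps intro!: eq_matI)
  moreover have "lie_algebra_axioms L"
  proof (unfold_locales, goal_cases)
    case (1 x y)
    then show ?case by (rule bracket_closed)
  next
    case (2 x y z)
    then show ?case using c[OF 2(1)] c[OF 2(2)] c[OF 2(3)]
      by (simp add: ops add_mult_distrib_mat[where nr = r and n = r and nc = r] mult_add_distrib_mat[where nr = r and n = r and nc = r])
        (rule eq_matI; simp del: index_mult_mat(1) add: algebra_simps)
  next
    case (3 x y z)
    then show ?case using c[OF 3(1)] c[OF 3(2)] c[OF 3(3)]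
      by (simp add: ops add_mult_distrib_mat[where nr = r and n = r and nc = r] mult_add_distrib_mat[where nr = r and n = r and nc = r])
        (rule eq_matI; simp del: index_mult_mat(1) add: algebra_simps)
  next
    case (4 x y a)
    then show ?case using c[OF 4(1)] c[OF 4(2)]
      by (simp add: ops mult_smult_distrib[where nr = r and n = r and nc = r] mult_smult_assoc_mat[where nr = r and n = r and nc = r])
        (rule eq_matI; simp del: index_mult_mat(1) add: algebra_simps)
  next
    case (5 x y a)
    then show ?case using c[OF 5(1)] c[OF 5(2)]
      by (simp add: ops mult_smult_distrib[where nr = r and n = r and nc = r] mult_smult_assoc_mat[where nr = r and n = r and nc = r])
        (rule eq_matI; simp del: index_mult_mat(1) add: algebra_simps)
  next
    case (6 x)
    then show ?case using c[OF 6] by (auto simp: ops intro!: eq_matI)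
  next
    case (7 x y z)
    note m = c[OF 7(1)] c[OF 7(2)] c[OF 7(3)]
    \<comment> \<open>Each double bracket becomes four triple products, and the cyclic sum cancels
      entrywise.\<close>
    have b: "A * (B * C - C * B) - (B * C - C * B) * A = (A * B * C - A * C * B) - (B * C * A - C * B * A)"
      if "A \<in> carrier_mat r r" "B \<in> carrier_mat r r" "C \<in> carrier_mat r r" for A B C :: "'k mat"
    proof -
      have "A * (B * C - C * B) = A * (B * C) - A * (C * B)"
        by (rule mult_minus_distrib_mat) (use that in auto)
      moreover have "(B * C - C * B) * A = B * C * A - C * B * A"
        by (rule minus_mult_distrib_mat) (use that in auto)
      moreover have "A * (B * C) = A * B * C" "A * (C * B) = A * C * B"
        using assoc_mult_mat[OF that] assoc_mult_mat[OF that(1,3,2)] by simp_all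
      ultimately show ?thesis by simp
    qed
    show ?case
      unfolding ops b[OF m] b[OF m(2,3,1)] b[OF m(3,1,2)]
      by (rule eq_matI) (use m in \<open>simp_all del: index_mult_mat(1)\<close>)
  qed
  ultimately show ?thesis by (simp add: lie_algebra_def)
qed

lemma lie_algebra_gl: "lie_algebra (gl r :: ('k::field, 'k mat) lie_algebra)"
  by (rule lie_algebra_mat[of _ r]) (auto intro!: lie_closed.intro minus_carrier_mat mult_carrier_mat)

lemma lie_algebra_sl: "lie_algebra (sl r :: ('k::field, 'k mat) lie_algebra)"
  by (rule lie_algebra_mat[of _ r]) (auto intro: lie_closed_sl)

section \<open>Representations on spaces of functions\<close>

lemma fun_space_simps [simp]:
  "carrier (fun_space W) = W" "zero (fun_space W) = (\<lambda>_. 0)" "add (fun_space W) = (\<lambda>v w y. v y + w y)"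
  "smult (fun_space W) = (\<lambda>c v y. c * v y)"
  by (simp_all add: fun_space_def)

lemma vectorspace_fun_space:
  fixes W :: "('y \<Rightarrow> 'k::field) set"
  assumes "(\<lambda>_. 0) \<in> W" "\<And>v w. v \<in> W \<Longrightarrow> w \<in> W \<Longrightarrow> (\<lambda>y. v y + w y) \<in> W"
    "\<And>c v. v \<in> W \<Longrightarrow> (\<lambda>y. c * v y) \<in> W"
  shows "vectorspace class_ring (fun_space W)"
proof (rule vectorspace_class_ringI)
  show "abelian_group (fun_space W)"
  proof (rule abelian_groupI)
    show "\<exists>w\<in>carrier (fun_space W). w \<oplus>\<^bsub>fun_space W\<^esub> v = \<zero>\<^bsub>fun_space W\<^esub>"
      if "v \<in> carrier (fun_space W)" for v
      using assms(3)[of v "- 1"] that by (intro bexI[of _ "\<lambda>y. - 1 * v y"]) auto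
  qed (use assms in \<open>auto simp: algebra_simps\<close>)
qed (use assms in \<open>auto simp: algebra_simps\<close>)

lemma minus_fun_space:
  fixes W :: "('y \<Rightarrow> 'k::field) set"
  assumes V: "vectorspace class_ring (fun_space W)" and v: "v \<in> W" and w: "w \<in> W"
  shows "v \<ominus>\<^bsub>fun_space W\<^esub> w = (\<lambda>y. v y - w y)"
proof -
  interpret vectorspace class_ring "fun_space W" by (rule V)
  have m: "(\<lambda>y. - 1 * w y) \<in> W" using smult_closed[of "- 1" w] w by simp
  have "\<ominus>\<^bsub>fun_space W\<^esub> w = (\<lambda>y. - w y)"
    by (rule minus_equality) (use w m in auto)
  then show ?thesis by (simp add: a_minus_def)
qed

text \<open>The delicate point is the bracket: its difference is formed in
  \<open>fun_space W\<close> on one side and in \<open>fun_space T\<close> on the other, and both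
  are pointwise.\<close>

lemma sub_lie_rep_fun_space:
  assumes rep: "lie_rep L (fun_space T) \<rho>" and L: "lie_algebra L'"
    and sub: "carrier L' \<subseteq> carrier L" "add L' = add L" "smult L' = smult L" "lie_bracket L' = lie_bracket L"
    and W: "lie_subrep L' (fun_space T) \<rho> W"
  shows "lie_rep L' (fun_space W) \<rho>"
proof -
  have V: "vectorspace class_ring (fun_space T)" using rep by (simp add: lie_rep_def)
  have s: "submodule class_ring W (fun_space T)" using W by (simp add: lie_subrep_def subspace_def)
  have WT: "W \<subseteq> T" using submodule.subset[OF s] by simp
  have VW: "vectorspace class_ring (fun_space W)"
    using submodule.m_closed[OF s] submodule.zero_closed[OF s] submodule.smult_closed[OF s]
    by (intro vectorspace_fun_space) auto
  have st: "\<rho> x w \<in> W" if "x \<in> carrier L'" "w \<in> W" for x w using W that by (simp add: lie_subrep_def)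
  have lin: "\<rho> x (\<lambda>y. v y + w y) = (\<lambda>y. \<rho> x v y + \<rho> x w y)" if "x \<in> carrier L" "v \<in> T" "w \<in> T" for x v w
    using rep that unfolding lie_rep_def linear_map_def mod_hom_def mod_hom_axioms_def module_hom_def by auto
  have lin2: "\<rho> x (\<lambda>y. c * v y) = (\<lambda>y. c * \<rho> x v y)" if "x \<in> carrier L" "v \<in> T" for x v c
    using rep that unfolding lie_rep_def linear_map_def mod_hom_def mod_hom_axioms_def module_hom_def by auto
  have xL: "x \<in> carrier L" if "x \<in> carrier L'" for x using sub(1) that by (rule subsetD)
  have vT: "v \<in> T" if "v \<in> W" for v using WT that by (rule subsetD)
  show ?thesis
    unfolding lie_rep_def
  proof (intro conjI ballI allI)
    show "\<rho> (x \<oplus>\<^bsub>L'\<^esub> y) v = \<rho> x v \<oplus>\<^bsub>fun_space W\<^esub> \<rho> y v"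
      if "x \<in> carrier L'" "y \<in> carrier L'" "v \<in> carrier (fun_space W)" for x y v
      using rep xL[OF that(1)] xL[OF that(2)] vT[of v] that(3) by (simp add: lie_rep_def sub)
    show "\<rho> (c \<odot>\<^bsub>L'\<^esub> x) v = c \<odot>\<^bsub>fun_space W\<^esub> \<rho> x v"
      if "x \<in> carrier L'" "v \<in> carrier (fun_space W)" for c x v
      using rep xL[OF that(1)] vT[of v] that(2) by (simp add: lie_rep_def sub)
    show "linear_map class_ring (fun_space W) (fun_space W) (\<rho> x)" if "x \<in> carrier L'" for x
      by (rule linear_map_class_ringI[OF VW VW])
        (simp_all add: st[OF that] lin[OF subsetD[OF sub(1) that]] lin2[OF subsetD[OF sub(1) that]]
          subsetD[OF WT])
    show "\<rho> (lie_bracket L' x y) v = \<rho> x (\<rho> y v) \<ominus>\<^bsub>fun_space W\<^esub> \<rho> y (\<rho> x v)"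
      if "x \<in> carrier L'" "y \<in> carrier L'" "v \<in> carrier (fun_space W)" for x y v
    proof -
      have "\<rho> x (\<rho> y v) \<in> W" "\<rho> y (\<rho> x v) \<in> W" using that st by auto
      moreover have "\<rho> (lie_bracket L x y) v = \<rho> x (\<rho> y v) \<ominus>\<^bsub>fun_space T\<^esub> \<rho> y (\<rho> x v)"
        using rep xL[OF that(1)] xL[OF that(2)] vT[of v] that(3) by (simp add: lie_rep_def)
      ultimately show ?thesis
        using minus_fun_space[OF V] minus_fun_space[OF VW] WT sub by (simp add: subset_iff)
    qed
  qed (use L VW in simp_all)
qed

section \<open>The matrix action\<close>

context oligomorphic_measure begin

abbreviation (input) "idx r \<equiv> {..<r} \<times> {..<r::nat}"

lemma gl_act_eq: "gl_act X G \<mu> r A \<phi> P = (\<Sum>p\<in>idx r. A $$ p * E r (fst p) (snd p) \<phi> P)"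
  by (simp add: gl_act_def sum.cartesian_product case_prod_unfold)

lemma gl_act_schwartz: "\<phi> \<in> S r \<Longrightarrow> gl_act X G \<mu> r A \<phi> \<in> S r"
  unfolding gl_act_eq[abs_def] by (intro schwartz_sum schwartz_scale E_schwartz) auto

lemma gl_act_add:
  assumes "\<phi> \<in> S r" "\<psi> \<in> S r"
  shows "gl_act X G \<mu> r A (\<lambda>P. \<phi> P + \<psi> P) = (\<lambda>P. gl_act X G \<mu> r A \<phi> P + gl_act X G \<mu> r A \<psi> P)"
proof
  fix P
  show "gl_act X G \<mu> r A (\<lambda>P. \<phi> P + \<psi> P) P = gl_act X G \<mu> r A \<phi> P + gl_act X G \<mu> r A \<psi> P"
    unfolding gl_act_eq sum.distrib[symmetric]
    by (rule sum.cong) (auto simp: E_add[OF assms] distrib_left)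
qed

lemma gl_act_scale:
  assumes "\<phi> \<in> S r"
  shows "gl_act X G \<mu> r A (\<lambda>P. c * \<phi> P) = (\<lambda>P. c * gl_act X G \<mu> r A \<phi> P)"
proof
  fix P
  show "gl_act X G \<mu> r A (\<lambda>P. c * \<phi> P) P = c * gl_act X G \<mu> r A \<phi> P"
    unfolding gl_act_eq sum_distrib_left
    by (rule sum.cong) (auto simp: E_scale[OF assms])
qed

text \<open>Coinciding moved points contribute matrix multiplication. The remaining double sum is
  symmetric in \<open>A\<close> and \<open>B\<close> by \<open>pair_integ_symmetric\<close>, so it
  drops out of the commutator.\<close>

lemma gl_act_gl_act:
  assumes \<phi>: "\<phi> \<in> S r" and P: "P \<in> Part X G r" and A: "A \<in> carrier_mat r r" and B: "B \<in> carrier_mat r r"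
  shows "gl_act X G \<mu> r A (gl_act X G \<mu> r B \<phi>) P = gl_act X G \<mu> r (A * B) \<phi> P +
    (\<Sum>p\<in>idx r. \<Sum>q\<in>idx r. A $$ p * B $$ q * pair_integ (fst p) (snd p) (fst q) (snd q) \<phi> P)"
proof -
  have 1: "E r i j (gl_act X G \<mu> r B \<phi>) P = (\<Sum>q\<in>idx r. B $$ q * E r i j (E r (fst q) (snd q) \<phi>) P)"
    if ij: "i < r" "j < r" for i j
    unfolding gl_act_eq[abs_def]
    by (subst E_sum[OF _ ij]) (auto intro!: schwartz_scale E_schwartz \<phi> sum.cong E_scale ij)
  have "gl_act X G \<mu> r A (gl_act X G \<mu> r B \<phi>) P =
      (\<Sum>p\<in>idx r. \<Sum>q\<in>idx r. A $$ p * B $$ q * E r (fst p) (snd p) (E r (fst q) (snd q) \<phi>) P)"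
    unfolding gl_act_eq[of r A]
    by (rule sum.cong) (auto simp: 1 sum_distrib_left mult.assoc)
  also have "\<dots> = (\<Sum>p\<in>idx r. \<Sum>q\<in>idx r. A $$ p * B $$ q * (if snd p = fst q then E r (fst p) (snd q) \<phi> P else 0) +
      A $$ p * B $$ q * pair_integ (fst p) (snd p) (fst q) (snd q) \<phi> P)"
    by (intro sum.cong refl) (auto simp: E_E[OF \<phi> P] distrib_left)
  also have "\<dots> = (\<Sum>p\<in>idx r. \<Sum>q\<in>idx r. A $$ p * B $$ q * (if snd p = fst q then E r (fst p) (snd q) \<phi> P else 0)) +
      (\<Sum>p\<in>idx r. \<Sum>q\<in>idx r. A $$ p * B $$ q * pair_integ (fst p) (snd p) (fst q) (snd q) \<phi> P)"
    by (simp add: sum.distrib)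
  also have "(\<Sum>p\<in>idx r. \<Sum>q\<in>idx r. A $$ p * B $$ q * (if snd p = fst q then E r (fst p) (snd q) \<phi> P else 0)) =
      (\<Sum>(i, j)\<in>idx r. \<Sum>(k, l)\<in>idx r. if j = k then A $$ (i, j) * B $$ (k, l) * E r i l \<phi> P else 0)"
    by (auto intro!: sum.cong)
  also have "\<dots> = (\<Sum>i<r. \<Sum>j<r. \<Sum>k<r. \<Sum>l<r. if j = k then A $$ (i, j) * B $$ (k, l) * E r i l \<phi> P else 0)"
    by (simp only: sum.cartesian_product[symmetric])
  also have "\<dots> = (\<Sum>i<r. \<Sum>j<r. \<Sum>l<r. A $$ (i, j) * B $$ (j, l) * E r i l \<phi> P)"
  proof (rule sum.cong[OF refl], rule sum.cong[OF refl])
    fix i j assume "j \<in> {..<r}"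
    have "(\<Sum>k<r. \<Sum>l<r. if j = k then A $$ (i, j) * B $$ (k, l) * E r i l \<phi> P else 0) =
        (\<Sum>k<r. if j = k then \<Sum>l<r. A $$ (i, j) * B $$ (k, l) * E r i l \<phi> P else 0)"
      by (intro sum.cong refl) simp
    then show "(\<Sum>k<r. \<Sum>l<r. if j = k then A $$ (i, j) * B $$ (k, l) * E r i l \<phi> P else 0) =
        (\<Sum>l<r. A $$ (i, j) * B $$ (j, l) * E r i l \<phi> P)"
      using \<open>j \<in> _\<close> by simp
  qed
  also have "\<dots> = (\<Sum>i<r. \<Sum>l<r. \<Sum>j<r. A $$ (i, j) * B $$ (j, l) * E r i l \<phi> P)"
    by (rule sum.cong[OF refl], rule sum.swap)
  also have "\<dots> = gl_act X G \<mu> r (A * B) \<phi> P"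
    unfolding gl_act_def using A B
    by (intro sum.cong refl) (simp add: scalar_prod_def sum_distrib_right atLeast0LessThan)
  finally show ?thesis .
qed

lemma gl_act_outside: "P \<notin> Part X G r \<Longrightarrow> gl_act X G \<mu> r A \<phi> P = 0"
  by (simp add: gl_act_eq E_outside)

lemma gl_act_bracket:
  assumes \<phi>: "\<phi> \<in> S r" and A: "A \<in> carrier_mat r r" and B: "B \<in> carrier_mat r r"
  shows "gl_act X G \<mu> r (A * B - B * A) \<phi> P =
    gl_act X G \<mu> r A (gl_act X G \<mu> r B \<phi>) P - gl_act X G \<mu> r B (gl_act X G \<mu> r A \<phi>) P"
proof (cases "P \<in> Part X G r")
  case P: True
  have "(\<Sum>p\<in>idx r. \<Sum>q\<in>idx r. A $$ p * B $$ q * pair_integ (fst p) (snd p) (fst q) (snd q) \<phi> P) =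
      (\<Sum>q\<in>idx r. \<Sum>p\<in>idx r. A $$ p * B $$ q * pair_integ (fst p) (snd p) (fst q) (snd q) \<phi> P)"
    by (rule sum.swap)
  also have "\<dots> = (\<Sum>q\<in>idx r. \<Sum>p\<in>idx r. B $$ q * A $$ p * pair_integ (fst q) (snd q) (fst p) (snd p) \<phi> P)"
    by (intro sum.cong refl) (auto simp: mult.commute intro: pair_integ_symmetric[OF \<phi> P])
  finally have sym: "(\<Sum>p\<in>idx r. \<Sum>q\<in>idx r. A $$ p * B $$ q * pair_integ (fst p) (snd p) (fst q) (snd q) \<phi> P) =
      (\<Sum>p\<in>idx r. \<Sum>q\<in>idx r. B $$ p * A $$ q * pair_integ (fst p) (snd p) (fst q) (snd q) \<phi> P)" .
  have "gl_act X G \<mu> r (A * B - B * A) \<phi> P = gl_act X G \<mu> r (A * B) \<phi> P - gl_act X G \<mu> r (B * A) \<phi> P"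
    using A B by (auto simp: gl_act_def sum_subtractf[symmetric] left_diff_distrib
        simp del: index_mult_mat(1) intro!: sum.cong)
  then show ?thesis
    using gl_act_gl_act[OF \<phi> P A B] gl_act_gl_act[OF \<phi> P B A] sym by simp
qed (simp add: gl_act_outside)

lemma vectorspace_tensor_power: "vectorspace class_ring (tensor_power X G r :: ('k, _) module)"
  unfolding tensor_power_def
  by (rule vectorspace_fun_space) (simp_all add: schwartz_zero schwartz_add schwartz_scale)

lemma gl_act_mat_add:
  assumes "A \<in> carrier_mat r r" "B \<in> carrier_mat r r"
  shows "gl_act X G \<mu> r (A + B) \<phi> = (\<lambda>P. gl_act X G \<mu> r A \<phi> P + gl_act X G \<mu> r B \<phi> P)"
  unfolding gl_act_def sum.distrib[symmetric] using assms
  by (intro ext sum.cong refl) (simp add: distrib_right)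

lemma gl_act_mat_scale:
  assumes "A \<in> carrier_mat r r"
  shows "gl_act X G \<mu> r (c \<cdot>\<^sub>m A) \<phi> = (\<lambda>P. c * gl_act X G \<mu> r A \<phi> P)"
  unfolding gl_act_def sum_distrib_left using assms
  by (intro ext sum.cong refl) (simp add: mult.assoc)

theorem gl_rep: "lie_rep (gl r) (tensor_power X G r) (gl_act X G \<mu> r)"
  unfolding lie_rep_def
proof (intro conjI ballI allI)
  note V = vectorspace_tensor_power[of r]
  show "linear_map class_ring (tensor_power X G r) (tensor_power X G r) (gl_act X G \<mu> r A)" for A
    by (rule linear_map_class_ringI[OF V V])
      (simp_all add: tensor_power_def gl_act_schwartz gl_act_add gl_act_scale)
  show "gl_act X G \<mu> r (A \<oplus>\<^bsub>gl r\<^esub> B) \<phi> = gl_act X G \<mu> r A \<phi> \<oplus>\<^bsub>tensor_power X G r\<^esub> gl_act X G \<mu> r B \<phi>"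
    if "A \<in> carrier (gl r)" "B \<in> carrier (gl r)" for A B \<phi>
    using that by (simp add: tensor_power_def gl_act_mat_add)
  show "gl_act X G \<mu> r (c \<odot>\<^bsub>gl r\<^esub> A) \<phi> = c \<odot>\<^bsub>tensor_power X G r\<^esub> gl_act X G \<mu> r A \<phi>"
    if "A \<in> carrier (gl r)" for c A \<phi>
    using that by (simp add: tensor_power_def gl_act_mat_scale)
  show "gl_act X G \<mu> r (lie_bracket (gl r) A B) \<phi> =
      gl_act X G \<mu> r A (gl_act X G \<mu> r B \<phi>) \<ominus>\<^bsub>tensor_power X G r\<^esub> gl_act X G \<mu> r B (gl_act X G \<mu> r A \<phi>)"
    if AB: "A \<in> carrier (gl r)" "B \<in> carrier (gl r)" and \<phi>: "\<phi> \<in> carrier (tensor_power X G r)" for A B \<phi>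
  proof -
    have p: "\<phi> \<in> S r" using \<phi> by (simp add: tensor_power_def)
    have "gl_act X G \<mu> r (lie_bracket (gl r) A B) \<phi> =
        (\<lambda>P. gl_act X G \<mu> r A (gl_act X G \<mu> r B \<phi>) P - gl_act X G \<mu> r B (gl_act X G \<mu> r A \<phi>) P)"
      using AB by (intro ext) (simp add: gl_act_bracket[OF p])
    then show ?thesis
      using minus_fun_space[OF V[unfolded tensor_power_def]
          gl_act_schwartz[OF gl_act_schwartz[OF p]] gl_act_schwartz[OF gl_act_schwartz[OF p]]]
      by (simp only: tensor_power_def)
  qed
qed (use lie_algebra_gl vectorspace_tensor_power in auto)

lemma gl_act_elem_mat:
  assumes "i < r" "j < r"
  shows "gl_act X G \<mu> r (elem_mat r i j) \<phi> = E r i j \<phi>"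
proof
  fix P
  have "gl_act X G \<mu> r (elem_mat r i j) \<phi> P = (\<Sum>a<r. \<Sum>b<r. if a = i \<and> b = j then E r a b \<phi> P else 0)"
    unfolding gl_act_def by (intro sum.cong refl) (simp add: elem_mat_def)
  also have "\<dots> = (\<Sum>a<r. if a = i then \<Sum>b<r. if b = j then E r a b \<phi> P else 0 else 0)"
    by (intro sum.cong refl) simp
  also have "\<dots> = E r i j \<phi> P" using assms by simp
  finally show "gl_act X G \<mu> r (elem_mat r i j) \<phi> P = E r i j \<phi> P" .
qed

lemma gl_act_translate:
  assumes \<phi>: "\<phi> \<in> S r" and g: "g \<in> G"
  shows "gl_act X G \<mu> r A (tr r g \<phi>) = tr r g (gl_act X G \<mu> r A \<phi>)"
proof
  fix P
  have "gl_act X G \<mu> r A (tr r g \<phi>) P = (\<Sum>p\<in>idx r. A $$ p * tr r g (E r (fst p) (snd p) \<phi>) P)"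
    unfolding gl_act_eq by (intro sum.cong refl) (auto simp: E_tr[OF \<phi> g])
  then show "gl_act X G \<mu> r A (tr r g \<phi>) P = tr r g (gl_act X G \<mu> r A \<phi>) P"
    by (simp add: translate_def gl_act_eq)
qed

end

section \<open>The orbit algebra\<close>

text \<open>Cameron's injectivity: the differences \<open>T \<mapsto> v (T \<union> {x}) - v (T \<union> {y})\<close> satisfy the same
  hypothesis for smaller sets, so \<open>v\<close> is constant along exchanges of single points.\<close>

lemma subset_sum_injective:
  fixes v :: "'x set \<Rightarrow> 'k::field_char_0"
  assumes "infinite X" "\<And>B. B \<in> nsets X (Suc n) \<Longrightarrow> (\<Sum>y\<in>B. v (B - {y})) = 0" "A \<in> nsets X n"
  shows "v A = 0"
  using assms
proof (induction n arbitrary: X v A)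
  case 0
  obtain x where "x \<in> X" using infinite_imp_nonempty[OF 0(1)] by blast
  then have "{x} \<in> nsets X (Suc 0)" by (simp add: nsets_def)
  from 0(2)[OF this] have "v {} = 0" by simp
  moreover have "A = {}" using 0(3) by (auto simp: nsets_def)
  ultimately show ?case by simp
next
  case (Suc n)
  have swap: "v (insert x T) = v (insert y T)"
    if xy: "x \<in> X" "y \<in> X" "x \<noteq> y" and T: "T \<in> nsets (X - {x, y}) n" for x y T
  proof -
    have "v (insert x T) - v (insert y T) = 0"
    proof (rule Suc.IH[of "X - {x, y}" "\<lambda>T. v (insert x T) - v (insert y T)", OF _ _ T])
      show "infinite (X - {x, y})" using Suc.prems(1) by simp
      fix B assume B: "B \<in> nsets (X - {x, y}) (Suc n)"
      \<comment> \<open>In the hypothesis for \<open>insert z B\<close>, deleting \<open>z\<close>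
        contributes \<open>v B\<close>. The other deletions therefore sum to \<open>- v B\<close>,
        for \<open>z = x\<close> and \<open>z = y\<close> alike, and the difference
        vanishes.\<close>
      have one: "(\<Sum>t\<in>B. v (insert z (B - {t}))) = - v B" if z: "z \<in> {x, y}" for z
      proof -
        have zB: "z \<notin> B" "finite B" using B z by (auto simp: nsets_def)
        have "insert z B \<in> nsets X (Suc (Suc n))" using B xy z zB by (auto simp: nsets_def)
        then have "(\<Sum>t\<in>insert z B. v (insert z B - {t})) = 0" by (rule Suc.prems(2))
        moreover have "(\<Sum>t\<in>insert z B. v (insert z B - {t})) = v B + (\<Sum>t\<in>B. v (insert z B - {t}))"
          using zB by simp
        moreover have "(\<Sum>t\<in>B. v (insert z B - {t})) = (\<Sum>t\<in>B. v (insert z (B - {t})))"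
          by (rule sum.cong) (use zB in \<open>auto simp: insert_Diff_if\<close>)
        ultimately show ?thesis by (simp add: add_eq_0_iff)
      qed
      show "(\<Sum>t\<in>B. v (insert x (B - {t})) - v (insert y (B - {t}))) = 0"
        by (simp add: sum_subtractf one)
    qed
    then show ?thesis by simp
  qed
  have A: "finite A" "A \<subseteq> X" "card A = Suc n" using Suc.prems(3) by (auto simp: nsets_def)
  have "infinite (X - A)" using Suc.prems(1) A(1) by simp
  then obtain b where b: "b \<in> X" "b \<notin> A" using infinite_imp_nonempty by blast
  \<comment> \<open>Replacing \<open>y\<close> by the outside point \<open>b\<close> is an exchange
    covered by \<open>swap\<close>.\<close>
  have e: "v (insert b A - {y}) = v A" if y: "y \<in> A" for y
  proof -
    have "A - {y} \<in> nsets (X - {b, y}) n" using A b y by (auto simp: nsets_def)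
    then have "v (insert b (A - {y})) = v (insert y (A - {y}))" using A b y by (intro swap) auto
    moreover have "insert b A - {y} = insert b (A - {y})" "insert y (A - {y}) = A" using b y by auto
    ultimately show ?thesis by simp
  qed
  have "insert b A \<in> nsets X (Suc (Suc n))" using A b by (auto simp: nsets_def)
  then have "(\<Sum>y\<in>insert b A. v (insert b A - {y})) = 0" by (rule Suc.prems(2))
  moreover have "(\<Sum>y\<in>insert b A. v (insert b A - {y})) = v A + (\<Sum>y\<in>A. v A)"
    using A b e by simp
  \<comment> \<open>All \<open>n + 2\<close> one-point deletions of \<open>insert b A\<close> have
    the value \<open>v A\<close>; characteristic zero then applies.\<close>
  ultimately have "of_nat (Suc (Suc n)) * v A = 0" using A by (simp add: algebra_simps)
  then show ?case by (simp only: mult_eq_0_iff of_nat_eq_0_iff) simp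
qed

lemma sum_fun_apply: "(\<Sum>i\<in>I. f i) x = (\<Sum>i\<in>I. f i x :: 'b::comm_monoid_add)"
  by (induction I rule: infinite_finite_induct) (simp_all add: zero_fun_def plus_fun_def)

context oligomorphic_group begin

section \<open>Partitions into two parts, and functions of bounded degree\<close>

abbreviation two_part where "two_part A \<equiv> [A, X - A]"

lemma two_part_Part: "ghat_subset X G A \<Longrightarrow> two_part A \<in> Part X G 2"
proof (rule PartI)
  show "\<exists>i<2. x \<in> two_part A ! i" if "x \<in> X" for x
    using that by (intro exI[of _ "if x \<in> A then 0 else 1"]) simp
qed (use ghat_subset_X ghat_subset_Diff in \<open>auto simp: less_2_cases_iff nth_Cons' split: if_splits\<close>)

lemma Part2_eq:
  assumes P: "P \<in> Part X G 2"
  shows "P = two_part (P ! 0)" "P ! 1 = X - P ! 0"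
proof -
  have "P ! 1 = X - P ! 0"
    using PartD(3)[OF P, of 1] PartD(4)[OF P, of 0 1] PartD(5)[OF P] by (auto simp: less_2_cases_iff)
  moreover have "P = [P ! 0, P ! 1]" using PartD(1)[OF P] by (intro nth_equalityI) (auto simp: less_2_cases_iff)
  ultimately show "P = two_part (P ! 0)" "P ! 1 = X - P ! 0" by simp_all
qed

lemma part_act_0: "P \<in> Part X G 2 \<Longrightarrow> part_act g P ! 0 = g ` (P ! 0)"
  using PartD(1)[of P 2] by (simp add: nth_part_act)

lemma part_act_card:
  assumes "P \<in> Part X G 2" "g \<in> G"
  shows "finite (part_act g P ! 0) \<longleftrightarrow> finite (P ! 0)" "card (part_act g P ! 0) = card (P ! 0)"
proof -
  have "inj_on g (P ! 0)" using G_inj[OF assms(2)] PartD(3)[OF assms(1), of 0] by (auto intro: inj_on_subset)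
  then show "finite (part_act g P ! 0) \<longleftrightarrow> finite (P ! 0)" "card (part_act g P ! 0) = card (P ! 0)"
    by (simp_all add: part_act_0[OF assms(1)] finite_image_iff card_image)
qed

lemma part_act_two_part:
  assumes "ghat_subset X G A" "g \<in> G"
  shows "part_act g (two_part A) = two_part (g ` A)"
  using Part2_eq(1)[OF part_act_Part[OF assms(2) two_part_Part[OF assms(1)]]] by (simp add: part_act_def)

lemma move_0:
  assumes "P \<in> Part X G 2"
  shows "move 0 1 y P ! 0 = P ! 0 - {y}" "move 1 0 y P ! 0 = insert y (P ! 0)"
  using PartD(1)[OF assms] by (simp_all add: move_def)

lemma orbit_embed_sum:
  "(\<Sum>n<N. orbit_embed X G n (v n) P) =
    (if P \<in> Part X G 2 \<and> finite (P ! 0) \<and> card (P ! 0) < N then v (card (P ! 0)) (P ! 0) else 0)"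
proof -
  have "P \<in> Part X G 2 \<Longrightarrow> P ! 0 \<in> nsets X n \<longleftrightarrow> finite (P ! 0) \<and> card (P ! 0) = n" for n
    using PartD(3)[of P 2 0] by (auto simp: nsets_def)
  then have "(\<Sum>n<N. orbit_embed X G n (v n) P) =
      (\<Sum>n<N. if n = card (P ! 0) then (if P \<in> Part X G 2 \<and> finite (P ! 0) then v n (P ! 0) else 0) else 0)"
    by (intro sum.cong) (auto simp: orbit_embed_def)
  then show ?thesis by simp
qed

text \<open>The degree of a partition is the size of its first part. A finite sum of embedded
  components is the same as a \<open>G\<close>-invariant function supported in bounded degree, a
  description free of the choice of components.\<close>

lemma orbit_algebra_iff:
  "\<phi> \<in> orbit_algebra X G \<longleftrightarrow> (\<forall>P. P \<notin> Part X G 2 \<longrightarrow> \<phi> P = 0) \<and> part_invariant 2 G \<phi> \<and>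
     (\<exists>N. \<forall>P\<in>Part X G 2. \<phi> P \<noteq> 0 \<longrightarrow> finite (P ! 0) \<and> card (P ! 0) < N)"
proof
  assume "\<phi> \<in> orbit_algebra X G"
  then obtain N v where \<phi>: "\<phi> = (\<lambda>P. \<Sum>n<N. orbit_embed X G n (v n) P)"
    and v: "\<forall>n. v n \<in> orbit_component X G n" by (auto simp: orbit_algebra_def)
  have "\<phi> (part_act g P) = \<phi> P" if g: "g \<in> G" and P: "P \<in> Part X G 2" for g P
  proof -
    have "v (card (P ! 0)) (g ` (P ! 0)) = v (card (P ! 0)) (P ! 0)" if "finite (P ! 0)"
    proof -
      have "P ! 0 \<in> nsets X (card (P ! 0))" using that PartD(3)[OF P, of 0] by (simp add: nsets_def)
      then show ?thesis using v g unfolding orbit_component_def by blast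
    qed
    then show ?thesis unfolding \<phi> orbit_embed_sum
      using part_act_Part[OF g P] P part_act_card[OF P g] by (simp add: part_act_0)
  qed
  then have "part_invariant 2 G \<phi>" using osub_G by (simp add: part_invariant_def)
  then show "(\<forall>P. P \<notin> Part X G 2 \<longrightarrow> \<phi> P = 0) \<and> part_invariant 2 G \<phi> \<and>
     (\<exists>N. \<forall>P\<in>Part X G 2. \<phi> P \<noteq> 0 \<longrightarrow> finite (P ! 0) \<and> card (P ! 0) < N)"
    unfolding \<phi> orbit_embed_sum by (auto intro!: exI[of _ N] split: if_splits)
next
  assume r: "(\<forall>P. P \<notin> Part X G 2 \<longrightarrow> \<phi> P = 0) \<and> part_invariant 2 G \<phi> \<and>
     (\<exists>N. \<forall>P\<in>Part X G 2. \<phi> P \<noteq> 0 \<longrightarrow> finite (P ! 0) \<and> card (P ! 0) < N)"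
  then obtain N where N: "\<forall>P\<in>Part X G 2. \<phi> P \<noteq> 0 \<longrightarrow> finite (P ! 0) \<and> card (P ! 0) < N" by blast
  \<comment> \<open>A finite set is the first part of exactly one partition, so the components can
    be read off there.\<close>
  define v where "v n A = (if A \<in> nsets X n then \<phi> (two_part A) else 0)" for n A
  have "v n \<in> orbit_component X G n" for n
    unfolding orbit_component_def
  proof (intro CollectI conjI ballI allI impI)
    fix g A assume g: "g \<in> G" and A: "A \<in> nsets X n"
    then have "inj_on g A" using G_inj by (auto simp: nsets_def intro: inj_on_subset)
    then have gA: "g ` A \<in> nsets X n" using A g by (auto simp: nsets_def card_image G_mem subset_iff)
    have "ghat_subset X G A" using A by (auto simp: nsets_def intro: ghat_subset_finite)
    then have "\<phi> (two_part (g ` A)) = \<phi> (two_part A)"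
      using r g part_act_two_part[OF _ g] two_part_Part unfolding part_invariant_def by metis
    then show "v n (g ` A) = v n A" using A gA by (simp add: v_def)
  qed (simp add: v_def)
  moreover have "\<phi> = (\<lambda>P. \<Sum>n<N. orbit_embed X G n (v n) P)"
  proof
    fix P
    show "\<phi> P = (\<Sum>n<N. orbit_embed X G n (v n) P)"
    proof (cases "P \<in> Part X G 2 \<and> finite (P ! 0) \<and> card (P ! 0) < N")
      case True
      then have "P ! 0 \<in> nsets X (card (P ! 0))" using PartD(3)[of P 2 0] by (simp add: nsets_def)
      then show ?thesis using True Part2_eq(1)[of P] unfolding orbit_embed_sum by (simp add: v_def)
    next
      case False
      then have "\<phi> P = 0" using r N by blast
      then show ?thesis using False unfolding orbit_embed_sum by auto
    qed
  qed
  ultimately show "\<phi> \<in> orbit_algebra X G" unfolding orbit_algebra_def by blast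
qed

lemma orbit_algebra_schwartz: "\<phi> \<in> orbit_algebra X G \<Longrightarrow> \<phi> \<in> S 2"
  by (auto simp: orbit_algebra_iff schwartz_iff)

lemma orbit_algebra_zero: "(\<lambda>_. 0) \<in> orbit_algebra X G"
  using osub_G by (simp add: orbit_algebra_iff part_invariant_def)

lemma orbit_algebra_scale: "\<phi> \<in> orbit_algebra X G \<Longrightarrow> (\<lambda>P. c * \<phi> P) \<in> orbit_algebra X G"
  by (auto simp: orbit_algebra_iff part_invariant_def)

lemma orbit_algebra_add:
  assumes "\<phi> \<in> orbit_algebra X G" "\<psi> \<in> orbit_algebra X G"
  shows "(\<lambda>P. \<phi> P + \<psi> P) \<in> orbit_algebra X G"
proof -
  obtain N where N: "\<forall>P\<in>Part X G 2. \<phi> P \<noteq> 0 \<longrightarrow> finite (P ! 0) \<and> card (P ! 0) < N"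
    using assms(1) unfolding orbit_algebra_iff by blast
  obtain M where M: "\<forall>P\<in>Part X G 2. \<psi> P \<noteq> 0 \<longrightarrow> finite (P ! 0) \<and> card (P ! 0) < M"
    using assms(2) unfolding orbit_algebra_iff by blast
  have "\<forall>P\<in>Part X G 2. \<phi> P + \<psi> P \<noteq> 0 \<longrightarrow> finite (P ! 0) \<and> card (P ! 0) < max N M"
  proof (intro ballI impI)
    fix P assume P: "P \<in> Part X G 2" "\<phi> P + \<psi> P \<noteq> 0"
    then have "\<phi> P \<noteq> 0 \<or> \<psi> P \<noteq> 0" by auto
    then show "finite (P ! 0) \<and> card (P ! 0) < max N M" using N M P(1) by (auto simp: less_max_iff_disj)
  qed
  then show ?thesis using assms by (auto simp: orbit_algebra_iff part_invariant_def)
qed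

lemma orbit_algebra_sum: "(\<And>i. i \<in> I \<Longrightarrow> f i \<in> orbit_algebra X G) \<Longrightarrow> (\<lambda>P. \<Sum>i\<in>I. f i P) \<in> orbit_algebra X G"
  by (induction I rule: infinite_finite_induct) (simp_all add: orbit_algebra_zero orbit_algebra_add)

text \<open>Finiteness is explicit because \<open>card\<close> is 0 on infinite sets, which would
  otherwise count as degree 0.\<close>

definition proj :: "nat \<Rightarrow> ('x set list \<Rightarrow> complex) \<Rightarrow> 'x set list \<Rightarrow> complex" where
  "proj n \<phi> P = (if finite (P ! 0) \<and> card (P ! 0) = n then \<phi> P else 0)"

lemma proj_mem: "\<phi> \<in> orbit_algebra X G \<Longrightarrow> proj n \<phi> \<in> orbit_algebra X G"
  using part_act_card by (auto simp: orbit_algebra_iff proj_def part_invariant_def)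

definition nset_orbit where "nset_orbit A = (\<lambda>g. g ` A) ` G"

text \<open>An \<open>n\<close>-set is the set of entries of an \<open>n\<close>-tuple, so its orbit
  is the image of an orbit on tuples.\<close>

lemma finite_nset_orbits: "finite (nset_orbit ` nsets X n)"
proof -
  have "nset_orbit ` nsets X n \<subseteq> (\<lambda>Q. set ` Q) `
      ((\<lambda>xs. (\<lambda>u. map u xs) ` G) ` {xs. length xs = n \<and> set xs \<subseteq> X})"
  proof (rule image_subsetI)
    fix A assume A: "A \<in> nsets X n"
    then obtain xs where xs: "set xs = A" "distinct xs" using finite_distinct_list by (auto simp: nsets_def)
    then have "length xs = n" using A distinct_card by (fastforce simp: nsets_def)
    moreover have "nset_orbit A = set ` ((\<lambda>u. map u xs) ` G)" using xs by (simp add: nset_orbit_def image_image)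
    ultimately show "nset_orbit A \<in> (\<lambda>Q. set ` Q) `
        ((\<lambda>xs. (\<lambda>u. map u xs) ` G) ` {xs. length xs = n \<and> set xs \<subseteq> X})"
      using A xs by (intro image_eqI[OF _ imageI[of xs]]) (auto simp: nsets_def)
  qed
  then show ?thesis by (rule finite_subset[OF _ finite_imageI[OF finite_tuple_orbits[OF osub_G]]])
qed

lemma nset_image: "A \<in> nsets X n \<Longrightarrow> g \<in> G \<Longrightarrow> g ` A \<in> nsets X n"
  using inj_on_subset[OF G_inj[of g], of A] by (auto simp: nsets_def card_image G_mem subset_iff)

lemma image_mul: "A \<subseteq> X \<Longrightarrow> g \<in> G \<Longrightarrow> h \<in> G \<Longrightarrow> g ` h ` A = (g \<cdot> h) ` A"
  by (auto simp: image_image mul_apply subset_iff intro!: image_cong)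

lemma nset_orbit_refl: "A \<subseteq> X \<Longrightarrow> A \<in> nset_orbit A"
  unfolding nset_orbit_def by (rule image_eqI[OF _ G_closed(3)]) (force simp: gid_apply)

lemma nset_orbit_closed: "A \<subseteq> X \<Longrightarrow> B \<in> nset_orbit A \<Longrightarrow> g \<in> G \<Longrightarrow> g ` B \<in> nset_orbit A"
  using image_mul[of A g] G_closed(1)[of g] by (auto simp: nset_orbit_def)

lemma nset_orbit_subset: "A \<subseteq> X \<Longrightarrow> B \<in> nset_orbit A \<Longrightarrow> B \<subseteq> X"
  by (auto simp: nset_orbit_def G_mem)

lemma nset_orbit_sym: "A \<subseteq> X \<Longrightarrow> B \<in> nset_orbit A \<Longrightarrow> A \<in> nset_orbit B"
proof -
  assume A: "A \<subseteq> X" and B: "B \<in> nset_orbit A"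
  obtain g where g: "g \<in> G" "B = g ` A" using B by (auto simp: nset_orbit_def)
  have "ginv g ` B = A" using g A ginv_apply(1)[OF g(1)] by (force simp: image_image)
  then show ?thesis using G_closed(2)[OF g(1)] by (auto simp: nset_orbit_def)
qed

lemma nset_orbit_eq:
  assumes A: "A \<subseteq> X" and B: "B \<in> nset_orbit A"
  shows "nset_orbit B = nset_orbit A"
proof -
  have "nset_orbit D \<subseteq> nset_orbit C" if "C \<subseteq> X" "D \<in> nset_orbit C" for C D
    using nset_orbit_closed[OF that] by (auto simp: nset_orbit_def[of D])
  then show ?thesis using A B nset_orbit_sym[OF A B] nset_orbit_subset[OF A B] by blast
qed

lemma nset_orbit_member: "W \<in> nset_orbit ` nsets X n \<Longrightarrow> B \<in> W \<Longrightarrow> B \<in> nsets X n \<and> nset_orbit B = W"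
proof -
  assume W: "W \<in> nset_orbit ` nsets X n" and B: "B \<in> W"
  obtain A where A: "A \<in> nsets X n" "W = nset_orbit A" using W by blast
  then obtain g where "g \<in> G" "B = g ` A" using B by (auto simp: nset_orbit_def)
  then have "B \<in> nsets X n" using nset_image[OF A(1)] by simp
  moreover have "A \<subseteq> X" using A(1) by (simp add: nsets_def)
  ultimately show ?thesis using nset_orbit_eq B A(2) by simp
qed

definition orbit_ind :: "'x set set \<Rightarrow> 'x set list \<Rightarrow> complex" where
  "orbit_ind W P = (if P \<in> Part X G 2 \<and> P ! 0 \<in> W then 1 else 0)"

lemma orbit_ind_mem:
  assumes W: "W \<in> nset_orbit ` nsets X n"
  shows "orbit_ind W \<in> orbit_algebra X G" "proj n (orbit_ind W) = orbit_ind W"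
proof -
  obtain A where A: "A \<in> nsets X n" "W = nset_orbit A" using W by auto
  have AX: "A \<subseteq> X" using A by (simp add: nsets_def)
  have "part_act g P ! 0 \<in> W \<longleftrightarrow> P ! 0 \<in> W" if g: "g \<in> G" and P: "P \<in> Part X G 2" for g P
  proof
    assume "part_act g P ! 0 \<in> W"
    then have "part_act (ginv g) (part_act g P) ! 0 \<in> W"
      using nset_orbit_closed[OF AX _ G_closed(2)[OF g]] A(2) part_act_0[OF part_act_Part[OF g P]] by simp
    then show "P ! 0 \<in> W" by (simp add: part_act_inv[OF g P])
  qed (use nset_orbit_closed[OF AX _ g] A(2) part_act_0[OF P] in simp)
  then have "part_invariant 2 G (orbit_ind W)"
    using osub_G part_act_Part by (simp add: part_invariant_def orbit_ind_def)
  moreover have n: "finite (P ! 0) \<and> card (P ! 0) = n" if "orbit_ind W P \<noteq> 0" for P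
  proof -
    have "P ! 0 \<in> W" using that by (simp add: orbit_ind_def split: if_splits)
    from conjunct1[OF nset_orbit_member[OF W this]] show ?thesis by (simp add: nsets_def)
  qed
  ultimately show "orbit_ind W \<in> orbit_algebra X G"
    unfolding orbit_algebra_iff by (auto simp: orbit_ind_def intro!: exI[of _ "Suc n"])
  show "proj n (orbit_ind W) = orbit_ind W" using n by (auto simp: proj_def fun_eq_iff)
qed

lemma orbit_ind_expand:
  assumes v: "v \<in> orbit_algebra X G" "proj n v = v"
  shows "v P = (\<Sum>W\<in>nset_orbit ` nsets X n. v (two_part (SOME A. A \<in> W)) * orbit_ind W P)"
proof (cases "P \<in> Part X G 2 \<and> P ! 0 \<in> nsets X n")
  case True
  let ?A = "P ! 0"
  have AX: "?A \<subseteq> X" using True by (simp add: nsets_def)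
  have mem: "?A \<in> W \<longleftrightarrow> W = nset_orbit ?A" if "W \<in> nset_orbit ` nsets X n" for W
  proof
    assume "?A \<in> W"
    from conjunct2[OF nset_orbit_member[OF that this]] show "W = nset_orbit ?A" by (rule sym)
  qed (simp add: nset_orbit_refl[OF AX])
  have rep: "v (two_part (SOME A. A \<in> nset_orbit ?A)) = v P"
  proof -
    have "(SOME A. A \<in> nset_orbit ?A) \<in> nset_orbit ?A" by (rule someI) (rule nset_orbit_refl[OF AX])
    then obtain g where g: "g \<in> G" "(SOME A. A \<in> nset_orbit ?A) = g ` ?A" by (auto simp: nset_orbit_def)
    have "ghat_subset X G ?A" using True by (intro PartD(2)) auto
    then have "v (two_part (g ` ?A)) = v (part_act g (two_part ?A))" by (simp add: part_act_two_part g)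
    also have "two_part ?A = P" using Part2_eq(1) True by auto
    also have "v (part_act g P) = v P" using v(1) g True by (simp add: orbit_algebra_iff part_invariant_def)
    finally show ?thesis using g by simp
  qed
  have "(\<Sum>W\<in>nset_orbit ` nsets X n. v (two_part (SOME A. A \<in> W)) * orbit_ind W P) =
      (\<Sum>W\<in>nset_orbit ` nsets X n. if W = nset_orbit ?A then v P else 0)"
    using True by (intro sum.cong refl) (auto simp: orbit_ind_def mem rep)
  also have "\<dots> = v P" using finite_nset_orbits True by (simp add: sum.delta)
  finally show ?thesis by simp
next
  case False
  have "orbit_ind W P = 0" if "W \<in> nset_orbit ` nsets X n" for W
    using conjunct1[OF nset_orbit_member[OF that]] False by (auto simp: orbit_ind_def)
  moreover have "v P = 0"
  proof (cases "P \<in> Part X G 2")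
    case True
    then have "\<not> (finite (P ! 0) \<and> card (P ! 0) = n)" using False PartD(3)[OF True, of 0] by (auto simp: nsets_def)
    then have "proj n v P = 0" by (auto simp: proj_def)
    then show ?thesis by (simp only: v(2))
  qed (use v in \<open>simp add: orbit_algebra_iff\<close>)
  ultimately show ?thesis by simp
qed

text \<open>Oligomorphy makes each graded component finite-dimensional: it is spanned by the
  indicators of the finitely many orbits on \<open>n\<close>-sets. They are enumerated because the
  filtration adjoins generators by index.\<close>

lemma orbit_basis:
  "\<exists>g (d :: nat). (\<forall>i<d. g i \<in> orbit_algebra X G \<and> proj n (g i) = g i) \<and>
     (\<forall>v. v \<in> orbit_algebra X G \<longrightarrow> proj n v = v \<longrightarrow> (\<exists>a. v = (\<lambda>P. \<Sum>i<d. a i * g i P)))"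
proof -
  let ?B = "nset_orbit ` nsets X n"
  obtain h where h: "bij_betw h {0..<card ?B} ?B" using ex_bij_betw_nat_finite[OF finite_nset_orbits] by blast
  have hB: "h i \<in> ?B" if "i < card ?B" for i using bij_betw_apply[OF h, of i] that by simp
  have 1: "\<forall>i<card ?B. orbit_ind (h i) \<in> orbit_algebra X G \<and> proj n (orbit_ind (h i)) = orbit_ind (h i)"
    using orbit_ind_mem[OF hB] by blast
  have 2: "\<exists>a. v = (\<lambda>P. \<Sum>i<card ?B. a i * orbit_ind (h i) P)"
    if v: "v \<in> orbit_algebra X G" "proj n v = v" for v
  proof (intro exI ext)
    fix P
    have "v P = (\<Sum>W\<in>?B. v (two_part (SOME A. A \<in> W)) * orbit_ind W P)" by (rule orbit_ind_expand[OF v])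
    also have "\<dots> = (\<Sum>i<card ?B. v (two_part (SOME A. A \<in> h i)) * orbit_ind (h i) P)"
      using sum.reindex_bij_betw[OF h, of "\<lambda>W. v (two_part (SOME A. A \<in> W)) * orbit_ind W P"]
      by (simp add: atLeast0LessThan)
    finally show "v P = (\<Sum>i<card ?B. v (two_part (SOME A. A \<in> h i)) * orbit_ind (h i) P)" .
  qed
  show ?thesis
    by (rule exI[of _ "\<lambda>i. orbit_ind (h i)"], rule exI[of _ "card ?B"]) (use 1 2 in blast)
qed

end

section \<open>The operators \<open>e\<close>, \<open>f\<close>, \<open>h\<close> on the orbit
  algebra\<close>

locale oligomorphic_measure_complex = oligomorphic_measure X G \<mu>
  for X :: "'x set" and G :: "('x \<Rightarrow> 'x) set" and \<mu> :: "('x, 'x upoint) ghat_set \<Rightarrow> complex"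
begin

abbreviation "OA \<equiv> orbit_algebra X G"

lemma E_nonzero:
  assumes \<phi>: "\<phi> \<in> S r" and ij: "i < r" "j < r" and nz: "E r i j \<phi> P \<noteq> 0"
  shows "P \<in> Part X G r" "\<exists>y\<in>P ! i. \<phi> (move i j y P) \<noteq> 0"
proof -
  show P: "P \<in> Part X G r" using nz E_outside by blast
  show "\<exists>y\<in>P ! i. \<phi> (move i j y P) \<noteq> 0"
  proof (rule ccontr)
    assume "\<not> ?thesis"
    then have "integ (move_fun i j \<phi> P) = integ (\<lambda>y. 0)" by (intro integ_cong) (simp add: move_fun_def)
    then show False using nz E_eq[OF \<phi> P ij] by simp
  qed
qed

lemma E_part_invariant:
  assumes \<phi>: "\<phi> \<in> OA" and ij: "i < 2" "j < 2"
  shows "part_invariant 2 G (E 2 i j \<phi>)"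
proof -
  have z: "\<forall>P. P \<notin> Part X G 2 \<longrightarrow> \<phi> P = 0" and inv: "part_invariant 2 G \<phi>"
    using \<phi> by (simp_all add: orbit_algebra_iff)
  have "\<forall>g\<in>G. tr 2 g \<phi> = \<phi>" using translate_invariant_iff[OF osub_G z] inv by simp
  then have "\<forall>g\<in>G. tr 2 g (E 2 i j \<phi>) = E 2 i j \<phi>"
    using E_tr[OF orbit_algebra_schwartz[OF \<phi>] _ ij] by metis
  then show ?thesis using translate_invariant_iff[OF osub_G, of 2 "E 2 i j \<phi>"] by (simp add: E_outside)
qed

text \<open>Evaluating after moving one point shrinks the first part by at most one element, so a
  degree bound \<open>N\<close> becomes \<open>Suc N\<close>.\<close>

lemma E_orbit_algebra:
  assumes \<phi>: "\<phi> \<in> OA" and ij: "i < 2" "j < 2"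
  shows "E 2 i j \<phi> \<in> OA"
proof -
  obtain N where N: "\<forall>P\<in>Part X G 2. \<phi> P \<noteq> 0 \<longrightarrow> finite (P ! 0) \<and> card (P ! 0) < N"
    using \<phi> unfolding orbit_algebra_iff by blast
  have "finite (P ! 0) \<and> card (P ! 0) < Suc N" if nz: "E 2 i j \<phi> P \<noteq> 0" for P
  proof -
    note E = E_nonzero[OF orbit_algebra_schwartz[OF \<phi>] ij nz]
    obtain y where y: "y \<in> P ! i" "\<phi> (move i j y P) \<noteq> 0" using E(2) by blast
    have M: "finite (move i j y P ! 0)" "card (move i j y P ! 0) < N"
      using N y move_Part[OF E(1) ij] by auto
    have "P ! 0 \<subseteq> insert y (move i j y P ! 0)"
    proof
      fix z assume "z \<in> P ! 0"
      then show "z \<in> insert y (move i j y P ! 0)"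
        using mem_move[OF E(1) ij _ y(1), of 0 z] by (cases "z = y") simp_all
    qed
    then have "finite (P ! 0)" "card (P ! 0) \<le> card (insert y (move i j y P ! 0))"
      using M(1) by (auto intro: finite_subset card_mono)
    moreover have "card (insert y (move i j y P ! 0)) \<le> Suc (card (move i j y P ! 0))"
      by (simp add: card_insert_if M(1))
    ultimately show ?thesis using M(2) by linarith
  qed
  then show ?thesis using E_part_invariant[OF assms] by (auto simp: orbit_algebra_iff E_outside)
qed

lemma gl_act_orbit_algebra: "\<phi> \<in> OA \<Longrightarrow> gl_act X G \<mu> 2 A \<phi> \<in> OA"
  unfolding gl_act_eq[abs_def] by (intro orbit_algebra_sum orbit_algebra_scale E_orbit_algebra) auto

lemma orbit_algebra_subrep: "lie_subrep (sl 2) (tensor_power X G 2) (gl_act X G \<mu> 2) OA"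
  unfolding lie_subrep_def
  by (intro conjI subspace_class_ringI vectorspace_tensor_power ballI gl_act_orbit_algebra)
    (auto simp: tensor_power_def orbit_algebra_schwartz orbit_algebra_zero orbit_algebra_add
      orbit_algebra_scale)

lemma orbit_algebra_rep: "lie_rep (sl 2) (fun_space OA) (gl_act X G \<mu> 2)"
  by (rule sub_lie_rep_fun_space[OF gl_rep[of 2, unfolded tensor_power_def] lie_algebra_sl _ _ _ _
        orbit_algebra_subrep[unfolded tensor_power_def]]) auto

definition e_op where "e_op = E 2 0 1"
definition f_op where "f_op = E 2 1 0"
definition h_op where "h_op \<phi> P = E 2 0 0 \<phi> P - E 2 1 1 \<phi> P"

text \<open>Points have measure 1, so over a finite first part the integral is a plain sum,
  independent of the measure. From an infinite first part one removes only a point, and elements of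
  the orbit algebra vanish there.\<close>

lemma e_op_apply:
  assumes \<phi>: "\<phi> \<in> OA" and P: "P \<in> Part X G 2"
  shows "e_op \<phi> P = (if finite (P ! 0) then \<Sum>y\<in>P ! 0. \<phi> (move 0 1 y P) else 0)"
proof (cases "finite (P ! 0)")
  case True
  have "integ (move_fun 0 1 \<phi> P) = (\<Sum>y\<in>P ! 0. move_fun 0 1 \<phi> P y)"
    using True PartD(3)[OF P, of 0] by (intro integ_finite_support) (auto simp: move_fun_def)
  then show ?thesis using True E_eq[OF orbit_algebra_schwartz[OF \<phi>] P, of 0 1]
    by (simp add: e_op_def move_fun_def)
next
  case False
  have "e_op \<phi> P = 0"
  proof (rule ccontr)
    assume "e_op \<phi> P \<noteq> 0"
    then obtain y where y: "y \<in> P ! 0" "\<phi> (move 0 1 y P) \<noteq> 0"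
      using E_nonzero(2)[OF orbit_algebra_schwartz[OF \<phi>], of 0 1 P] by (auto simp: e_op_def)
    then have "finite (move 0 1 y P ! 0)" using \<phi> move_Part[OF P _ _ y(1), of 1] by (auto simp: orbit_algebra_iff)
    then show False using False move_0(1)[OF P] by simp
  qed
  then show ?thesis using False by simp
qed

lemma diag_op: "P \<in> Part X G 2 \<Longrightarrow> i < 2 \<Longrightarrow> E 2 i i \<phi> P = nu (P ! i) * \<phi> P"
  by (simp add: E_op_def nu_def)

text \<open>The first part has measure its size \<open>n\<close>, the second \<open>nu X - n\<close>
  by additivity; the difference is the weight.\<close>

lemma h_op_apply:
  assumes P: "P \<in> Part X G 2" and fin: "finite (P ! 0)"
  shows "h_op \<phi> P = (2 * of_nat (card (P ! 0)) - nu X) * \<phi> P"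
proof -
  have s: "P ! 0 \<subseteq> X" using PartD(3)[OF P, of 0] by simp
  have n: "nu (P ! 0) = of_nat (card (P ! 0))" by (rule nu_finite[OF fin s])
  have "nu (P ! 0 \<union> P ! 1) = nu (P ! 0) + nu (P ! 1)"
    by (rule nu_Un[OF PartD(2)[OF P] PartD(2)[OF P]]) (auto simp: Part2_eq(2)[OF P, simplified])
  moreover have "P ! 0 \<union> P ! 1 = X" using Part2_eq(2)[OF P] s by auto
  ultimately have "nu (P ! 1) = nu X - of_nat (card (P ! 0))" using n by simp
  then have "h_op \<phi> P = of_nat (card (P ! 0)) * \<phi> P - (nu X - of_nat (card (P ! 0))) * \<phi> P"
    using n by (simp add: h_op_def diag_op[OF P])
  then show ?thesis by (simp add: algebra_simps)
qed

lemma op_mem_OA: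
  assumes "\<phi> \<in> OA"
  shows "e_op \<phi> \<in> OA" "f_op \<phi> \<in> OA" "h_op \<phi> \<in> OA"
proof -
  show "e_op \<phi> \<in> OA" "f_op \<phi> \<in> OA" by (simp_all add: e_op_def f_op_def E_orbit_algebra assms)
  have "(\<lambda>P. E 2 0 0 \<phi> P + - 1 * E 2 1 1 \<phi> P) \<in> OA"
    by (intro orbit_algebra_add orbit_algebra_scale E_orbit_algebra assms) auto
  moreover have "(\<lambda>P. E 2 0 0 \<phi> P + - 1 * E 2 1 1 \<phi> P) = h_op \<phi>" by (simp add: h_op_def fun_eq_iff)
  ultimately show "h_op \<phi> \<in> OA" by simp
qed

lemma op_add_OA:
  assumes "\<phi> \<in> OA" "\<psi> \<in> OA"
  shows "e_op (\<lambda>P. \<phi> P + \<psi> P) = (\<lambda>P. e_op \<phi> P + e_op \<psi> P)"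
    "f_op (\<lambda>P. \<phi> P + \<psi> P) = (\<lambda>P. f_op \<phi> P + f_op \<psi> P)"
    "h_op (\<lambda>P. \<phi> P + \<psi> P) = (\<lambda>P. h_op \<phi> P + h_op \<psi> P)"
  using E_add[OF assms[THEN orbit_algebra_schwartz]]
  by (auto simp: e_op_def f_op_def h_op_def fun_eq_iff)

lemma op_scale_OA:
  assumes "\<phi> \<in> OA"
  shows "e_op (\<lambda>P. a * \<phi> P) = (\<lambda>P. a * e_op \<phi> P)" "f_op (\<lambda>P. a * \<phi> P) = (\<lambda>P. a * f_op \<phi> P)"
    "h_op (\<lambda>P. a * \<phi> P) = (\<lambda>P. a * h_op \<phi> P)"
  using E_scale[OF orbit_algebra_schwartz[OF assms]]
  by (auto simp: e_op_def f_op_def h_op_def fun_eq_iff algebra_simps)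

text \<open>The double integrals in the two products are equal by symmetry and cancel.\<close>

lemma commutator:
  assumes \<phi>: "\<phi> \<in> OA" and P: "P \<in> Part X G 2" and ijkl: "i < 2" "j < 2" "k < 2" "l < 2"
  shows "E 2 i j (E 2 k l \<phi>) P - E 2 k l (E 2 i j \<phi>) P =
    (if j = k then E 2 i l \<phi> P else 0) - (if l = i then E 2 k j \<phi> P else 0)"
  using pair_integ_symmetric[OF orbit_algebra_schwartz[OF \<phi>] P ijkl]
  by (simp add: E_E[OF orbit_algebra_schwartz[OF \<phi>] P] ijkl)

lemma e_h_diff:
  assumes "\<phi> \<in> OA"
  shows "e_op (h_op \<phi>) P = E 2 0 1 (E 2 0 0 \<phi>) P - E 2 0 1 (E 2 1 1 \<phi>) P"
proof -
  have S: "E 2 0 0 \<phi> \<in> S 2" "E 2 1 1 \<phi> \<in> S 2"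
    using assms by (auto intro: E_schwartz orbit_algebra_schwartz)
  have "h_op \<phi> = (\<lambda>P. E 2 0 0 \<phi> P + - 1 * E 2 1 1 \<phi> P)" by (simp add: h_op_def fun_eq_iff)
  then show ?thesis
    using E_add[OF S(1) schwartz_scale[OF S(2), of "- 1"], of 0 1 P] E_scale[OF S(2), of 0 1 "- 1" P]
    by (simp add: e_op_def)
qed

lemma fe_relation: "\<phi> \<in> OA \<Longrightarrow> f_op (e_op \<phi>) P = e_op (f_op \<phi>) P - h_op \<phi> P"
  using commutator[of \<phi> P 1 0 0 1]
  by (cases "P \<in> Part X G 2") (auto simp: e_op_def f_op_def h_op_def E_outside algebra_simps)

lemma he_relation:
  assumes "\<phi> \<in> OA"
  shows "h_op (e_op \<phi>) P = e_op (h_op \<phi>) P + 2 * e_op \<phi> P"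
proof (cases "P \<in> Part X G 2")
  case True
  then show ?thesis
    using commutator[OF assms True, of 0 0 0 1] commutator[OF assms True, of 1 1 0 1]
    unfolding e_h_diff[OF assms] by (simp add: h_op_def e_op_def algebra_simps)
qed (simp add: e_op_def h_op_def E_outside)

lemma proj_e_op:
  assumes \<phi>: "\<phi> \<in> OA"
  shows "proj (Suc n) (e_op \<phi>) = e_op (proj n \<phi>)" "proj 0 (e_op \<phi>) = (\<lambda>_. 0)"
proof -
  have out: "e_op \<psi> P = 0" if "P \<notin> Part X G 2" for P \<psi> using that by (simp add: e_op_def E_outside)
  show "proj (Suc n) (e_op \<phi>) = e_op (proj n \<phi>)"
  proof
    fix P
    show "proj (Suc n) (e_op \<phi>) P = e_op (proj n \<phi>) P"
    proof (cases "P \<in> Part X G 2 \<and> finite (P ! 0)")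
      case True
      then have P: "P \<in> Part X G 2" and fin: "finite (P ! 0)" by auto
      have "proj n \<phi> (move 0 1 y P) = (if card (P ! 0) = Suc n then \<phi> (move 0 1 y P) else 0)"
        if y: "y \<in> P ! 0" for y
      proof -
        have "card (P ! 0) = Suc (card (P ! 0 - {y}))" using card_Suc_Diff1[OF fin y] by simp
        then show ?thesis unfolding proj_def move_0(1)[OF P] using fin by auto
      qed
      then have "e_op (proj n \<phi>) P = (\<Sum>y\<in>P ! 0. if card (P ! 0) = Suc n then \<phi> (move 0 1 y P) else 0)"
        using fin by (simp add: e_op_apply[OF proj_mem[OF \<phi>] P])
      then show ?thesis using fin by (auto simp: proj_def e_op_apply[OF \<phi> P])
    next
      case False
      then show ?thesis
        by (cases "P \<in> Part X G 2") (auto simp: proj_def out e_op_apply[OF proj_mem[OF \<phi>]])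
    qed
  qed
  show "proj 0 (e_op \<phi>) = (\<lambda>_. 0)"
  proof
    fix P
    show "proj 0 (e_op \<phi>) P = 0"
      by (cases "P \<in> Part X G 2") (auto simp: proj_def out e_op_apply[OF \<phi>])
  qed
qed

text \<open>A point of the second part is new to the first, so moving it raises a finite degree by
  exactly one; the result never has degree 0.\<close>

lemma move_fun_proj:
  assumes P: "P \<in> Part X G 2" and y: "y \<in> P ! 1"
  shows "proj (Suc n) \<phi> (move 1 0 y P) = (if finite (P ! 0) \<and> card (P ! 0) = n then \<phi> (move 1 0 y P) else 0)"
    "proj 0 \<phi> (move 1 0 y P) = 0"
proof -
  have "y \<notin> P ! 0" using y Part2_eq(2)[OF P] by auto
  then show "proj (Suc n) \<phi> (move 1 0 y P) = (if finite (P ! 0) \<and> card (P ! 0) = n then \<phi> (move 1 0 y P) else 0)"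
    unfolding proj_def move_0(2)[OF P] by auto
  show "proj 0 \<phi> (move 1 0 y P) = 0" unfolding proj_def move_0(2)[OF P] by auto
qed

lemma proj_f_op:
  assumes \<phi>: "\<phi> \<in> OA"
  shows "proj n (f_op \<phi>) = f_op (proj (Suc n) \<phi>)" "f_op (proj 0 \<phi>) = (\<lambda>_. 0)"
proof -
  have eq: "f_op \<psi> P = integ (move_fun 1 0 \<psi> P)" if "\<psi> \<in> OA" "P \<in> Part X G 2" for \<psi> P
    using E_eq[OF orbit_algebra_schwartz[OF that(1)] that(2), of 1 0] by (simp add: f_op_def)
  show "proj n (f_op \<phi>) = f_op (proj (Suc n) \<phi>)"
  proof
    fix P
    show "proj n (f_op \<phi>) P = f_op (proj (Suc n) \<phi>) P"
    proof (cases "P \<in> Part X G 2")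
      case P: True
      have "integ (move_fun 1 0 (proj (Suc n) \<phi>) P) =
          integ (\<lambda>y. if finite (P ! 0) \<and> card (P ! 0) = n then move_fun 1 0 \<phi> P y else 0)"
        by (rule integ_cong) (simp add: move_fun_def move_fun_proj[OF P] del: One_nat_def)
      then show ?thesis using eq[OF \<phi> P] eq[OF proj_mem[OF \<phi>] P]
        by (cases "finite (P ! 0) \<and> card (P ! 0) = n") (auto simp: proj_def)
    qed (simp add: proj_def f_op_def E_outside)
  qed
  show "f_op (proj 0 \<phi>) = (\<lambda>_. 0)"
  proof
    fix P
    show "f_op (proj 0 \<phi>) P = 0"
    proof (cases "P \<in> Part X G 2")
      case P: True
      have "integ (move_fun 1 0 (proj 0 \<phi>) P) = integ (\<lambda>y. 0)"
        by (rule integ_cong) (simp add: move_fun_def move_fun_proj[OF P] del: One_nat_def)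
      then show ?thesis using eq[OF proj_mem[OF \<phi>] P] by simp
    qed (simp add: f_op_def E_outside)
  qed
qed

lemma proj_h_op: "proj n (h_op \<phi>) P = (2 * of_nat n - nu X) * proj n \<phi> P" if "\<phi> \<in> OA"
proof (cases "P \<in> Part X G 2")
  case True
  then show ?thesis by (auto simp: proj_def h_op_apply)
next
  case False
  then have "h_op \<phi> P = 0" "\<phi> P = 0" using that by (simp_all add: h_op_def E_outside orbit_algebra_iff)
  then show ?thesis by (simp add: proj_def)
qed

text \<open>At \<open>two_part B\<close> with \<open>B\<close> of size \<open>n + 1\<close>,
  \<open>e\<close> sums \<phi> over the one-point deletions of \<open>B\<close>; its vanishing is
  the hypothesis of \<open>subset_sum_injective\<close>.\<close>

lemma e_op_injective:
  assumes inf: "infinite X" and \<phi>: "\<phi> \<in> OA" and pr: "proj n \<phi> = \<phi>" and e: "e_op \<phi> = (\<lambda>_. 0)"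
  shows "\<phi> = (\<lambda>_. 0)"
proof
  fix P
  show "\<phi> P = 0"
  proof (cases "P \<in> Part X G 2 \<and> finite (P ! 0) \<and> card (P ! 0) = n")
    case True
    then have P: "P \<in> Part X G 2" and A: "P ! 0 \<in> nsets X n"
      using PartD(3)[of P 2 0] by (auto simp: nsets_def)
    have "\<phi> (two_part (P ! 0)) = 0"
    proof (rule subset_sum_injective[OF inf _ A])
      fix B assume "B \<in> nsets X (Suc n)"
      then have B: "B \<subseteq> X" "finite B" by (auto simp: nsets_def)
      have Q: "two_part B \<in> Part X G 2" by (rule two_part_Part[OF ghat_subset_finite[OF B(2,1)]])
      have m: "move 0 1 y (two_part B) = two_part (B - {y})" if "y \<in> B" for y
        using that B by (auto simp: move_def)
      have "0 = (\<Sum>y\<in>B. \<phi> (move 0 1 y (two_part B)))"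
        using e_op_apply[OF \<phi> Q] e B by simp
      also have "\<dots> = (\<Sum>y\<in>B. \<phi> (two_part (B - {y})))"
        by (rule sum.cong[OF refl]) (simp only: m)
      finally show "(\<Sum>y\<in>B. \<phi> (two_part (B - {y}))) = 0" by (rule sym)
    qed
    then show ?thesis using Part2_eq(1)[OF P] by simp
  next
    case False
    show ?thesis
    proof (cases "P \<in> Part X G 2")
      case True
      then have "proj n \<phi> P = 0" using False by (auto simp: proj_def)
      then show ?thesis by (simp only: pr)
    qed (use \<phi> in \<open>simp add: orbit_algebra_iff\<close>)
  qed
qed

lemma proj_sum:
  assumes \<phi>: "\<phi> \<in> OA"
  shows "\<exists>n. \<phi> = (\<Sum>i<n. proj i \<phi>)"
proof -
  obtain N where N: "\<forall>P\<in>Part X G 2. \<phi> P \<noteq> 0 \<longrightarrow> finite (P ! 0) \<and> card (P ! 0) < N"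
    and z: "\<forall>P. P \<notin> Part X G 2 \<longrightarrow> \<phi> P = 0"
    using \<phi> unfolding orbit_algebra_iff by blast
  have "\<phi> P = (\<Sum>i<N. proj i \<phi> P)" for P
  proof -
    have "(\<Sum>i<N. proj i \<phi> P) = (\<Sum>i<N. if i = card (P ! 0) then (if finite (P ! 0) then \<phi> P else 0) else 0)"
      by (intro sum.cong) (auto simp: proj_def)
    also have "\<dots> = (if card (P ! 0) < N \<and> finite (P ! 0) then \<phi> P else 0)" by simp
    also have "\<dots> = \<phi> P" using N z by auto
    finally show ?thesis by simp
  qed
  then show ?thesis by (auto simp: fun_eq_iff sum_fun_apply)
qed

lemma orbit_algebra_filtration:
  assumes inf: "infinite X"
  defines "H \<equiv> fun_space OA" and "\<rho> \<equiv> gl_act X G \<mu> 2"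
  shows "\<exists>(N :: enat) F.
     F 0 = {\<zero>\<^bsub>H\<^esub>} \<and>
     (\<forall>n. enat n < N \<longrightarrow> F n \<subseteq> F (Suc n)) \<and>
     (\<forall>n. enat n \<le> N \<longrightarrow> lie_subrep (sl 2) H \<rho> (F n)) \<and>
     (\<Union>n\<in>{n. enat n \<le> N}. F n) = carrier H \<and>
     (\<forall>n. enat n < N \<longrightarrow>
        (\<exists>l. lie_rep_iso (sl 2)
               (quot_space (H\<lparr>carrier := F (Suc n)\<rparr>) (F n))
               (quot_act (H\<lparr>carrier := F (Suc n)\<rparr>) (F n) \<rho>)
               (verma_space l) (verma_act l)))"
proof -
  have "\<forall>n. \<exists>g (d :: nat). (\<forall>i<d. g i \<in> OA \<and> proj n (g i) = g i) \<and>
     (\<forall>v. v \<in> OA \<longrightarrow> proj n v = v \<longrightarrow> (\<exists>a. v = (\<lambda>P. \<Sum>i<d. a i * g i P)))"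
    using orbit_basis by blast
  then obtain g where "\<forall>n. \<exists>d :: nat. (\<forall>i<d. g n i \<in> OA \<and> proj n (g n i) = g n i) \<and>
     (\<forall>v. v \<in> OA \<longrightarrow> proj n v = v \<longrightarrow> (\<exists>a. v = (\<lambda>P. \<Sum>i<d. a i * g n i P)))"
    by (rule choice[THEN exE])
  then obtain d where gd: "\<forall>n. (\<forall>i<d n. g n i \<in> OA \<and> proj n (g n i) = g n i) \<and>
     (\<forall>v. v \<in> OA \<longrightarrow> proj n v = v \<longrightarrow> (\<exists>a. v = (\<lambda>P. \<Sum>i<d n. a i * g n i P)))"
    by (rule choice[THEN exE])
  let ?scl = "\<lambda>c (v :: 'x set list \<Rightarrow> complex) P. c * v P"
  have vs: "Vector_Spaces.vector_space ?scl"
    by unfold_locales (auto simp: fun_eq_iff algebra_simps)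
  have rho: "\<rho> A v = ?scl (A $$ (0, 1)) (e_op v) + ?scl (A $$ (1, 0)) (f_op v) + ?scl (A $$ (0, 0)) (h_op v)"
    if "A \<in> carrier (sl 2)" for A v
    using that unfolding carrier_sl2
    by (simp add: \<rho>_def gl_act_def fun_eq_iff numeral_2_eq_2 e_op_def f_op_def h_op_def algebra_simps)
  have span: "\<exists>a. v = (\<Sum>i<d n. ?scl (a i) (g n i))" if v: "v \<in> OA" "proj n v = v" for v n
  proof -
    obtain a where "v = (\<lambda>P. \<Sum>i<d n. a i * g n i P)" using gd v by blast
    then show ?thesis by (intro exI[of _ a]) (simp add: fun_eq_iff sum_fun_apply)
  qed
  have fe: "f_op (e_op v) = (\<lambda>P. e_op (f_op v) P - h_op v P)"
    and he: "h_op (e_op v) = (\<lambda>P. e_op (h_op v) P + 2 * e_op v P)"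
    and ph: "proj n (h_op v) = (\<lambda>P. (2 * of_nat n - nu X) * proj n v P)" if "v \<in> OA" for v n
    using that by (auto intro!: ext simp: fe_relation he_relation proj_h_op)
  have pl: "proj n (\<lambda>P. v P + w P) = (\<lambda>P. proj n v P + proj n w P)"
    "proj n (\<lambda>P. a * v P) = (\<lambda>P. a * proj n v P)"
    "proj m (proj n v) = (if m = n then proj n v else (\<lambda>_. 0))" for m n v w a
    by (auto simp: proj_def fun_eq_iff)
  \<comment> \<open>The constant of the locale is \<open>nu X\<close>, so the lowest weights are
    \<open>2 m - nu X\<close>, with \<open>m\<close> the degree of the adjoined vector.\<close>
  have "graded_sl2_axioms ?scl H \<rho> proj e_op f_op h_op (nu X) g d"
  proof (rule graded_sl2_axioms.intro, goal_cases)
    case 1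
    show ?case unfolding H_def
      by (rule vectorspace_fun_space) (simp_all add: orbit_algebra_zero orbit_algebra_add orbit_algebra_scale)
  next
    case 2
    show ?case by (simp add: H_def plus_fun_def fun_eq_iff)
  qed (use gd in \<open>simp_all add: H_def rho span plus_fun_def zero_fun_def fun_diff_def orbit_algebra_zero
      orbit_algebra_add orbit_algebra_scale op_mem_OA proj_mem op_add_OA op_scale_OA fe he
      proj_e_op proj_f_op ph pl proj_sum e_op_injective[OF inf]\<close>)
  with vs interpret graded_sl2 ?scl H \<rho> proj e_op f_op h_op "nu X" g d
    by (rule graded_sl2.intro)
  show ?thesis by (rule verma_filtration)
qed

end

theorem theoremB:
  fixes X :: "'x set" and G :: "('x \<Rightarrow> 'x) set"
  assumes "oligomorphic X G"
  shows
    "(\<forall>\<mu> :: ('x, 'x upoint) ghat_set \<Rightarrow> 'k::field. ghat_measure X G \<mu> \<longrightarrow>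
        (\<forall>r\<ge>1.
           lie_rep (gl r) (tensor_power X G r) (gl_act X G \<mu> r) \<and>
           (\<forall>i<r. \<forall>j<r. \<forall>\<phi>\<in>carrier (tensor_power X G r).
              gl_act X G \<mu> r (elem_mat r i j) \<phi> = E_op X G \<mu> r i j \<phi>) \<and>
           (\<forall>A\<in>carrier (gl r). \<forall>g\<in>G. \<forall>\<phi>\<in>carrier (tensor_power X G r).
              gl_act X G \<mu> r A (translate X (Part X G r) part_act g \<phi>) =
              translate X (Part X G r) part_act g (gl_act X G \<mu> r A \<phi>)))) \<and>
     (\<forall>\<mu> :: ('x, 'x upoint) ghat_set \<Rightarrow> complex. ghat_measure X G \<mu> \<longrightarrow>
        (let \<rho> = gl_act X G \<mu> 2; H = fun_space (orbit_algebra X G)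
         in lie_subrep (sl 2) (tensor_power X G 2) \<rho> (orbit_algebra X G) \<and>
            lie_rep (sl 2) H \<rho> \<and>
            (infinite X \<longrightarrow>
              (\<exists>(N :: enat) F.
                 F 0 = {\<zero>\<^bsub>H\<^esub>} \<and>
                 (\<forall>n. enat n < N \<longrightarrow> F n \<subseteq> F (Suc n)) \<and>
                 (\<forall>n. enat n \<le> N \<longrightarrow> lie_subrep (sl 2) H \<rho> (F n)) \<and>
                 (\<Union>n\<in>{n. enat n \<le> N}. F n) = carrier H \<and>
                 (\<forall>n. enat n < N \<longrightarrow>
                    (\<exists>l. lie_rep_iso (sl 2)
                           (quot_space (H\<lparr>carrier := F (Suc n)\<rparr>) (F n))
                           (quot_act (H\<lparr>carrier := F (Suc n)\<rparr>) (F n) \<rho>)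
                           (verma_space l) (verma_act l)))))))"
proof (intro conjI allI impI)
  fix \<mu> :: "('x, 'x upoint) ghat_set \<Rightarrow> 'k" and r :: nat
  assume "ghat_measure X G \<mu>"
  then interpret oligomorphic_measure X G \<mu>
    by (simp add: oligomorphic_measure_def oligomorphic_group_def assms)
  show "lie_rep (gl r) (tensor_power X G r) (gl_act X G \<mu> r)" by (rule gl_rep)
  show "\<forall>\<phi>\<in>carrier (tensor_power X G r). gl_act X G \<mu> r (elem_mat r i j) \<phi> = E_op X G \<mu> r i j \<phi>"
    if "i < r" "j < r" for i j
    using gl_act_elem_mat[OF that] by blast
  show "\<forall>A\<in>carrier (gl r). \<forall>g\<in>G. \<forall>\<phi>\<in>carrier (tensor_power X G r).
      gl_act X G \<mu> r A (translate X (Part X G r) part_act g \<phi>) =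
      translate X (Part X G r) part_act g (gl_act X G \<mu> r A \<phi>)"
    using gl_act_translate by (auto simp: tensor_power_def)
next
  fix \<mu> :: "('x, 'x upoint) ghat_set \<Rightarrow> complex"
  assume "ghat_measure X G \<mu>"
  then interpret oligomorphic_measure_complex X G \<mu>
    by (simp add: oligomorphic_measure_complex_def oligomorphic_measure_def oligomorphic_group_def assms)
  show "let \<rho> = gl_act X G \<mu> 2; H = fun_space (orbit_algebra X G)
         in lie_subrep (sl 2) (tensor_power X G 2) \<rho> (orbit_algebra X G) \<and>
            lie_rep (sl 2) H \<rho> \<and>
            (infinite X \<longrightarrow>
              (\<exists>(N :: enat) F.
                 F 0 = {\<zero>\<^bsub>H\<^esub>} \<and>
                 (\<forall>n. enat n < N \<longrightarrow> F n \<subseteq> F (Suc n)) \<and>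
                 (\<forall>n. enat n \<le> N \<longrightarrow> lie_subrep (sl 2) H \<rho> (F n)) \<and>
                 (\<Union>n\<in>{n. enat n \<le> N}. F n) = carrier H \<and>
                 (\<forall>n. enat n < N \<longrightarrow>
                    (\<exists>l. lie_rep_iso (sl 2)
                           (quot_space (H\<lparr>carrier := F (Suc n)\<rparr>) (F n))
                           (quot_act (H\<lparr>carrier := F (Suc n)\<rparr>) (F n) \<rho>)
                           (verma_space l) (verma_act l)))))"
    unfolding Let_def
    by (intro conjI impI orbit_algebra_subrep orbit_algebra_rep orbit_algebra_filtration)
qed

end
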